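(* Let $D$ be a discrete valuation ring with uniformizing parameter $\pi$ and quotient field $Q$, let $\mathcal O\subseteq M_n(Q)$ be a classical order over $D$, and let $\Lambda=\mathcal O/\pi\mathcal O$. If $M$ is a nonzero left $\Lambda$-module with $\operatorname{p\,dim}{}_{\mathcal O}M=m<\infty$, then $m>0$ and $\Omega_\Lambda^{m-1}(M)\cong\Omega_\Lambda^{m+1}(M)\oplus P$ for some projective $\Lambda$-module $P$. In particular, $\operatorname{rep}({}_\Lambda M)\le m-1$, and if $M$ is finitely generated, then ${}_\Lambda M$ has finite syzygy type.
   Context: A classical order $\mathcal O\subseteq M_n(Q)$ over $D$ is a $D$-subalgebra of $M_n(Q)$ which is finitely generated as a $D$-module and which generates $M_n(Q)$ over $Q$. Then $\Lambda=\mathcal O/\pi\mathcal O$ is a finite dimensional algebra over the field $K=D/\pi D$. Left $\Lambda$-modules are viewed as left $\mathcal O$-modules via $\mathcal O\to\Lambda$, and $\operatorname{p\,dim}{}_{\mathcal O}M$ is the projective dimension of $M$ as an $\mathcal O$-module. For a $\Lambda$-module $M$, $\Omega_\Lambda^0(M)=M$, $\Omega_\Lambda^1(M)$ is the kernel of a $\Lambda$-projective cover of $M$, and $\Omega_\Lambda^{j+1}(M)=\Omega_\Lambda^1(\Omega_\Lambda^j(M))$. Repetition index: the minimal projective resolution of ${}_\Lambda M$ is repetitive at degree $k\ge 0$ if there is a decomposition $\Omega_\Lambda^k(M)= P'\oplus\bigoplus_{i\in I}A_i$ with $P'$ projective such that each $A_i$ occurs (up to isomorphism) as a direct summand of $\Omega_\Lambda^j(M)$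 for infinitely many $j$. $\operatorname{rep}({}_\Lambda M)$ is the least nonnegative integer $k$ such that this holds at degree $k$, or $\infty$ if there is no such $k$. Syzygy type: the syzygy category of ${}_\Lambda M$ is $\operatorname{add}(\{\Omega_\Lambda^j(M)\mid j\ge 0\})$, the full subcategory of $\Lambda$-modules whose objects are the finite direct sums of copies of direct summands of the modules $\Omega_\Lambda^j(M)$. ${}_\Lambda M$ has finite syzygy type if this is a Krull-Schmidt category with only finitely many isomorphism types of indecomposable objects (for finitely generated $M$ the Krull-Schmidt condition is automatic). *)

theory Defs
  imports
    "HOL-Library.Extended_Nat"
    "HOL-Computational_Algebra.Polynomial_Factorial"
    "HOL-Algebra.QuotRing"
    "HOL-Algebra.Subrings"
    "HOL-Algebra.Ring_Divisibility"
    "Jordan_Normal_Form.VS_Connect"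
begin

section \<open>Left modules over a not necessarily commutative ring\<close>

text \<open>
  The locale \<^locale>\<open>module\<close> of HOL-Algebra requires a commutative ring of scalars. As there, the
  fields \<open>mult\<close> and \<open>one\<close> of a module record are irrelevant.
\<close>

locale left_module = R?: ring R + M?: abelian_group M
  for R :: "('r, 'x) ring_scheme" (structure) and M :: "('r, 'm, 'y) module_scheme" (structure) +
  assumes smult_closed: "\<lbrakk>a \<in> carrier R; x \<in> carrier M\<rbrakk> \<Longrightarrow> a \<odot>\<^bsub>M\<^esub> x \<in> carrier M"
    and smult_l_distr: "\<lbrakk>a \<in> carrier R; b \<in> carrier R; x \<in> carrier M\<rbrakk> \<Longrightarrow>
      (a \<oplus> b) \<odot>\<^bsub>M\<^esub> x = a \<odot>\<^bsub>M\<^esub> x \<oplus>\<^bsub>M\<^esub> b \<odot>\<^bsub>M\<^esub> x"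
    and smult_r_distr: "\<lbrakk>a \<in> carrier R; x \<in> carrier M; y \<in> carrier M\<rbrakk> \<Longrightarrow>
      a \<odot>\<^bsub>M\<^esub> (x \<oplus>\<^bsub>M\<^esub> y) = a \<odot>\<^bsub>M\<^esub> x \<oplus>\<^bsub>M\<^esub> a \<odot>\<^bsub>M\<^esub> y"
    and smult_assoc: "\<lbrakk>a \<in> carrier R; b \<in> carrier R; x \<in> carrier M\<rbrakk> \<Longrightarrow>
      (a \<otimes> b) \<odot>\<^bsub>M\<^esub> x = a \<odot>\<^bsub>M\<^esub> (b \<odot>\<^bsub>M\<^esub> x)"
    and smult_one: "x \<in> carrier M \<Longrightarrow> \<one> \<odot>\<^bsub>M\<^esub> x = x"

definition lmod_hom ::
  "('r, 'x) ring_scheme \<Rightarrow> ('r, 'm) module \<Rightarrow> ('r, 'n) module \<Rightarrow> ('m \<Rightarrow> 'n) set"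
  where "lmod_hom R M N = {f \<in> hom (add_monoid M) (add_monoid N).
    \<forall>a\<in>carrier R. \<forall>x\<in>carrier M. f (a \<odot>\<^bsub>M\<^esub> x) = a \<odot>\<^bsub>N\<^esub> f x}"

definition lmod_iso :: "('r, 'x) ring_scheme \<Rightarrow> ('r, 'm) module \<Rightarrow> ('r, 'n) module \<Rightarrow> bool"
  where "lmod_iso R M N \<longleftrightarrow> (\<exists>f\<in>lmod_hom R M N. bij_betw f (carrier M) (carrier N))"

definition lmod_span ::
  "('r, 'x) ring_scheme \<Rightarrow> ('r, 'm) module \<Rightarrow> 'm set \<Rightarrow> 'm set"
  where "lmod_span R M B = \<Inter>{H. Module.submodule H R M \<and> B \<subseteq> H}"

definition finitely_generated :: "('r, 'x) ring_scheme \<Rightarrow> ('r, 'm) module \<Rightarrow> bool"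
  where "finitely_generated R M \<longleftrightarrow>
    (\<exists>B. finite B \<and> B \<subseteq> carrier M \<and> lmod_span R M B = carrier M)"

definition restrict_scalars :: "('s \<Rightarrow> 'r) \<Rightarrow> ('r, 'm) module \<Rightarrow> ('s, 'm) module"
  where "restrict_scalars \<phi> M = \<lparr>carrier = carrier M, monoid.mult = monoid.mult M, one = one M,
    zero = zero M, add = add M, smult = (\<lambda>s x. \<phi> s \<odot>\<^bsub>M\<^esub> x)\<rparr>"

definition dsum2 :: "('r, 'm) module \<Rightarrow> ('r, 'n) module \<Rightarrow> ('r, 'm \<times> 'n) module"
  where "dsum2 M N = \<lparr>carrier = carrier M \<times> carrier N, monoid.mult = undefined, one = undefined,
    zero = (\<zero>\<^bsub>M\<^esub>, \<zero>\<^bsub>N\<^esub>),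
    add = (\<lambda>(x, y) (x', y'). (x \<oplus>\<^bsub>M\<^esub> x', y \<oplus>\<^bsub>N\<^esub> y')),
    smult = (\<lambda>a (x, y). (a \<odot>\<^bsub>M\<^esub> x, a \<odot>\<^bsub>N\<^esub> y))\<rparr>"

definition dsum :: "'i set \<Rightarrow> ('i \<Rightarrow> ('r, 'm) module) \<Rightarrow> ('r, 'i \<Rightarrow> 'm) module"
  where "dsum I A = \<lparr>carrier = {f \<in> (\<Pi>\<^sub>E i\<in>I. carrier (A i)). finite {i\<in>I. f i \<noteq> \<zero>\<^bsub>A i\<^esub>}},
    monoid.mult = undefined, one = undefined,
    zero = (\<lambda>i\<in>I. \<zero>\<^bsub>A i\<^esub>),
    add = (\<lambda>f g. \<lambda>i\<in>I. f i \<oplus>\<^bsub>A i\<^esub> g i),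
    smult = (\<lambda>a f. \<lambda>i\<in>I. a \<odot>\<^bsub>A i\<^esub> f i)\<rparr>"

definition direct_summand :: "('r, 'x) ring_scheme \<Rightarrow> ('r, 'a) module \<Rightarrow> ('r, 'm) module \<Rightarrow> bool"
  where "direct_summand R A M \<longleftrightarrow> left_module R A \<and>
    (\<exists>H K. Module.submodule H R M \<and> Module.submodule K R M \<and>
      H \<inter> K = {\<zero>\<^bsub>M\<^esub>} \<and> H <+>\<^bsub>M\<^esub> K = carrier M \<and>
      lmod_iso R A (M\<lparr>carrier := H\<rparr>))"

definition regular_module :: "('r, 'x) ring_scheme \<Rightarrow> ('r, 'r) module"
  where "regular_module R = \<lparr>carrier = carrier R, monoid.mult = monoid.mult R, one = one R,
    zero = zero R, add = add R, smult = monoid.mult R\<rparr>"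

definition free_module :: "('r, 'x) ring_scheme \<Rightarrow> 'i set \<Rightarrow> ('r, 'i \<Rightarrow> 'r) module"
  where "free_module R X = dsum X (\<lambda>_. regular_module R)"

text \<open>
  Direct summands of free modules. It is no restriction that the basis is taken in the type of \<open>P\<close>:
  a projective \<open>P\<close> is a direct summand of the free module on its own carrier.
\<close>

definition projective :: "('r, 'x) ring_scheme \<Rightarrow> ('r, 'm) module \<Rightarrow> bool"
  where "projective R P \<longleftrightarrow> (\<exists>X::'m set. direct_summand R P (free_module R X))"


section \<open>Projective dimension and syzygies\<close>

text \<open>
  Quantifiers in HOL range over the modules on a fixed type only. For a module on \<open>'m\<close> over a ring
  on \<open>'r\<close> we let them range over modules on \<open>('r + 'm) list\<close>. This type is infinite and at least as
  large as \<open>'r\<close> and \<open>'m\<close>. Hence up to isomorphism it carries all modules of cardinality at most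
  max(|\<open>'r\<close>|, |\<open>'m\<close>|, aleph-zero), among them free modules on bases of that cardinality,
  submodules, quotients and countable direct sums of such modules.
\<close>

type_synonym ('r, 'm) univ = "('r + 'm) list"

definition proj_resolution :: "('r, 'x) ring_scheme \<Rightarrow> ('r, 'm) module \<Rightarrow>
    (nat \<Rightarrow> ('r, 'u) module) \<Rightarrow> (nat \<Rightarrow> 'u \<Rightarrow> 'u) \<Rightarrow> ('u \<Rightarrow> 'm) \<Rightarrow> bool"
  where "proj_resolution R M P d e \<longleftrightarrow>
    (\<forall>i. projective R (P i)) \<and>
    e \<in> lmod_hom R (P 0) M \<and>
    (\<forall>i. d i \<in> lmod_hom R (P (Suc i)) (P i)) \<and>
    e ` carrier (P 0) = carrier M \<and>
    d 0 ` carrier (P 1) = a_kernel (P 0) M e \<and>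
    (\<forall>i. d (Suc i) ` carrier (P (Suc (Suc i))) = a_kernel (P (Suc i)) (P i) (d i))"

definition proj_dim :: "('r, 'x) ring_scheme \<Rightarrow> ('r, 'm) module \<Rightarrow> enat"
  where "proj_dim R M = Inf {enat k | k.
    \<exists>(P :: nat \<Rightarrow> ('r, ('r, 'm) univ) module) d e.
      proj_resolution R M P d e \<and> (\<forall>i>k. carrier (P i) = {\<zero>\<^bsub>P i\<^esub>})}"

definition projective_cover ::
  "('r, 'x) ring_scheme \<Rightarrow> ('r, 'p) module \<Rightarrow> ('p \<Rightarrow> 'm) \<Rightarrow> ('r, 'm) module \<Rightarrow> bool"
  where "projective_cover R P p M \<longleftrightarrow>
    projective R P \<and> p \<in> lmod_hom R P M \<and> p ` carrier P = carrier M \<and>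
    (\<forall>H. Module.submodule H R P \<and> H <+>\<^bsub>P\<^esub> a_kernel P M p = carrier P \<longrightarrow> H = carrier P)"

text \<open>
  Projective covers are unique up to isomorphism, and they exist over finite dimensional algebras;
  so there the choice in \<open>Omega1\<close> determines the syzygies up to isomorphism.
\<close>

definition Omega1 :: "('r, 'x) ring_scheme \<Rightarrow> ('r, 'u) module \<Rightarrow> ('r, 'u) module"
  where "Omega1 R M = (SOME N. \<exists>(P :: ('r, 'u) module) p.
    projective_cover R P p M \<and> N = P\<lparr>carrier := a_kernel P M p\<rparr>)"

text \<open>An isomorphic copy of \<open>M\<close>, transported along the embedding \<open>x \<mapsto> [Inr x]\<close>.\<close>

definition univ_copy :: "('r, 'm) module \<Rightarrow> ('r, ('r, 'm) univ) module"
  where "univ_copy M = \<lparr>carrier = (\<lambda>x. [Inr x]) ` carrier M, monoid.mult = undefined, one = undefined,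
    zero = [Inr \<zero>\<^bsub>M\<^esub>],
    add = (\<lambda>x y. [Inr (projr (hd x) \<oplus>\<^bsub>M\<^esub> projr (hd y))]),
    smult = (\<lambda>a x. [Inr (a \<odot>\<^bsub>M\<^esub> projr (hd x))])\<rparr>"

fun Omega ::
  "('r, 'x) ring_scheme \<Rightarrow> nat \<Rightarrow> ('r, 'm) module \<Rightarrow> ('r, ('r, 'm) univ) module"
  where
    "Omega R 0 M = univ_copy M"
  | "Omega R (Suc j) M = Omega1 R (Omega R j M)"


section \<open>Repetition index and syzygy type\<close>

text \<open>
  The index set \<open>I\<close> is taken in the type of the module. This is no restriction, since only
  the nonzero summands matter and they are indexed injectively by nonzero elements.
\<close>

definition repetitive_at :: "('r, 'x) ring_scheme \<Rightarrow> ('r, 'm) module \<Rightarrow> nat \<Rightarrow> bool"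
  where "repetitive_at R M k \<longleftrightarrow>
    (\<exists>(P' :: ('r, ('r, 'm) univ) module) (I :: ('r, 'm) univ set)
      (A :: ('r, 'm) univ \<Rightarrow> ('r, ('r, 'm) univ) module).
      projective R P' \<and> (\<forall>i\<in>I. left_module R (A i)) \<and>
      lmod_iso R (Omega R k M) (dsum2 P' (dsum I A)) \<and>
      (\<forall>i\<in>I. infinite {j. direct_summand R (A i) (Omega R j M)}))"

definition rep :: "('r, 'x) ring_scheme \<Rightarrow> ('r, 'm) module \<Rightarrow> enat"
  where "rep R M = Inf {enat k | k. repetitive_at R M k}"

text \<open>Full subcategories of the category of left modules are given by their sets of objects.\<close>

definition add_category :: "('r, 'x) ring_scheme \<Rightarrow> ('r, 'u) module set \<Rightarrow> ('r, 'u) module set"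
  where "add_category R S = {X. left_module R X \<and>
    (\<exists>(k::nat) (A :: nat \<Rightarrow> ('r, 'u) module).
      (\<forall>i<k. \<exists>N\<in>S. direct_summand R (A i) N) \<and> lmod_iso R X (dsum {..<k} A))}"

definition syzygy_category ::
  "('r, 'x) ring_scheme \<Rightarrow> ('r, 'm) module \<Rightarrow> ('r, ('r, 'm) univ) module set"
  where "syzygy_category R M = add_category R (range (\<lambda>j. Omega R j M))"

text \<open>Endomorphisms are represented by extensional functions, so that equality is that of maps on
  the carrier.\<close>

definition End_ring :: "('r, 'x) ring_scheme \<Rightarrow> ('r, 'm) module \<Rightarrow> ('m \<Rightarrow> 'm) ring"
  where "End_ring R M = \<lparr>carrier = lmod_hom R M M \<inter> extensional (carrier M),
    monoid.mult = compose (carrier M), one = (\<lambda>x\<in>carrier M. x),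
    zero = (\<lambda>x\<in>carrier M. \<zero>\<^bsub>M\<^esub>), add = (\<lambda>f g. \<lambda>x\<in>carrier M. f x \<oplus>\<^bsub>M\<^esub> g x)\<rparr>"

definition local_ring :: "('r, 'x) ring_scheme \<Rightarrow> bool"
  where "local_ring R \<longleftrightarrow> ring R \<and> \<one>\<^bsub>R\<^esub> \<noteq> \<zero>\<^bsub>R\<^esub> \<and>
    (\<forall>a\<in>carrier R - Units R. \<forall>b\<in>carrier R - Units R. a \<oplus>\<^bsub>R\<^esub> b \<notin> Units R)"

text \<open>Additivity of the category is not restated: \<^const>\<open>add_category\<close> is closed under finite direct
  sums by construction.\<close>

definition krull_schmidt :: "('r, 'x) ring_scheme \<Rightarrow> ('r, 'u) module set \<Rightarrow> bool"
  where "krull_schmidt R C \<longleftrightarrow> (\<forall>X\<in>C. \<exists>(k::nat) A.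
    (\<forall>i<k. A i \<in> C \<and> local_ring (End_ring R (A i))) \<and> lmod_iso R X (dsum {..<k} A))"

definition indecomposable_in ::
  "('r, 'x) ring_scheme \<Rightarrow> ('r, 'u) module set \<Rightarrow> ('r, 'u) module \<Rightarrow> bool"
  where "indecomposable_in R C X \<longleftrightarrow> X \<in> C \<and> carrier X \<noteq> {\<zero>\<^bsub>X\<^esub>} \<and>
    (\<forall>A\<in>C. \<forall>B\<in>C. lmod_iso R X (dsum2 A B) \<longrightarrow> carrier A = {\<zero>\<^bsub>A\<^esub>} \<or> carrier B = {\<zero>\<^bsub>B\<^esub>})"

definition finite_syzygy_type :: "('r, 'x) ring_scheme \<Rightarrow> ('r, 'm) module \<Rightarrow> bool"
  where "finite_syzygy_type R M \<longleftrightarrow>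
    krull_schmidt R (syzygy_category R M) \<and>
    (\<exists>F :: ('r, ('r, 'm) univ) module set. finite F \<and> (\<forall>X. indecomposable_in R (syzygy_category R M) X \<longrightarrow>
      (\<exists>Y\<in>F. lmod_iso R X Y)))"


section \<open>Classical orders over discrete valuation rings\<close>

definition discrete_valuation_ring :: "('a, 'x) ring_scheme \<Rightarrow> bool"
  where "discrete_valuation_ring R \<longleftrightarrow>
    principal_domain R \<and> \<not> Ring.field R \<and> (\<exists>!I. maximalideal I R)"

definition uniformizer :: "('a, 'x) ring_scheme \<Rightarrow> 'a \<Rightarrow> bool"
  where "uniformizer R \<pi> \<longleftrightarrow> \<pi> \<in> carrier R \<and> maximalideal (PIdl\<^bsub>R\<^esub> \<pi>) R"

text \<open>
  The discrete valuation ring \<open>D\<close> is a type \<open>'d\<close>, with quotient field \<open>Q\<close> the type \<open>'d fract\<close>.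
\<close>

definition mat_module_base :: "nat \<Rightarrow> ('d::idom, 'd fract mat) module"
  where "mat_module_base n = restrict_scalars to_fract (module_mat TYPE('d fract) n n)"

definition classical_order :: "nat \<Rightarrow> 'd::idom fract mat set \<Rightarrow> bool"
  where "classical_order n \<O> \<longleftrightarrow>
    subring \<O> (ring_mat TYPE('d fract) n ()) \<and>
    Module.submodule \<O> (class_ring :: 'd ring) (mat_module_base n) \<and>
    finitely_generated (class_ring :: 'd ring) ((mat_module_base n)\<lparr>carrier := \<O>\<rparr>) \<and>
    lmod_span (class_ring :: 'd fract ring) (module_mat TYPE('d fract) n n) \<O> = carrier_mat n n"

definition order_ring :: "nat \<Rightarrow> 'd::idom fract mat set \<Rightarrow> 'd fract mat ring"
  where "order_ring n \<O> = (ring_mat TYPE('d fract) n ())\<lparr>carrier := \<O>\<rparr>"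

definition pi_ideal :: "'d::idom \<Rightarrow> 'd fract mat set \<Rightarrow> 'd fract mat set"
  where "pi_ideal \<pi> \<O> = (\<lambda>A. to_fract \<pi> \<cdot>\<^sub>m A) ` \<O>"

definition order_quotient :: "nat \<Rightarrow> 'd::idom \<Rightarrow> 'd fract mat set \<Rightarrow> 'd fract mat set ring"
  where "order_quotient n \<pi> \<O> = order_ring n \<O> Quot pi_ideal \<pi> \<O>"

definition inflate :: "nat \<Rightarrow> 'd::idom \<Rightarrow> 'd fract mat set \<Rightarrow>
    ('d fract mat set, 'm) module \<Rightarrow> ('d fract mat, 'm) module"
  where "inflate n \<pi> \<O> M = restrict_scalars (\<lambda>a. pi_ideal \<pi> \<O> +>\<^bsub>order_ring n \<O>\<^esub> a) M"

end

theory Submission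
  imports Defs
begin

text \<open>
  Write \<open>O\<close> for the order and \<open>\<pi>\<close> also for the scalar matrix, which is central in \<open>O\<close> and not a
  zero divisor. Projective \<open>O\<close>-modules are submodules of free ones, so \<open>\<pi>\<close> acts injectively on them.
  As \<open>\<pi>\<close> kills \<open>M\<close> and \<open>M\<close> is not zero, \<open>M\<close> is not projective over \<open>O\<close>; hence \<open>m > 0\<close>.

  Let \<open>0 \<rightarrow> K \<rightarrow> P \<rightarrow> M \<rightarrow> 0\<close> be exact with \<open>P\<close> projective over \<open>O\<close>, so that \<open>K\<close> has projective
  dimension at most \<open>m - 1\<close>. Since \<open>\<pi> P \<subseteq> K\<close> and \<open>\<pi> P / \<pi> K\<close> is isomorphic to \<open>P / K = M\<close>, reduction
  modulo \<open>\<pi>\<close> gives an exact sequence of \<open>\<Lambda>\<close>-modules (\<open>reduction_sequence\<close>)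
  \<open>0 \<rightarrow> M \<rightarrow> K/\<pi>K \<rightarrow> P/\<pi>P \<rightarrow> M \<rightarrow> 0\<close>.
  Here \<open>P/\<pi>P\<close> is projective over \<open>\<Lambda>\<close>. Moreover \<open>K/\<pi>K\<close> has projective dimension at most \<open>m - 1\<close> over
  \<open>\<Lambda>\<close>, because reduction preserves the exactness of a projective resolution of the torsion-free
  module \<open>K\<close> (\<open>pd_le_reduction\<close>).

  The image \<open>L\<close> of the middle map is \<open>\<Omega> M\<close> up to a projective summand, and \<open>M\<close> is the kernel of a map
  from \<open>K/\<pi>K\<close> onto \<open>L\<close>. If the middle term of a short exact sequence has projective dimension at
  most \<open>k\<close>, then from degree \<open>k\<close> on the syzygies of the left term are those of the right term shifted
  by one, up to a projective summand (\<open>syzygy_of_extension\<close>). With \<open>k = m - 1\<close> this compares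
  \<open>\<Omega>^(m-1) M\<close> with \<open>\<Omega>^m L\<close>, which is \<open>\<Omega>^(m+1) M\<close>; see \<open>syzygy_periodic\<close>.

  Taking syzygies once more removes the projective summand, so the syzygies have period two from
  degree \<open>m\<close> on. This bounds the repetition index at once. It also leaves only finitely many
  isomorphism types of syzygies; if \<open>M\<close> is finitely generated, these have finite length, and the theorem
  of Krull and Schmidt bounds the indecomposable summands (\<open>finite_type_of_finite_length\<close>).

  The argument needs a projective cover of every \<open>\<Lambda>\<close>-module, finitely generated or not. It exists
  because \<open>\<Lambda>\<close> has finite length over itself: the radical \<open>J\<close> is nilpotent and \<open>\<Lambda>/J\<close> is semisimple, and
  a decomposition of a free module modulo \<open>J\<close> lifts (\<open>projective_cover_in_projective\<close>). All
  \<open>\<Lambda>\<close>-modules are kept on one type; it has room for the pullbacks, quotients and covers that occur,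
  since finite sequences over it embed into it.
\<close>

hide_const (open) LinearCombinations.submodule Ring_Hom.ring_hom
hide_fact (open) LinearCombinations.submodule_def


section \<open>Left modules and their homomorphisms\<close>

context abelian_group
begin

lemma add_diff_cancel: "\<lbrakk>x \<in> carrier G; y \<in> carrier G\<rbrakk> \<Longrightarrow> y \<oplus> (x \<ominus> y) = x"
  by (simp add: minus_eq a_comm r_neg2 a_assoc r_neg1 a_lcomm r_neg)

lemma diff_add_cancel: "\<lbrakk>x \<in> carrier G; y \<in> carrier G\<rbrakk> \<Longrightarrow> (x \<ominus> y) \<oplus> y = x"
  by (simp add: minus_eq a_assoc l_neg)

lemma add_diff_cancel_right: "\<lbrakk>x \<in> carrier G; y \<in> carrier G\<rbrakk> \<Longrightarrow> (x \<oplus> y) \<ominus> y = x"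
  by (simp add: minus_eq a_assoc r_neg)

lemma add_diff_cancel_left: "\<lbrakk>x \<in> carrier G; y \<in> carrier G\<rbrakk> \<Longrightarrow> (x \<oplus> y) \<ominus> x = y"
  by (simp add: add_diff_cancel_right a_comm[of x y])

lemma diff_zero: "x \<in> carrier G \<Longrightarrow> x \<ominus> \<zero> = x"
  by (simp add: minus_eq)

lemma diff_self: "x \<in> carrier G \<Longrightarrow> x \<ominus> x = \<zero>"
  by (simp add: minus_eq r_neg)

lemma diff_eq_zero_iff: "\<lbrakk>x \<in> carrier G; y \<in> carrier G\<rbrakk> \<Longrightarrow> x \<ominus> y = \<zero> \<longleftrightarrow> x = y"
  by simp

lemma add_diff_add:
  "\<lbrakk>x \<in> carrier G; y \<in> carrier G; u \<in> carrier G; v \<in> carrier G\<rbrakk> \<Longrightarrow>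
    (x \<oplus> y) \<ominus> (u \<oplus> v) = (x \<ominus> u) \<oplus> (y \<ominus> v)"
  by (simp add: minus_eq minus_add a_ac)

lemma add_add_swap:
  "\<lbrakk>x \<in> carrier G; y \<in> carrier G; u \<in> carrier G; v \<in> carrier G\<rbrakk> \<Longrightarrow>
    (x \<oplus> y) \<oplus> (u \<oplus> v) = (x \<oplus> u) \<oplus> (y \<oplus> v)"
  by (simp add: a_ac)

lemma diff_eq_iff:
  "\<lbrakk>x \<in> carrier G; y \<in> carrier G; u \<in> carrier G\<rbrakk> \<Longrightarrow> x \<ominus> y = u \<longleftrightarrow> x = u \<oplus> y"
  by (metis add_diff_cancel_right diff_add_cancel)

end

context left_module
begin

lemma smult_zero_right: "a \<in> carrier R \<Longrightarrow> a \<odot>\<^bsub>M\<^esub> \<zero>\<^bsub>M\<^esub> = \<zero>\<^bsub>M\<^esub>"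
  using smult_r_distr[of a "\<zero>\<^bsub>M\<^esub>" "\<zero>\<^bsub>M\<^esub>"] smult_closed[of a "\<zero>\<^bsub>M\<^esub>"]
  by (metis M.add.l_cancel_one M.add.one_closed M.r_zero)

lemma smult_zero_left: "x \<in> carrier M \<Longrightarrow> \<zero> \<odot>\<^bsub>M\<^esub> x = \<zero>\<^bsub>M\<^esub>"
  using smult_l_distr[of \<zero> \<zero> x] smult_closed[of \<zero> x]
  by (metis M.add.l_cancel_one R.r_zero R.zero_closed)

lemma smult_neg_right: "\<lbrakk>a \<in> carrier R; x \<in> carrier M\<rbrakk> \<Longrightarrow> a \<odot>\<^bsub>M\<^esub> (\<ominus>\<^bsub>M\<^esub> x) = \<ominus>\<^bsub>M\<^esub> (a \<odot>\<^bsub>M\<^esub> x)"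
  using smult_r_distr[of a "\<ominus>\<^bsub>M\<^esub> x" x]
  by (metis M.l_neg M.minus_equality M.a_inv_closed smult_closed smult_zero_right)

lemma smult_neg_left: "\<lbrakk>a \<in> carrier R; x \<in> carrier M\<rbrakk> \<Longrightarrow> (\<ominus> a) \<odot>\<^bsub>M\<^esub> x = \<ominus>\<^bsub>M\<^esub> (a \<odot>\<^bsub>M\<^esub> x)"
  using smult_l_distr[of "\<ominus> a" a x]
  by (metis M.minus_equality R.a_inv_closed R.l_neg smult_closed smult_zero_left)

lemma smult_diff_right:
  "\<lbrakk>a \<in> carrier R; x \<in> carrier M; y \<in> carrier M\<rbrakk> \<Longrightarrow>
    a \<odot>\<^bsub>M\<^esub> (x \<ominus>\<^bsub>M\<^esub> y) = a \<odot>\<^bsub>M\<^esub> x \<ominus>\<^bsub>M\<^esub> a \<odot>\<^bsub>M\<^esub> y"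
  by (simp add: M.minus_eq smult_r_distr smult_neg_right)

lemma smult_diff_left:
  "\<lbrakk>a \<in> carrier R; b \<in> carrier R; x \<in> carrier M\<rbrakk> \<Longrightarrow>
    (a \<ominus> b) \<odot>\<^bsub>M\<^esub> x = a \<odot>\<^bsub>M\<^esub> x \<ominus>\<^bsub>M\<^esub> b \<odot>\<^bsub>M\<^esub> x"
  by (simp add: M.minus_eq R.minus_eq smult_l_distr smult_neg_left)

lemma submoduleI:
  assumes "H \<subseteq> carrier M" "\<zero>\<^bsub>M\<^esub> \<in> H" "\<And>x y. \<lbrakk>x \<in> H; y \<in> H\<rbrakk> \<Longrightarrow> x \<oplus>\<^bsub>M\<^esub> y \<in> H"
    "\<And>a x. \<lbrakk>a \<in> carrier R; x \<in> H\<rbrakk> \<Longrightarrow> a \<odot>\<^bsub>M\<^esub> x \<in> H"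
  shows "submodule H R M"
proof -
  have "\<ominus>\<^bsub>M\<^esub> x \<in> H" if "x \<in> H" for x
    using assms(4)[of "\<ominus> \<one>" x] that assms(1) smult_neg_left[of \<one> x] by (auto simp: smult_one)
  then show ?thesis
    using assms unfolding submodule_def submodule_axioms_def
    by (auto intro!: subgroup.intro simp: a_inv_def)
qed

end

lemma submodule_subset: "submodule H R M \<Longrightarrow> H \<subseteq> carrier M"
  unfolding submodule_def using subgroup.subset by fastforce

lemma submodule_mem: "\<lbrakk>submodule H R M; x \<in> H\<rbrakk> \<Longrightarrow> x \<in> carrier M"
  using submodule_subset by blast

lemma submodule_zero: "submodule H R M \<Longrightarrow> \<zero>\<^bsub>M\<^esub> \<in> H"
  unfolding submodule_def using subgroup.one_closed by fastforce

lemma submodule_add: "\<lbrakk>submodule H R M; x \<in> H; y \<in> H\<rbrakk> \<Longrightarrow> x \<oplus>\<^bsub>M\<^esub> y \<in> H"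
  unfolding submodule_def using subgroup.m_closed by fastforce

lemma submodule_neg: "\<lbrakk>submodule H R M; x \<in> H\<rbrakk> \<Longrightarrow> \<ominus>\<^bsub>M\<^esub> x \<in> H"
  using subgroup.m_inv_closed[of H "add_monoid M" x] by (simp add: submodule_def a_inv_def)

lemma submodule_diff: "\<lbrakk>submodule H R M; x \<in> H; y \<in> H\<rbrakk> \<Longrightarrow> x \<ominus>\<^bsub>M\<^esub> y \<in> H"
  unfolding a_minus_def by (simp add: submodule_add submodule_neg)

lemma submodule_smult: "\<lbrakk>submodule H R M; a \<in> carrier R; x \<in> H\<rbrakk> \<Longrightarrow> a \<odot>\<^bsub>M\<^esub> x \<in> H"
  by (simp add: submodule_def submodule_axioms_def)

lemma set_add_iff: "x \<in> H <+>\<^bsub>M\<^esub> K \<longleftrightarrow> (\<exists>h\<in>H. \<exists>k\<in>K. x = h \<oplus>\<^bsub>M\<^esub> k)"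
  by (auto simp: set_add_def')

lemma set_add_eqD: "\<lbrakk>H <+>\<^bsub>M\<^esub> K = L; x \<in> L\<rbrakk> \<Longrightarrow> \<exists>h\<in>H. \<exists>k\<in>K. x = h \<oplus>\<^bsub>M\<^esub> k"
  by (auto simp: set_add_iff)

lemma set_add_subsetD: "\<lbrakk>L \<subseteq> H <+>\<^bsub>M\<^esub> K; x \<in> L\<rbrakk> \<Longrightarrow> \<exists>h\<in>H. \<exists>k\<in>K. x = h \<oplus>\<^bsub>M\<^esub> k"
  by (auto simp: set_add_iff)

lemma left_module_submodule:
  assumes "left_module R M" "submodule H R M"
  shows "left_module R (M\<lparr>carrier := H\<rparr>)"
proof -
  interpret M: left_module R M by fact
  note mem = submodule_mem[OF assms(2)]
  have "abelian_group (M\<lparr>carrier := H\<rparr>)"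
  proof (rule abelian_groupI)
    fix x assume "x \<in> carrier (M\<lparr>carrier := H\<rparr>)"
    then show "\<exists>y\<in>carrier (M\<lparr>carrier := H\<rparr>). y \<oplus>\<^bsub>M\<lparr>carrier := H\<rparr>\<^esub> x = \<zero>\<^bsub>M\<lparr>carrier := H\<rparr>\<^esub>"
      by (intro bexI[of _ "\<ominus>\<^bsub>M\<^esub> x"]) (auto simp: M.M.l_neg mem submodule_neg[OF assms(2)])
  qed (auto simp: submodule_zero[OF assms(2)] submodule_add[OF assms(2)] mem M.M.a_ac)
  moreover have "H \<subseteq> carrier M" using assms(2) by (rule submodule_subset)
  ultimately show ?thesis
    by (intro left_module.intro left_module_axioms.intro M.R.ring_axioms)
      (auto simp: mem submodule_smult[OF assms(2)] M.smult_l_distr M.smult_r_distr M.smult_assoc M.smult_one)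
qed

lemma submodule_carrier:
  assumes "left_module R M"
  shows "submodule (carrier M) R M"
proof -
  interpret M: left_module R M by fact
  show ?thesis by (rule M.submoduleI) (auto simp: M.smult_closed)
qed

lemma zero_mem_carrier: "left_module R M \<Longrightarrow> \<zero>\<^bsub>M\<^esub> \<in> carrier M"
  using submodule_zero[OF submodule_carrier] .

lemma submodule_trans:
  assumes "left_module R M" "submodule H R M"
  shows "submodule K R (M\<lparr>carrier := H\<rparr>) \<longleftrightarrow> submodule K R M \<and> K \<subseteq> H"
proof -
  interpret M: left_module R M by fact
  interpret H: left_module R "M\<lparr>carrier := H\<rparr>" by (rule left_module_submodule[OF assms])
  show ?thesis
  proof (intro iffI conjI)
    assume K: "submodule K R (M\<lparr>carrier := H\<rparr>)"
    show "submodule K R M"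
      using submodule_subset[OF K] submodule_subset[OF assms(2)] submodule_zero[OF K]
        submodule_add[OF K] submodule_smult[OF K]
      by (intro M.submoduleI) auto
    show "K \<subseteq> H" using submodule_subset[OF K] by simp
  next
    assume "submodule K R M \<and> K \<subseteq> H"
    then show "submodule K R (M\<lparr>carrier := H\<rparr>)"
      using submodule_zero submodule_add submodule_smult
      by (intro H.submoduleI) fastforce+
  qed
qed

lemma submodule_Int:
  assumes "left_module R M" "submodule H R M" "submodule K R M"
  shows "submodule (H \<inter> K) R M"
  using assms submodule_subset[OF assms(2)]
  by (intro left_module.submoduleI) (auto simp: submodule_zero submodule_add submodule_smult)

lemma submodule_set_add:
  assumes "left_module R M" "submodule H R M" "submodule K R M"
  shows "submodule (H <+>\<^bsub>M\<^esub> K) R M"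
proof -
  interpret M: left_module R M by fact
  note mem = submodule_mem[OF assms(2)] submodule_mem[OF assms(3)]
  show ?thesis
  proof (rule M.submoduleI)
    show "H <+>\<^bsub>M\<^esub> K \<subseteq> carrier M" by (auto simp: set_add_iff mem)
    show "\<zero>\<^bsub>M\<^esub> \<in> H <+>\<^bsub>M\<^esub> K" 
      using submodule_zero[OF assms(2)] submodule_zero[OF assms(3)] by (force simp: set_add_iff)
  next
    fix x y assume "x \<in> H <+>\<^bsub>M\<^esub> K" "y \<in> H <+>\<^bsub>M\<^esub> K"
    then obtain h k h' k' where "h \<in> H" "k \<in> K" "h' \<in> H" "k' \<in> K" "x = h \<oplus>\<^bsub>M\<^esub> k" "y = h' \<oplus>\<^bsub>M\<^esub> k'"
      by (auto simp: set_add_iff)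
    then show "x \<oplus>\<^bsub>M\<^esub> y \<in> H <+>\<^bsub>M\<^esub> K"
      using M.M.add_add_swap[of h k h' k'] submodule_add assms mem by (metis set_add_iff)
  next
    fix a x assume "a \<in> carrier R" "x \<in> H <+>\<^bsub>M\<^esub> K"
    then show "a \<odot>\<^bsub>M\<^esub> x \<in> H <+>\<^bsub>M\<^esub> K"
      by (auto simp: set_add_iff) (metis M.smult_r_distr mem assms(2,3) submodule_smult)
  qed
qed

lemma set_add_superset:
  assumes "left_module R M" "submodule H R M" "submodule K R M"
  shows "H \<subseteq> H <+>\<^bsub>M\<^esub> K" "K \<subseteq> H <+>\<^bsub>M\<^esub> K"
proof -
  interpret M: left_module R M by fact
  note mem = submodule_mem[OF assms(2)] submodule_mem[OF assms(3)]
  show "H \<subseteq> H <+>\<^bsub>M\<^esub> K"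
    using submodule_zero[OF assms(3)] mem by (force simp: set_add_iff intro!: bexI)
  show "K \<subseteq> H <+>\<^bsub>M\<^esub> K"
    using submodule_zero[OF assms(2)] mem by (force simp: set_add_iff intro!: bexI)
qed

lemma set_add_least:
  assumes "submodule L R M" "H \<subseteq> L" "K \<subseteq> L"
  shows "H <+>\<^bsub>M\<^esub> K \<subseteq> L"
  using assms submodule_add[OF assms(1)] by (auto simp: set_add_iff subset_eq)

lemma submodule_zero_set: "left_module R M \<Longrightarrow> submodule {\<zero>\<^bsub>M\<^esub>} R M"
proof -
  assume "left_module R M"
  then interpret M: left_module R M .
  show ?thesis by (rule M.submoduleI) (auto simp: M.smult_zero_right)
qed

lemma lmod_homI:
  assumes "\<And>x. x \<in> carrier M \<Longrightarrow> f x \<in> carrier N"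
    "\<And>x y. \<lbrakk>x \<in> carrier M; y \<in> carrier M\<rbrakk> \<Longrightarrow> f (x \<oplus>\<^bsub>M\<^esub> y) = f x \<oplus>\<^bsub>N\<^esub> f y"
    "\<And>a x. \<lbrakk>a \<in> carrier R; x \<in> carrier M\<rbrakk> \<Longrightarrow> f (a \<odot>\<^bsub>M\<^esub> x) = a \<odot>\<^bsub>N\<^esub> f x"
  shows "f \<in> lmod_hom R M N"
  using assms by (auto simp: lmod_hom_def hom_def)

lemma lmod_hom_closed: "\<lbrakk>f \<in> lmod_hom R M N; x \<in> carrier M\<rbrakk> \<Longrightarrow> f x \<in> carrier N"
  by (auto simp: lmod_hom_def hom_def)

lemma lmod_hom_add:
  "\<lbrakk>f \<in> lmod_hom R M N; x \<in> carrier M; y \<in> carrier M\<rbrakk> \<Longrightarrow> f (x \<oplus>\<^bsub>M\<^esub> y) = f x \<oplus>\<^bsub>N\<^esub> f y"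
  by (auto simp: lmod_hom_def hom_def)

lemma lmod_hom_smult:
  "\<lbrakk>f \<in> lmod_hom R M N; a \<in> carrier R; x \<in> carrier M\<rbrakk> \<Longrightarrow> f (a \<odot>\<^bsub>M\<^esub> x) = a \<odot>\<^bsub>N\<^esub> f x"
  by (auto simp: lmod_hom_def)

lemma lmod_hom_cong:
  "\<lbrakk>f \<in> lmod_hom R M N; left_module R M; \<And>x. x \<in> carrier M \<Longrightarrow> g x = f x\<rbrakk> \<Longrightarrow> g \<in> lmod_hom R M N"
  by (auto intro!: lmod_homI simp: lmod_hom_closed lmod_hom_add lmod_hom_smult
      left_module.smult_closed abelian_monoid.a_closed abelian_group.axioms(1) left_module.axioms(2))

lemma lmod_hom_compose:
  "\<lbrakk>f \<in> lmod_hom R M N; g \<in> lmod_hom R N L\<rbrakk> \<Longrightarrow> (\<lambda>x. g (f x)) \<in> lmod_hom R M L"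
  by (auto intro!: lmod_homI simp: lmod_hom_closed lmod_hom_add lmod_hom_smult)

lemma lmod_hom_id: "(\<lambda>x. x) \<in> lmod_hom R M M"
  by (auto intro!: lmod_homI)

lemma lmod_hom_incl: "H \<subseteq> carrier M \<Longrightarrow> (\<lambda>x. x) \<in> lmod_hom R (M\<lparr>carrier := H\<rparr>) M"
  by (auto intro!: lmod_homI)

lemma lmod_hom_restrict:
  "\<lbrakk>f \<in> lmod_hom R M N; H \<subseteq> carrier M; f ` H \<subseteq> K\<rbrakk> \<Longrightarrow>
    f \<in> lmod_hom R (M\<lparr>carrier := H\<rparr>) (N\<lparr>carrier := K\<rparr>)"
  by (auto intro!: lmod_homI simp: lmod_hom_add lmod_hom_smult subset_eq)

lemma lmod_hom_restrict_dom:
  "\<lbrakk>f \<in> lmod_hom R M N; H \<subseteq> carrier M\<rbrakk> \<Longrightarrow> f \<in> lmod_hom R (M\<lparr>carrier := H\<rparr>) N"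
  by (auto intro!: lmod_homI simp: lmod_hom_add lmod_hom_smult subset_eq lmod_hom_closed)

lemma lmod_hom_restrict_cod:
  "\<lbrakk>f \<in> lmod_hom R M N; f ` carrier M \<subseteq> K\<rbrakk> \<Longrightarrow> f \<in> lmod_hom R M (N\<lparr>carrier := K\<rparr>)"
  by (auto intro!: lmod_homI simp: lmod_hom_add lmod_hom_smult subset_eq)

lemma lmod_hom_zero:
  assumes "f \<in> lmod_hom R M N" "left_module R M" "left_module R N"
  shows "f \<zero>\<^bsub>M\<^esub> = \<zero>\<^bsub>N\<^esub>"
proof -
  interpret M: left_module R M by fact
  interpret N: left_module R N by fact
  have "f \<zero>\<^bsub>M\<^esub> \<oplus>\<^bsub>N\<^esub> f \<zero>\<^bsub>M\<^esub> = f \<zero>\<^bsub>M\<^esub>"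
    using lmod_hom_add[OF assms(1), of "\<zero>\<^bsub>M\<^esub>" "\<zero>\<^bsub>M\<^esub>"] by simp
  then show ?thesis
    using N.M.add.l_cancel_one[of "f \<zero>\<^bsub>M\<^esub>" "f \<zero>\<^bsub>M\<^esub>"] lmod_hom_closed[OF assms(1), of "\<zero>\<^bsub>M\<^esub>"] by simp
qed

lemma lmod_hom_diff:
  assumes "f \<in> lmod_hom R M N" "left_module R M" "left_module R N" "x \<in> carrier M" "y \<in> carrier M"
  shows "f (x \<ominus>\<^bsub>M\<^esub> y) = f x \<ominus>\<^bsub>N\<^esub> f y"
proof -
  interpret M: left_module R M by fact
  interpret N: left_module R N by fact
  have "f (x \<ominus>\<^bsub>M\<^esub> y) \<oplus>\<^bsub>N\<^esub> f y = f x"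
    using lmod_hom_add[OF assms(1), of "x \<ominus>\<^bsub>M\<^esub> y" y] assms M.M.diff_add_cancel by simp
  then show ?thesis
    using N.M.diff_eq_iff[of "f x" "f y" "f (x \<ominus>\<^bsub>M\<^esub> y)"] lmod_hom_closed[OF assms(1)] assms(4,5) by simp
qed

lemma lmod_hom_sum:
  assumes "f \<in> lmod_hom R M N" "g \<in> lmod_hom R M N" "left_module R N"
  shows "(\<lambda>x. f x \<oplus>\<^bsub>N\<^esub> g x) \<in> lmod_hom R M N"
proof -
  interpret N: left_module R N by fact
  show ?thesis
    using assms by (auto intro!: lmod_homI N.M.add_add_swap
        simp: lmod_hom_closed lmod_hom_add lmod_hom_smult N.smult_r_distr)
qed

lemma lmod_hom_difference:
  assumes "f \<in> lmod_hom R M N" "g \<in> lmod_hom R M N" "left_module R N"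
  shows "(\<lambda>x. f x \<ominus>\<^bsub>N\<^esub> g x) \<in> lmod_hom R M N"
proof -
  interpret N: left_module R N by fact
  show ?thesis
    using assms by (auto intro!: lmod_homI N.M.add_diff_add
        simp: lmod_hom_closed lmod_hom_add lmod_hom_smult N.smult_diff_right)
qed

lemma lmod_hom_const_zero: "left_module R N \<Longrightarrow> (\<lambda>x. \<zero>\<^bsub>N\<^esub>) \<in> lmod_hom R M N"
proof -
  assume "left_module R N"
  then interpret N: left_module R N .
  show ?thesis by (auto intro!: lmod_homI simp: N.smult_zero_right)
qed

lemma a_kernel_iff: "x \<in> a_kernel M N f \<longleftrightarrow> x \<in> carrier M \<and> f x = \<zero>\<^bsub>N\<^esub>"
  by (simp add: a_kernel_def')

lemma a_kernel_subset: "a_kernel M N f \<subseteq> carrier M"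
  by (auto simp: a_kernel_iff)

abbreviation ker_module :: "('r, 'm) module \<Rightarrow> ('r, 'n) module \<Rightarrow> ('m \<Rightarrow> 'n) \<Rightarrow> ('r, 'm) module"
  where "ker_module M N f \<equiv> M\<lparr>carrier := a_kernel M N f\<rparr>"

lemma submodule_kernel:
  assumes "f \<in> lmod_hom R M N" "left_module R M" "left_module R N"
  shows "submodule (a_kernel M N f) R M"
proof -
  interpret M: left_module R M by fact
  interpret N: left_module R N by fact
  show ?thesis
    by (rule M.submoduleI)
      (auto simp: a_kernel_iff lmod_hom_zero[OF assms] lmod_hom_add[OF assms(1)]
        lmod_hom_smult[OF assms(1)] N.smult_zero_right M.smult_closed)
qed

lemma left_module_kernel:
  assumes "f \<in> lmod_hom R M N" "left_module R M" "left_module R N"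
  shows "left_module R (ker_module M N f)"
  by (rule left_module_submodule[OF assms(2) submodule_kernel[OF assms]])

lemma submodule_image:
  assumes "f \<in> lmod_hom R M N" "left_module R M" "left_module R N" "submodule H R M"
  shows "submodule (f ` H) R N"
proof -
  interpret M: left_module R M by fact
  interpret N: left_module R N by fact
  note mem = submodule_mem[OF assms(4)]
  show ?thesis
  proof (rule N.submoduleI)
    show "f ` H \<subseteq> carrier N" using lmod_hom_closed[OF assms(1)] mem by auto
    show "\<zero>\<^bsub>N\<^esub> \<in> f ` H" using lmod_hom_zero[OF assms(1-3)] submodule_zero[OF assms(4)] by force
    fix x y assume "x \<in> f ` H" "y \<in> f ` H"
    then show "x \<oplus>\<^bsub>N\<^esub> y \<in> f ` H"
      using lmod_hom_add[OF assms(1)] mem submodule_add[OF assms(4)] by (smt (verit) image_iff)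
  next
    fix a x assume "a \<in> carrier R" "x \<in> f ` H"
    then show "a \<odot>\<^bsub>N\<^esub> x \<in> f ` H"
      using lmod_hom_smult[OF assms(1)] mem submodule_smult[OF assms(4)] by (smt (verit) image_iff)
  qed
qed

lemma submodule_vimage:
  assumes "f \<in> lmod_hom R M N" "left_module R M" "left_module R N" "submodule H R N"
  shows "submodule {x \<in> carrier M. f x \<in> H} R M"
proof -
  interpret M: left_module R M by fact
  show ?thesis
    by (rule M.submoduleI)
      (auto simp: lmod_hom_zero[OF assms(1-3)] lmod_hom_add[OF assms(1)] lmod_hom_smult[OF assms(1)]
        submodule_zero[OF assms(4)] submodule_add[OF assms(4)] submodule_smult[OF assms(4)] M.smult_closed)
qed

lemma inj_on_kernel:
  assumes "f \<in> lmod_hom R M N" "left_module R M" "left_module R N"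
    and "\<And>x. \<lbrakk>x \<in> carrier M; f x = \<zero>\<^bsub>N\<^esub>\<rbrakk> \<Longrightarrow> x = \<zero>\<^bsub>M\<^esub>"
  shows "inj_on f (carrier M)"
proof (rule inj_onI)
  interpret M: left_module R M by fact
  interpret N: left_module R N by fact
  fix x y assume xy: "x \<in> carrier M" "y \<in> carrier M" "f x = f y"
  then have "f (x \<ominus>\<^bsub>M\<^esub> y) = \<zero>\<^bsub>N\<^esub>"
    using lmod_hom_diff[OF assms(1-3)] lmod_hom_closed[OF assms(1)] N.M.diff_self by simp
  then show "x = y" using assms(4)[of "x \<ominus>\<^bsub>M\<^esub> y"] M.M.diff_eq_zero_iff xy by simp
qed

lemma lmod_isoI: "\<lbrakk>f \<in> lmod_hom R M N; bij_betw f (carrier M) (carrier N)\<rbrakk> \<Longrightarrow> lmod_iso R M N"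
  by (auto simp: lmod_iso_def)

lemma lmod_isoI_inverse:
  assumes "f \<in> lmod_hom R M N" "g \<in> lmod_hom R N M"
    "\<And>x. x \<in> carrier M \<Longrightarrow> g (f x) = x" "\<And>y. y \<in> carrier N \<Longrightarrow> f (g y) = y"
  shows "lmod_iso R M N"
proof (rule lmod_isoI[OF assms(1)])
  show "bij_betw f (carrier M) (carrier N)"
    by (rule bij_betwI[where g = g]) (auto simp: assms lmod_hom_closed[OF assms(1)] lmod_hom_closed[OF assms(2)])
qed

lemma lmod_hom_inverse:
  assumes "f \<in> lmod_hom R M N" "bij_betw f (carrier M) (carrier N)" "left_module R M"
  shows "inv_into (carrier M) f \<in> lmod_hom R N M"
proof -
  interpret M: left_module R M by fact
  let ?g = "inv_into (carrier M) f"
  have g: "?g y \<in> carrier M" "f (?g y) = y" if "y \<in> carrier N" for y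
    using assms(2) that by (metis bij_betw_def inv_into_into, metis bij_betw_inv_into_right)
  have gf: "?g (f x) = x" if "x \<in> carrier M" for x
    using assms(2) that by (simp add: bij_betw_def)
  show ?thesis
  proof (rule lmod_homI)
    fix x y assume "x \<in> carrier N" "y \<in> carrier N"
    then show "?g (x \<oplus>\<^bsub>N\<^esub> y) = ?g x \<oplus>\<^bsub>M\<^esub> ?g y"
      using lmod_hom_add[OF assms(1), of "?g x" "?g y"] g gf[of "?g x \<oplus>\<^bsub>M\<^esub> ?g y"] by simp
  next
    fix a x assume "a \<in> carrier R" "x \<in> carrier N"
    then show "?g (a \<odot>\<^bsub>N\<^esub> x) = a \<odot>\<^bsub>M\<^esub> ?g x"
      using lmod_hom_smult[OF assms(1), of a "?g x"] g gf[of "a \<odot>\<^bsub>M\<^esub> ?g x"] by (simp add: M.smult_closed)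
  qed (rule g)
qed

lemma lmod_iso_inverse:
  assumes "lmod_iso R M N" "left_module R M"
  shows "\<exists>f\<in>lmod_hom R M N. \<exists>g\<in>lmod_hom R N M.
    (\<forall>x\<in>carrier M. g (f x) = x) \<and> (\<forall>y\<in>carrier N. f (g y) = y)"
proof -
  obtain f where f: "f \<in> lmod_hom R M N" "bij_betw f (carrier M) (carrier N)"
    using assms(1) by (auto simp: lmod_iso_def)
  have "\<forall>x\<in>carrier M. inv_into (carrier M) f (f x) = x" "\<forall>y\<in>carrier N. f (inv_into (carrier M) f y) = y"
    using f(2) by (auto simp: bij_betw_def f_inv_into_f)
  then show ?thesis using f(1) lmod_hom_inverse[OF f assms(2)] by blast
qed

lemma lmod_iso_refl: "lmod_iso R M M"
  by (rule lmod_isoI_inverse[OF lmod_hom_id lmod_hom_id]) auto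

lemma lmod_iso_sym: "\<lbrakk>lmod_iso R M N; left_module R M\<rbrakk> \<Longrightarrow> lmod_iso R N M"
  by (drule (1) lmod_iso_inverse) (auto intro: lmod_isoI_inverse)

lemma lmod_iso_trans: "\<lbrakk>lmod_iso R M N; lmod_iso R N L\<rbrakk> \<Longrightarrow> lmod_iso R M L"
  using lmod_hom_compose[of _ R M N _ L] bij_betw_trans[of _ "carrier M" "carrier N" _ "carrier L"]
  unfolding lmod_iso_def comp_def by blast

lemma dsum2_simps [simp]:
  "carrier (dsum2 M N) = carrier M \<times> carrier N"
  "\<zero>\<^bsub>dsum2 M N\<^esub> = (\<zero>\<^bsub>M\<^esub>, \<zero>\<^bsub>N\<^esub>)"
  "(x, y) \<oplus>\<^bsub>dsum2 M N\<^esub> (x', y') = (x \<oplus>\<^bsub>M\<^esub> x', y \<oplus>\<^bsub>N\<^esub> y')"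
  "a \<odot>\<^bsub>dsum2 M N\<^esub> (x, y) = (a \<odot>\<^bsub>M\<^esub> x, a \<odot>\<^bsub>N\<^esub> y)"
  by (simp_all add: dsum2_def)

lemma left_module_dsum2:
  assumes "left_module R M" "left_module R N"
  shows "left_module R (dsum2 M N)"
proof -
  interpret M: left_module R M by fact
  interpret N: left_module R N by fact
  show ?thesis
  proof (intro left_module.intro M.R.ring_axioms left_module_axioms.intro abelian_groupI)
    fix x assume "x \<in> carrier (dsum2 M N)"
    then obtain u v where "x = (u, v)" "u \<in> carrier M" "v \<in> carrier N" by auto
    then show "\<exists>y\<in>carrier (dsum2 M N). y \<oplus>\<^bsub>dsum2 M N\<^esub> x = \<zero>\<^bsub>dsum2 M N\<^esub>"
      by (intro bexI[of _ "(\<ominus>\<^bsub>M\<^esub> u, \<ominus>\<^bsub>N\<^esub> v)"]) (auto simp: M.M.l_neg N.M.l_neg)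
  qed (auto simp: M.M.a_ac N.M.a_ac M.smult_closed N.smult_closed M.smult_l_distr N.smult_l_distr
      M.smult_r_distr N.smult_r_distr M.smult_assoc N.smult_assoc M.smult_one N.smult_one)
qed

lemma lmod_hom_fst: "fst \<in> lmod_hom R (dsum2 M N) M"
  and lmod_hom_snd: "snd \<in> lmod_hom R (dsum2 M N) N"
  by (auto intro!: lmod_homI)

lemma lmod_hom_pair:
  "\<lbrakk>f \<in> lmod_hom R L M; g \<in> lmod_hom R L N\<rbrakk> \<Longrightarrow> (\<lambda>x. (f x, g x)) \<in> lmod_hom R L (dsum2 M N)"
  by (auto intro!: lmod_homI simp: lmod_hom_closed lmod_hom_add lmod_hom_smult)

lemma lmod_hom_inl: "left_module R N \<Longrightarrow> (\<lambda>x. (x, \<zero>\<^bsub>N\<^esub>)) \<in> lmod_hom R M (dsum2 M N)"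
  by (intro lmod_hom_pair lmod_hom_id lmod_hom_const_zero)

lemma lmod_hom_inr: "left_module R M \<Longrightarrow> (\<lambda>x. (\<zero>\<^bsub>M\<^esub>, x)) \<in> lmod_hom R N (dsum2 M N)"
  by (intro lmod_hom_pair lmod_hom_id lmod_hom_const_zero)

lemma lmod_hom_copair:
  assumes "f \<in> lmod_hom R M L" "g \<in> lmod_hom R N L" "left_module R L"
  shows "(\<lambda>(x, y). f x \<oplus>\<^bsub>L\<^esub> g y) \<in> lmod_hom R (dsum2 M N) L"
  using lmod_hom_sum[OF lmod_hom_compose[OF lmod_hom_fst assms(1)] lmod_hom_compose[OF lmod_hom_snd assms(2)] assms(3)]
  by (simp add: case_prod_unfold)

lemma lmod_hom_map_prod:
  assumes "f \<in> lmod_hom R M M'" "g \<in> lmod_hom R N N'"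
  shows "map_prod f g \<in> lmod_hom R (dsum2 M N) (dsum2 M' N')"
  using assms by (auto intro!: lmod_homI simp: lmod_hom_closed lmod_hom_add lmod_hom_smult)

lemma dsum2_cong:
  assumes "lmod_iso R M M'" "lmod_iso R N N'"
  shows "lmod_iso R (dsum2 M N) (dsum2 M' N')"
  using assms unfolding lmod_iso_def
  by (auto intro!: bexI lmod_hom_map_prod bij_betw_map_prod)

lemma dsum2_commute: "lmod_iso R (dsum2 M N) (dsum2 N M)"
  by (rule lmod_isoI_inverse[OF lmod_hom_pair[OF lmod_hom_snd lmod_hom_fst] lmod_hom_pair[OF lmod_hom_snd lmod_hom_fst]])
    auto

lemma dsum2_assoc: "lmod_iso R (dsum2 (dsum2 M N) L) (dsum2 M (dsum2 N L))"
  by (rule lmod_isoI_inverse[where f = "\<lambda>((x, y), z). (x, (y, z))" and g = "\<lambda>(x, (y, z)). ((x, y), z)"])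
    (auto intro!: lmod_homI)

text \<open>
  The isomorphism sends \<open>x\<close> to the pair of \<open>x - s (f x)\<close> and \<open>f x\<close>.
\<close>

lemma split_iso:
  assumes M: "left_module R M" and N: "left_module R N"
    and f: "f \<in> lmod_hom R M N" and s: "s \<in> lmod_hom R N M"
    and fs: "\<And>y. y \<in> carrier N \<Longrightarrow> f (s y) = y"
  shows "lmod_iso R M (dsum2 (ker_module M N f) N)"
proof -
  interpret M: left_module R M by fact
  interpret N: left_module R N by fact
  have d: "(\<lambda>x. x \<ominus>\<^bsub>M\<^esub> s (f x)) \<in> lmod_hom R M M"
    by (intro lmod_hom_difference lmod_hom_id lmod_hom_compose[OF f s] M)
  have k: "x \<ominus>\<^bsub>M\<^esub> s (f x) \<in> a_kernel M N f" if "x \<in> carrier M" for x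
    using that lmod_hom_diff[OF f M N] lmod_hom_closed[OF f] lmod_hom_closed[OF s]
    by (simp add: a_kernel_iff fs N.M.diff_self)
  show ?thesis
  proof (rule lmod_isoI_inverse)
    show "(\<lambda>x. (x \<ominus>\<^bsub>M\<^esub> s (f x), f x)) \<in> lmod_hom R M (dsum2 (ker_module M N f) N)"
      by (intro lmod_hom_pair f lmod_hom_restrict_cod[OF d]) (auto simp: k)
    show "(\<lambda>(x, y). x \<oplus>\<^bsub>M\<^esub> s y) \<in> lmod_hom R (dsum2 (ker_module M N f) N) M"
      by (rule lmod_hom_copair[OF lmod_hom_incl s M]) (auto simp: a_kernel_iff)
  next
    fix x assume "x \<in> carrier M"
    then show "(case (x \<ominus>\<^bsub>M\<^esub> s (f x), f x) of (x, y) \<Rightarrow> x \<oplus>\<^bsub>M\<^esub> s y) = x"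
      using lmod_hom_closed[OF f] lmod_hom_closed[OF s] by (simp add: M.M.diff_add_cancel)
  next
    fix y assume "y \<in> carrier (dsum2 (ker_module M N f) N)"
    then obtain u v where y: "y = (u, v)" "u \<in> carrier M" "f u = \<zero>\<^bsub>N\<^esub>" "v \<in> carrier N"
      by (auto simp: a_kernel_iff)
    have "f (u \<oplus>\<^bsub>M\<^esub> s v) = v"
      using y lmod_hom_add[OF f] lmod_hom_closed[OF s] fs by simp
    then show "((case y of (x, y) \<Rightarrow> x \<oplus>\<^bsub>M\<^esub> s y) \<ominus>\<^bsub>M\<^esub> s (f (case y of (x, y) \<Rightarrow> x \<oplus>\<^bsub>M\<^esub> s y)),
        f (case y of (x, y) \<Rightarrow> x \<oplus>\<^bsub>M\<^esub> s y)) = y"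
      using y lmod_hom_closed[OF s] by (simp add: M.M.add_diff_cancel_right)
  qed
qed


section \<open>Restriction of scalars and quotient modules\<close>

lemma restrict_scalars_simps [simp]:
  "carrier (restrict_scalars \<phi> M) = carrier M"
  "\<zero>\<^bsub>restrict_scalars \<phi> M\<^esub> = \<zero>\<^bsub>M\<^esub>"
  "x \<oplus>\<^bsub>restrict_scalars \<phi> M\<^esub> y = x \<oplus>\<^bsub>M\<^esub> y"
  "a \<odot>\<^bsub>restrict_scalars \<phi> M\<^esub> x = \<phi> a \<odot>\<^bsub>M\<^esub> x"
  by (simp_all add: restrict_scalars_def)

lemma restrict_scalars_id: "restrict_scalars (\<lambda>a. a) (M :: ('r, 'm) module) = M"
  by (simp add: restrict_scalars_def)

lemma left_module_restrict_scalars: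
  assumes "left_module S M" "\<phi> \<in> ring_hom R S" "ring R"
  shows "left_module R (restrict_scalars \<phi> M)"
proof -
  interpret M: left_module S M by fact
  interpret R: ring R by fact
  have ab: "abelian_group (restrict_scalars \<phi> M)"
  proof (rule abelian_groupI)
    fix x assume "x \<in> carrier (restrict_scalars \<phi> M)"
    then show "\<exists>y\<in>carrier (restrict_scalars \<phi> M). y \<oplus>\<^bsub>restrict_scalars \<phi> M\<^esub> x = \<zero>\<^bsub>restrict_scalars \<phi> M\<^esub>"
      by (intro bexI[of _ "\<ominus>\<^bsub>M\<^esub> x"]) (auto simp: M.M.l_neg)
  qed (auto simp: M.M.a_ac)
  show ?thesis
    by (intro left_module.intro assms(3) ab left_module_axioms.intro)
      (auto simp: ring_hom_closed[OF assms(2)] ring_hom_add[OF assms(2)] ring_hom_mult[OF assms(2)]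
        ring_hom_one[OF assms(2)] M.smult_closed M.smult_l_distr M.smult_r_distr M.smult_assoc M.smult_one)
qed

lemma lmod_hom_restrict_scalars:
  assumes "f \<in> lmod_hom S M N" "\<phi> \<in> ring_hom R S"
  shows "f \<in> lmod_hom R (restrict_scalars \<phi> M) (restrict_scalars \<phi> N)"
  using assms by (auto intro!: lmod_homI simp: lmod_hom_closed lmod_hom_add lmod_hom_smult ring_hom_closed)

text \<open>
  Quotient modules are needed on prescribed types. Hence a quotient is described by an arbitrary map
  \<open>\<rho>\<close> whose fibres are the classes: the structure of \<open>X\<close> is pushed forward to the image of \<open>\<rho>\<close>. The
  scalars may be pushed forward along a surjective ring homomorphism at the same time.
\<close>

lemma push_module:
  fixes \<rho> :: "'m \<Rightarrow> 'n"
  assumes X: "left_module R X" and S: "ring S"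
    and \<phi>: "\<phi> \<in> ring_hom R S" "\<phi> ` carrier R = carrier S"
    and add: "\<And>x y x' y'. \<lbrakk>x \<in> carrier X; y \<in> carrier X; x' \<in> carrier X; y' \<in> carrier X; \<rho> x = \<rho> x'; \<rho> y = \<rho> y'\<rbrakk>
      \<Longrightarrow> \<rho> (x \<oplus>\<^bsub>X\<^esub> y) = \<rho> (x' \<oplus>\<^bsub>X\<^esub> y')"
    and smult: "\<And>a x a' x'. \<lbrakk>a \<in> carrier R; a' \<in> carrier R; x \<in> carrier X; x' \<in> carrier X; \<phi> a = \<phi> a'; \<rho> x = \<rho> x'\<rbrakk>
      \<Longrightarrow> \<rho> (a \<odot>\<^bsub>X\<^esub> x) = \<rho> (a' \<odot>\<^bsub>X\<^esub> x')"
  obtains Y :: "('s, 'n) module" where "left_module S Y" "carrier Y = \<rho> ` carrier X"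
    "\<rho> \<in> lmod_hom R X (restrict_scalars \<phi> Y)"
proof -
  interpret X: left_module R X by fact
  interpret S: ring S by fact
  define sx where "sx = inv_into (carrier X) \<rho>"
  define sr where "sr = inv_into (carrier R) \<phi>"
  have sx: "sx (\<rho> x) \<in> carrier X" "\<rho> (sx (\<rho> x)) = \<rho> x" if "x \<in> carrier X" for x
    using that by (auto simp: sx_def inv_into_into f_inv_into_f)
  have sr: "sr (\<phi> a) \<in> carrier R" "\<phi> (sr (\<phi> a)) = \<phi> a" if "a \<in> carrier R" for a
    using that by (auto simp: sr_def inv_into_into f_inv_into_f)
  define Y :: "('s, 'n) module" where
    "Y = \<lparr>carrier = \<rho> ` carrier X, monoid.mult = undefined, one = undefined, zero = \<rho> \<zero>\<^bsub>X\<^esub>,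
      add = (\<lambda>u v. \<rho> (sx u \<oplus>\<^bsub>X\<^esub> sx v)), smult = (\<lambda>s u. \<rho> (sr s \<odot>\<^bsub>X\<^esub> sx u))\<rparr>"
  have Y: "carrier Y = \<rho> ` carrier X" "\<zero>\<^bsub>Y\<^esub> = \<rho> \<zero>\<^bsub>X\<^esub>" by (simp_all add: Y_def)
  have Yadd: "\<rho> x \<oplus>\<^bsub>Y\<^esub> \<rho> y = \<rho> (x \<oplus>\<^bsub>X\<^esub> y)" if "x \<in> carrier X" "y \<in> carrier X" for x y
    using add[of "sx (\<rho> x)" "sx (\<rho> y)" x y] sx that by (simp add: Y_def)
  have Ysm: "\<phi> a \<odot>\<^bsub>Y\<^esub> \<rho> x = \<rho> (a \<odot>\<^bsub>X\<^esub> x)" if "a \<in> carrier R" "x \<in> carrier X" for a x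
    using smult[of "sr (\<phi> a)" a "sx (\<rho> x)" x] sx sr that by (simp add: Y_def)
  have ab: "abelian_group Y"
  proof (rule abelian_groupI)
    fix u assume "u \<in> carrier Y"
    then obtain x where "x \<in> carrier X" "u = \<rho> x" by (auto simp: Y)
    then show "\<exists>v\<in>carrier Y. v \<oplus>\<^bsub>Y\<^esub> u = \<zero>\<^bsub>Y\<^esub>"
      by (intro bexI[of _ "\<rho> (\<ominus>\<^bsub>X\<^esub> x)"]) (auto simp: Y Yadd X.M.l_neg)
  qed (auto simp: Y Yadd X.M.a_ac)
  have cS: "\<exists>b\<in>carrier R. a = \<phi> b" if "a \<in> carrier S" for a using that \<phi>(2) by auto
  have "left_module S Y"
  proof (intro left_module.intro S ab left_module_axioms.intro)
    fix a u assume "a \<in> carrier S" "u \<in> carrier Y"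
    then show "a \<odot>\<^bsub>Y\<^esub> u \<in> carrier Y"
      using cS[of a] by (auto simp: Y Ysm X.smult_closed)
  next
    fix a b u assume "a \<in> carrier S" "b \<in> carrier S" "u \<in> carrier Y"
    then obtain a' b' x where *: "a' \<in> carrier R" "b' \<in> carrier R" "x \<in> carrier X" "a = \<phi> a'" "b = \<phi> b'" "u = \<rho> x"
      using cS Y by (smt (verit) image_iff)
    then show "(a \<oplus>\<^bsub>S\<^esub> b) \<odot>\<^bsub>Y\<^esub> u = a \<odot>\<^bsub>Y\<^esub> u \<oplus>\<^bsub>Y\<^esub> b \<odot>\<^bsub>Y\<^esub> u"
      by (simp add: ring_hom_add[OF \<phi>(1), symmetric] Ysm Yadd X.smult_closed X.smult_l_distr)
    show "(a \<otimes>\<^bsub>S\<^esub> b) \<odot>\<^bsub>Y\<^esub> u = a \<odot>\<^bsub>Y\<^esub> (b \<odot>\<^bsub>Y\<^esub> u)"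
      using * by (simp add: ring_hom_mult[OF \<phi>(1), symmetric] Ysm X.smult_closed X.smult_assoc)
  next
    fix a u v assume "a \<in> carrier S" "u \<in> carrier Y" "v \<in> carrier Y"
    then obtain a' x y where "a' \<in> carrier R" "x \<in> carrier X" "y \<in> carrier X" "a = \<phi> a'" "u = \<rho> x" "v = \<rho> y"
      using cS Y by (smt (verit) image_iff)
    then show "a \<odot>\<^bsub>Y\<^esub> (u \<oplus>\<^bsub>Y\<^esub> v) = a \<odot>\<^bsub>Y\<^esub> u \<oplus>\<^bsub>Y\<^esub> a \<odot>\<^bsub>Y\<^esub> v"
      by (simp add: Ysm Yadd X.smult_closed X.smult_r_distr)
  next
    fix u assume "u \<in> carrier Y"
    then show "\<one>\<^bsub>S\<^esub> \<odot>\<^bsub>Y\<^esub> u = u"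
      using Ysm[of "\<one>\<^bsub>R\<^esub>"] by (auto simp: Y ring_hom_one[OF \<phi>(1)] X.smult_one)
  qed
  moreover have "\<rho> \<in> lmod_hom R X (restrict_scalars \<phi> Y)"
    by (rule lmod_homI) (auto simp: Y Yadd Ysm)
  ultimately show ?thesis using that Y by blast
qed

lemma copy_module:
  assumes "left_module R M" "inj_on h (carrier M)"
  obtains N :: "('r, 'u) module" where "left_module R N" "carrier N = h ` carrier M"
    "h \<in> lmod_hom R M N" "bij_betw h (carrier M) (carrier N)"
proof -
  have id: "(\<lambda>a. a) \<in> ring_hom R R" by (rule ring_hom_memI) auto
  have "ring R" using assms(1) by (simp add: left_module_def)
  then obtain N :: "('r, 'u) module" where "left_module R N" "carrier N = h ` carrier M"
    "h \<in> lmod_hom R M (restrict_scalars (\<lambda>a. a) N)"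
    using push_module[OF assms(1) _ id, where \<rho> = h] assms(2) by (auto simp: inj_on_eq_iff)
  then show ?thesis using that[of N] assms(2)
    by (simp add: restrict_scalars_id inj_on_imp_bij_betw)
qed

text \<open>
  A homomorphism that is constant on the fibres of \<open>\<rho>\<close> descends to the quotient, and it may be
  evaluated at an arbitrary preimage. The scalars change along \<open>\<phi>\<close> at the same time.
\<close>

lemma lmod_hom_factor:
  assumes X: "left_module R X"
    and \<phi>: "\<phi> ` carrier R = carrier S"
    and \<rho>: "\<rho> \<in> lmod_hom R X (restrict_scalars \<phi> Y)" "\<rho> ` carrier X = carrier Y"
    and f: "f \<in> lmod_hom R X (restrict_scalars \<phi> Z)"
    and fib: "\<And>x x'. \<lbrakk>x \<in> carrier X; x' \<in> carrier X; \<rho> x = \<rho> x'\<rbrakk> \<Longrightarrow> f x = f x'"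
  shows "\<exists>g\<in>lmod_hom S Y Z. \<forall>x\<in>carrier X. g (\<rho> x) = f x"
proof -
  interpret X: left_module R X by fact
  define g where "g u = f (inv_into (carrier X) \<rho> u)" for u
  have g: "g (\<rho> x) = f x" if "x \<in> carrier X" for x
    unfolding g_def using that by (intro fib) (auto simp: inv_into_into f_inv_into_f)
  have "g \<in> lmod_hom S Y Z"
  proof (rule lmod_homI)
    fix u assume "u \<in> carrier Y"
    then obtain x where "u = \<rho> x" "x \<in> carrier X" using \<rho>(2) by (metis imageE)
    then show "g u \<in> carrier Z" using g lmod_hom_closed[OF f] by simp
  next
    fix u v assume "u \<in> carrier Y" "v \<in> carrier Y"
    then obtain x y where *: "u = \<rho> x" "v = \<rho> y" "x \<in> carrier X" "y \<in> carrier X"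
      using \<rho>(2) by (metis imageE)
    show "g (u \<oplus>\<^bsub>Y\<^esub> v) = g u \<oplus>\<^bsub>Z\<^esub> g v"
      using g[of "x \<oplus>\<^bsub>X\<^esub> y"] lmod_hom_add[OF \<rho>(1), of x y] lmod_hom_add[OF f, of x y] * g by simp
  next
    fix a u assume "a \<in> carrier S" "u \<in> carrier Y"
    then obtain b x where *: "u = \<rho> x" "a = \<phi> b" "x \<in> carrier X" "b \<in> carrier R"
      using \<rho>(2) \<phi> by (metis imageE)
    show "g (a \<odot>\<^bsub>Y\<^esub> u) = a \<odot>\<^bsub>Z\<^esub> g u"
      using g[of "b \<odot>\<^bsub>X\<^esub> x"] lmod_hom_smult[OF \<rho>(1), of b x] lmod_hom_smult[OF f, of b x] * g
      by (simp add: X.smult_closed)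
  qed
  then show ?thesis using g by blast
qed


section \<open>Free and projective modules\<close>

lemma dsum_simps [simp]:
  "\<zero>\<^bsub>dsum I A\<^esub> = (\<lambda>i\<in>I. \<zero>\<^bsub>A i\<^esub>)"
  "f \<oplus>\<^bsub>dsum I A\<^esub> g = (\<lambda>i\<in>I. f i \<oplus>\<^bsub>A i\<^esub> g i)"
  "a \<odot>\<^bsub>dsum I A\<^esub> f = (\<lambda>i\<in>I. a \<odot>\<^bsub>A i\<^esub> f i)"
  by (simp_all add: dsum_def)

lemma dsum_carrier_iff:
  "f \<in> carrier (dsum I A) \<longleftrightarrow> f \<in> (\<Pi>\<^sub>E i\<in>I. carrier (A i)) \<and> finite {i\<in>I. f i \<noteq> \<zero>\<^bsub>A i\<^esub>}"
  by (simp add: dsum_def)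

lemma left_module_dsum:
  assumes R: "ring R" and A: "\<And>i. i \<in> I \<Longrightarrow> left_module R (A i)"
  shows "left_module R (dsum I A)"
proof -
  interpret R: ring R by fact
  have ab: "abelian_group (A i)" if "i \<in> I" for i using A[OF that] by (rule left_module.axioms(2))
  have am: "abelian_monoid (A i)" if "i \<in> I" for i using ab[OF that] by (rule abelian_group.axioms(1))
  have mem: "f i \<in> carrier (A i)" if "f \<in> carrier (dsum I A)" "i \<in> I" for f i
    using that by (auto simp: dsum_carrier_iff)
  have fin: "finite {i\<in>I. f i \<noteq> \<zero>\<^bsub>A i\<^esub>}" if "f \<in> carrier (dsum I A)" for f
    using that by (auto simp: dsum_carrier_iff)
  have clI: "f \<in> carrier (dsum I A)" if "\<And>i. i \<in> I \<Longrightarrow> f i \<in> carrier (A i)" "f \<in> extensional I"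
    "finite T" "{i\<in>I. f i \<noteq> \<zero>\<^bsub>A i\<^esub>} \<subseteq> T" for f T
    using that finite_subset by (auto simp: dsum_carrier_iff PiE_def)
  have add: "f \<oplus>\<^bsub>dsum I A\<^esub> g \<in> carrier (dsum I A)"
    if "f \<in> carrier (dsum I A)" "g \<in> carrier (dsum I A)" for f g
    by (rule clI[OF _ _ finite_UnI[OF fin[OF that(1)] fin[OF that(2)]]])
      (use that am mem in \<open>auto simp: abelian_monoid.a_closed abelian_monoid.l_zero abelian_monoid.zero_closed\<close>)
  have sm: "a \<odot>\<^bsub>dsum I A\<^esub> f \<in> carrier (dsum I A)"
    if "f \<in> carrier (dsum I A)" "a \<in> carrier R" for f a
    by (rule clI[OF _ _ fin[OF that(1)]])
      (use that mem in \<open>auto simp: left_module.smult_closed[OF A] left_module.smult_zero_right[OF A]\<close>)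
  have z: "\<zero>\<^bsub>dsum I A\<^esub> \<in> carrier (dsum I A)"
    by (rule clI[of _ "{}"]) (auto simp: am abelian_monoid.zero_closed)
  note eqI = extensionalityI[of _ I]
  have ext: "f \<in> extensional I" if "f \<in> carrier (dsum I A)" for f using that by (auto simp: dsum_carrier_iff PiE_def)
  have abD: "abelian_group (dsum I A)"
  proof (rule abelian_groupI[OF add z])
    fix f g h assume "f \<in> carrier (dsum I A)" "g \<in> carrier (dsum I A)" "h \<in> carrier (dsum I A)"
    then show "f \<oplus>\<^bsub>dsum I A\<^esub> g \<oplus>\<^bsub>dsum I A\<^esub> h = f \<oplus>\<^bsub>dsum I A\<^esub> (g \<oplus>\<^bsub>dsum I A\<^esub> h)"
      by (intro eqI) (auto simp: abelian_monoid.a_assoc am mem)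
  next
    fix f g assume "f \<in> carrier (dsum I A)" "g \<in> carrier (dsum I A)"
    then show "f \<oplus>\<^bsub>dsum I A\<^esub> g = g \<oplus>\<^bsub>dsum I A\<^esub> f"
      by (intro eqI) (auto simp: abelian_monoid.a_comm am mem)
  next
    fix f assume f: "f \<in> carrier (dsum I A)"
    then show "\<zero>\<^bsub>dsum I A\<^esub> \<oplus>\<^bsub>dsum I A\<^esub> f = f"
      by (intro eqI) (auto simp: ext abelian_monoid.l_zero am mem)
    have "(\<ominus>\<^bsub>R\<^esub> \<one>\<^bsub>R\<^esub>) \<odot>\<^bsub>dsum I A\<^esub> f \<oplus>\<^bsub>dsum I A\<^esub> f = \<zero>\<^bsub>dsum I A\<^esub>"
      using f by (intro eqI)
        (auto simp: mem left_module.smult_neg_left[OF A] left_module.smult_one[OF A] abelian_group.l_neg ab)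
    then show "\<exists>g\<in>carrier (dsum I A). g \<oplus>\<^bsub>dsum I A\<^esub> f = \<zero>\<^bsub>dsum I A\<^esub>"
      using sm[OF f, of "\<ominus>\<^bsub>R\<^esub> \<one>\<^bsub>R\<^esub>"] by blast
  qed
  show ?thesis
  proof (intro left_module.intro R abD left_module_axioms.intro sm)
    fix a b f assume *: "a \<in> carrier R" "b \<in> carrier R" "f \<in> carrier (dsum I A)"
    then show "(a \<oplus>\<^bsub>R\<^esub> b) \<odot>\<^bsub>dsum I A\<^esub> f = a \<odot>\<^bsub>dsum I A\<^esub> f \<oplus>\<^bsub>dsum I A\<^esub> b \<odot>\<^bsub>dsum I A\<^esub> f"
      by (intro eqI) (auto simp: mem left_module.smult_l_distr[OF A])
    show "(a \<otimes>\<^bsub>R\<^esub> b) \<odot>\<^bsub>dsum I A\<^esub> f = a \<odot>\<^bsub>dsum I A\<^esub> (b \<odot>\<^bsub>dsum I A\<^esub> f)"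
      using * by (intro eqI) (auto simp: mem left_module.smult_assoc[OF A])
  next
    fix a f g assume "a \<in> carrier R" "f \<in> carrier (dsum I A)" "g \<in> carrier (dsum I A)"
    then show "a \<odot>\<^bsub>dsum I A\<^esub> (f \<oplus>\<^bsub>dsum I A\<^esub> g) = a \<odot>\<^bsub>dsum I A\<^esub> f \<oplus>\<^bsub>dsum I A\<^esub> a \<odot>\<^bsub>dsum I A\<^esub> g"
      by (intro eqI) (auto simp: mem left_module.smult_r_distr[OF A])
  next
    fix f assume "f \<in> carrier (dsum I A)"
    then show "\<one>\<^bsub>R\<^esub> \<odot>\<^bsub>dsum I A\<^esub> f = f"
      by (intro eqI) (auto simp: ext mem left_module.smult_one[OF A])
  qed auto
qed

lemma regular_module_simps [simp]:
  "carrier (regular_module R) = carrier R" "\<zero>\<^bsub>regular_module R\<^esub> = \<zero>\<^bsub>R\<^esub>"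
  "x \<oplus>\<^bsub>regular_module R\<^esub> y = x \<oplus>\<^bsub>R\<^esub> y" "a \<odot>\<^bsub>regular_module R\<^esub> x = a \<otimes>\<^bsub>R\<^esub> x"
  by (simp_all add: regular_module_def)

lemma left_module_regular: "ring R \<Longrightarrow> left_module R (regular_module R)"
proof -
  assume "ring R"
  then interpret R: ring R .
  have ab: "abelian_group (regular_module R)"
  proof (rule abelian_groupI)
    fix x assume "x \<in> carrier (regular_module R)"
    then show "\<exists>y\<in>carrier (regular_module R). y \<oplus>\<^bsub>regular_module R\<^esub> x = \<zero>\<^bsub>regular_module R\<^esub>"
      by (intro bexI[of _ "\<ominus>\<^bsub>R\<^esub> x"]) (auto simp: R.l_neg)
  qed (auto simp: R.a_ac)
  show ?thesis
    by (intro left_module.intro \<open>ring R\<close> ab left_module_axioms.intro)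
      (auto simp: R.l_distr R.r_distr R.m_assoc)
qed

lemma left_module_free: "ring R \<Longrightarrow> left_module R (free_module R X)"
  unfolding free_module_def by (intro left_module_dsum left_module_regular)

lemma free_module_carrier_iff:
  "f \<in> carrier (free_module R X) \<longleftrightarrow> f \<in> (\<Pi>\<^sub>E x\<in>X. carrier R) \<and> finite {x\<in>X. f x \<noteq> \<zero>\<^bsub>R\<^esub>}"
  by (simp add: free_module_def dsum_carrier_iff)

lemma free_module_simps [simp]:
  "\<zero>\<^bsub>free_module R X\<^esub> = (\<lambda>x\<in>X. \<zero>\<^bsub>R\<^esub>)"
  "f \<oplus>\<^bsub>free_module R X\<^esub> g = (\<lambda>x\<in>X. f x \<oplus>\<^bsub>R\<^esub> g x)"
  "a \<odot>\<^bsub>free_module R X\<^esub> f = (\<lambda>x\<in>X. a \<otimes>\<^bsub>R\<^esub> f x)"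
  by (simp_all add: free_module_def)

definition free_basis :: "('r, 'x) ring_scheme \<Rightarrow> 'i set \<Rightarrow> 'i \<Rightarrow> 'i \<Rightarrow> 'r"
  where "free_basis R X x = (\<lambda>y\<in>X. if y = x then \<one>\<^bsub>R\<^esub> else \<zero>\<^bsub>R\<^esub>)"

definition free_lift :: "('r, 'x) ring_scheme \<Rightarrow> 'i set \<Rightarrow> ('r, 'm) module \<Rightarrow> ('i \<Rightarrow> 'm) \<Rightarrow> ('i \<Rightarrow> 'r) \<Rightarrow> 'm"
  where "free_lift R X N v f = finsum N (\<lambda>x. f x \<odot>\<^bsub>N\<^esub> v x) {x\<in>X. f x \<noteq> \<zero>\<^bsub>R\<^esub>}"

lemma free_basis_closed:
  assumes "ring R"
  shows "free_basis R X x \<in> carrier (free_module R X)"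
proof -
  interpret R: ring R by fact
  have "{y\<in>X. free_basis R X x y \<noteq> \<zero>\<^bsub>R\<^esub>} \<subseteq> {x}" by (auto simp: free_basis_def)
  then have "finite {y\<in>X. free_basis R X x y \<noteq> \<zero>\<^bsub>R\<^esub>}" using finite_subset by blast
  then show ?thesis unfolding free_module_carrier_iff by (auto simp: free_basis_def)
qed

lemma free_lift_superset:
  assumes N: "left_module R N" and v: "\<And>x. x \<in> X \<Longrightarrow> v x \<in> carrier N"
    and f: "f \<in> carrier (free_module R X)" and T: "finite T" "T \<subseteq> X" "{x\<in>X. f x \<noteq> \<zero>\<^bsub>R\<^esub>} \<subseteq> T"
  shows "free_lift R X N v f = finsum N (\<lambda>x. f x \<odot>\<^bsub>N\<^esub> v x) T"
proof -
  interpret N: left_module R N by fact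
  have "f x \<in> carrier R" if "x \<in> X" for x using f that by (auto simp: free_module_carrier_iff)
  then show ?thesis unfolding free_lift_def using T v
    by (intro N.M.add.finprod_mono_neutral_cong_left)
      (auto simp: N.smult_closed N.smult_zero_left)
qed

lemma free_lift_hom:
  assumes N: "left_module R N" and v: "\<And>x. x \<in> X \<Longrightarrow> v x \<in> carrier N"
  shows "free_lift R X N v \<in> lmod_hom R (free_module R X) N"
proof -
  interpret N: left_module R N by fact
  interpret F: left_module R "free_module R X" by (rule left_module_free) (rule N.R.ring_axioms)
  have mem: "f x \<in> carrier R" if "f \<in> carrier (free_module R X)" "x \<in> X" for f x
    using that by (auto simp: free_module_carrier_iff)
  have fin: "finite {x\<in>X. f x \<noteq> \<zero>\<^bsub>R\<^esub>}" if "f \<in> carrier (free_module R X)" for f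
    using that by (auto simp: free_module_carrier_iff)
  show ?thesis
  proof (rule lmod_homI)
    fix f assume f: "f \<in> carrier (free_module R X)"
    show "free_lift R X N v f \<in> carrier N"
      unfolding free_lift_def using mem[OF f] v by (intro N.M.finsum_closed) (auto simp: N.smult_closed)
  next
    fix f g assume fg: "f \<in> carrier (free_module R X)" "g \<in> carrier (free_module R X)"
    define T where "T = {x\<in>X. f x \<noteq> \<zero>\<^bsub>R\<^esub>} \<union> {x\<in>X. g x \<noteq> \<zero>\<^bsub>R\<^esub>}"
    have T: "finite T" "T \<subseteq> X" using fin[OF fg(1)] fin[OF fg(2)] by (auto simp: T_def)
    have "free_lift R X N v (f \<oplus>\<^bsub>free_module R X\<^esub> g)
        = finsum N (\<lambda>x. (f \<oplus>\<^bsub>free_module R X\<^esub> g) x \<odot>\<^bsub>N\<^esub> v x) T"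
      by (rule free_lift_superset[OF N v F.M.a_closed[OF fg] T]) (auto simp: T_def)
    also have "\<dots> = finsum N (\<lambda>x. f x \<odot>\<^bsub>N\<^esub> v x \<oplus>\<^bsub>N\<^esub> g x \<odot>\<^bsub>N\<^esub> v x) T"
      using T v mem[OF fg(1)] mem[OF fg(2)]
      by (intro N.M.finsum_cong') (auto simp: N.smult_closed N.smult_l_distr subset_eq)
    also have "\<dots> = finsum N (\<lambda>x. f x \<odot>\<^bsub>N\<^esub> v x) T \<oplus>\<^bsub>N\<^esub> finsum N (\<lambda>x. g x \<odot>\<^bsub>N\<^esub> v x) T"
      using T v mem[OF fg(1)] mem[OF fg(2)] by (intro N.M.finsum_addf) (auto simp: N.smult_closed subset_eq)
    also have "finsum N (\<lambda>x. f x \<odot>\<^bsub>N\<^esub> v x) T = free_lift R X N v f"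
      by (rule free_lift_superset[OF N v fg(1) T, symmetric]) (auto simp: T_def)
    also have "finsum N (\<lambda>x. g x \<odot>\<^bsub>N\<^esub> v x) T = free_lift R X N v g"
      by (rule free_lift_superset[OF N v fg(2) T, symmetric]) (auto simp: T_def)
    finally show "free_lift R X N v (f \<oplus>\<^bsub>free_module R X\<^esub> g) = free_lift R X N v f \<oplus>\<^bsub>N\<^esub> free_lift R X N v g" .
  next
    fix a f assume a: "a \<in> carrier R" and f: "f \<in> carrier (free_module R X)"
    define T where "T = {x\<in>X. f x \<noteq> \<zero>\<^bsub>R\<^esub>}"
    have T: "finite T" "T \<subseteq> X" using fin[OF f] by (auto simp: T_def)
    have distr: "a \<odot>\<^bsub>N\<^esub> finsum N g S = finsum N (\<lambda>x. a \<odot>\<^bsub>N\<^esub> g x) S"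
      if "finite S" "g \<in> S \<rightarrow> carrier N" for g S
      using that a by (induction S rule: finite_induct)
        (auto simp: N.smult_zero_right N.M.finsum_insert Pi_def N.smult_closed N.smult_r_distr)
    have "free_lift R X N v (a \<odot>\<^bsub>free_module R X\<^esub> f)
        = finsum N (\<lambda>x. (a \<odot>\<^bsub>free_module R X\<^esub> f) x \<odot>\<^bsub>N\<^esub> v x) T"
      by (rule free_lift_superset[OF N v F.smult_closed[OF a f] T]) (auto simp: T_def a)
    also have "\<dots> = finsum N (\<lambda>x. a \<odot>\<^bsub>N\<^esub> (f x \<odot>\<^bsub>N\<^esub> v x)) T"
      using T v mem[OF f] a by (intro N.M.finsum_cong') (auto simp: N.smult_closed N.smult_assoc subset_eq)
    also have "\<dots> = a \<odot>\<^bsub>N\<^esub> free_lift R X N v f"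
      unfolding free_lift_def T_def[symmetric] using T v mem[OF f]
      by (intro distr[symmetric]) (auto simp: N.smult_closed subset_eq)
    finally show "free_lift R X N v (a \<odot>\<^bsub>free_module R X\<^esub> f) = a \<odot>\<^bsub>N\<^esub> free_lift R X N v f" .
  qed
qed

lemma free_lift_basis:
  assumes N: "left_module R N" and v: "\<And>x. x \<in> X \<Longrightarrow> v x \<in> carrier N" and x: "x \<in> X"
  shows "free_lift R X N v (free_basis R X x) = v x"
proof -
  interpret N: left_module R N by fact
  have "free_lift R X N v (free_basis R X x) = finsum N (\<lambda>y. free_basis R X x y \<odot>\<^bsub>N\<^esub> v y) {x}"
    by (rule free_lift_superset[OF N v free_basis_closed]) (auto simp: x N.R.ring_axioms free_basis_def)
  also have "\<dots> = v x" using v[OF x] x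
    by (simp add: N.smult_one free_basis_def)
  finally show ?thesis .
qed

text \<open>
  By induction on a finite set that contains the support of \<open>w\<close>: removing one element from it
  subtracts from \<open>w\<close> a multiple of a basis vector.
\<close>

lemma free_module_hom_ext:
  assumes N: "left_module R N"
    and f: "f \<in> lmod_hom R (free_module R X) N" and g: "g \<in> lmod_hom R (free_module R X) N"
    and eq: "\<And>x. x \<in> X \<Longrightarrow> f (free_basis R X x) = g (free_basis R X x)"
    and w: "w \<in> carrier (free_module R X)"
  shows "f w = g w"
proof -
  interpret N: left_module R N by fact
  interpret F: left_module R "free_module R X" by (rule left_module_free) (rule N.R.ring_axioms)
  have "finite T \<Longrightarrow> \<forall>w\<in>carrier (free_module R X). {x\<in>X. w x \<noteq> \<zero>\<^bsub>R\<^esub>} \<subseteq> T \<longrightarrow> f w = g w" for T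
  proof (induction T rule: finite_induct)
    case empty
    have "w = \<zero>\<^bsub>free_module R X\<^esub>" if "w \<in> carrier (free_module R X)" "{x\<in>X. w x \<noteq> \<zero>\<^bsub>R\<^esub>} \<subseteq> {}" for w
      using that by (intro extensionalityI[of _ X]) (auto simp: free_module_carrier_iff PiE_def)
    then show ?case using lmod_hom_zero[OF f F.left_module_axioms N] lmod_hom_zero[OF g F.left_module_axioms N]
      by (auto simp del: free_module_simps)
  next
    case (insert x T)
    show ?case
    proof (intro ballI impI)
      fix w assume w: "w \<in> carrier (free_module R X)" "{y\<in>X. w y \<noteq> \<zero>\<^bsub>R\<^esub>} \<subseteq> insert x T"
      have mem: "w y \<in> carrier R" if "y \<in> X" for y using w(1) that by (auto simp: free_module_carrier_iff)
      show "f w = g w"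
      proof (cases "x \<in> X")
        case False
        then have "{y\<in>X. w y \<noteq> \<zero>\<^bsub>R\<^esub>} \<subseteq> T" using w by auto
        then show ?thesis using insert w by blast
      next
        case True
        define w' where "w' = (\<lambda>y\<in>X. if y = x then \<zero>\<^bsub>R\<^esub> else w y)"
        have "finite {y\<in>X. w' y \<noteq> \<zero>\<^bsub>R\<^esub>}"
          by (rule finite_subset[of _ "{y\<in>X. w y \<noteq> \<zero>\<^bsub>R\<^esub>}"]) (use w in \<open>auto simp: w'_def free_module_carrier_iff\<close>)
        then have w': "w' \<in> carrier (free_module R X)"
          unfolding free_module_carrier_iff by (auto simp: w'_def mem)
        have s: "{y\<in>X. w' y \<noteq> \<zero>\<^bsub>R\<^esub>} \<subseteq> T" using w(2) by (auto simp: w'_def)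
        have b: "free_basis R X x \<in> carrier (free_module R X)" by (rule free_basis_closed) (rule N.R.ring_axioms)
        have e: "w = w' \<oplus>\<^bsub>free_module R X\<^esub> (w x \<odot>\<^bsub>free_module R X\<^esub> free_basis R X x)"
        proof (rule extensionalityI[of _ X])
          show "w \<in> extensional X" using w(1) by (auto simp: free_module_carrier_iff PiE_def)
        qed (auto simp: w'_def free_basis_def mem True)
        have "f w' = g w'" using insert w' s by blast
        have "h w = h w' \<oplus>\<^bsub>N\<^esub> (w x \<odot>\<^bsub>N\<^esub> h (free_basis R X x))" if h: "h \<in> lmod_hom R (free_module R X) N" for h
          by (subst e, subst lmod_hom_add[OF h w' F.smult_closed[OF mem[OF True] b]], subst lmod_hom_smult[OF h mem[OF True] b])
            (rule refl)
        from this[OF f] this[OF g] \<open>f w' = g w'\<close> show ?thesis using eq[OF True] by simp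
      qed
    qed
  qed
  then show ?thesis using w by (auto simp: free_module_carrier_iff)
qed

lemma free_module_lift:
  assumes N: "left_module R N" and N': "left_module R N'"
    and f: "f \<in> lmod_hom R (free_module R X) N'"
    and g: "g \<in> lmod_hom R N N'" "g ` carrier N = carrier N'"
  shows "\<exists>h\<in>lmod_hom R (free_module R X) N. \<forall>w\<in>carrier (free_module R X). g (h w) = f w"
proof -
  have R: "ring R" using N by (simp add: left_module_def)
  define v where "v x = inv_into (carrier N) g (f (free_basis R X x))" for x
  have "f (free_basis R X x) \<in> g ` carrier N" for x
    using lmod_hom_closed[OF f free_basis_closed[OF R]] g(2) by simp
  then have v: "v x \<in> carrier N" "g (v x) = f (free_basis R X x)" for x
    unfolding v_def by (auto intro: inv_into_into f_inv_into_f)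
  have h: "free_lift R X N v \<in> lmod_hom R (free_module R X) N" using free_lift_hom[OF N v(1)] .
  have "g (free_lift R X N v w) = f w" if "w \<in> carrier (free_module R X)" for w
    by (rule free_module_hom_ext[OF N' lmod_hom_compose[OF h g(1)] f _ that])
      (simp add: free_lift_basis[OF N v(1)] v(2))
  then show ?thesis using h by blast
qed

text \<open>
  Direct summands and retracts are the same: a summand is the image of the projection along its
  complement, and a retraction splits the module into the image of the section and its own kernel.
\<close>

lemma internal_projection:
  assumes M: "left_module R M" and H: "submodule H R M" and K: "submodule K R M"
    and HK: "H \<inter> K = {\<zero>\<^bsub>M\<^esub>}" "H <+>\<^bsub>M\<^esub> K = carrier M"
  shows "\<exists>p\<in>lmod_hom R M (M\<lparr>carrier := H\<rparr>). \<forall>h\<in>H. p h = h"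
proof -
  interpret M: left_module R M by fact
  note memH = submodule_mem[OF H] and memK = submodule_mem[OF K]
  define p where "p x = (SOME h. h \<in> H \<and> (\<exists>k\<in>K. x = h \<oplus>\<^bsub>M\<^esub> k))" for x
  have p: "p (h \<oplus>\<^bsub>M\<^esub> k) = h" if "h \<in> H" "k \<in> K" for h k
    unfolding p_def
  proof (rule some_equality)
    show "h \<in> H \<and> (\<exists>k'\<in>K. h \<oplus>\<^bsub>M\<^esub> k = h \<oplus>\<^bsub>M\<^esub> k')" using that by blast
    fix h' assume "h' \<in> H \<and> (\<exists>k'\<in>K. h \<oplus>\<^bsub>M\<^esub> k = h' \<oplus>\<^bsub>M\<^esub> k')"
    then obtain k' where *: "h' \<in> H" "k' \<in> K" "h \<oplus>\<^bsub>M\<^esub> k = h' \<oplus>\<^bsub>M\<^esub> k'" by blast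
    have "(h \<ominus>\<^bsub>M\<^esub> h') \<oplus>\<^bsub>M\<^esub> (k \<ominus>\<^bsub>M\<^esub> k') = \<zero>\<^bsub>M\<^esub>"
      using M.M.add_diff_add[of h k h' k'] * that memH memK M.M.diff_self[of "h' \<oplus>\<^bsub>M\<^esub> k'"] by simp
    then have "h \<ominus>\<^bsub>M\<^esub> h' = \<ominus>\<^bsub>M\<^esub> (k \<ominus>\<^bsub>M\<^esub> k')"
      using M.M.minus_equality[of "h \<ominus>\<^bsub>M\<^esub> h'" "k \<ominus>\<^bsub>M\<^esub> k'"] * that memH memK by simp
    then have "h \<ominus>\<^bsub>M\<^esub> h' \<in> H \<inter> K"
      using submodule_diff[OF H] submodule_diff[OF K] submodule_neg[OF K] * that by (metis IntI)
    then show "h' = h" using HK(1) M.M.diff_eq_zero_iff[of h h'] * that memH by auto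
  qed
  have dec: "\<exists>h\<in>H. \<exists>k\<in>K. x = h \<oplus>\<^bsub>M\<^esub> k" if "x \<in> carrier M" for x
    using HK(2) that set_add_iff by metis
  have ph: "p \<in> lmod_hom R M (M\<lparr>carrier := H\<rparr>)"
  proof (rule lmod_homI)
    fix x assume "x \<in> carrier M"
    then show "p x \<in> carrier (M\<lparr>carrier := H\<rparr>)" using dec p by fastforce
  next
    fix x y assume "x \<in> carrier M" "y \<in> carrier M"
    then obtain h k h' k' where "h \<in> H" "k \<in> K" "x = h \<oplus>\<^bsub>M\<^esub> k" "h' \<in> H" "k' \<in> K" "y = h' \<oplus>\<^bsub>M\<^esub> k'"
      using dec by metis
    then show "p (x \<oplus>\<^bsub>M\<^esub> y) = p x \<oplus>\<^bsub>M\<lparr>carrier := H\<rparr>\<^esub> p y"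
      using p[of "h \<oplus>\<^bsub>M\<^esub> h'" "k \<oplus>\<^bsub>M\<^esub> k'"] M.M.add_add_swap[of h k h' k'] memH memK submodule_add[OF H] submodule_add[OF K]
      by (simp add: p)
  next
    fix a x assume a: "a \<in> carrier R" and "x \<in> carrier M"
    then obtain h k where "h \<in> H" "k \<in> K" "x = h \<oplus>\<^bsub>M\<^esub> k" using dec by metis
    then show "p (a \<odot>\<^bsub>M\<^esub> x) = a \<odot>\<^bsub>M\<lparr>carrier := H\<rparr>\<^esub> p x"
      using a by (simp add: p memH memK M.smult_r_distr submodule_smult[OF H] submodule_smult[OF K])
  qed
  have pH: "p h = h" if "h \<in> H" for h
    using p[OF that submodule_zero[OF K]] memH[OF that] by simp
  then show ?thesis using ph by blast
qed

lemma direct_summand_retract: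
  assumes "direct_summand R A M" "left_module R M"
  shows "\<exists>s\<in>lmod_hom R A M. \<exists>r\<in>lmod_hom R M A. \<forall>x\<in>carrier A. r (s x) = x"
proof -
  obtain H K where A: "left_module R A" and H: "submodule H R M" and K: "submodule K R M"
    and HK: "H \<inter> K = {\<zero>\<^bsub>M\<^esub>}" "H <+>\<^bsub>M\<^esub> K = carrier M" and iso: "lmod_iso R A (M\<lparr>carrier := H\<rparr>)"
    using assms(1) unfolding direct_summand_def by blast
  obtain s t where s: "s \<in> lmod_hom R A (M\<lparr>carrier := H\<rparr>)" and t: "t \<in> lmod_hom R (M\<lparr>carrier := H\<rparr>) A"
    and ts: "\<forall>x\<in>carrier A. t (s x) = x"
    using lmod_iso_inverse[OF iso A] by blast
  obtain p where ph: "p \<in> lmod_hom R M (M\<lparr>carrier := H\<rparr>)" and pH: "\<forall>h\<in>H. p h = h"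
    using internal_projection[OF assms(2) H K HK] by blast
  have "t (p (s x)) = x" if "x \<in> carrier A" for x
    using pH lmod_hom_closed[OF s that] ts that by simp
  moreover have "s \<in> lmod_hom R A M"
    using lmod_hom_compose[OF s lmod_hom_incl[OF submodule_subset[OF H]]] .
  ultimately show ?thesis
    by (intro bexI[OF _ lmod_hom_compose[OF ph t]] bexI[of _ s] ballI)
qed

lemma direct_summandI:
  assumes A: "left_module R A" and M: "left_module R M"
    and s: "s \<in> lmod_hom R A M" and r: "r \<in> lmod_hom R M A"
    and rs: "\<And>x. x \<in> carrier A \<Longrightarrow> r (s x) = x"
  shows "direct_summand R A M"
proof -
  interpret M: left_module R M by fact
  interpret A: left_module R A by fact
  have H: "submodule (s ` carrier A) R M" by (rule submodule_image[OF s A M submodule_carrier[OF A]])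
  have K: "submodule (a_kernel M A r) R M" by (rule submodule_kernel[OF r M A])
  have "s ` carrier A \<inter> a_kernel M A r = {\<zero>\<^bsub>M\<^esub>}"
  proof -
    have "x = \<zero>\<^bsub>M\<^esub>" if "x \<in> s ` carrier A" "x \<in> a_kernel M A r" for x
      using that rs lmod_hom_zero[OF s A M] by (auto simp: a_kernel_iff)
    then show ?thesis using submodule_zero[OF H] submodule_zero[OF K] by blast
  qed
  moreover have "s ` carrier A <+>\<^bsub>M\<^esub> a_kernel M A r = carrier M"
  proof
    show "s ` carrier A <+>\<^bsub>M\<^esub> a_kernel M A r \<subseteq> carrier M"
      by (rule set_add_least[OF submodule_carrier[OF M] submodule_subset[OF H] submodule_subset[OF K]])
    show "carrier M \<subseteq> s ` carrier A <+>\<^bsub>M\<^esub> a_kernel M A r"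
    proof
      fix x assume x: "x \<in> carrier M"
      note c = lmod_hom_closed[OF r x] lmod_hom_closed[OF s lmod_hom_closed[OF r x]]
      have "r (x \<ominus>\<^bsub>M\<^esub> s (r x)) = \<zero>\<^bsub>A\<^esub>"
        using lmod_hom_diff[OF r M A x c(2)] rs c A.M.diff_self by simp
      then have "x \<ominus>\<^bsub>M\<^esub> s (r x) \<in> a_kernel M A r" using x c by (simp add: a_kernel_iff)
      then show "x \<in> s ` carrier A <+>\<^bsub>M\<^esub> a_kernel M A r"
        using M.M.add_diff_cancel[OF x c(2)] c(1) unfolding set_add_iff by (metis imageI)
    qed
  qed
  moreover have "lmod_iso R A (M\<lparr>carrier := s ` carrier A\<rparr>)"
    by (rule lmod_isoI_inverse[OF lmod_hom_restrict_cod[OF s] lmod_hom_restrict_dom[OF r submodule_subset[OF H]]])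
      (auto simp: rs)
  ultimately show ?thesis unfolding direct_summand_def using A H K by blast
qed

lemma projective_left_module: "projective R P \<Longrightarrow> left_module R P"
  by (auto simp: projective_def direct_summand_def)

lemma projective_lift:
  fixes P :: "('r, 'm) module"
  assumes P: "projective R P" and N: "left_module R N" and N': "left_module R N'"
    and f: "f \<in> lmod_hom R P N'" and g: "g \<in> lmod_hom R N N'" "g ` carrier N = carrier N'"
  shows "\<exists>h\<in>lmod_hom R P N. \<forall>x\<in>carrier P. g (h x) = f x"
proof -
  have R: "ring R" using N by (simp add: left_module_def)
  obtain X :: "'m set" where "direct_summand R P (free_module R X)"
    using P unfolding projective_def by blast
  then obtain s r where s: "s \<in> lmod_hom R P (free_module R X)" and r: "r \<in> lmod_hom R (free_module R X) P"
    and rs: "\<forall>x\<in>carrier P. r (s x) = x"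
    using direct_summand_retract[OF _ left_module_free[OF R]] by blast
  obtain h where h: "h \<in> lmod_hom R (free_module R X) N" "\<forall>w\<in>carrier (free_module R X). g (h w) = f (r w)"
    using free_module_lift[OF N N' lmod_hom_compose[OF r f] g] by blast
  have "\<forall>x\<in>carrier P. g (h (s x)) = f x" using h(2) rs lmod_hom_closed[OF s] by simp
  then show ?thesis by (rule bexI[OF _ lmod_hom_compose[OF s h(1)]])
qed

lemma free_cover:
  assumes "left_module R N"
  shows "free_lift R (carrier N) N (\<lambda>x. x) \<in> lmod_hom R (free_module R (carrier N)) N"
    and "free_lift R (carrier N) N (\<lambda>x. x) ` carrier (free_module R (carrier N)) = carrier N"
proof -
  have R: "ring R" using assms by (simp add: left_module_def)
  show h: "free_lift R (carrier N) N (\<lambda>x. x) \<in> lmod_hom R (free_module R (carrier N)) N"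
    by (rule free_lift_hom[OF assms])
  show "free_lift R (carrier N) N (\<lambda>x. x) ` carrier (free_module R (carrier N)) = carrier N"
  proof (intro equalityI subsetI)
    fix y assume "y \<in> carrier N"
    then show "y \<in> free_lift R (carrier N) N (\<lambda>x. x) ` carrier (free_module R (carrier N))"
      using free_lift_basis[OF assms, of "carrier N" "\<lambda>x. x" y] free_basis_closed[OF R]
      by (metis image_eqI)
  qed (auto simp: lmod_hom_closed[OF h])
qed

lemma projectiveI:
  assumes P: "left_module R P" and s: "s \<in> lmod_hom R P (free_module R (carrier P))"
    and "\<And>x. x \<in> carrier P \<Longrightarrow> free_lift R (carrier P) P (\<lambda>x. x) (s x) = x"
  shows "projective R P"
proof -
  have R: "ring R" using P by (simp add: left_module_def)
  show ?thesis unfolding projective_def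
    using direct_summandI[OF P left_module_free[OF R] s free_cover(1)[OF P]] assms(3) by blast
qed

text \<open>
  The module \<open>Q\<close> may live on any type, whereas the definition of projectivity asks for a free module
  on a basis in the type of \<open>P\<close>. Lifting the retraction to the free module on the carrier of \<open>P\<close>
  bridges this gap.
\<close>

lemma projective_retract:
  assumes Q: "projective R Q" and P: "left_module R P"
    and s: "s \<in> lmod_hom R P Q" and r: "r \<in> lmod_hom R Q P" and rs: "\<And>x. x \<in> carrier P \<Longrightarrow> r (s x) = x"
  shows "projective R P"
proof -
  have R: "ring R" using P by (simp add: left_module_def)
  obtain h where h: "h \<in> lmod_hom R Q (free_module R (carrier P))"
    "\<forall>x\<in>carrier Q. free_lift R (carrier P) P (\<lambda>x. x) (h x) = r x"
    using projective_lift[OF Q left_module_free[OF R] P r free_cover[OF P]] by blast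
  show ?thesis
    by (rule projectiveI[OF P lmod_hom_compose[OF s h(1)]]) (simp add: h(2) lmod_hom_closed[OF s] rs)
qed

lemma projective_iso:
  assumes "projective R P" "left_module R Q" "lmod_iso R P Q"
  shows "projective R Q"
proof -
  obtain f g where "f \<in> lmod_hom R P Q" "g \<in> lmod_hom R Q P" "\<forall>y\<in>carrier Q. f (g y) = y"
    using lmod_iso_inverse[OF assms(3) projective_left_module[OF assms(1)]] by blast
  then show ?thesis using projective_retract[OF assms(1,2)] by blast
qed

lemma projective_dsum2:
  assumes P: "projective R P" and Q: "projective R Q"
  shows "projective R (dsum2 P Q)"
proof -
  note lP = projective_left_module[OF P] and lQ = projective_left_module[OF Q]
  have R: "ring R" using lP by (simp add: left_module_def)
  let ?D = "dsum2 P Q"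
  have D: "left_module R ?D" by (rule left_module_dsum2[OF lP lQ])
  let ?F = "free_module R (carrier ?D)" and ?c = "free_lift R (carrier ?D) ?D (\<lambda>x. x)"
  have F: "left_module R ?F" by (rule left_module_free[OF R])
  obtain h where h: "h \<in> lmod_hom R P ?F" "\<forall>x\<in>carrier P. ?c (h x) = (x, \<zero>\<^bsub>Q\<^esub>)"
    using projective_lift[OF P F D lmod_hom_inl[OF lQ] free_cover[OF D]] by blast
  obtain k where k: "k \<in> lmod_hom R Q ?F" "\<forall>x\<in>carrier Q. ?c (k x) = (\<zero>\<^bsub>P\<^esub>, x)"
    using projective_lift[OF Q F D lmod_hom_inr[OF lP] free_cover[OF D]] by blast
  interpret P: left_module R P by (rule lP)
  interpret Q: left_module R Q by (rule lQ)
  have eq: "?c (h x \<oplus>\<^bsub>?F\<^esub> k y) = (x, y)" if "x \<in> carrier P" "y \<in> carrier Q" for x y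
    using lmod_hom_add[OF free_cover(1)[OF D] lmod_hom_closed[OF h(1) that(1)] lmod_hom_closed[OF k(1) that(2)]]
      bspec[OF h(2) that(1)] bspec[OF k(2) that(2)] that by (simp only: dsum2_simps P.M.r_zero Q.M.l_zero)
  show ?thesis
  proof (rule projectiveI[OF D lmod_hom_copair[OF h(1) k(1) F]])
    fix w assume "w \<in> carrier ?D"
    then obtain x y where "w = (x, y)" "x \<in> carrier P" "y \<in> carrier Q" by auto
    then show "?c (case w of (x, y) \<Rightarrow> h x \<oplus>\<^bsub>?F\<^esub> k y) = w" using eq by (simp only: prod.case)
  qed
qed

lemma projective_free_module: "ring R \<Longrightarrow> projective R (free_module R X)"
proof -
  assume R: "ring R"
  let ?F = "free_module R X"
  have F: "left_module R ?F" by (rule left_module_free[OF R])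
  obtain h where "h \<in> lmod_hom R ?F (free_module R (carrier ?F))"
    "\<forall>x\<in>carrier ?F. free_lift R (carrier ?F) ?F (\<lambda>x. x) (h x) = x"
    using free_module_lift[OF left_module_free[OF R] F lmod_hom_id free_cover[OF F]] by blast
  then show ?thesis using projectiveI[OF F] by blast
qed

lemma projective_split:
  assumes P: "projective R P" and N: "left_module R N"
    and g: "g \<in> lmod_hom R N P" "g ` carrier N = carrier P"
  shows "\<exists>s\<in>lmod_hom R P N. \<forall>x\<in>carrier P. g (s x) = x"
  using projective_lift[OF P N projective_left_module[OF P] lmod_hom_id g] by blast


section \<open>Projective covers\<close>

lemma kernel_iso:
  assumes f: "f \<in> lmod_hom R A N" and g: "g \<in> lmod_hom R B N"
    and t: "t \<in> lmod_hom R A B" and u: "u \<in> lmod_hom R B A"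
    and ut: "\<forall>x\<in>carrier A. u (t x) = x" and tu: "\<forall>x\<in>carrier B. t (u x) = x"
    and gt: "\<forall>x\<in>carrier A. g (t x) = f x"
  shows "lmod_iso R (ker_module A N f) (ker_module B N g)"
proof (rule lmod_isoI_inverse)
  show "t \<in> lmod_hom R (ker_module A N f) (ker_module B N g)"
    by (rule lmod_hom_restrict[OF t]) (auto simp: a_kernel_iff gt lmod_hom_closed[OF t])
  have "f (u x) = g x" if "x \<in> carrier B" for x using gt tu that lmod_hom_closed[OF u that] by metis
  then show "u \<in> lmod_hom R (ker_module B N g) (ker_module A N f)"
    by (intro lmod_hom_restrict[OF u]) (auto simp: a_kernel_iff lmod_hom_closed[OF u])
qed (auto simp: a_kernel_iff ut tu)

lemma kernel_compose_iso:
  assumes f: "f \<in> lmod_hom R A N" and g: "g \<in> lmod_hom R N N'" "left_module R N" "left_module R N'"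
    and h: "\<forall>x\<in>carrier N. h (g x) = x"
  shows "a_kernel A N' (\<lambda>x. g (f x)) = a_kernel A N f"
proof -
  have "g (f x) = \<zero>\<^bsub>N'\<^esub> \<longleftrightarrow> f x = \<zero>\<^bsub>N\<^esub>" if "x \<in> carrier A" for x
    using lmod_hom_zero[OF g] bspec[OF h lmod_hom_closed[OF f that]]
      bspec[OF h abelian_monoid.zero_closed[OF abelian_group.axioms(1)[OF left_module.axioms(2)[OF g(2)]]]]
    by metis
  then show ?thesis by (auto simp: a_kernel_iff lmod_hom_zero[OF g])
qed

lemma projective_coverD:
  assumes "projective_cover R P p M"
  shows "projective R P" "p \<in> lmod_hom R P M" "p ` carrier P = carrier M"
    "\<And>H. \<lbrakk>submodule H R P; H <+>\<^bsub>P\<^esub> a_kernel P M p = carrier P\<rbrakk> \<Longrightarrow> H = carrier P"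
  using assms unfolding projective_cover_def by blast+

text \<open>
  The map \<open>q\<close> lifts to the cover \<open>C\<close>, since \<open>P\<close> is projective. Together with the kernel of \<open>p\<close> the image of
  the lift spans \<open>C\<close>, so the lift is onto, as this kernel is superfluous. Hence it splits.
\<close>

lemma cover_lift_split:
  assumes X: "left_module R X" and C: "projective_cover R C p X"
    and P: "projective R P" and q: "q \<in> lmod_hom R P X" "q ` carrier P = carrier X"
  shows "\<exists>g\<in>lmod_hom R P C. \<exists>s\<in>lmod_hom R C P.
    (\<forall>x\<in>carrier P. p (g x) = q x) \<and> (\<forall>y\<in>carrier C. g (s y) = y)"
proof -
  note c = projective_coverD[OF C]
  note lP = projective_left_module[OF P] and lC = projective_left_module[OF c(1)]
  interpret X: left_module R X by fact
  interpret C: left_module R C by (rule lC)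
  obtain g where g: "g \<in> lmod_hom R P C" "\<forall>x\<in>carrier P. p (g x) = q x"
    using projective_lift[OF P lC X q(1) c(2,3)] by blast
  have sub: "submodule (g ` carrier P) R C"
    by (rule submodule_image[OF g(1) lP lC submodule_carrier[OF lP]])
  have "g ` carrier P <+>\<^bsub>C\<^esub> a_kernel C X p = carrier C"
  proof
    show "g ` carrier P <+>\<^bsub>C\<^esub> a_kernel C X p \<subseteq> carrier C"
      by (rule set_add_least[OF submodule_carrier[OF lC] submodule_subset[OF sub]]) (auto simp: a_kernel_iff)
    show "carrier C \<subseteq> g ` carrier P <+>\<^bsub>C\<^esub> a_kernel C X p"
    proof
      fix y assume y: "y \<in> carrier C"
      then obtain x where x: "x \<in> carrier P" "q x = p y"
        using lmod_hom_closed[OF c(2) y] q(2) by (metis imageE)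
      note gx = lmod_hom_closed[OF g(1) x(1)]
      have "y \<ominus>\<^bsub>C\<^esub> g x \<in> a_kernel C X p"
        using lmod_hom_diff[OF c(2) lC X y gx] x g(2) y gx lmod_hom_closed[OF c(2) y] by (simp add: a_kernel_iff X.M.diff_self)
      then show "y \<in> g ` carrier P <+>\<^bsub>C\<^esub> a_kernel C X p"
        using C.M.add_diff_cancel[OF y gx] x(1) unfolding set_add_iff by (metis imageI)
    qed
  qed
  then have "g ` carrier P = carrier C" using c(4)[OF sub] by simp
  then show ?thesis using projective_split[OF c(1) lP g(1)] g by blast
qed

lemma projective_kernel_split:
  assumes P: "projective R P" and C: "left_module R C"
    and g: "g \<in> lmod_hom R P C" and s: "s \<in> lmod_hom R C P" and gs: "\<forall>y\<in>carrier C. g (s y) = y"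
  shows "projective R (ker_module P C g)"
proof -
  note lP = projective_left_module[OF P]
  interpret P: left_module R P by (rule lP)
  interpret C: left_module R C by (rule C)
  have d: "(\<lambda>x. x \<ominus>\<^bsub>P\<^esub> s (g x)) \<in> lmod_hom R P P"
    by (intro lmod_hom_difference lmod_hom_id lmod_hom_compose[OF g s] lP)
  have "g (x \<ominus>\<^bsub>P\<^esub> s (g x)) = \<zero>\<^bsub>C\<^esub>" if "x \<in> carrier P" for x
    using lmod_hom_diff[OF g lP C that lmod_hom_closed[OF s lmod_hom_closed[OF g that]]] gs
      lmod_hom_closed[OF g that] C.M.diff_self by simp
  then have r: "(\<lambda>x. x \<ominus>\<^bsub>P\<^esub> s (g x)) \<in> lmod_hom R P (ker_module P C g)"
    by (intro lmod_hom_restrict_cod[OF d]) (auto simp: a_kernel_iff lmod_hom_closed[OF d])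
  show ?thesis
  proof (rule projective_retract[OF P left_module_kernel[OF g lP C] lmod_hom_incl r])
    show "a_kernel P C g \<subseteq> carrier P" by (auto simp: a_kernel_iff)
    fix x assume "x \<in> carrier (ker_module P C g)"
    then show "x \<ominus>\<^bsub>P\<^esub> s (g x) = x"
      by (auto simp: a_kernel_iff lmod_hom_zero[OF s C lP] P.M.diff_zero)
  qed
qed

text \<open>
  The kernel of any projective presentation of \<open>X\<close> is that of the cover plus a projective module: the
  split surjection \<open>P \<rightarrow> C\<close> restricts to a split surjection of the kernels, and its own kernel is a
  direct summand of \<open>P\<close>.
\<close>

lemma cover_kernel:
  assumes X: "left_module R X" and C: "projective_cover R C p X"
    and P: "projective R P" and q: "q \<in> lmod_hom R P X" "q ` carrier P = carrier X"
  shows "\<exists>H. projective R (P\<lparr>carrier := H\<rparr>) \<and>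
    lmod_iso R (ker_module P X q) (dsum2 (ker_module C X p) (P\<lparr>carrier := H\<rparr>))"
proof -
  note c = projective_coverD[OF C]
  note lP = projective_left_module[OF P] and lC = projective_left_module[OF c(1)]
  obtain g s where g: "g \<in> lmod_hom R P C" and s: "s \<in> lmod_hom R C P"
    and pg: "\<forall>x\<in>carrier P. p (g x) = q x" and gs: "\<forall>y\<in>carrier C. g (s y) = y"
    using cover_lift_split[OF assms] by blast
  have qs: "q (s y) = p y" if "y \<in> carrier C" for y
    using pg gs lmod_hom_closed[OF s that] that by metis
  have "lmod_iso R (ker_module P X q)
      (dsum2 (ker_module (ker_module P X q) (ker_module C X p) g) (ker_module C X p))"
  proof (rule split_iso[OF left_module_kernel[OF q(1) lP X] left_module_kernel[OF c(2) lC X]])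
    show "g \<in> lmod_hom R (ker_module P X q) (ker_module C X p)"
      by (rule lmod_hom_restrict[OF g]) (auto simp: a_kernel_iff lmod_hom_closed[OF g] pg)
    show "s \<in> lmod_hom R (ker_module C X p) (ker_module P X q)"
      by (rule lmod_hom_restrict[OF s]) (auto simp: a_kernel_iff lmod_hom_closed[OF s] qs)
  qed (use gs in \<open>auto simp: a_kernel_iff\<close>)
  moreover have "a_kernel (ker_module P X q) (ker_module C X p) g = a_kernel P C g"
  proof -
    have "q x = \<zero>\<^bsub>X\<^esub>" if "x \<in> carrier P" "g x = \<zero>\<^bsub>C\<^esub>" for x
      using pg that lmod_hom_zero[OF c(2) lC X] by metis
    then show ?thesis by (auto simp: a_kernel_iff)
  qed
  ultimately have "lmod_iso R (ker_module P X q) (dsum2 (ker_module P C g) (ker_module C X p))" by simp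
  then have "lmod_iso R (ker_module P X q) (dsum2 (ker_module C X p) (ker_module P C g))"
    by (rule lmod_iso_trans[OF _ dsum2_commute])
  then show ?thesis using projective_kernel_split[OF P lC g s gs] by blast
qed

text \<open>
  If both maps are covers, then the section of \<open>P \<rightarrow> C\<close> is onto as well, because the kernel of \<open>q\<close> is
  superfluous.
\<close>

lemma cover_kernel_unique:
  assumes X: "left_module R X" and C: "projective_cover R C p X" and P: "projective_cover R P q X"
  shows "lmod_iso R (ker_module C X p) (ker_module P X q)"
proof -
  note c = projective_coverD[OF C] and d = projective_coverD[OF P]
  note lP = projective_left_module[OF d(1)] and lC = projective_left_module[OF c(1)]
  interpret P: left_module R P by (rule lP)
  interpret X: left_module R X by (rule X)
  obtain g s where g: "g \<in> lmod_hom R P C" and s: "s \<in> lmod_hom R C P"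
    and pg: "\<forall>x\<in>carrier P. p (g x) = q x" and gs: "\<forall>y\<in>carrier C. g (s y) = y"
    using cover_lift_split[OF X C d(1-3)] by blast
  have qs: "q (s y) = p y" if "y \<in> carrier C" for y
    using pg gs lmod_hom_closed[OF s that] that by metis
  have sub: "submodule (s ` carrier C) R P" by (rule submodule_image[OF s lC lP submodule_carrier[OF lC]])
  have "s ` carrier C <+>\<^bsub>P\<^esub> a_kernel P X q = carrier P"
  proof
    show "s ` carrier C <+>\<^bsub>P\<^esub> a_kernel P X q \<subseteq> carrier P"
      by (rule set_add_least[OF submodule_carrier[OF lP] submodule_subset[OF sub]]) (auto simp: a_kernel_iff)
    show "carrier P \<subseteq> s ` carrier C <+>\<^bsub>P\<^esub> a_kernel P X q"
    proof
      fix x assume x: "x \<in> carrier P"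
      note gx = lmod_hom_closed[OF g x]
      note sgx = lmod_hom_closed[OF s gx]
      have "q (s (g x)) = q x" using qs[OF gx] pg x by simp
      then have "x \<ominus>\<^bsub>P\<^esub> s (g x) \<in> a_kernel P X q"
        using lmod_hom_diff[OF d(2) lP X x sgx] x sgx X.M.diff_self[OF lmod_hom_closed[OF d(2) x]]
        by (simp add: a_kernel_iff)
      then show "x \<in> s ` carrier C <+>\<^bsub>P\<^esub> a_kernel P X q"
        using P.M.add_diff_cancel[OF x sgx] gx unfolding set_add_iff by (metis imageI)
    qed
  qed
  then have "s ` carrier C = carrier P" using d(4)[OF sub] by simp
  then have sg: "\<forall>x\<in>carrier P. s (g x) = x" using gs by (metis imageE)
  show ?thesis
    by (rule kernel_iso[OF c(2) d(2) s g gs sg]) (simp add: qs)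
qed

lemma projective_cover_iso:
  assumes "projective_cover R C p X" "left_module R X" "left_module R Y"
    and f: "f \<in> lmod_hom R X Y" and g: "g \<in> lmod_hom R Y X"
    and gf: "\<forall>x\<in>carrier X. g (f x) = x" and fg: "\<forall>y\<in>carrier Y. f (g y) = y"
  shows "projective_cover R C (\<lambda>x. f (p x)) Y" "ker_module C Y (\<lambda>x. f (p x)) = ker_module C X p"
proof -
  note c = projective_coverD[OF assms(1)]
  have k: "a_kernel C Y (\<lambda>x. f (p x)) = a_kernel C X p"
    by (rule kernel_compose_iso[OF c(2) f assms(2,3) gf])
  then show "ker_module C Y (\<lambda>x. f (p x)) = ker_module C X p" by simp
  have "f ` carrier X = carrier Y"
    using fg lmod_hom_closed[OF f] lmod_hom_closed[OF g] by (auto simp: image_iff) metis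
  then have "(\<lambda>x. f (p x)) ` carrier C = carrier Y"
    using c(3) by (metis image_image)
  then show "projective_cover R C (\<lambda>x. f (p x)) Y"
    unfolding projective_cover_def k using c lmod_hom_compose[OF c(2) f] by blast
qed

text \<open>
  The kernel does not grow, and it stays superfluous: if \<open>H\<close> and the kernel span \<open>C \<oplus> P\<close>, then the
  part of \<open>H\<close> in \<open>C\<close> and the kernel span \<open>C\<close>. So \<open>H\<close> contains \<open>C\<close>, and then everything.
\<close>

lemma projective_cover_dsum2:
  assumes C: "projective_cover R C p X" and X: "left_module R X" and P: "projective R P"
  shows "projective_cover R (dsum2 C P) (map_prod p (\<lambda>x. x)) (dsum2 X P)"
    and "lmod_iso R (ker_module C X p) (ker_module (dsum2 C P) (dsum2 X P) (map_prod p (\<lambda>x. x)))"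
proof -
  note c = projective_coverD[OF C]
  note lP = projective_left_module[OF P] and lC = projective_left_module[OF c(1)]
  interpret P: left_module R P by (rule lP)
  interpret C: left_module R C by (rule lC)
  interpret X: left_module R X by (rule X)
  let ?p = "map_prod p (\<lambda>x. x)"
  have p: "?p \<in> lmod_hom R (dsum2 C P) (dsum2 X P)" by (rule lmod_hom_map_prod[OF c(2) lmod_hom_id])
  have ker: "a_kernel (dsum2 C P) (dsum2 X P) ?p = (\<lambda>x. (x, \<zero>\<^bsub>P\<^esub>)) ` a_kernel C X p"
    by (auto simp: a_kernel_iff)
  show "lmod_iso R (ker_module C X p) (ker_module (dsum2 C P) (dsum2 X P) ?p)"
    by (rule lmod_isoI_inverse[where g = fst,
        OF lmod_hom_restrict[OF lmod_hom_inl[OF lP]] lmod_hom_restrict[OF lmod_hom_fst]])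
      (auto simp: ker a_kernel_iff)
  show "projective_cover R (dsum2 C P) ?p (dsum2 X P)"
    unfolding projective_cover_def
  proof (intro conjI allI impI)
    show "projective R (dsum2 C P)" by (rule projective_dsum2[OF c(1) P])
    show "?p ` carrier (dsum2 C P) = carrier (dsum2 X P)" using c(3) by (simp add: map_prod_surj_on)
    fix H assume "submodule H R (dsum2 C P) \<and>
      H <+>\<^bsub>dsum2 C P\<^esub> a_kernel (dsum2 C P) (dsum2 X P) ?p = carrier (dsum2 C P)"
    then have H: "submodule H R (dsum2 C P)"
      and e: "H <+>\<^bsub>dsum2 C P\<^esub> a_kernel (dsum2 C P) (dsum2 X P) ?p = carrier (dsum2 C P)" by auto
    have dec: "\<exists>u k. (u, y) \<in> H \<and> u \<in> carrier C \<and> k \<in> a_kernel C X p \<and> x = u \<oplus>\<^bsub>C\<^esub> k"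
      if "x \<in> carrier C" "y \<in> carrier P" for x y
    proof -
      have "(x, y) \<in> H <+>\<^bsub>dsum2 C P\<^esub> a_kernel (dsum2 C P) (dsum2 X P) ?p" using that e by simp
      then obtain h k where "h \<in> H" "k \<in> a_kernel C X p" "(x, y) = h \<oplus>\<^bsub>dsum2 C P\<^esub> (k, \<zero>\<^bsub>P\<^esub>)"
        unfolding set_add_iff ker by blast
      moreover obtain u v where "h = (u, v)" "u \<in> carrier C" "v \<in> carrier P"
        using submodule_mem[OF H \<open>h \<in> H\<close>] by auto
      ultimately show ?thesis by auto
    qed
    define H0 where "H0 = {x \<in> carrier C. (x, \<zero>\<^bsub>P\<^esub>) \<in> H}"
    have H0: "submodule H0 R C"
      unfolding H0_def by (rule submodule_vimage[OF lmod_hom_inl[OF lP] lC left_module_dsum2[OF lC lP] H])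
    have "H0 <+>\<^bsub>C\<^esub> a_kernel C X p = carrier C"
    proof
      show "H0 <+>\<^bsub>C\<^esub> a_kernel C X p \<subseteq> carrier C"
        by (rule set_add_least[OF submodule_carrier[OF lC]]) (auto simp: a_kernel_iff H0_def)
      show "carrier C \<subseteq> H0 <+>\<^bsub>C\<^esub> a_kernel C X p"
      proof
        fix x assume "x \<in> carrier C"
        from dec[OF this P.M.zero_closed] obtain u k where
          "(u, \<zero>\<^bsub>P\<^esub>) \<in> H" "u \<in> carrier C" "k \<in> a_kernel C X p" "x = u \<oplus>\<^bsub>C\<^esub> k" by (elim exE conjE)
        then show "x \<in> H0 <+>\<^bsub>C\<^esub> a_kernel C X p"
          unfolding set_add_iff H0_def by (intro bexI[of _ u] bexI[of _ k]) simp_all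
      qed
    qed
    then have "H0 = carrier C" using c(4)[OF H0] by simp
    have "(x, y) \<in> H" if xy: "x \<in> carrier C" "y \<in> carrier P" for x y
    proof -
      from dec[OF xy] obtain u where u: "(u, y) \<in> H" "u \<in> carrier C" by (elim exE conjE)
      have "x \<ominus>\<^bsub>C\<^esub> u \<in> H0" using \<open>H0 = carrier C\<close> xy u by simp
      then have "(x \<ominus>\<^bsub>C\<^esub> u, \<zero>\<^bsub>P\<^esub>) \<in> H" by (simp add: H0_def)
      then have "(x \<ominus>\<^bsub>C\<^esub> u, \<zero>\<^bsub>P\<^esub>) \<oplus>\<^bsub>dsum2 C P\<^esub> (u, y) \<in> H" using submodule_add[OF H] u by blast
      then show ?thesis using xy u by (simp add: C.M.diff_add_cancel)
    qed
    then show "H = carrier (dsum2 C P)" using submodule_subset[OF H] by auto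
  qed (rule p)
qed


section \<open>Syzygies\<close>

text \<open>
  Projective dimension at most \<open>k\<close>. The recursion along kernels suits inductions on a resolution, and
  keeping all terms on the type of the module allows these inductions to replace the module.
\<close>

primrec pd_le :: "('r, 'x) ring_scheme \<Rightarrow> nat \<Rightarrow> ('r, 'u) module \<Rightarrow> bool" where
  "pd_le R 0 N \<longleftrightarrow> projective R N"
| "pd_le R (Suc k) N \<longleftrightarrow> left_module R N \<and> (\<exists>(P :: ('r, 'u) module) p. projective R P \<and>
    p \<in> lmod_hom R P N \<and> p ` carrier P = carrier N \<and> pd_le R k (ker_module P N p))"

lemma pd_le_left_module: "pd_le R k N \<Longrightarrow> left_module R N"
  by (cases k) (auto intro: projective_left_module)

lemma pd_le_iso:
  fixes N N' :: "('r, 'u) module"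
  assumes "pd_le R k N" "left_module R N'" "lmod_iso R N N'"
  shows "pd_le R k N'"
proof (cases k)
  case 0
  then show ?thesis using assms projective_iso by auto
next
  case (Suc j)
  have N: "left_module R N" using assms(1) by (rule pd_le_left_module)
  obtain P :: "('r, 'u) module" and p where P: "projective R P" "p \<in> lmod_hom R P N" "p ` carrier P = carrier N"
    "pd_le R j (ker_module P N p)" using assms(1) Suc by auto
  obtain f g where fg: "f \<in> lmod_hom R N N'" "g \<in> lmod_hom R N' N"
    "\<forall>x\<in>carrier N. g (f x) = x" "\<forall>y\<in>carrier N'. f (g y) = y"
    using lmod_iso_inverse[OF assms(3) N] by blast
  have "f ` carrier N = carrier N'"
    using fg(4) lmod_hom_closed[OF fg(1)] lmod_hom_closed[OF fg(2)] by (auto simp: image_iff) metis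
  then have "(\<lambda>x. f (p x)) ` carrier P = carrier N'"
    using P(3) by (metis image_image)
  moreover have "a_kernel P N' (\<lambda>x. f (p x)) = a_kernel P N p"
    by (rule kernel_compose_iso[OF P(2) fg(1) N assms(2) fg(3)])
  then have "pd_le R j (ker_module P N' (\<lambda>x. f (p x)))" using P(4) by simp
  ultimately show ?thesis
    using Suc assms(2) P(1) lmod_hom_compose[OF P(2) fg(1)] by auto
qed

text \<open>
  A ring is left perfect if each of its left modules has a projective cover. Here this is required of
  the modules on one type \<open>'u\<close>. The injection \<open>enc\<close> gives this type room for copies of the direct sum of
  two modules on \<open>'u\<close> and of the free modules with a basis in \<open>'u\<close>.
\<close>

locale perfect_ring =
  fixes R :: "('r, 'x) ring_scheme" and enc :: "('r \<times> 'u) list \<Rightarrow> 'u"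
  assumes ring: "ring R" and inj_enc: "inj enc"
    and cover_exists: "\<And>M :: ('r, 'u) module. left_module R M \<Longrightarrow>
      \<exists>(C :: ('r, 'u) module) p. projective_cover R C p M"
begin

text \<open>
  The scalars are fillers, as \<open>enc\<close> takes lists of pairs of a scalar and an element.
\<close>

definition pair :: "'u \<times> 'u \<Rightarrow> 'u"
  where "pair = (\<lambda>(x, y). enc [(undefined, x), (undefined, y)])"

lemma inj_pair: "inj pair"
  using inj_enc by (auto simp: inj_def pair_def)

lemma Omega1_cover:
  fixes M :: "('r, 'u) module"
  assumes "left_module R M"
  shows "\<exists>(C :: ('r, 'u) module) p. projective_cover R C p M \<and> Omega1 R M = ker_module C M p"
proof -
  have "\<exists>N (C :: ('r, 'u) module) p. projective_cover R C p M \<and> N = ker_module C M p"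
    using cover_exists[OF assms] by blast
  from someI_ex[OF this] show ?thesis unfolding Omega1_def .
qed

lemma left_module_Omega1:
  fixes M :: "('r, 'u) module"
  assumes "left_module R M"
  shows "left_module R (Omega1 R M)"
proof -
  obtain C :: "('r, 'u) module" and p where "projective_cover R C p M" "Omega1 R M = ker_module C M p"
    using Omega1_cover[OF assms] by blast
  then show ?thesis
    using left_module_kernel[OF projective_coverD(2) projective_left_module[OF projective_coverD(1)] assms] by metis
qed

lemma left_module_Omega1_funpow:
  fixes M :: "('r, 'u) module"
  shows "left_module R M \<Longrightarrow> left_module R ((Omega1 R ^^ k) M)"
  by (induction k) (auto intro: left_module_Omega1)

lemma Omega1_unique:
  fixes M :: "('r, 'u) module"
  assumes "left_module R M" "projective_cover R C p M"
  shows "lmod_iso R (Omega1 R M) (ker_module C M p)"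
  using Omega1_cover[OF assms(1)] cover_kernel_unique[OF assms(1) _ assms(2)] by metis

lemma Omega1_cong:
  fixes M N :: "('r, 'u) module"
  assumes "left_module R M" "left_module R N" "lmod_iso R M N"
  shows "lmod_iso R (Omega1 R M) (Omega1 R N)"
proof -
  obtain C :: "('r, 'u) module" and p where C: "projective_cover R C p M" "Omega1 R M = ker_module C M p"
    using Omega1_cover[OF assms(1)] by blast
  obtain f g where fg: "f \<in> lmod_hom R M N" "g \<in> lmod_hom R N M"
    "\<forall>x\<in>carrier M. g (f x) = x" "\<forall>y\<in>carrier N. f (g y) = y"
    using lmod_iso_inverse[OF assms(3,1)] by blast
  note * = projective_cover_iso[OF C(1) assms(1,2) fg]
  have "lmod_iso R (Omega1 R N) (Omega1 R M)"
    using Omega1_unique[OF assms(2) *(1)] *(2) C(2) by simp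
  then show ?thesis by (rule lmod_iso_sym[OF _ left_module_Omega1[OF assms(2)]])
qed

lemma Omega1_funpow_cong:
  fixes M N :: "('r, 'u) module"
  assumes "left_module R M" "left_module R N" "lmod_iso R M N"
  shows "lmod_iso R ((Omega1 R ^^ k) M) ((Omega1 R ^^ k) N)"
  using assms by (induction k) (auto intro: Omega1_cong left_module_Omega1_funpow)

text \<open>
  The identity is a cover of a projective module, so syzygies do not see projective summands.
\<close>

lemma Omega1_dsum2:
  fixes M Z :: "('r, 'u) module"
  assumes M: "left_module R M" and Z: "left_module R Z" and P: "projective R P" and iso: "lmod_iso R Z (dsum2 M P)"
  shows "lmod_iso R (Omega1 R Z) (Omega1 R M)"
proof -
  obtain C :: "('r, 'u) module" and p where C: "projective_cover R C p M" "Omega1 R M = ker_module C M p"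
    using Omega1_cover[OF M] by blast
  note lP = projective_left_module[OF P]
  have D: "left_module R (dsum2 M P)" by (rule left_module_dsum2[OF M lP])
  obtain f g where fg: "f \<in> lmod_hom R Z (dsum2 M P)" "g \<in> lmod_hom R (dsum2 M P) Z"
    "\<forall>x\<in>carrier Z. g (f x) = x" "\<forall>y\<in>carrier (dsum2 M P). f (g y) = y"
    using lmod_iso_inverse[OF iso Z] by blast
  note c = projective_cover_dsum2[OF C(1) M P]
  note * = projective_cover_iso[OF c(1) D Z fg(2,1,4,3)]
  have "lmod_iso R (Omega1 R Z) (ker_module (dsum2 C P) (dsum2 M P) (map_prod p (\<lambda>x. x)))"
    using Omega1_unique[OF Z *(1)] *(2) by simp
  moreover have "lmod_iso R (ker_module (dsum2 C P) (dsum2 M P) (map_prod p (\<lambda>x. x))) (Omega1 R M)"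
    using lmod_iso_sym[OF c(2)] left_module_Omega1[OF M] C(2) by simp
  ultimately show ?thesis by (rule lmod_iso_trans)
qed

lemma Omega1_kernel:
  fixes M :: "('r, 'u) module"
  assumes "left_module R M" "projective R P" "q \<in> lmod_hom R P M" "q ` carrier P = carrier M"
  shows "\<exists>H. projective R (P\<lparr>carrier := H\<rparr>) \<and>
    lmod_iso R (ker_module P M q) (dsum2 (Omega1 R M) (P\<lparr>carrier := H\<rparr>))"
proof -
  obtain C :: "('r, 'u) module" and p where C: "projective_cover R C p M" "Omega1 R M = ker_module C M p"
    using Omega1_cover[OF assms(1)] by blast
  show ?thesis using cover_kernel[OF assms(1) C(1) assms(2-4)] C(2) by simp
qed

text \<open>
  As \<open>C\<close> is projective, \<open>T\<close> is the direct sum of \<open>C\<close> and the kernel. So adding \<open>C\<close> to the first term of a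
  resolution of the kernel gives a resolution of \<open>T\<close>.
\<close>

lemma pd_le_extension:
  fixes T :: "('r, 'u) module" and C :: "('r, 'u) module"
  assumes T: "left_module R T" and C: "projective R C" and s: "s \<in> lmod_hom R T C" "s ` carrier T = carrier C"
    and K: "pd_le R k (ker_module T C s)"
  shows "pd_le R k T"
proof -
  note lC = projective_left_module[OF C]
  interpret T: left_module R T by (rule T)
  interpret C: left_module R C by (rule lC)
  obtain z where z: "z \<in> lmod_hom R C T" "\<forall>x\<in>carrier C. s (z x) = x"
    using projective_split[OF C T s] by blast
  show ?thesis
  proof (cases k)
    case 0
    have iso: "lmod_iso R T (dsum2 (ker_module T C s) C)"
      using split_iso[OF T lC s(1) z(1)] z(2) by blast
    have D: "projective R (dsum2 (ker_module T C s) C)"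
      using projective_dsum2[OF _ C] K 0 by simp
    show ?thesis
      using projective_iso[OF D T lmod_iso_sym[OF iso T]] 0 by simp
  next
    case (Suc j)
    let ?K = "ker_module T C s"
    obtain Q :: "('r, 'u) module" and p where Q: "projective R Q" "p \<in> lmod_hom R Q ?K" "p ` carrier Q = carrier ?K"
      "pd_le R j (ker_module Q ?K p)" using K Suc by auto
    note lQ = projective_left_module[OF Q(1)]
    interpret Q: left_module R Q by (rule lQ)
    let ?D = "dsum2 Q C"
    have lD: "left_module R ?D" by (rule left_module_dsum2[OF lQ lC])
    obtain D :: "('r, 'u) module" where D: "left_module R D" "carrier D = pair ` carrier ?D"
      "pair \<in> lmod_hom R ?D D" "bij_betw pair (carrier ?D) (carrier D)"
      using copy_module[OF lD inj_on_subset[OF inj_pair]] by blast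
    define e where "e = inv_into (carrier ?D) pair"
    have e: "e \<in> lmod_hom R D ?D" unfolding e_def by (rule lmod_hom_inverse[OF D(3,4) lD])
    have ep: "e (pair w) = w" if "w \<in> carrier ?D" for w
      using that D(4) unfolding e_def by (simp add: bij_betw_def)
    have p': "p \<in> lmod_hom R Q T"
      using lmod_hom_compose[OF Q(2) lmod_hom_incl[OF a_kernel_subset]] .
    have sp: "s (p x) = \<zero>\<^bsub>C\<^esub>" if "x \<in> carrier Q" for x
      using lmod_hom_closed[OF Q(2) that] by (simp add: a_kernel_iff)
    define h where "h = (\<lambda>w. (\<lambda>(x, y). p x \<oplus>\<^bsub>T\<^esub> z y) (e w))"
    have h: "h \<in> lmod_hom R D T"
      unfolding h_def by (rule lmod_hom_compose[OF e lmod_hom_copair[OF p' z(1) T]])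
    have hp: "h (pair (x, y)) = p x \<oplus>\<^bsub>T\<^esub> z y" if "x \<in> carrier Q" "y \<in> carrier C" for x y
      using ep[of "(x, y)"] that by (simp add: h_def)
    have shp: "s (h (pair (x, y))) = y" if "x \<in> carrier Q" "y \<in> carrier C" for x y
      using that lmod_hom_add[OF s(1) lmod_hom_closed[OF p' that(1)] lmod_hom_closed[OF z(1) that(2)]] sp z(2)
      by (simp add: hp)
    have "h ` carrier D = carrier T"
    proof (intro equalityI subsetI)
      fix t assume t: "t \<in> carrier T"
      note zst = lmod_hom_closed[OF z(1) lmod_hom_closed[OF s(1) t]]
      have "s (t \<ominus>\<^bsub>T\<^esub> z (s t)) = \<zero>\<^bsub>C\<^esub>"
        using lmod_hom_diff[OF s(1) T lC t zst] z(2) lmod_hom_closed[OF s(1) t] C.M.diff_self by simp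
      then have "t \<ominus>\<^bsub>T\<^esub> z (s t) \<in> carrier ?K" using t zst by (simp add: a_kernel_iff)
      then obtain x where "x \<in> carrier Q" "p x = t \<ominus>\<^bsub>T\<^esub> z (s t)" using Q(3) by (metis imageE)
      then have "h (pair (x, s t)) = t" "(x, s t) \<in> carrier ?D"
        using hp[of x "s t"] T.M.diff_add_cancel[OF t zst] lmod_hom_closed[OF s(1) t] by auto
      then show "t \<in> h ` carrier D" using D(2) by (metis imageI)
    qed (auto simp: lmod_hom_closed[OF h])
    moreover have "lmod_iso R (ker_module Q ?K p) (ker_module D T h)"
    proof (rule lmod_isoI_inverse)
      have inc: "(\<lambda>x. pair (x, \<zero>\<^bsub>C\<^esub>)) \<in> lmod_hom R Q D" by (rule lmod_hom_compose[OF lmod_hom_inl[OF lC] D(3)])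
      have fe: "(\<lambda>x. fst (e x)) \<in> lmod_hom R D Q" by (rule lmod_hom_compose[OF e lmod_hom_fst])
      have h0: "h (pair (x, \<zero>\<^bsub>C\<^esub>)) = p x" if "x \<in> carrier Q" for x
        using that lmod_hom_zero[OF z(1) lC T] lmod_hom_closed[OF p' that] by (simp add: hp)
      show "(\<lambda>x. pair (x, \<zero>\<^bsub>C\<^esub>)) \<in> lmod_hom R (ker_module Q ?K p) (ker_module D T h)"
        by (rule lmod_hom_restrict[OF inc]) (auto simp: a_kernel_iff h0 lmod_hom_closed[OF inc])
      have ker: "\<exists>x\<in>carrier Q. w = pair (x, \<zero>\<^bsub>C\<^esub>) \<and> p x = \<zero>\<^bsub>T\<^esub>" if w: "w \<in> a_kernel D T h" for w
      proof -
        obtain x y where xy: "w = pair (x, y)" "x \<in> carrier Q" "y \<in> carrier C"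
          using w D(2) by (auto simp: a_kernel_iff)
        have "h w = \<zero>\<^bsub>T\<^esub>" using w by (simp add: a_kernel_iff)
        then have "y = \<zero>\<^bsub>C\<^esub>" using shp[OF xy(2,3)] xy(1) lmod_hom_zero[OF s(1) T lC] by simp
        then show ?thesis using xy h0 \<open>h w = \<zero>\<^bsub>T\<^esub>\<close> by auto
      qed
      show "(\<lambda>x. fst (e x)) \<in> lmod_hom R (ker_module D T h) (ker_module Q ?K p)"
      proof (rule lmod_hom_restrict[OF fe a_kernel_subset], rule image_subsetI)
        fix w assume "w \<in> a_kernel D T h"
        from ker[OF this] obtain x where "x \<in> carrier Q" "w = pair (x, \<zero>\<^bsub>C\<^esub>)" "p x = \<zero>\<^bsub>T\<^esub>" by blast
        then show "fst (e w) \<in> a_kernel Q ?K p" by (simp add: ep a_kernel_iff)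
      qed
      show "pair (fst (e w), \<zero>\<^bsub>C\<^esub>) = w" if "w \<in> carrier (ker_module D T h)" for w
        using ker[of w] that by (auto simp: ep)
      show "fst (e (pair (x, \<zero>\<^bsub>C\<^esub>))) = x" if "x \<in> carrier (ker_module Q ?K p)" for x
        using that by (auto simp: ep a_kernel_iff)
    qed
    then have "pd_le R j (ker_module D T h)"
      by (rule pd_le_iso[OF Q(4) left_module_kernel[OF h D(1) T]])
    moreover have "projective R D"
      by (rule projective_iso[OF projective_dsum2[OF Q(1) C] D(1) lmod_isoI[OF D(3,4)]])
    ultimately show ?thesis using Suc T h by auto
  qed
qed

text \<open>
  For an exact sequence \<open>0 \<rightarrow> A \<rightarrow> B \<rightarrow> L \<rightarrow> 0\<close> with \<open>B\<close> projective, \<open>A\<close> is the syzygy of \<open>L\<close> up to a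
  projective summand. Otherwise let \<open>Q \<rightarrow> B\<close> be onto with \<open>Q\<close> projective and with a kernel of projective
  dimension at most \<open>k - 1\<close>. The kernel \<open>E\<close> of \<open>Q \<rightarrow> L\<close> is \<open>\<Omega> L\<close> up to a projective summand.
  The pullback \<open>T\<close> of \<open>E \<rightarrow> A\<close> and the cover \<open>C \<rightarrow> A\<close> is an extension in two ways: of \<open>E\<close> by \<open>\<Omega> A\<close>,
  and of \<open>C\<close> by the kernel of \<open>Q \<rightarrow> B\<close>. By the second one \<open>T\<close> has projective dimension at most
  \<open>k - 1\<close>, so induction applies to the first one.
\<close>

lemma syzygy_of_extension:
  fixes A B L :: "('r, 'u) module"
  assumes "pd_le R k B" "left_module R L" "q \<in> lmod_hom R B L" "q ` carrier B = carrier L"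
    and "left_module R A" "lmod_iso R A (ker_module B L q)"
  shows "\<exists>P :: ('r, 'u) module. projective R P \<and>
    lmod_iso R ((Omega1 R ^^ k) A) (dsum2 ((Omega1 R ^^ Suc k) L) P)"
  using assms
proof (induction k arbitrary: A B L q)
  case (0 A B L q)
  then obtain H where "projective R (B\<lparr>carrier := H\<rparr>)"
    "lmod_iso R (ker_module B L q) (dsum2 (Omega1 R L) (B\<lparr>carrier := H\<rparr>))"
    using Omega1_kernel[of L B q] by auto
  then show ?case using lmod_iso_trans[OF 0(6)] by auto
next
  case (Suc k A B L q)
  note q = Suc.prems(3,4)
  obtain Q :: "('r, 'u) module" and r where Q: "projective R Q" "r \<in> lmod_hom R Q B" "r ` carrier Q = carrier B"
    "pd_le R k (ker_module Q B r)" using Suc.prems(1) by auto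
  have lB: "left_module R B" using Suc.prems(1) by simp
  note lL = Suc.prems(2) and lQ = projective_left_module[OF Q(1)]
  let ?A = "ker_module B L q"
  have lA: "left_module R ?A" by (rule left_module_kernel[OF q(1) lB lL])
  have qr: "(\<lambda>x. q (r x)) \<in> lmod_hom R Q L" by (rule lmod_hom_compose[OF Q(2) q(1)])
  let ?E = "ker_module Q L (\<lambda>x. q (r x))"
  have lE: "left_module R ?E" by (rule left_module_kernel[OF qr lQ lL])
  have qrs: "(\<lambda>x. q (r x)) ` carrier Q = carrier L" using Q(3) q(2) by (metis image_image)
  obtain H where H: "projective R (Q\<lparr>carrier := H\<rparr>)"
    "lmod_iso R ?E (dsum2 (Omega1 R L) (Q\<lparr>carrier := H\<rparr>))"
    using Omega1_kernel[OF lL Q(1) qr qrs] by blast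
  obtain C :: "('r, 'u) module" and c where C: "projective_cover R C c ?A" "Omega1 R ?A = ker_module C ?A c"
    using Omega1_cover[OF lA] by blast
  note c = projective_coverD[OF C(1)]
  note lC = projective_left_module[OF c(1)]
  interpret C: left_module R C by (rule lC)
  interpret E: left_module R ?E by (rule lE)
  interpret B: left_module R B by (rule lB)
  have cB: "c x \<in> carrier B" "q (c x) = \<zero>\<^bsub>L\<^esub>" if "x \<in> carrier C" for x
    using lmod_hom_closed[OF c(2) that] by (auto simp: a_kernel_iff)
  have rE: "r \<in> lmod_hom R ?E ?A"
    by (rule lmod_hom_restrict[OF Q(2)]) (auto simp: a_kernel_iff lmod_hom_closed[OF Q(2)])
  \<comment> \<open>the pullback of the cover of \<open>A\<close> along \<open>E \<rightarrow> A\<close>\<close>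
  let ?CE = "dsum2 C ?E"
  have lCE: "left_module R ?CE" by (rule left_module_dsum2[OF lC lE])
  define d where "d = (\<lambda>w. c (fst w) \<ominus>\<^bsub>?A\<^esub> r (snd w))"
  have d: "d \<in> lmod_hom R ?CE ?A" unfolding d_def
    by (intro lmod_hom_difference lmod_hom_compose[OF lmod_hom_fst c(2)] lmod_hom_compose[OF lmod_hom_snd rE] lA)
  interpret A: left_module R ?A by (rule lA)
  let ?T = "ker_module ?CE ?A d"
  have lT: "left_module R ?T" by (rule left_module_kernel[OF d lCE lA])
  have T_iff: "w \<in> carrier ?T \<longleftrightarrow> (\<exists>x e. w = (x, e) \<and> x \<in> carrier C \<and> e \<in> carrier ?E \<and> c x = r e)" for w
    using A.M.diff_eq_zero_iff lmod_hom_closed[OF c(2)] lmod_hom_closed[OF rE]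
    by (cases w) (auto simp: a_kernel_iff[of _ ?CE] d_def)
  obtain T :: "('r, 'u) module" where T: "left_module R T" "carrier T = pair ` carrier ?T"
    "pair \<in> lmod_hom R ?T T" "bij_betw pair (carrier ?T) (carrier T)"
    using copy_module[OF lT inj_on_subset[OF inj_pair]] by blast
  define i where "i = inv_into (carrier ?T) pair"
  have i: "i \<in> lmod_hom R T ?T" unfolding i_def by (rule lmod_hom_inverse[OF T(3,4) lT])
  have ip: "i (pair w) = w" if "w \<in> carrier ?T" for w
    using that T(4) unfolding i_def by (simp add: bij_betw_def)
  have i': "i \<in> lmod_hom R T ?CE"
    using lmod_hom_compose[OF i lmod_hom_incl[OF a_kernel_subset]] .
  have f1: "(\<lambda>w. fst (i w)) \<in> lmod_hom R T C" by (rule lmod_hom_compose[OF i' lmod_hom_fst])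
  have f2: "(\<lambda>w. snd (i w)) \<in> lmod_hom R T ?E" by (rule lmod_hom_compose[OF i' lmod_hom_snd])
  have T1: "pair (x, e) \<in> carrier T" "i (pair (x, e)) = (x, e)"
    if "x \<in> carrier C" "e \<in> carrier ?E" "c x = r e" for x e
    using that T_iff[of "(x, e)"] T(2) ip[of "(x, e)"] by auto
  have T2: "\<exists>x e. w = pair (x, e) \<and> x \<in> carrier C \<and> e \<in> carrier ?E \<and> c x = r e" if w: "w \<in> carrier T" for w
  proof -
    have "w \<in> pair ` carrier ?T" using w unfolding T(2) .
    then obtain v where "v \<in> carrier ?T" "w = pair v" by (elim imageE)
    moreover from this(1)[unfolded T_iff] obtain x e where
      "v = (x, e)" "x \<in> carrier C" "e \<in> carrier ?E" "c x = r e" by blast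
    ultimately show ?thesis by blast
  qed
  have r0: "r \<zero>\<^bsub>Q\<^esub> = \<zero>\<^bsub>B\<^esub>" by (rule lmod_hom_zero[OF Q(2) lQ lB])
  have c0: "c \<zero>\<^bsub>C\<^esub> = \<zero>\<^bsub>B\<^esub>" using lmod_hom_zero[OF c(2) lC lA] by simp
  \<comment> \<open>the projection of the pullback to \<open>E\<close> is onto with kernel the syzygy of \<open>A\<close>\<close>
  have s2: "(\<lambda>w. snd (i w)) ` carrier T = carrier ?E"
  proof (intro equalityI subsetI)
    fix e assume e: "e \<in> carrier ?E"
    then obtain x where "x \<in> carrier C" "c x = r e"
      using c(3) lmod_hom_closed[OF rE e] by (metis imageE)
    then show "e \<in> (\<lambda>w. snd (i w)) ` carrier T" using T1[of x e] e by (metis imageI snd_conv)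
  qed (use lmod_hom_closed[OF f2] in auto)
  have k2: "lmod_iso R (Omega1 R ?A) (ker_module T ?E (\<lambda>w. snd (i w)))"
    unfolding C(2)
  proof (rule lmod_isoI_inverse)
    have in1: "pair (x, \<zero>\<^bsub>Q\<^esub>) \<in> carrier T" "i (pair (x, \<zero>\<^bsub>Q\<^esub>)) = (x, \<zero>\<^bsub>Q\<^esub>)"
      if "x \<in> carrier C" "c x = \<zero>\<^bsub>B\<^esub>" for x
      using T1[of x "\<zero>\<^bsub>Q\<^esub>"] that r0 E.M.zero_closed by auto
    have "(\<lambda>x. (x, \<zero>\<^bsub>Q\<^esub>)) \<in> lmod_hom R (ker_module C ?A c) ?T"
    proof (rule lmod_hom_restrict)
      show "(\<lambda>x. (x, \<zero>\<^bsub>Q\<^esub>)) \<in> lmod_hom R C ?CE" using lmod_hom_inl[OF lE, where M = C] by simp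
      show "(\<lambda>x. (x, \<zero>\<^bsub>Q\<^esub>)) ` a_kernel C ?A c \<subseteq> a_kernel ?CE ?A d"
        using T_iff r0 E.M.zero_closed by (auto simp: a_kernel_iff[of _ C])
    qed (auto simp: a_kernel_iff)
    from lmod_hom_compose[OF this T(3)]
    show "(\<lambda>x. pair (x, \<zero>\<^bsub>Q\<^esub>)) \<in> lmod_hom R (ker_module C ?A c) (ker_module T ?E (\<lambda>w. snd (i w)))"
      by (rule lmod_hom_restrict_cod) (auto simp: a_kernel_iff[of _ C] a_kernel_iff[of _ T] in1)
    have ker: "\<exists>x\<in>carrier C. w = pair (x, \<zero>\<^bsub>Q\<^esub>) \<and> c x = \<zero>\<^bsub>B\<^esub>" if "w \<in> a_kernel T ?E (\<lambda>w. snd (i w))" for w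
    proof -
      have w: "w \<in> carrier T" "snd (i w) = \<zero>\<^bsub>Q\<^esub>" using that by (auto simp: a_kernel_iff[of _ T])
      obtain x e where xe: "w = pair (x, e)" "x \<in> carrier C" "e \<in> carrier ?E" "c x = r e" using T2[OF w(1)] by blast
      then show ?thesis using w(2) T1[OF xe(2-4)] r0 by auto
    qed
    show "(\<lambda>w. fst (i w)) \<in> lmod_hom R (ker_module T ?E (\<lambda>w. snd (i w))) (ker_module C ?A c)"
    proof (rule lmod_hom_restrict[OF f1 a_kernel_subset], rule image_subsetI)
      fix w assume "w \<in> a_kernel T ?E (\<lambda>w. snd (i w))"
      from ker[OF this] obtain x where "x \<in> carrier C" "w = pair (x, \<zero>\<^bsub>Q\<^esub>)" "c x = \<zero>\<^bsub>B\<^esub>" by blast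
      then show "fst (i w) \<in> a_kernel C ?A c" by (simp add: in1 a_kernel_iff[of _ C])
    qed
    show "pair (fst (i w), \<zero>\<^bsub>Q\<^esub>) = w" if "w \<in> carrier (ker_module T ?E (\<lambda>w. snd (i w)))" for w
      using ker[of w] that by (auto simp: in1)
    show "fst (i (pair (x, \<zero>\<^bsub>Q\<^esub>))) = x" if "x \<in> carrier (ker_module C ?A c)" for x
      using that by (auto simp: in1 a_kernel_iff[of _ C])
  qed
  \<comment> \<open>the projection of the pullback to the cover of \<open>A\<close> is onto with kernel that of \<open>Q \<rightarrow> B\<close>\<close>
  have s1: "(\<lambda>w. fst (i w)) ` carrier T = carrier C"
  proof (intro equalityI subsetI)
    fix x assume x: "x \<in> carrier C"
    then obtain e where e: "e \<in> carrier Q" "c x = r e" using Q(3) cB(1)[OF x] by (metis imageE)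
    then have "e \<in> carrier ?E" using cB(2)[OF x] by (simp add: a_kernel_iff)
    then show "x \<in> (\<lambda>w. fst (i w)) ` carrier T" using T1[of x e] x e by (metis imageI fst_conv)
  qed (use lmod_hom_closed[OF f1] in auto)
  have k1: "lmod_iso R (ker_module Q B r) (ker_module T C (\<lambda>w. fst (i w)))"
  proof (rule lmod_isoI_inverse)
    have kE: "a_kernel Q B r \<subseteq> carrier ?E" using lmod_hom_zero[OF q(1) lB lL] by (auto simp: a_kernel_iff)
    have in1: "pair (\<zero>\<^bsub>C\<^esub>, e) \<in> carrier T" "i (pair (\<zero>\<^bsub>C\<^esub>, e)) = (\<zero>\<^bsub>C\<^esub>, e)"
      if "e \<in> a_kernel Q B r" for e
      using T1[of "\<zero>\<^bsub>C\<^esub>" e] that c0 kE C.M.zero_closed by (auto simp: a_kernel_iff[of _ Q B])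
    have "(\<lambda>e. (\<zero>\<^bsub>C\<^esub>, e)) \<in> lmod_hom R (?E\<lparr>carrier := a_kernel Q B r\<rparr>) ?T"
    proof (rule lmod_hom_restrict[OF lmod_hom_inr[OF lC] kE])
      show "(\<lambda>e. (\<zero>\<^bsub>C\<^esub>, e)) ` a_kernel Q B r \<subseteq> a_kernel ?CE ?A d"
        using T_iff c0 kE C.M.zero_closed by (auto simp: a_kernel_iff[of _ Q B])
    qed
    then have "(\<lambda>e. (\<zero>\<^bsub>C\<^esub>, e)) \<in> lmod_hom R (ker_module Q B r) ?T" by simp
    from lmod_hom_compose[OF this T(3)]
    show "(\<lambda>e. pair (\<zero>\<^bsub>C\<^esub>, e)) \<in> lmod_hom R (ker_module Q B r) (ker_module T C (\<lambda>w. fst (i w)))"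
      by (rule lmod_hom_restrict_cod) (auto simp: a_kernel_iff[of _ T] in1)
    have ker: "\<exists>e\<in>a_kernel Q B r. w = pair (\<zero>\<^bsub>C\<^esub>, e)" if "w \<in> a_kernel T C (\<lambda>w. fst (i w))" for w
    proof -
      have w: "w \<in> carrier T" "fst (i w) = \<zero>\<^bsub>C\<^esub>" using that by (auto simp: a_kernel_iff[of _ T])
      obtain x e where xe: "w = pair (x, e)" "x \<in> carrier C" "e \<in> carrier ?E" "c x = r e" using T2[OF w(1)] by blast
      then have "x = \<zero>\<^bsub>C\<^esub>" using w(2) T1[OF xe(2-4)] by simp
      moreover have "e \<in> carrier Q" using xe(3) by (simp add: a_kernel_iff)
      ultimately show ?thesis using xe c0 by (auto simp: a_kernel_iff[of _ Q B])
    qed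
    have "(\<lambda>w. snd (i w)) \<in> lmod_hom R (ker_module T C (\<lambda>w. fst (i w))) (?E\<lparr>carrier := a_kernel Q B r\<rparr>)"
    proof (rule lmod_hom_restrict[OF f2 a_kernel_subset], rule image_subsetI)
      fix w assume "w \<in> a_kernel T C (\<lambda>w. fst (i w))"
      from ker[OF this] obtain e where "e \<in> a_kernel Q B r" "w = pair (\<zero>\<^bsub>C\<^esub>, e)" by blast
      then show "snd (i w) \<in> a_kernel Q B r" by (simp add: in1)
    qed
    then show "(\<lambda>w. snd (i w)) \<in> lmod_hom R (ker_module T C (\<lambda>w. fst (i w))) (ker_module Q B r)" by simp
    show "pair (\<zero>\<^bsub>C\<^esub>, snd (i w)) = w" if "w \<in> carrier (ker_module T C (\<lambda>w. fst (i w)))" for w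
      using ker[of w] that by (auto simp: in1)
    show "snd (i (pair (\<zero>\<^bsub>C\<^esub>, e))) = e" if "e \<in> carrier (ker_module Q B r)" for e
      using that by (auto simp: in1)
  qed
  have "pd_le R k (ker_module T C (\<lambda>w. fst (i w)))"
    by (rule pd_le_iso[OF Q(4) left_module_kernel[OF f1 T(1) lC] k1])
  then have "pd_le R k T" by (rule pd_le_extension[OF T(1) c(1) f1 s1])
  then obtain P :: "('r, 'u) module" where P: "projective R P"
    "lmod_iso R ((Omega1 R ^^ k) (Omega1 R ?A)) (dsum2 ((Omega1 R ^^ Suc k) ?E) P)"
    using Suc.IH[OF _ lE f2 s2 left_module_Omega1[OF lA] k2] by blast
  note OL = left_module_Omega1[OF lL]
  have "lmod_iso R ((Omega1 R ^^ k) (Omega1 R ?E)) ((Omega1 R ^^ k) (Omega1 R (Omega1 R L)))"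
    by (intro Omega1_funpow_cong left_module_Omega1 lE OL Omega1_dsum2[OF OL lE H])
  then have "lmod_iso R ((Omega1 R ^^ Suc k) ?E) ((Omega1 R ^^ Suc (Suc k)) L)"
    by (simp add: funpow_swap1)
  then have "lmod_iso R ((Omega1 R ^^ k) (Omega1 R ?A)) (dsum2 ((Omega1 R ^^ Suc (Suc k)) L) P)"
    by (rule lmod_iso_trans[OF P(2) dsum2_cong[OF _ lmod_iso_refl]])
  then have "lmod_iso R ((Omega1 R ^^ Suc k) ?A) (dsum2 ((Omega1 R ^^ Suc (Suc k)) L) P)"
    by (simp only: funpow_Suc_right o_apply)
  moreover have "lmod_iso R ((Omega1 R ^^ Suc k) A) ((Omega1 R ^^ Suc k) ?A)"
    by (rule Omega1_funpow_cong[OF Suc.prems(5) lA Suc.prems(6)])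
  ultimately show ?case using P(1) lmod_iso_trans by blast
qed

end


section \<open>Modules of finite length\<close>

text \<open>
  A module has finite length if and only if there is a strictly monotone function from its
  submodules to the natural numbers; the length itself is one. In this form the notion passes to
  submodules and yields both chain conditions at once.
\<close>

definition finite_length :: "('r, 'x) ring_scheme \<Rightarrow> ('r, 'm) module \<Rightarrow> bool"
  where "finite_length R M \<longleftrightarrow> (\<exists>\<mu> :: 'm set \<Rightarrow> nat.
    \<forall>H K. submodule H R M \<longrightarrow> submodule K R M \<longrightarrow> H \<subset> K \<longrightarrow> \<mu> H < \<mu> K)"

lemma finite_length_minimal:
  assumes "finite_length R M" "S \<noteq> {}" "\<And>H. H \<in> S \<Longrightarrow> submodule H R M"
  shows "\<exists>H\<in>S. \<forall>K\<in>S. K \<subseteq> H \<longrightarrow> K = H"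
proof -
  obtain \<mu> :: "_ set \<Rightarrow> nat" where \<mu>: "\<And>H K. \<lbrakk>submodule H R M; submodule K R M; H \<subset> K\<rbrakk> \<Longrightarrow> \<mu> H < \<mu> K"
    using assms(1) unfolding finite_length_def by blast
  obtain H where "H \<in> S" "\<forall>K. K \<in> S \<longrightarrow> \<mu> H \<le> \<mu> K"
    using ex_has_least_nat[of "\<lambda>H. H \<in> S" _ \<mu>] assms(2) by blast
  then show ?thesis using \<mu> assms(3) by (metis leD psubsetI)
qed

lemma finite_length_maximal:
  assumes "finite_length R M" "left_module R M" "S \<noteq> {}" "\<And>H. H \<in> S \<Longrightarrow> submodule H R M"
  shows "\<exists>H\<in>S. \<forall>K\<in>S. H \<subseteq> K \<longrightarrow> K = H"
proof -
  obtain \<mu> :: "_ set \<Rightarrow> nat" where \<mu>: "\<And>H K. \<lbrakk>submodule H R M; submodule K R M; H \<subset> K\<rbrakk> \<Longrightarrow> \<mu> H < \<mu> K"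
    using assms(1) unfolding finite_length_def by blast
  have "\<mu> H < Suc (\<mu> (carrier M))" if "H \<in> S" for H
  proof (cases "H = carrier M")
    case False
    then show ?thesis
      using \<mu>[OF assms(4)[OF that] submodule_carrier[OF assms(2)]] submodule_subset[OF assms(4)[OF that]] by fastforce
  qed simp
  then obtain H where "H \<in> S" "\<forall>K. K \<in> S \<longrightarrow> \<mu> K \<le> \<mu> H"
    using ex_has_greatest_nat[of "\<lambda>H. H \<in> S" _ \<mu> "Suc (\<mu> (carrier M))"] assms(3) by (metis ex_in_conv)
  then show ?thesis using \<mu> assms(4) by (metis leD psubsetI)
qed

lemma finite_length_submodule:
  assumes "finite_length R M" "left_module R M" "submodule N R M"
  shows "finite_length R (M\<lparr>carrier := N\<rparr>)"
proof -
  obtain \<mu> :: "_ set \<Rightarrow> nat" where \<mu>: "\<forall>H K. submodule H R M \<longrightarrow> submodule K R M \<longrightarrow> H \<subset> K \<longrightarrow> \<mu> H < \<mu> K"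
    using assms(1) unfolding finite_length_def by (elim exE)
  then show ?thesis unfolding finite_length_def submodule_trans[OF assms(2,3)]
    by (intro exI[of _ \<mu>]) simp
qed

definition maximal_submodule :: "('r, 'x) ring_scheme \<Rightarrow> ('r, 'm) module \<Rightarrow> 'm set \<Rightarrow> bool"
  where "maximal_submodule R M V \<longleftrightarrow> submodule V R M \<and> V \<noteq> carrier M \<and>
    (\<forall>K. submodule K R M \<longrightarrow> V \<subseteq> K \<longrightarrow> K = V \<or> K = carrier M)"

lemma maximal_submodule_exists:
  assumes "finite_length R M" "left_module R M" "carrier M \<noteq> {\<zero>\<^bsub>M\<^esub>}"
  shows "\<exists>V. maximal_submodule R M V"
proof -
  let ?S = "{V. submodule V R M \<and> V \<noteq> carrier M}"
  have "{\<zero>\<^bsub>M\<^esub>} \<in> ?S" using submodule_zero_set[OF assms(2)] assms(3) by simp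
  then have "?S \<noteq> {}" by blast
  then have "\<exists>H\<in>?S. \<forall>K\<in>?S. H \<subseteq> K \<longrightarrow> K = H" by (rule finite_length_maximal[OF assms(1,2)]) simp
  then show ?thesis unfolding maximal_submodule_def by blast
qed

lemma smult_hom:
  assumes "left_module R M" "x \<in> carrier M"
  shows "(\<lambda>a. a \<odot>\<^bsub>M\<^esub> x) \<in> lmod_hom R (regular_module R) M"
proof -
  interpret M: left_module R M by fact
  show ?thesis using assms(2)
    by (intro lmod_homI) (auto simp: M.smult_closed M.smult_l_distr M.smult_assoc)
qed

lemma span_superset: "B \<subseteq> lmod_span R M B"
  by (auto simp: lmod_span_def)

lemma span_least: "\<lbrakk>submodule H R M; B \<subseteq> H\<rbrakk> \<Longrightarrow> lmod_span R M B \<subseteq> H"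
  by (auto simp: lmod_span_def)

lemma submodule_span:
  assumes "left_module R M" "B \<subseteq> carrier M"
  shows "submodule (lmod_span R M B) R M"
proof -
  interpret M: left_module R M by fact
  have "lmod_span R M B \<subseteq> carrier M" by (rule span_least[OF submodule_carrier[OF assms(1)] assms(2)])
  then show ?thesis unfolding lmod_span_def
    by (intro M.submoduleI) (auto simp: submodule_zero submodule_add submodule_smult)
qed

lemma span_mono: "B \<subseteq> C \<Longrightarrow> lmod_span R M B \<subseteq> lmod_span R M C"
  by (auto simp: lmod_span_def)


section \<open>The radical of a ring of finite length\<close>

definition jacobson :: "('r, 'x) ring_scheme \<Rightarrow> 'r set"
  where "jacobson R = {a \<in> carrier R. \<forall>V. maximal_submodule R (regular_module R) V \<longrightarrow> a \<in> V}"

definition rad_mult :: "('r, 'x) ring_scheme \<Rightarrow> ('r, 'm) module \<Rightarrow> 'm set \<Rightarrow> 'm set"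
  where "rad_mult R M U = lmod_span R M {a \<odot>\<^bsub>M\<^esub> x | a x. a \<in> jacobson R \<and> x \<in> U}"

text \<open>
  The map \<open>a \<mapsto> a x\<close> induces an isomorphism from \<open>R\<close> modulo this left ideal to the simple module \<open>M/V\<close>.
\<close>

lemma maximal_submodule_colon:
  assumes M: "left_module R M" and V: "maximal_submodule R M V" and x: "x \<in> carrier M" "x \<notin> V"
  shows "maximal_submodule R (regular_module R) {a \<in> carrier R. a \<odot>\<^bsub>M\<^esub> x \<in> V}"
proof -
  interpret M: left_module R M by fact
  have reg: "left_module R (regular_module R)" by (rule left_module_regular) (rule M.R.ring_axioms)
  have sV: "submodule V R M" using V by (simp add: maximal_submodule_def)
  have sub: "submodule {a \<in> carrier R. a \<odot>\<^bsub>M\<^esub> x \<in> V} R (regular_module R)"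
    using submodule_vimage[OF smult_hom[OF M x(1)] reg M sV] by simp
  have 1: "\<one>\<^bsub>R\<^esub> \<in> carrier (regular_module R)" "\<one>\<^bsub>R\<^esub> \<notin> {a \<in> carrier R. a \<odot>\<^bsub>M\<^esub> x \<in> V}"
    using x by (auto simp: M.smult_one)
  have "K = carrier (regular_module R)"
    if K: "submodule K R (regular_module R)" "{a \<in> carrier R. a \<odot>\<^bsub>M\<^esub> x \<in> V} \<subseteq> K"
      and ne: "K \<noteq> {a \<in> carrier R. a \<odot>\<^bsub>M\<^esub> x \<in> V}" for K
  proof -
    have KR: "K \<subseteq> carrier R" using submodule_subset[OF K(1)] by simp
    obtain a where a: "a \<in> K" "a \<odot>\<^bsub>M\<^esub> x \<notin> V" using K ne KR by blast
    have aR: "a \<in> carrier R" using a KR by blast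
    define y where "y = a \<odot>\<^bsub>M\<^esub> x"
    have y: "y \<in> carrier M" "y \<notin> V" using a aR x by (auto simp: y_def M.smult_closed)
    let ?C = "(\<lambda>b. b \<odot>\<^bsub>M\<^esub> y) ` carrier R"
    have C: "submodule ?C R M"
      using submodule_image[OF smult_hom[OF M y(1)] reg M submodule_carrier[OF reg]] by simp
    have VC: "submodule (V <+>\<^bsub>M\<^esub> ?C) R M" by (rule submodule_set_add[OF M sV C])
    have "y \<in> ?C" using y by (auto simp: image_iff M.smult_one intro!: bexI[of _ "\<one>\<^bsub>R\<^esub>"])
    then have "y \<in> V <+>\<^bsub>M\<^esub> ?C" using set_add_superset(2)[OF M sV C] by blast
    then have "V <+>\<^bsub>M\<^esub> ?C = carrier M"
      using V VC set_add_superset(1)[OF M sV C] y(2) unfolding maximal_submodule_def by blast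
    then obtain v b where vb: "v \<in> V" "b \<in> carrier R" "x = v \<oplus>\<^bsub>M\<^esub> b \<odot>\<^bsub>M\<^esub> y"
      using set_add_eqD[OF _ x(1)] by blast
    have vM: "v \<in> carrier M" using submodule_mem[OF sV vb(1)] .
    have by': "b \<odot>\<^bsub>M\<^esub> y = (b \<otimes>\<^bsub>R\<^esub> a) \<odot>\<^bsub>M\<^esub> x" using vb aR x by (simp add: y_def M.smult_assoc)
    have ba: "b \<otimes>\<^bsub>R\<^esub> a \<in> K" using submodule_smult[OF K(1) vb(2) a(1)] by simp
    have baR: "b \<otimes>\<^bsub>R\<^esub> a \<in> carrier R" using ba KR by blast
    have "(\<one>\<^bsub>R\<^esub> \<ominus>\<^bsub>R\<^esub> b \<otimes>\<^bsub>R\<^esub> a) \<odot>\<^bsub>M\<^esub> x = x \<ominus>\<^bsub>M\<^esub> b \<odot>\<^bsub>M\<^esub> y"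
      using x baR by (simp add: M.smult_diff_left M.smult_one by')
    also have "\<dots> = v" using vb(3) vM M.smult_closed[OF vb(2) y(1)] M.M.add_diff_cancel_right by simp
    finally have "\<one>\<^bsub>R\<^esub> \<ominus>\<^bsub>R\<^esub> b \<otimes>\<^bsub>R\<^esub> a \<in> K" using K(2) vb(1) baR by auto
    then have "(\<one>\<^bsub>R\<^esub> \<ominus>\<^bsub>R\<^esub> b \<otimes>\<^bsub>R\<^esub> a) \<oplus>\<^bsub>R\<^esub> b \<otimes>\<^bsub>R\<^esub> a \<in> K" using submodule_add[OF K(1) _ ba] by simp
    then have "\<one>\<^bsub>R\<^esub> \<in> K" using baR M.R.diff_add_cancel by simp
    then have "carrier R \<subseteq> K" using submodule_smult[OF K(1), of _ "\<one>\<^bsub>R\<^esub>"] by auto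
    then show ?thesis using KR by simp
  qed
  then show ?thesis unfolding maximal_submodule_def using sub 1 by blast
qed

lemma jacobson_carrier: "a \<in> jacobson R \<Longrightarrow> a \<in> carrier R"
  by (simp add: jacobson_def)

lemma jacobson_smult_maximal:
  assumes M: "left_module R M" and V: "maximal_submodule R M V" and x: "x \<in> carrier M" and a: "a \<in> jacobson R"
  shows "a \<odot>\<^bsub>M\<^esub> x \<in> V"
proof (cases "x \<in> V")
  case True
  then show ?thesis using V a by (auto simp: maximal_submodule_def jacobson_def submodule_smult)
next
  case False
  then show ?thesis using maximal_submodule_colon[OF M V x] a unfolding jacobson_def by blast
qed

lemma submodule_jacobson:
  assumes "ring R"
  shows "submodule (jacobson R) R (regular_module R)"
proof -
  interpret left_module R "regular_module R" by (rule left_module_regular[OF assms])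
  show ?thesis
  proof (rule submoduleI)
    show "jacobson R \<subseteq> carrier (regular_module R)" by (auto simp: jacobson_def)
    have sV: "submodule V R (regular_module R)" if "maximal_submodule R (regular_module R) V" for V
      using that by (simp add: maximal_submodule_def)
    show "\<zero>\<^bsub>regular_module R\<^esub> \<in> jacobson R"
      using submodule_zero[OF sV] M.zero_closed by (auto simp: jacobson_def)
    show "x \<oplus>\<^bsub>regular_module R\<^esub> y \<in> jacobson R" if "x \<in> jacobson R" "y \<in> jacobson R" for x y
      using submodule_add[OF sV, of _ x y] M.a_closed[of x y] that by (auto simp: jacobson_def)
    show "a \<odot>\<^bsub>regular_module R\<^esub> x \<in> jacobson R" if "a \<in> carrier R" "x \<in> jacobson R" for a x
      using submodule_smult[OF sV that(1), of _ x] smult_closed[of a x] that by (auto simp: jacobson_def)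
  qed
qed

text \<open>
  The radical annihilates every simple module, so it is a right ideal as well.
\<close>

lemma jacobson_mult_right:
  assumes "ring R" "a \<in> jacobson R" "b \<in> carrier R"
  shows "a \<otimes>\<^bsub>R\<^esub> b \<in> jacobson R"
proof -
  interpret ring R by fact
  have "a \<otimes>\<^bsub>R\<^esub> b \<in> V" if "maximal_submodule R (regular_module R) V" for V
    using jacobson_smult_maximal[OF left_module_regular[OF assms(1)] that _ assms(2), of b] assms(3) by simp
  then show ?thesis using assms jacobson_carrier[OF assms(2)] by (auto simp: jacobson_def)
qed

lemma rad_mult_gen: "\<lbrakk>a \<in> jacobson R; x \<in> U\<rbrakk> \<Longrightarrow> a \<odot>\<^bsub>M\<^esub> x \<in> rad_mult R M U"
  unfolding rad_mult_def by (rule subsetD[OF span_superset]) blast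

lemma rad_mult_least:
  "\<lbrakk>submodule H R M; \<And>a x. \<lbrakk>a \<in> jacobson R; x \<in> U\<rbrakk> \<Longrightarrow> a \<odot>\<^bsub>M\<^esub> x \<in> H\<rbrakk> \<Longrightarrow> rad_mult R M U \<subseteq> H"
  unfolding rad_mult_def by (rule span_least) auto

lemma submodule_rad_mult:
  assumes "left_module R M" "U \<subseteq> carrier M"
  shows "submodule (rad_mult R M U) R M"
proof -
  interpret M: left_module R M by fact
  show ?thesis unfolding rad_mult_def
    using assms(2) by (intro submodule_span[OF assms(1)]) (auto simp: M.smult_closed jacobson_carrier)
qed

lemma submodule_rad_mult_funpow:
  assumes "left_module R M"
  shows "submodule ((rad_mult R M ^^ k) (carrier M)) R M"
proof (induction k)
  case (Suc k)
  then show ?case using submodule_rad_mult[OF assms submodule_subset] by simp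
qed (simp add: submodule_carrier[OF assms])

lemma rad_mult_subset:
  assumes "left_module R M" "submodule U R M"
  shows "rad_mult R M U \<subseteq> U"
  by (rule rad_mult_least[OF assms(2)]) (simp add: submodule_smult[OF assms(2)] jacobson_carrier)

lemma rad_mult_hom:
  assumes M: "left_module R M" and N: "left_module R N" and f: "f \<in> lmod_hom R M N"
    and U: "U \<subseteq> carrier M" and U': "U' \<subseteq> carrier N" "f ` U \<subseteq> U'"
  shows "f ` rad_mult R M U \<subseteq> rad_mult R N U'"
proof -
  have s: "submodule {x \<in> carrier M. f x \<in> rad_mult R N U'} R M"
    by (rule submodule_vimage[OF f M N submodule_rad_mult[OF N U'(1)]])
  have "rad_mult R M U \<subseteq> {x \<in> carrier M. f x \<in> rad_mult R N U'}"
  proof (rule rad_mult_least[OF s])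
    fix a x assume a: "a \<in> jacobson R" and "x \<in> U"
    then have "x \<in> carrier M" "f x \<in> U'" using U U'(2) by auto
    then show "a \<odot>\<^bsub>M\<^esub> x \<in> {x \<in> carrier M. f x \<in> rad_mult R N U'}"
      using a rad_mult_gen[of a R "f x" U' N] lmod_hom_smult[OF f, of a x] left_module.smult_closed[OF M, of a x]
      by (auto simp: jacobson_carrier)
  qed
  then show ?thesis by blast
qed

text \<open>
  By the descending chain condition the powers of the radical become stationary at some \<open>U\<close> with
  \<open>J U = U\<close>. If \<open>U\<close> is not zero, it has a maximal submodule by the ascending chain condition, and this
  contains \<open>J U\<close>.
\<close>

lemma jacobson_nilpotent:
  assumes R: "ring R" and fl: "finite_length R (regular_module R)"
  shows "\<exists>k. (rad_mult R (regular_module R) ^^ k) (carrier R) = {\<zero>\<^bsub>R\<^esub>}"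
proof -
  let ?L = "regular_module R"
  have L: "left_module R ?L" by (rule left_module_regular[OF R])
  let ?P = "\<lambda>k. (rad_mult R ?L ^^ k) (carrier ?L)"
  have "\<exists>H\<in>range ?P. \<forall>K\<in>range ?P. K \<subseteq> H \<longrightarrow> K = H"
  proof (rule finite_length_minimal[OF fl])
    fix H assume "H \<in> range ?P"
    then show "submodule H R ?L" by (elim rangeE) (simp only: submodule_rad_mult_funpow[OF L])
  qed simp
  then obtain H where "H \<in> range ?P" and H: "\<forall>K\<in>range ?P. K \<subseteq> H \<longrightarrow> K = H" by blast
  then obtain k where k: "H = ?P k" by blast
  have sH: "submodule H R ?L" unfolding k by (rule submodule_rad_mult_funpow[OF L])
  have "rad_mult R ?L H = ?P (Suc k)" by (simp add: k)
  then have "rad_mult R ?L H \<in> range ?P" by (metis rangeI)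
  then have JH: "rad_mult R ?L H = H" using H rad_mult_subset[OF L sH] by blast
  let ?H = "?L\<lparr>carrier := H\<rparr>"
  have lH: "left_module R ?H" by (rule left_module_submodule[OF L sH])
  have "H = {\<zero>\<^bsub>R\<^esub>}"
  proof (rule ccontr)
    assume "H \<noteq> {\<zero>\<^bsub>R\<^esub>}"
    then obtain V where V: "maximal_submodule R ?H V"
      using maximal_submodule_exists[OF finite_length_submodule[OF fl L sH] lH] by auto
    then have sV: "submodule V R ?L" "V \<subseteq> H" "V \<noteq> H"
      using submodule_trans[OF L sH] by (auto simp: maximal_submodule_def)
    have "rad_mult R ?L H \<subseteq> V"
      by (rule rad_mult_least[OF sV(1)]) (use jacobson_smult_maximal[OF lH V] in simp)
    then show False using JH sV by blast
  qed
  then show ?thesis using k by auto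
qed

text \<open>
  \<open>J^k M\<close> is contained in \<open>J^k \<cdot> M\<close>, where the power is taken first in the ring. This transfers the
  nilpotency of the radical to all modules.
\<close>

lemma rad_mult_funpow_bound:
  assumes M: "left_module R M"
  shows "(rad_mult R M ^^ k) (carrier M) \<subseteq>
    lmod_span R M {a \<odot>\<^bsub>M\<^esub> x | a x. a \<in> (rad_mult R (regular_module R) ^^ k) (carrier R) \<and> x \<in> carrier M}"
proof (induction k)
  interpret M: left_module R M by fact
  case 0
  have "carrier M \<subseteq> {a \<odot>\<^bsub>M\<^esub> x | a x. a \<in> carrier R \<and> x \<in> carrier M}"
  proof
    fix x assume x: "x \<in> carrier M"
    have "x = \<one>\<^bsub>R\<^esub> \<odot>\<^bsub>M\<^esub> x" by (simp only: M.smult_one[OF x])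
    then show "x \<in> {a \<odot>\<^bsub>M\<^esub> x | a x. a \<in> carrier R \<and> x \<in> carrier M}"
      using x M.R.one_closed by blast
  qed
  from subset_trans[OF this span_superset] show ?case by (simp only: funpow.simps(1) id_apply)
next
  case (Suc k)
  interpret M: left_module R M by fact
  let ?L = "regular_module R"
  have L: "left_module R ?L" by (rule left_module_regular) (rule M.R.ring_axioms)
  let ?P = "\<lambda>k. (rad_mult R ?L ^^ k) (carrier R)"
  let ?G = "\<lambda>k. {a \<odot>\<^bsub>M\<^esub> x | a x. a \<in> ?P k \<and> x \<in> carrier M}"
  have sP: "submodule (?P k) R ?L" for k using submodule_rad_mult_funpow[OF L, of k] by simp
  have PR: "?P k \<subseteq> carrier R" for k using submodule_subset[OF sP, of k] by simp
  have GM: "?G k \<subseteq> carrier M" for k using PR[of k] by (auto simp: M.smult_closed)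
  have sG: "submodule (lmod_span R M (?G k)) R M" for k by (rule submodule_span[OF M GM])
  \<comment> \<open>this is a submodule since the radical is a right ideal\<close>
  define Y where "Y = {y \<in> carrier M. \<forall>j\<in>jacobson R. j \<odot>\<^bsub>M\<^esub> y \<in> lmod_span R M (?G (Suc k))}"
  have "submodule Y R M"
  proof (rule M.submoduleI)
    fix a y assume "a \<in> carrier R" "y \<in> Y"
    then show "a \<odot>\<^bsub>M\<^esub> y \<in> Y"
      using jacobson_mult_right[OF M.R.ring_axioms] by (auto simp: Y_def M.smult_closed M.smult_assoc[symmetric] jacobson_carrier)
  qed (auto simp: Y_def M.smult_zero_right M.smult_r_distr jacobson_carrier submodule_zero[OF sG] submodule_add[OF sG] simp del: funpow.simps)
  moreover have "?G k \<subseteq> Y"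
  proof
    fix y assume "y \<in> ?G k"
    then obtain a x where y: "y = a \<odot>\<^bsub>M\<^esub> x" "a \<in> ?P k" "x \<in> carrier M" by blast
    have aR: "a \<in> carrier R" using y(2) PR by blast
    have "j \<odot>\<^bsub>M\<^esub> y \<in> lmod_span R M (?G (Suc k))" if j: "j \<in> jacobson R" for j
    proof -
      have "j \<otimes>\<^bsub>R\<^esub> a \<in> ?P (Suc k)" using rad_mult_gen[OF j y(2), of ?L] by simp
      moreover have "j \<odot>\<^bsub>M\<^esub> y = (j \<otimes>\<^bsub>R\<^esub> a) \<odot>\<^bsub>M\<^esub> x"
        using y aR jacobson_carrier[OF j] by (simp add: M.smult_assoc)
      ultimately show ?thesis using y(3) by (intro subsetD[OF span_superset]) blast
    qed
    then show "y \<in> Y" using y aR by (auto simp: Y_def M.smult_closed)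
  qed
  ultimately have "lmod_span R M (?G k) \<subseteq> Y" by (rule span_least)
  then have "(rad_mult R M ^^ k) (carrier M) \<subseteq> Y" using Suc by blast
  then have "rad_mult R M ((rad_mult R M ^^ k) (carrier M)) \<subseteq> lmod_span R M (?G (Suc k))"
    by (intro rad_mult_least[OF sG]) (auto simp: Y_def simp del: funpow.simps)
  then show ?case by simp
qed

lemma rad_mult_nilpotent:
  assumes M: "left_module R M" and k: "(rad_mult R (regular_module R) ^^ k) (carrier R) = {\<zero>\<^bsub>R\<^esub>}"
  shows "(rad_mult R M ^^ k) (carrier M) = {\<zero>\<^bsub>M\<^esub>}"
proof -
  interpret M: left_module R M by fact
  have "lmod_span R M {a \<odot>\<^bsub>M\<^esub> x | a x. a \<in> {\<zero>\<^bsub>R\<^esub>} \<and> x \<in> carrier M} \<subseteq> {\<zero>\<^bsub>M\<^esub>}"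
    by (rule span_least[OF submodule_zero_set[OF M]]) (auto simp: M.smult_zero_left)
  then show ?thesis
    using rad_mult_funpow_bound[OF M, of k] submodule_zero[OF submodule_rad_mult_funpow[OF M, of k]] k by auto
qed

text \<open>
  Nakayama's lemma for arbitrary modules. Substituting the decomposition of \<open>M\<close> into itself gives
  \<open>M = H + J^i M\<close> for all \<open>i\<close>, and \<open>J^k M = 0\<close>.
\<close>

lemma rad_superfluous:
  assumes M: "left_module R M" and k: "(rad_mult R (regular_module R) ^^ k) (carrier R) = {\<zero>\<^bsub>R\<^esub>}"
    and H: "submodule H R M" and e: "H <+>\<^bsub>M\<^esub> rad_mult R M (carrier M) = carrier M"
  shows "H = carrier M"
proof -
  interpret M: left_module R M by fact
  let ?J = "\<lambda>i. (rad_mult R M ^^ i) (carrier M)"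
  note sJ = submodule_rad_mult_funpow[OF M]
  have "carrier M \<subseteq> H <+>\<^bsub>M\<^esub> ?J i" for i
  proof (induction i)
    case 0
    then show ?case using set_add_superset(2)[OF M H submodule_carrier[OF M]] by simp
  next
    case (Suc i)
    have s: "submodule (H <+>\<^bsub>M\<^esub> ?J (Suc i)) R M" by (rule submodule_set_add[OF M H sJ])
    have "rad_mult R M (carrier M) \<subseteq> H <+>\<^bsub>M\<^esub> ?J (Suc i)"
    proof (rule rad_mult_least[OF s])
      fix a x assume a: "a \<in> jacobson R" and "x \<in> carrier M"
      then obtain h y where hy: "h \<in> H" "y \<in> ?J i" "x = h \<oplus>\<^bsub>M\<^esub> y" using set_add_subsetD[OF Suc] by blast
      have "a \<odot>\<^bsub>M\<^esub> x = a \<odot>\<^bsub>M\<^esub> h \<oplus>\<^bsub>M\<^esub> a \<odot>\<^bsub>M\<^esub> y"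
        using hy a submodule_mem[OF H] submodule_mem[OF sJ] by (simp add: M.smult_r_distr jacobson_carrier)
      moreover have "a \<odot>\<^bsub>M\<^esub> h \<in> H" using submodule_smult[OF H jacobson_carrier[OF a] hy(1)] .
      moreover have "a \<odot>\<^bsub>M\<^esub> y \<in> ?J (Suc i)" using rad_mult_gen[OF a hy(2)] by simp
      ultimately show "a \<odot>\<^bsub>M\<^esub> x \<in> H <+>\<^bsub>M\<^esub> ?J (Suc i)" unfolding set_add_iff by blast
    qed
    then have "H <+>\<^bsub>M\<^esub> rad_mult R M (carrier M) \<subseteq> H <+>\<^bsub>M\<^esub> ?J (Suc i)"
      by (intro set_add_least[OF s] set_add_superset(1)[OF M H sJ])
    then show ?case using e by simp
  qed
  from this[of k] have "carrier M \<subseteq> H"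
    using rad_mult_nilpotent[OF M k] submodule_mem[OF H] by (auto simp: set_add_iff)
  then show ?thesis using submodule_subset[OF H] by blast
qed

text \<open>
  These are the preimages of the minimal left ideals of \<open>R\<close> modulo its radical.
\<close>

definition minimal_above_jacobson :: "('r, 'x) ring_scheme \<Rightarrow> 'r set \<Rightarrow> bool"
  where "minimal_above_jacobson R S \<longleftrightarrow> submodule S R (regular_module R) \<and> jacobson R \<subset> S \<and>
    (\<forall>K. submodule K R (regular_module R) \<longrightarrow> jacobson R \<subseteq> K \<longrightarrow> K \<subseteq> S \<longrightarrow> K = jacobson R \<or> K = S)"

text \<open>
  \<open>R\<close> modulo its radical is the sum of its minimal left ideals. Let \<open>H\<close> be minimal among the left ideals
  above the radical with \<open>H + T = R\<close>. If \<open>H\<close> is larger than the radical, it contains some \<open>S\<close> that is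
  minimal above the radical, and some maximal left ideal \<open>V\<close> does not contain \<open>S\<close>. Then \<open>S + V = R\<close> and
  \<open>S \<subseteq> T\<close> imply \<open>(H \<inter> V) + T = R\<close>, which contradicts the choice of \<open>H\<close>.
\<close>

lemma socle_above_jacobson:
  assumes R: "ring R" and fl: "finite_length R (regular_module R)"
    and T: "submodule T R (regular_module R)" "jacobson R \<subseteq> T"
    and S: "\<And>S. minimal_above_jacobson R S \<Longrightarrow> S \<subseteq> T"
  shows "T = carrier R"
proof -
  let ?L = "regular_module R"
  have L: "left_module R ?L" by (rule left_module_regular[OF R])
  interpret L: left_module R ?L by (rule L)
  note sJ = submodule_jacobson[OF R]
  let ?Hs = "{H. submodule H R ?L \<and> jacobson R \<subseteq> H \<and> H <+>\<^bsub>?L\<^esub> T = carrier ?L}"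
  have "carrier ?L \<in> ?Hs"
    using submodule_carrier[OF L] submodule_subset[OF sJ]
      set_add_least[OF submodule_carrier[OF L] subset_refl submodule_subset[OF T(1)]]
      set_add_superset(1)[OF L submodule_carrier[OF L] T(1)] by auto
  then have "\<exists>H\<in>?Hs. \<forall>K\<in>?Hs. K \<subseteq> H \<longrightarrow> K = H"
    by (intro finite_length_minimal[OF fl]) auto
  then obtain H where H0: "H \<in> ?Hs" and H1: "\<forall>K\<in>?Hs. K \<subseteq> H \<longrightarrow> K = H" by (elim bexE)
  have H: "submodule H R ?L" "jacobson R \<subseteq> H" "H <+>\<^bsub>?L\<^esub> T = carrier ?L" using H0 by auto
  have Hmin: "K = H" if "submodule K R ?L" "jacobson R \<subseteq> K" "K <+>\<^bsub>?L\<^esub> T = carrier ?L" "K \<subseteq> H" for K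
    using H1 that by simp
  have "H = jacobson R"
  proof (rule ccontr)
    assume ne: "H \<noteq> jacobson R"
    let ?Ks = "{K. submodule K R ?L \<and> jacobson R \<subset> K \<and> K \<subseteq> H}"
    have "H \<in> ?Ks" using H ne by blast
    then have "\<exists>S\<in>?Ks. \<forall>K\<in>?Ks. K \<subseteq> S \<longrightarrow> K = S"
      by (intro finite_length_minimal[OF fl]) auto
    then obtain S where S0: "S \<in> ?Ks" and S': "\<forall>K\<in>?Ks. K \<subseteq> S \<longrightarrow> K = S" by (elim bexE)
    have S1: "submodule S R ?L" "jacobson R \<subset> S" "S \<subseteq> H" using S0 by auto
    have S2: "K = S" if "submodule K R ?L" "jacobson R \<subset> K" "K \<subseteq> S" for K
      using S' that S1(3) by simp
    have "minimal_above_jacobson R S" unfolding minimal_above_jacobson_def using S1 S2 by blast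
    then have ST: "S \<subseteq> T" by (rule S)
    have "\<exists>V. maximal_submodule R ?L V \<and> \<not> S \<subseteq> V"
    proof (rule ccontr)
      assume "\<not> ?thesis"
      then have "S \<subseteq> jacobson R" using submodule_subset[OF S1(1)] unfolding jacobson_def by auto
      then show False using S1(2) by blast
    qed
    then obtain V where V: "maximal_submodule R ?L V" "\<not> S \<subseteq> V" by blast
    have sV: "submodule V R ?L" using V(1) by (simp add: maximal_submodule_def)
    have JV: "jacobson R \<subseteq> V" using V(1) unfolding jacobson_def by blast
    have SV: "S <+>\<^bsub>?L\<^esub> V = carrier ?L"
      using V submodule_set_add[OF L S1(1) sV] set_add_superset[OF L S1(1) sV]
      unfolding maximal_submodule_def by blast
    have sHV: "submodule (H \<inter> V) R ?L" by (rule submodule_Int[OF L H(1) sV])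
    have sHVT: "submodule ((H \<inter> V) <+>\<^bsub>?L\<^esub> T) R ?L" by (rule submodule_set_add[OF L sHV T(1)])
    have "H \<subseteq> (H \<inter> V) <+>\<^bsub>?L\<^esub> T"
    proof
      fix h assume h: "h \<in> H"
      have hL: "h \<in> carrier ?L" using submodule_mem[OF H(1) h] .
      then obtain s v where sv: "s \<in> S" "v \<in> V" "h = s \<oplus>\<^bsub>?L\<^esub> v" using set_add_eqD[OF SV] by blast
      have c: "s \<in> carrier ?L" "v \<in> carrier ?L" using submodule_mem[OF S1(1) sv(1)] submodule_mem[OF sV sv(2)] by auto
      have "v = h \<ominus>\<^bsub>?L\<^esub> s" using L.M.add_diff_cancel_left[OF c] sv(3) by simp
      then have "v \<in> H" using submodule_diff[OF H(1) h] sv(1) S1(3) by blast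
      moreover have "h = v \<oplus>\<^bsub>?L\<^esub> s" using sv(3) c L.M.a_comm by simp
      ultimately show "h \<in> (H \<inter> V) <+>\<^bsub>?L\<^esub> T" using sv ST unfolding set_add_iff by blast
    qed
    then have "H <+>\<^bsub>?L\<^esub> T \<subseteq> (H \<inter> V) <+>\<^bsub>?L\<^esub> T"
      by (rule set_add_least[OF sHVT _ set_add_superset(2)[OF L sHV T(1)]])
    then have "(H \<inter> V) <+>\<^bsub>?L\<^esub> T = carrier ?L" using H(3) submodule_subset[OF sHVT] by blast
    then have "H \<inter> V = H" using Hmin[OF sHV] H(2) JV by blast
    then show False using S1(3) V(2) by blast
  qed
  then have "carrier ?L \<subseteq> T" using H(3) set_add_least[OF T(1) T(2) subset_refl] by simp
  then show ?thesis using submodule_subset[OF T(1)] by simp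
qed

lemma submodule_chain_Union:
  assumes M: "left_module R M" and C: "C \<noteq> {}" "\<And>W. W \<in> C \<Longrightarrow> submodule W R M"
    and ch: "\<And>W W'. \<lbrakk>W \<in> C; W' \<in> C\<rbrakk> \<Longrightarrow> W \<subseteq> W' \<or> W' \<subseteq> W"
  shows "submodule (\<Union>C) R M"
proof -
  interpret M: left_module R M by fact
  show ?thesis
  proof (rule M.submoduleI)
    show "\<Union>C \<subseteq> carrier M" using C(2) submodule_subset by blast
    show "\<zero>\<^bsub>M\<^esub> \<in> \<Union>C" using C submodule_zero by blast
    fix x y assume "x \<in> \<Union>C" "y \<in> \<Union>C"
    then obtain W W' where W: "W \<in> C" "W' \<in> C" "x \<in> W" "y \<in> W'" by blast
    then show "x \<oplus>\<^bsub>M\<^esub> y \<in> \<Union>C"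
      using ch[OF W(1,2)] submodule_add[OF C(2)[OF W(1)], of x y] submodule_add[OF C(2)[OF W(2)], of x y] by blast
  next
    fix a x assume "a \<in> carrier R" "x \<in> \<Union>C"
    then obtain W where "a \<in> carrier R" "W \<in> C" "x \<in> W" by blast
    then show "a \<odot>\<^bsub>M\<^esub> x \<in> \<Union>C" using submodule_smult[OF C(2)] by blast
  qed
qed

text \<open>
  A module that is killed by the radical is semisimple. Let \<open>W\<close> be maximal among the submodules that
  meet \<open>N\<close> only in \<open>J F\<close>. For \<open>x\<close> in \<open>F\<close> the left ideal of all \<open>a\<close> with \<open>a x \<in> W + N\<close> contains each minimal
  left ideal \<open>S\<close> above \<open>J\<close>, since otherwise \<open>W + S x\<close> would be larger than \<open>W\<close>. So it is \<open>R\<close>.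
\<close>

lemma complement_above_radical:
  assumes R: "ring R" and fl: "finite_length R (regular_module R)" and F: "left_module R F"
    and N: "submodule N R F" "rad_mult R F (carrier F) \<subseteq> N"
  shows "\<exists>W. submodule W R F \<and> rad_mult R F (carrier F) \<subseteq> W \<and> W \<inter> N = rad_mult R F (carrier F) \<and>
    W <+>\<^bsub>F\<^esub> N = carrier F"
proof -
  interpret F: left_module R F by fact
  let ?L = "regular_module R"
  have L: "left_module R ?L" by (rule left_module_regular[OF R])
  let ?J = "rad_mult R F (carrier F)"
  have sJ: "submodule ?J R F" by (rule submodule_rad_mult[OF F]) simp
  let ?Ws = "{W. submodule W R F \<and> ?J \<subseteq> W \<and> W \<inter> N = ?J}"
  have "?J \<in> ?Ws" using sJ N by blast
  then have ne: "?Ws \<noteq> {}" by blast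
  have "\<exists>W\<in>?Ws. \<forall>X\<in>?Ws. W \<subseteq> X \<longrightarrow> X = W"
  proof (rule subset_Zorn_nonempty[OF ne])
    fix C assume C: "C \<noteq> {}" "subset.chain ?Ws C"
    then have CW: "C \<subseteq> ?Ws" and ch: "\<And>W W'. \<lbrakk>W \<in> C; W' \<in> C\<rbrakk> \<Longrightarrow> W \<subseteq> W' \<or> W' \<subseteq> W"
      unfolding subset_chain_def by blast+
    have "submodule (\<Union>C) R F" using CW ch by (intro submodule_chain_Union[OF F C(1)]) auto
    then show "\<Union>C \<in> ?Ws" using CW C(1) by blast
  qed
  then obtain W where W0: "W \<in> ?Ws" and W1: "\<forall>X\<in>?Ws. W \<subseteq> X \<longrightarrow> X = W" by (elim bexE)
  have W: "submodule W R F" "?J \<subseteq> W" "W \<inter> N = ?J" using W0 by auto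
  have Wmax: "X = W" if "submodule X R F" "?J \<subseteq> X" "X \<inter> N = ?J" "W \<subseteq> X" for X
    using W1 that by simp
  let ?WN = "W <+>\<^bsub>F\<^esub> N"
  have sWN: "submodule ?WN R F" by (rule submodule_set_add[OF F W(1) N(1)])
  have WWN: "W \<subseteq> ?WN" "N \<subseteq> ?WN" using set_add_superset[OF F W(1) N(1)] by auto
  have "x \<in> ?WN" if x: "x \<in> carrier F" for x
  proof -
    define T where "T = {a \<in> carrier R. a \<odot>\<^bsub>F\<^esub> x \<in> ?WN}"
    have sT: "submodule T R ?L" unfolding T_def using submodule_vimage[OF smult_hom[OF F x] L F sWN] by simp
    have JW: "a \<odot>\<^bsub>F\<^esub> x \<in> W" if "a \<in> jacobson R" for a
      using rad_mult_gen[OF that x, of F] W(2) by (rule subsetD[rotated])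
    then have JT: "jacobson R \<subseteq> T"
      using WWN(1) jacobson_carrier[of _ R] by (auto simp: T_def)
    have "T = carrier R"
    proof (rule socle_above_jacobson[OF R fl sT JT])
      fix S assume S: "minimal_above_jacobson R S"
      then have sS: "submodule S R ?L" by (simp add: minimal_above_jacobson_def)
      have SR: "S \<subseteq> carrier R" using submodule_subset[OF sS] by simp
      have "submodule (S \<inter> T) R ?L" by (rule submodule_Int[OF L sS sT])
      moreover have "jacobson R \<subseteq> S \<inter> T" using S JT by (auto simp: minimal_above_jacobson_def)
      ultimately have "S \<inter> T = jacobson R \<or> S \<inter> T = S" using S by (auto simp: minimal_above_jacobson_def)
      then show "S \<subseteq> T"
      proof
        assume ST: "S \<inter> T = jacobson R"
        let ?Sx = "(\<lambda>a. a \<odot>\<^bsub>F\<^esub> x) ` S"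
        have sSx: "submodule ?Sx R F" by (rule submodule_image[OF smult_hom[OF F x] L F sS])
        let ?X = "W <+>\<^bsub>F\<^esub> ?Sx"
        have sX: "submodule ?X R F" by (rule submodule_set_add[OF F W(1) sSx])
        have WX: "W \<subseteq> ?X" "?Sx \<subseteq> ?X" using set_add_superset[OF F W(1) sSx] by auto
        have "?X \<inter> N \<subseteq> ?J"
        proof
          fix n assume n: "n \<in> ?X \<inter> N"
          then obtain w s where ws: "w \<in> W" "s \<in> S" "n = w \<oplus>\<^bsub>F\<^esub> s \<odot>\<^bsub>F\<^esub> x" by (auto simp: set_add_iff)
          have c: "w \<in> carrier F" "s \<odot>\<^bsub>F\<^esub> x \<in> carrier F"
            using submodule_mem[OF W(1) ws(1)] submodule_mem[OF sSx, of "s \<odot>\<^bsub>F\<^esub> x"] ws(2) by auto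
          have "s \<odot>\<^bsub>F\<^esub> x = n \<ominus>\<^bsub>F\<^esub> w" using ws(3) c F.M.add_diff_cancel_left by simp
          moreover have "n \<in> ?WN" "w \<in> ?WN" using n ws(1) WWN by auto
          ultimately have "s \<odot>\<^bsub>F\<^esub> x \<in> ?WN" using submodule_diff[OF sWN] by simp
          then have "s \<in> S \<inter> T" using ws(2) SR by (auto simp: T_def)
          then have "s \<in> jacobson R" unfolding ST .
          then have "s \<odot>\<^bsub>F\<^esub> x \<in> W" by (rule JW)
          then have "n \<in> W" using submodule_add[OF W(1) ws(1)] ws(3) by simp
          then show "n \<in> ?J" using n W(3) by blast
        qed
        then have "?X = W" using Wmax[OF sX] W(2) WX N(2) by blast
        then have "a \<odot>\<^bsub>F\<^esub> x \<in> ?WN" if "a \<in> S" for a using WX(2) WWN(1) that by blast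
        then show "S \<subseteq> T" using SR by (auto simp: T_def)
      qed blast
    qed
    then have "\<one>\<^bsub>R\<^esub> \<in> T" by simp
    then show ?thesis using x by (simp add: T_def F.smult_one)
  qed
  then have "?WN = carrier F" using submodule_subset[OF sWN] by blast
  then show ?thesis using W by blast
qed


section \<open>Existence of projective covers\<close>

lemma lmod_hom_funpow: "f \<in> lmod_hom R M M \<Longrightarrow> (f ^^ n) \<in> lmod_hom R M M"
proof (induction n)
  case 0
  then show ?case using lmod_hom_id[of R M] by (simp add: id_def)
next
  case (Suc n)
  then show ?case using lmod_hom_compose[OF Suc.IH[OF Suc.prems] Suc.prems] by (simp add: comp_def)
qed

lemma funpow_commute_on:
  assumes "\<forall>x\<in>A. f x \<in> A" "\<forall>x\<in>A. g x \<in> A" "\<forall>x\<in>A. f (g x) = g (f x)" "x \<in> A"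
  shows "(f ^^ n) x \<in> A" "(f ^^ n) (g x) = g ((f ^^ n) x)"
proof -
  have *: "(f ^^ n) x \<in> A" for n using assms(1,4) by (induction n) auto
  then show "(f ^^ n) x \<in> A" .
  show "(f ^^ n) (g x) = g ((f ^^ n) x)"
    using assms(3) * by (induction n) auto
qed

text \<open>
  If \<open>f + g\<close> is the identity, then \<open>f\<close> and \<open>g\<close> commute and the polynomials \<open>f^a\<close> and \<open>(1 - f)^b\<close> are
  coprime. So if a power of \<open>f g\<close> vanishes, the module is the direct sum of the kernels of the
  corresponding powers of \<open>g\<close> and \<open>f\<close>.
\<close>

lemma complementary_hom_commute:
  assumes M: "left_module R M" and f: "f \<in> lmod_hom R M M" and g: "g \<in> lmod_hom R M M"
    and fg: "\<forall>x\<in>carrier M. f x \<oplus>\<^bsub>M\<^esub> g x = x" and x: "x \<in> carrier M"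
  shows "f (g x) = g (f x)"
proof -
  interpret M: left_module R M by fact
  note c = lmod_hom_closed[OF f] lmod_hom_closed[OF g]
  have "f (f x) \<oplus>\<^bsub>M\<^esub> f (g x) = f (f x) \<oplus>\<^bsub>M\<^esub> g (f x)"
    using lmod_hom_add[OF f c(1)[OF x] c(2)[OF x]] bspec[OF fg x] bspec[OF fg c(1)[OF x]] by simp
  then show ?thesis using c x by simp
qed

lemma complementary_hom_coprime:
  assumes M: "left_module R M" and f: "f \<in> lmod_hom R M M" and g: "g \<in> lmod_hom R M M"
    and fg: "\<forall>x\<in>carrier M. f x \<oplus>\<^bsub>M\<^esub> g x = x"
  shows "x \<in> carrier M \<Longrightarrow> \<exists>u\<in>carrier M. \<exists>v\<in>carrier M. x = (f ^^ a) u \<oplus>\<^bsub>M\<^esub> (g ^^ b) v"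
    and "\<lbrakk>x \<in> carrier M; (f ^^ a) x = \<zero>\<^bsub>M\<^esub>; (g ^^ b) x = \<zero>\<^bsub>M\<^esub>\<rbrakk> \<Longrightarrow> x = \<zero>\<^bsub>M\<^esub>"
proof -
  interpret M: left_module R M by fact
  note c = lmod_hom_closed[OF f] lmod_hom_closed[OF g]
  note cn = lmod_hom_closed[OF lmod_hom_funpow[OF f]] lmod_hom_closed[OF lmod_hom_funpow[OF g]]
  have cl: "\<forall>x\<in>carrier M. f x \<in> carrier M" "\<forall>x\<in>carrier M. g x \<in> carrier M" using c by auto
  have comm: "\<forall>x\<in>carrier M. f (g x) = g (f x)" "\<forall>x\<in>carrier M. g (f x) = f (g x)"
    using complementary_hom_commute[OF M f g fg] by auto
  note gnf = funpow_commute_on(2)[OF cl(2,1) comm(2)]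
  have one: "\<exists>u\<in>carrier M. \<exists>v\<in>carrier M. x = (f ^^ a) u \<oplus>\<^bsub>M\<^esub> g v" if x: "x \<in> carrier M" for x
  proof (induction a)
    case 0
    show ?case using x lmod_hom_zero[OF g M M] by (intro bexI[of _ x] bexI[of _ "\<zero>\<^bsub>M\<^esub>"]) auto
  next
    case (Suc a)
    then obtain u v where uv: "u \<in> carrier M" "v \<in> carrier M" "x = (f ^^ a) u \<oplus>\<^bsub>M\<^esub> g v" by blast
    have "(f ^^ a) u = f ((f ^^ a) u) \<oplus>\<^bsub>M\<^esub> g ((f ^^ a) u)" using bspec[OF fg cn(1)[OF uv(1)]] by simp
    then have "x = (f ((f ^^ a) u) \<oplus>\<^bsub>M\<^esub> g ((f ^^ a) u)) \<oplus>\<^bsub>M\<^esub> g v" using uv(3) by simp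
    also have "\<dots> = (f ^^ Suc a) u \<oplus>\<^bsub>M\<^esub> g ((f ^^ a) u \<oplus>\<^bsub>M\<^esub> v)"
      using uv c cn lmod_hom_add[OF g cn(1)[OF uv(1)] uv(2)] by (simp add: M.M.a_assoc)
    finally show ?case using uv cn M.M.a_closed by blast
  qed
  show "\<exists>u\<in>carrier M. \<exists>v\<in>carrier M. x = (f ^^ a) u \<oplus>\<^bsub>M\<^esub> (g ^^ b) v" if x: "x \<in> carrier M"
  proof (induction b)
    case 0
    show ?case using x lmod_hom_zero[OF lmod_hom_funpow[OF f] M M]
      by (intro bexI[of _ x] bexI[of _ "\<zero>\<^bsub>M\<^esub>"]) auto
  next
    case (Suc b)
    then obtain u v where uv: "u \<in> carrier M" "v \<in> carrier M" "x = (f ^^ a) u \<oplus>\<^bsub>M\<^esub> (g ^^ b) v" by blast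
    obtain u' v' where uv': "u' \<in> carrier M" "v' \<in> carrier M" "v = (f ^^ a) u' \<oplus>\<^bsub>M\<^esub> g v'" using one[OF uv(2)] by blast
    have "(g ^^ b) v = (g ^^ b) ((f ^^ a) u') \<oplus>\<^bsub>M\<^esub> (g ^^ b) (g v')"
      using lmod_hom_add[OF lmod_hom_funpow[OF g] cn(1)[OF uv'(1)] c(2)[OF uv'(2)]] uv'(3) by simp
    also have "(g ^^ b) ((f ^^ a) u') = (f ^^ a) ((g ^^ b) u')"
      using funpow_commute_on(2)[of "carrier M" f "g ^^ b", OF cl(1) _ _ uv'(1)] cn(2) gnf by simp
    also have "(g ^^ b) (g v') = (g ^^ Suc b) v'" by (simp add: funpow_swap1)
    finally have "x = ((f ^^ a) u \<oplus>\<^bsub>M\<^esub> (f ^^ a) ((g ^^ b) u')) \<oplus>\<^bsub>M\<^esub> (g ^^ Suc b) v'"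
      using uv uv' cn c by (simp add: M.M.a_assoc)
    also have "(f ^^ a) u \<oplus>\<^bsub>M\<^esub> (f ^^ a) ((g ^^ b) u') = (f ^^ a) (u \<oplus>\<^bsub>M\<^esub> (g ^^ b) u')"
      using lmod_hom_add[OF lmod_hom_funpow[OF f] uv(1) cn(2)[OF uv'(1)]] by simp
    finally show ?case using uv uv' cn M.M.a_closed by blast
  qed
  show "\<lbrakk>x \<in> carrier M; (f ^^ a) x = \<zero>\<^bsub>M\<^esub>; (g ^^ b) x = \<zero>\<^bsub>M\<^esub>\<rbrakk> \<Longrightarrow> x = \<zero>\<^bsub>M\<^esub>"
  proof (induction a arbitrary: x)
    case (Suc a)
    have "(g ^^ b) (f x) = f ((g ^^ b) x)" using gnf[OF Suc.prems(1)] .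
    then have "f x = \<zero>\<^bsub>M\<^esub>"
      using Suc.IH[of "f x"] Suc.prems c lmod_hom_zero[OF f M M] by (simp add: funpow_swap1)
    then have "g x = x" using bspec[OF fg Suc.prems(1)] c(2)[OF Suc.prems(1)] by simp
    then have "(g ^^ b) x = x" by (induction b) auto
    then show ?case using Suc.prems by simp
  qed simp
qed

text \<open>
  Let \<open>N\<close> be the preimage of \<open>J M\<close> and let \<open>W\<close> be a complement of \<open>N\<close> modulo \<open>J F\<close>. As \<open>F\<close> is projective, the
  identity of \<open>F\<close> is a sum \<open>f + g\<close> with values in \<open>W\<close> and in \<open>N\<close>. Since \<open>g\<close> maps \<open>W\<close> into \<open>W \<inter> N = J F\<close>, the
  product \<open>f g\<close> is nilpotent, so \<open>F\<close> is the direct sum of the kernel \<open>C\<close> of \<open>g^k\<close> and the kernel \<open>D\<close> of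
  \<open>f^k\<close>. Modulo \<open>J F\<close> these are \<open>W\<close> and \<open>N\<close>. So \<open>C\<close> maps onto \<open>M\<close> modulo \<open>J M\<close>, hence onto \<open>M\<close>, and the
  kernel of this map is contained in \<open>J C\<close>, hence superfluous.
\<close>

lemma projective_cover_in_projective:
  assumes R: "ring R" and fl: "finite_length R (regular_module R)" and M: "left_module R M"
    and pF: "projective R F" and q: "q \<in> lmod_hom R F M" "q ` carrier F = carrier M"
  shows "\<exists>C. submodule C R F \<and> projective_cover R (F\<lparr>carrier := C\<rparr>) q M"
proof -
  have F: "left_module R F" by (rule projective_left_module[OF pF])
  interpret M: left_module R M by (rule M)
  interpret F: left_module R F by (rule F)
  obtain k where k: "(rad_mult R (regular_module R) ^^ k) (carrier R) = {\<zero>\<^bsub>R\<^esub>}"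
    using jacobson_nilpotent[OF R fl] by blast
  let ?J = "\<lambda>i. (rad_mult R F ^^ i) (carrier F)"
  let ?J1 = "rad_mult R F (carrier F)" and ?JM = "rad_mult R M (carrier M)"
  have sJM: "submodule ?JM R M" by (rule submodule_rad_mult[OF M]) simp
  have sJ: "submodule (?J i) R F" for i by (rule submodule_rad_mult_funpow[OF F])
  have sJ1: "submodule ?J1 R F" using sJ[of 1] by simp
  define N where "N = {x \<in> carrier F. q x \<in> ?JM}"
  have sN: "submodule N R F" unfolding N_def by (rule submodule_vimage[OF q(1) F M sJM])
  have "q ` ?J1 \<subseteq> ?JM" by (rule rad_mult_hom[OF F M q(1)]) (use lmod_hom_closed[OF q(1)] in auto)
  then have JN: "?J1 \<subseteq> N" using submodule_subset[OF sJ1] unfolding N_def by blast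
  obtain W where W: "submodule W R F" "?J1 \<subseteq> W" "W \<inter> N = ?J1" "W <+>\<^bsub>F\<^esub> N = carrier F"
    using complement_above_radical[OF R fl F sN JN] by blast
  note WF = submodule_mem[OF W(1)] and NF = submodule_mem[OF sN]
  \<comment> \<open>a section of the sum map \<open>W \<oplus> N \<rightarrow> F\<close>; its components are \<open>f\<close> and \<open>g\<close>\<close>
  let ?W = "F\<lparr>carrier := W\<rparr>" and ?N = "F\<lparr>carrier := N\<rparr>"
  have lW: "left_module R ?W" by (rule left_module_submodule[OF F W(1)])
  have lN: "left_module R ?N" by (rule left_module_submodule[OF F sN])
  have lWN: "left_module R (dsum2 ?W ?N)" by (rule left_module_dsum2[OF lW lN])
  let ?add = "\<lambda>(x, y). x \<oplus>\<^bsub>F\<^esub> y"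
  have add: "?add \<in> lmod_hom R (dsum2 ?W ?N) F"
    by (rule lmod_hom_copair[OF lmod_hom_incl[OF submodule_subset[OF W(1)]] lmod_hom_incl[OF submodule_subset[OF sN]] F])
  have "?add ` carrier (dsum2 ?W ?N) = carrier F"
  proof (intro equalityI subsetI)
    fix x assume "x \<in> carrier F"
    then obtain w n where "w \<in> W" "n \<in> N" "x = w \<oplus>\<^bsub>F\<^esub> n" using set_add_eqD[OF W(4)] by blast
    then show "x \<in> ?add ` carrier (dsum2 ?W ?N)" by (intro image_eqI[of _ _ "(w, n)"]) auto
  qed (use lmod_hom_closed[OF add] in blast)
  then obtain t where t: "t \<in> lmod_hom R F (dsum2 ?W ?N)" "\<forall>x\<in>carrier F. ?add (t x) = x"
    using projective_split[OF pF lWN add] by blast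
  define f where "f = (\<lambda>x. fst (t x))"
  define g where "g = (\<lambda>x. snd (t x))"
  have tx: "f x \<in> W" "g x \<in> N" "f x \<oplus>\<^bsub>F\<^esub> g x = x" if "x \<in> carrier F" for x
    using lmod_hom_closed[OF t(1) that] bspec[OF t(2) that] unfolding f_def g_def by (auto simp: case_prod_unfold)
  have fF: "f \<in> lmod_hom R F F"
    unfolding f_def by (rule lmod_hom_compose[OF lmod_hom_compose[OF t(1) lmod_hom_fst] lmod_hom_incl[OF submodule_subset[OF W(1)]]])
  have gF: "g \<in> lmod_hom R F F"
    unfolding g_def by (rule lmod_hom_compose[OF lmod_hom_compose[OF t(1) lmod_hom_snd] lmod_hom_incl[OF submodule_subset[OF sN]]])
  note c = lmod_hom_closed[OF fF] lmod_hom_closed[OF gF]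
  have fg: "\<forall>x\<in>carrier F. f x \<oplus>\<^bsub>F\<^esub> g x = x" using tx(3) by blast
  have cl: "\<forall>x\<in>carrier F. f x \<in> carrier F" "\<forall>x\<in>carrier F. g x \<in> carrier F" using c by auto
  have comm: "\<forall>x\<in>carrier F. f (g x) = g (f x)"
    using complementary_hom_commute[OF F fF gF fg] by blast
  have g_eq: "g x = x \<ominus>\<^bsub>F\<^esub> f x" if "x \<in> carrier F" for x
    using F.M.add_diff_cancel_left[OF c(1)[OF that] c(2)[OF that]] tx(3)[OF that] by simp
  have gW: "g x \<in> ?J1" if "x \<in> W" for x
    using g_eq[OF WF[OF that]] submodule_diff[OF W(1) that tx(1)[OF WF[OF that]]] tx(2)[OF WF[OF that]] W(3) by auto
  define h where "h = (\<lambda>x. g (f x))"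
  have h: "h \<in> lmod_hom R F F" unfolding h_def by (rule lmod_hom_compose[OF fF gF])
  have hJ: "h ` ?J i \<subseteq> ?J (Suc i)" for i
  proof (induction i)
    case 0
    then show ?case using gW tx(1) by (auto simp: h_def)
  next
    case (Suc i)
    have "h ` rad_mult R F (?J i) \<subseteq> rad_mult R F (?J (Suc i))"
      by (rule rad_mult_hom[OF F F h submodule_subset[OF sJ] submodule_subset[OF sJ] Suc])
    then show ?case by simp
  qed
  have hk: "(h ^^ i) x \<in> ?J i" if "x \<in> carrier F" for i x
  proof (induction i)
    case (Suc i)
    then show ?case using hJ[of i] by auto
  qed (simp add: that)
  have hfg: "(h ^^ i) x = (f ^^ i) ((g ^^ i) x)" if "x \<in> carrier F" for i x
  proof (induction i)
    case (Suc i)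
    note cn = lmod_hom_closed[OF lmod_hom_funpow[OF gF]]  lmod_hom_closed[OF lmod_hom_funpow[OF fF]]
    have "(h ^^ Suc i) x = g (f ((f ^^ i) ((g ^^ i) x)))" using Suc by (simp add: h_def)
    also have "\<dots> = f (g ((f ^^ i) ((g ^^ i) x)))" using bspec[OF comm cn(2)[OF cn(1)[OF that]]] by simp
    also have "g ((f ^^ i) ((g ^^ i) x)) = (f ^^ i) (g ((g ^^ i) x))"
      using funpow_commute_on(2)[OF cl comm cn(1)[OF that]] by simp
    finally show ?case by simp
  qed simp
  have fgk: "(f ^^ k) ((g ^^ k) x) = \<zero>\<^bsub>F\<^esub>" if "x \<in> carrier F" for x
    using hk[OF that, of k] hfg[OF that, of k] rad_mult_nilpotent[OF F k] by auto
  have gfk: "(g ^^ k) ((f ^^ k) x) = \<zero>\<^bsub>F\<^esub>" if "x \<in> carrier F" for x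
  proof -
    have "(g ^^ k) ((f ^^ k) x) = (f ^^ k) ((g ^^ k) x)"
      using funpow_commute_on(2)[of "carrier F" g "f ^^ k", OF cl(2) _ _ that]
        funpow_commute_on(2)[OF cl comm] lmod_hom_closed[OF lmod_hom_funpow[OF fF]] by simp
    then show ?thesis using fgk[OF that] by simp
  qed
  define C where "C = a_kernel F F (g ^^ k)"
  define D where "D = a_kernel F F (f ^^ k)"
  have sC: "submodule C R F" unfolding C_def by (rule submodule_kernel[OF lmod_hom_funpow[OF gF] F F])
  have sD: "submodule D R F" unfolding D_def by (rule submodule_kernel[OF lmod_hom_funpow[OF fF] F F])
  note cn = lmod_hom_closed[OF lmod_hom_funpow[OF fF]] lmod_hom_closed[OF lmod_hom_funpow[OF gF]]
  have dec: "\<exists>c\<in>C. \<exists>d\<in>D. x = c \<oplus>\<^bsub>F\<^esub> d" if xF: "x \<in> carrier F" for x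
  proof -
    obtain u v where uv: "u \<in> carrier F" "v \<in> carrier F" "x = (f ^^ k) u \<oplus>\<^bsub>F\<^esub> (g ^^ k) v"
      using complementary_hom_coprime(1)[OF F fF gF fg xF] by blast
    have "(f ^^ k) u \<in> C" "(g ^^ k) v \<in> D"
      using gfk[OF uv(1)] fgk[OF uv(2)] cn uv by (auto simp: C_def D_def a_kernel_iff)
    then show ?thesis using uv(3) by blast
  qed
  let ?C = "F\<lparr>carrier := C\<rparr>"
  have lC: "left_module R ?C" by (rule left_module_submodule[OF F sC])
  have "C \<inter> D = {\<zero>\<^bsub>F\<^esub>}"
    proof (intro equalityI subsetI)
      fix x assume "x \<in> C \<inter> D"
      then have "x \<in> carrier F" "(f ^^ k) x = \<zero>\<^bsub>F\<^esub>" "(g ^^ k) x = \<zero>\<^bsub>F\<^esub>"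
        by (auto simp: C_def D_def a_kernel_iff)
      then have "x = \<zero>\<^bsub>F\<^esub>" by (rule complementary_hom_coprime(2)[OF F fF gF fg])
      then show "x \<in> {\<zero>\<^bsub>F\<^esub>}" by simp
    qed (use submodule_zero[OF sC] submodule_zero[OF sD] in blast)
  moreover have "C <+>\<^bsub>F\<^esub> D = carrier F"
    proof (intro equalityI subsetI)
      fix x assume "x \<in> carrier F"
      then show "x \<in> C <+>\<^bsub>F\<^esub> D" unfolding set_add_iff by (rule dec)
    qed (use set_add_least[OF submodule_carrier[OF F] submodule_subset[OF sC] submodule_subset[OF sD]] in blast)
  ultimately obtain e where e: "e \<in> lmod_hom R F ?C" "\<forall>x\<in>C. e x = x"
    using internal_projection[OF F sC sD] by blast
  have pC: "projective R ?C"
    using projective_retract[OF pF lC lmod_hom_incl[OF submodule_subset[OF sC]] e(1)] e(2) by simp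
  have CW: "C \<subseteq> W"
  proof
    fix x assume x: "x \<in> C"
    have xF: "x \<in> carrier F" using submodule_mem[OF sC x] .
    \<comment> \<open>a telescoping sum of values of \<open>f\<close>; for \<open>i = k\<close> the power vanishes at \<open>x\<close>\<close>
    have "x \<ominus>\<^bsub>F\<^esub> (g ^^ i) x \<in> W" for i
    proof (induction i)
      case 0
      then show ?case using xF submodule_zero[OF W(1)] by (simp add: F.M.diff_self)
    next
      case (Suc i)
      let ?y = "(g ^^ i) x"
      have y: "?y \<in> carrier F" using cn(2)[OF xF] .
      have "x \<ominus>\<^bsub>F\<^esub> (g ^^ Suc i) x = (x \<ominus>\<^bsub>F\<^esub> ?y) \<oplus>\<^bsub>F\<^esub> (?y \<ominus>\<^bsub>F\<^esub> g ?y)"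
        using F.M.add_diff_add[OF xF y y c(2)[OF y]] F.M.a_comm[OF xF y] F.M.add_diff_add[OF y xF y c(2)[OF y]]
          F.M.diff_self[OF y] F.M.l_zero[OF F.M.minus_closed[OF xF c(2)[OF y]]] by simp
      moreover have "?y \<ominus>\<^bsub>F\<^esub> g ?y = f ?y"
        using F.M.add_diff_cancel_right[OF c(1)[OF y] c(2)[OF y]] tx(3)[OF y] by simp
      ultimately show ?case using submodule_add[OF W(1) Suc tx(1)[OF y]] by simp
    qed
    from this[of k] show "x \<in> W" using x F.M.diff_zero[OF xF] by (simp add: C_def a_kernel_iff)
  qed
  have DJ: "d \<in> ?J1" if d: "d \<in> D" "d \<in> W" for d
  proof -
    have dF: "d \<in> carrier F" using WF[OF d(2)] .
    have fW: "(f ^^ i) d \<in> W" for i using d(2) tx(1) WF by (induction i) auto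
    \<comment> \<open>a telescoping sum of values of \<open>g\<close> on \<open>W\<close>\<close>
    have "d \<ominus>\<^bsub>F\<^esub> (f ^^ i) d \<in> ?J1" for i
    proof (induction i)
      case 0
      then show ?case using submodule_zero[OF sJ1] by (simp add: F.M.diff_self dF)
    next
      case (Suc i)
      let ?y = "(f ^^ i) d"
      have y: "?y \<in> carrier F" using cn(1)[OF dF] .
      have "d \<ominus>\<^bsub>F\<^esub> (f ^^ Suc i) d = (d \<ominus>\<^bsub>F\<^esub> ?y) \<oplus>\<^bsub>F\<^esub> (?y \<ominus>\<^bsub>F\<^esub> f ?y)"
        using F.M.add_diff_add[OF dF y y c(1)[OF y]] F.M.a_comm[OF dF y] F.M.add_diff_add[OF y dF y c(1)[OF y]]
          F.M.diff_self[OF y] F.M.l_zero[OF F.M.minus_closed[OF dF c(1)[OF y]]] by simp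
      moreover have "?y \<ominus>\<^bsub>F\<^esub> f ?y \<in> ?J1" using gW[OF fW, of i] g_eq[OF y] by simp
      ultimately show ?case using submodule_add[OF sJ1 Suc] by simp
    qed
    from this[of k] show ?thesis using d(1) F.M.diff_zero[OF dF] by (simp add: D_def a_kernel_iff)
  qed
  have CN: "\<exists>c\<in>C. \<exists>n\<in>N. x = c \<oplus>\<^bsub>F\<^esub> n" if xF: "x \<in> carrier F" for x
  proof -
    obtain w n where wn: "w \<in> W" "n \<in> N" "x = w \<oplus>\<^bsub>F\<^esub> n" using set_add_eqD[OF W(4) xF] by blast
    obtain c d where cd: "c \<in> C" "d \<in> D" "w = c \<oplus>\<^bsub>F\<^esub> d" using dec[OF WF[OF wn(1)]] by blast
    have cF: "c \<in> carrier F" "d \<in> carrier F" using submodule_mem[OF sC cd(1)] submodule_mem[OF sD cd(2)] by auto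
    have "d = w \<ominus>\<^bsub>F\<^esub> c" using F.M.add_diff_cancel_left[OF cF] cd(3) by simp
    then have "d \<in> W" using submodule_diff[OF W(1) wn(1)] cd(1) CW by blast
    then have "d \<in> N" using DJ[OF cd(2)] JN by blast
    then have "d \<oplus>\<^bsub>F\<^esub> n \<in> N" using submodule_add[OF sN] wn(2) by blast
    moreover have "x = c \<oplus>\<^bsub>F\<^esub> (d \<oplus>\<^bsub>F\<^esub> n)" using wn cd(3) cF NF[OF wn(2)] F.M.a_assoc by simp
    ultimately show ?thesis using cd(1) by blast
  qed
  have qC: "q \<in> lmod_hom R ?C M" by (rule lmod_hom_restrict_dom[OF q(1) submodule_subset[OF sC]])
  have sqC: "submodule (q ` C) R M" by (rule submodule_image[OF q(1) F M sC])
  have "q ` C <+>\<^bsub>M\<^esub> ?JM = carrier M"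
  proof (intro equalityI subsetI)
    fix m assume "m \<in> carrier M"
    then obtain x where x: "x \<in> carrier F" "m = q x" using q(2) by (metis imageE)
    obtain c n where cn': "c \<in> C" "n \<in> N" "x = c \<oplus>\<^bsub>F\<^esub> n" using CN[OF x(1)] by blast
    have "m = q c \<oplus>\<^bsub>M\<^esub> q n" using lmod_hom_add[OF q(1) submodule_mem[OF sC cn'(1)] NF[OF cn'(2)]] x cn'(3) by simp
    moreover have "q n \<in> ?JM" using cn'(2) by (simp add: N_def)
    ultimately show "m \<in> q ` C <+>\<^bsub>M\<^esub> ?JM" using cn'(1) unfolding set_add_iff by blast
  qed (use set_add_least[OF submodule_carrier[OF M] submodule_subset[OF sqC] submodule_subset[OF sJM]] in blast)
  then have surj: "q ` carrier ?C = carrier M" using rad_superfluous[OF M k sqC] by simp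
  have kerJ: "a_kernel ?C M q \<subseteq> rad_mult R ?C (carrier ?C)"
  proof
    fix x assume "x \<in> a_kernel ?C M q"
    then have x: "x \<in> C" "q x = \<zero>\<^bsub>M\<^esub>" by (auto simp: a_kernel_iff)
    have "x \<in> N" using x submodule_mem[OF sC x(1)] submodule_zero[OF sJM] by (simp add: N_def)
    then have "x \<in> ?J1" using CW x(1) W(3) by blast
    moreover have "e ` ?J1 \<subseteq> rad_mult R ?C (carrier ?C)"
      by (rule rad_mult_hom[OF F lC e(1)]) (use lmod_hom_closed[OF e(1)] in auto)
    ultimately show "x \<in> rad_mult R ?C (carrier ?C)" using e(2) x(1) by (metis image_subset_iff)
  qed
  have "H = carrier ?C" if H: "submodule H R ?C" "H <+>\<^bsub>?C\<^esub> a_kernel ?C M q = carrier ?C" for H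
  proof (rule rad_superfluous[OF lC k H(1)])
    have sr: "submodule (rad_mult R ?C (carrier ?C)) R ?C" by (rule submodule_rad_mult[OF lC]) simp
    note s' = submodule_set_add[OF lC H(1) sr] set_add_superset[OF lC H(1) sr]
    show "H <+>\<^bsub>?C\<^esub> rad_mult R ?C (carrier ?C) = carrier ?C"
      using set_add_least[OF s'(1,2), of "a_kernel ?C M q"] kerJ s'(3) H(2) submodule_subset[OF s'(1)] by blast
  qed
  then have "projective_cover R ?C q M"
    unfolding projective_cover_def using pC qC surj by blast
  then show ?thesis using sC by blast
qed

lemma bij_inverse_hom:
  assumes "left_module R M" "h \<in> lmod_hom R M N" "bij_betw h (carrier M) (carrier N)"
  shows "\<exists>g\<in>lmod_hom R N M. (\<forall>x\<in>carrier M. g (h x) = x) \<and> (\<forall>y\<in>carrier N. h (g y) = y)"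
proof -
  have "\<forall>x\<in>carrier M. inv_into (carrier M) h (h x) = x" "\<forall>y\<in>carrier N. h (inv_into (carrier M) h y) = y"
    using assms(3) by (auto simp: bij_betw_def f_inv_into_f)
  then show ?thesis using lmod_hom_inverse[OF assms(2,3,1)] by blast
qed

lemma projective_cover_copy:
  assumes P: "projective_cover R P p M" and M: "left_module R M" and Q: "left_module R Q"
    and t: "t \<in> lmod_hom R P Q" and u: "u \<in> lmod_hom R Q P"
    and ut: "\<forall>x\<in>carrier P. u (t x) = x" and tu: "\<forall>x\<in>carrier Q. t (u x) = x"
  shows "projective_cover R Q (\<lambda>x. p (u x)) M"
proof -
  note c = projective_coverD[OF P]
  note lP = projective_left_module[OF c(1)]
  have uQ: "u ` carrier Q = carrier P"
    using ut lmod_hom_closed[OF t] lmod_hom_closed[OF u] by (auto simp: image_iff) metis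
  have "H = carrier Q"
    if H: "submodule H R Q" "H <+>\<^bsub>Q\<^esub> a_kernel Q M (\<lambda>x. p (u x)) = carrier Q" for H
  proof -
    have s: "submodule (u ` H) R P" by (rule submodule_image[OF u Q lP H(1)])
    have "u ` H <+>\<^bsub>P\<^esub> a_kernel P M p = carrier P"
    proof (intro equalityI subsetI)
      fix x assume x: "x \<in> carrier P"
      obtain h k where hk: "h \<in> H" "k \<in> a_kernel Q M (\<lambda>x. p (u x))" "t x = h \<oplus>\<^bsub>Q\<^esub> k"
        using set_add_eqD[OF H(2) lmod_hom_closed[OF t x]] by blast
      have c': "h \<in> carrier Q" "k \<in> carrier Q" "p (u k) = \<zero>\<^bsub>M\<^esub>"
        using submodule_mem[OF H(1) hk(1)] hk(2) by (auto simp: a_kernel_iff)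
      have "x = u h \<oplus>\<^bsub>P\<^esub> u k" using lmod_hom_add[OF u c'(1,2)] hk(3) bspec[OF ut x] by simp
      moreover have "u k \<in> a_kernel P M p" using c' lmod_hom_closed[OF u] by (simp add: a_kernel_iff)
      ultimately show "x \<in> u ` H <+>\<^bsub>P\<^esub> a_kernel P M p" using hk(1) unfolding set_add_iff by blast
    qed (use set_add_least[OF submodule_carrier[OF lP] submodule_subset[OF s] a_kernel_subset] in blast)
    then have "u ` H = carrier P" using c(4)[OF s] by simp
    show ?thesis
    proof (intro equalityI subsetI)
      fix x assume x: "x \<in> carrier Q"
      then have "u x \<in> u ` H" using \<open>u ` H = carrier P\<close> lmod_hom_closed[OF u] by simp
      then obtain h where "h \<in> H" "u x = u h" by blast
      then have "x = h" using tu x submodule_mem[OF H(1)] by metis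
      then show "x \<in> H" using \<open>h \<in> H\<close> by simp
    qed (use submodule_mem[OF H(1)] in blast)
  qed
  moreover have "projective R Q"
    by (rule projective_iso[OF c(1) Q lmod_isoI_inverse[OF t u]]) (auto simp: ut tu)
  moreover have "(\<lambda>x. p (u x)) ` carrier Q = carrier M"
    using c(3) uQ by (metis image_image)
  ultimately show ?thesis
    unfolding projective_cover_def using lmod_hom_compose[OF u c(2)] by blast
qed

text \<open>
  An element of a free module is determined by the list of its nonzero coefficients, each of them
  paired with its basis element.
\<close>

lemma free_module_embedding:
  fixes X :: "'u set" and enc :: "('r \<times> 'u) list \<Rightarrow> 'u"
  assumes "inj enc"
  shows "\<exists>h :: ('u \<Rightarrow> 'r) \<Rightarrow> 'u. inj_on h (carrier (free_module R X))"
proof -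
  define gr where "gr f = (\<lambda>x. (f x, x)) ` {x\<in>X. f x \<noteq> \<zero>\<^bsub>R\<^esub>}" for f
  define h where "h f = enc (SOME xs. set xs = gr f)" for f
  have *: "set (SOME xs. set xs = gr f) = gr f" if "f \<in> carrier (free_module R X)" for f
  proof (rule someI_ex)
    have "finite (gr f)" using that by (auto simp: gr_def free_module_carrier_iff)
    then show "\<exists>xs. set xs = gr f" by (rule finite_list)
  qed
  have aux: "f x = g x" if "gr f = gr g" "x \<in> X" "f x \<noteq> \<zero>\<^bsub>R\<^esub>" for f g x
  proof -
    have "(f x, x) \<in> gr f" using that(2,3) by (auto simp: gr_def)
    then have "(f x, x) \<in> gr g" using that(1) by simp
    then show ?thesis by (auto simp: gr_def)
  qed
  have "f = g" if f: "f \<in> carrier (free_module R X)" and g: "g \<in> carrier (free_module R X)" and e: "h f = h g" for f g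
  proof -
    have "(SOME xs. set xs = gr f) = (SOME xs. set xs = gr g)"
      using e injD[OF assms] unfolding h_def by blast
    then have gr: "gr f = gr g" using *[OF f] *[OF g] by metis
    show ?thesis
    proof (rule extensionalityI[of _ X])
      show "f \<in> extensional X" "g \<in> extensional X" using f g by (auto simp: free_module_carrier_iff PiE_def)
      fix x assume x: "x \<in> X"
      show "f x = g x" using aux[OF gr x] aux[OF gr[symmetric] x] by metis
    qed
  qed
  then show ?thesis by (auto simp: inj_on_def)
qed

lemma projective_cover_exists:
  fixes M :: "('r, 'u) module" and enc :: "('r \<times> 'u) list \<Rightarrow> 'u"
  assumes R: "ring R" and fl: "finite_length R (regular_module R)" and M: "left_module R M" and enc: "inj enc"
  shows "\<exists>(C :: ('r, 'u) module) p. projective_cover R C p M"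
proof -
  let ?F = "free_module R (carrier M)"
  obtain C where C: "submodule C R ?F"
    "projective_cover R (?F\<lparr>carrier := C\<rparr>) (free_lift R (carrier M) M (\<lambda>x. x)) M"
    using projective_cover_in_projective[OF R fl M projective_free_module[OF R] free_cover[OF M]] by blast
  let ?C = "?F\<lparr>carrier := C\<rparr>"
  have lC: "left_module R ?C" by (rule projective_left_module[OF projective_coverD(1)[OF C(2)]])
  obtain h :: "('u \<Rightarrow> 'r) \<Rightarrow> 'u" where "inj_on h (carrier ?F)"
    using free_module_embedding[OF enc] by blast
  then have "inj_on h (carrier ?C)" using submodule_subset[OF C(1)] by (simp add: inj_on_subset)
  then obtain D :: "('r, 'u) module" where D: "left_module R D" "h \<in> lmod_hom R ?C D" "bij_betw h (carrier ?C) (carrier D)"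
    using copy_module[OF lC] by blast
  obtain g where "g \<in> lmod_hom R D ?C" "\<forall>x\<in>carrier ?C. g (h x) = x" "\<forall>y\<in>carrier D. h (g y) = y"
    using bij_inverse_hom[OF lC D(2,3)] by blast
  then show ?thesis using projective_cover_copy[OF C(2) M D(1,2)] by blast
qed


section \<open>Finitely generated modules\<close>

text \<open>
  By induction on the generators: adding \<open>g\<close> to the generators of \<open>N\<close>, the length of a submodule \<open>H\<close> of
  \<open>N + R g\<close> is that of \<open>H \<inter> N\<close> plus the length of the left ideal of all \<open>a\<close> with \<open>a g \<in> H + N\<close>. This left
  ideal contains the annihilator of the module, so \<open>\<nu>\<close> need only measure the left ideals above some \<open>I\<close>
  that annihilates the module. In this form the lemma covers rings that do not have finite length
  themselves, such as discrete valuation rings.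
\<close>

lemma finite_length_span:
  fixes \<nu> :: "'r set \<Rightarrow> nat"
  assumes M: "left_module R M" and B: "finite B" "B \<subseteq> carrier M"
    and I: "\<And>a x. \<lbrakk>a \<in> I; x \<in> carrier M\<rbrakk> \<Longrightarrow> a \<odot>\<^bsub>M\<^esub> x = \<zero>\<^bsub>M\<^esub>" "I \<subseteq> carrier R"
    and \<nu>: "\<And>H K. \<lbrakk>submodule H R (regular_module R); submodule K R (regular_module R); I \<subseteq> H; H \<subset> K\<rbrakk> \<Longrightarrow> \<nu> H < \<nu> K"
  shows "finite_length R (M\<lparr>carrier := lmod_span R M B\<rparr>)"
  using B
proof (induction B rule: finite_induct)
  case empty
  interpret M: left_module R M by fact
  have s: "submodule (lmod_span R M {}) R M" by (rule submodule_span[OF M]) simp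
  have "lmod_span R M {} = {\<zero>\<^bsub>M\<^esub>}"
    using span_least[OF submodule_zero_set[OF M], of "{}"] submodule_zero[OF s] by auto
  then have "H = {\<zero>\<^bsub>M\<^esub>}" if "submodule H R (M\<lparr>carrier := lmod_span R M {}\<rparr>)" for H
    using submodule_subset[OF that] submodule_zero[OF that] by auto
  then show ?case unfolding finite_length_def by blast
next
  case (insert g B)
  interpret M: left_module R M by fact
  have L: "left_module R (regular_module R)" by (rule left_module_regular) (rule M.R.ring_axioms)
  have g: "g \<in> carrier M" and B: "B \<subseteq> carrier M" using insert by auto
  let ?N = "lmod_span R M B" and ?N' = "lmod_span R M (insert g B)"
  have sN: "submodule ?N R M" by (rule submodule_span[OF M B])
  have sN': "submodule ?N' R M" by (rule submodule_span[OF M insert.prems])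
  let ?G = "(\<lambda>a. a \<odot>\<^bsub>M\<^esub> g) ` carrier R"
  have sG: "submodule ?G R M" using submodule_image[OF smult_hom[OF M g] L M submodule_carrier[OF L]] by simp
  have "g \<in> ?G" using M.smult_one[OF g] by (metis M.R.one_closed imageI)
  then have "insert g B \<subseteq> ?N <+>\<^bsub>M\<^esub> ?G"
    using set_add_superset[OF M sN sG] span_superset[of B R M] by blast
  then have N'sub: "?N' \<subseteq> ?N <+>\<^bsub>M\<^esub> ?G" by (rule span_least[OF submodule_set_add[OF M sN sG]])
  obtain \<mu> :: "_ set \<Rightarrow> nat" where \<mu>: "\<forall>H K. submodule H R (M\<lparr>carrier := ?N\<rparr>) \<longrightarrow>
      submodule K R (M\<lparr>carrier := ?N\<rparr>) \<longrightarrow> H \<subset> K \<longrightarrow> \<mu> H < \<mu> K"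
    using insert.IH[OF B] unfolding finite_length_def by (elim exE)
  define col where "col H = {a \<in> carrier R. a \<odot>\<^bsub>M\<^esub> g \<in> H <+>\<^bsub>M\<^esub> ?N}" for H
  have scol: "submodule (col H) R (regular_module R)" if "submodule H R M" for H
    unfolding col_def using submodule_vimage[OF smult_hom[OF M g] L M submodule_set_add[OF M that sN]] by simp
  have Icol: "I \<subseteq> col H" if "submodule H R M" for H
    using I(2) I(1)[OF _ g] submodule_zero[OF submodule_set_add[OF M that sN]] by (auto simp: col_def)
  have "\<mu> (H \<inter> ?N) + \<nu> (col H) < \<mu> (K \<inter> ?N) + \<nu> (col K)"
    if H: "submodule H R M" "H \<subseteq> ?N'" and K: "submodule K R M" "K \<subseteq> ?N'" and HK: "H \<subset> K" for H K
  proof -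
    have sHN: "submodule (H \<inter> ?N) R (M\<lparr>carrier := ?N\<rparr>)" and sKN: "submodule (K \<inter> ?N) R (M\<lparr>carrier := ?N\<rparr>)"
      using submodule_Int[OF M H(1) sN] submodule_Int[OF M K(1) sN] by (auto simp: submodule_trans[OF M sN])
    have sub: "H \<inter> ?N \<subseteq> K \<inter> ?N" using HK by blast
    have KN: "K \<subseteq> K <+>\<^bsub>M\<^esub> ?N" "?N \<subseteq> K <+>\<^bsub>M\<^esub> ?N" by (rule set_add_superset[OF M K(1) sN])+
    have sKpN: "submodule (K <+>\<^bsub>M\<^esub> ?N) R M" by (rule submodule_set_add[OF M K(1) sN])
    have "H <+>\<^bsub>M\<^esub> ?N \<subseteq> K <+>\<^bsub>M\<^esub> ?N"
      by (rule set_add_least[OF sKpN]) (use HK KN in auto)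
    then have colsub: "col H \<subseteq> col K" by (auto simp: col_def)
    have "H \<inter> ?N \<noteq> K \<inter> ?N \<or> col H \<noteq> col K"
    proof (rule ccontr)
      assume "\<not> ?thesis"
      then have e: "H \<inter> ?N = K \<inter> ?N" "col H = col K" by auto
      have "K \<subseteq> H"
      proof
        fix x assume x: "x \<in> K"
        obtain n k where nk: "n \<in> ?N" "k \<in> ?G" "x = n \<oplus>\<^bsub>M\<^esub> k"
          using set_add_subsetD[OF N'sub, of x] x K(2) by blast
        obtain a where a: "a \<in> carrier R" "k = a \<odot>\<^bsub>M\<^esub> g" using nk(2) by blast
        have c: "n \<in> carrier M" "k \<in> carrier M" using submodule_mem[OF sN nk(1)] submodule_mem[OF sG nk(2)] by auto
        have "k = x \<ominus>\<^bsub>M\<^esub> n" using M.M.add_diff_cancel_left[OF c] nk(3) by simp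
        moreover have "x \<in> K <+>\<^bsub>M\<^esub> ?N" "n \<in> K <+>\<^bsub>M\<^esub> ?N" using KN x nk(1) by auto
        ultimately have "k \<in> K <+>\<^bsub>M\<^esub> ?N" using submodule_diff[OF sKpN] by simp
        then have "a \<in> col K" using a by (simp add: col_def)
        then have "a \<in> col H" unfolding e(2) .
        then have "k \<in> H <+>\<^bsub>M\<^esub> ?N" using a by (simp add: col_def)
        then obtain h n' where hn: "h \<in> H" "n' \<in> ?N" "k = h \<oplus>\<^bsub>M\<^esub> n'" unfolding set_add_iff by blast
        have c': "h \<in> carrier M" "n' \<in> carrier M" using submodule_mem[OF H(1) hn(1)] submodule_mem[OF sN hn(2)] by auto
        have x': "x = h \<oplus>\<^bsub>M\<^esub> (n \<oplus>\<^bsub>M\<^esub> n')" using nk(3) hn(3) c c' by (simp add: M.M.a_ac)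
        then have "n \<oplus>\<^bsub>M\<^esub> n' = x \<ominus>\<^bsub>M\<^esub> h" using M.M.add_diff_cancel_left[of h "n \<oplus>\<^bsub>M\<^esub> n'"] c c' by simp
        then have "n \<oplus>\<^bsub>M\<^esub> n' \<in> K" using submodule_diff[OF K(1) x] hn(1) HK by auto
        then have "n \<oplus>\<^bsub>M\<^esub> n' \<in> H" using e(1) submodule_add[OF sN nk(1) hn(2)] by blast
        then show "x \<in> H" using submodule_add[OF H(1) hn(1)] x' by simp
      qed
      then show False using HK by blast
    qed
    moreover have "\<mu> (H \<inter> ?N) < \<mu> (K \<inter> ?N) \<or> H \<inter> ?N = K \<inter> ?N"
      using \<mu> sHN sKN sub by blast
    moreover have "\<nu> (col H) < \<nu> (col K) \<or> col H = col K"
      using \<nu>[OF scol[OF H(1)] scol[OF K(1)] Icol[OF H(1)]] colsub by blast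
    ultimately show ?thesis by (elim disjE) simp_all
  qed
  then show ?case unfolding finite_length_def submodule_trans[OF M sN']
    by (intro exI[of _ "\<lambda>H. \<mu> (H \<inter> ?N) + \<nu> (col H)"]) blast
qed

lemma finite_length_finitely_generated:
  assumes fl: "finite_length R (regular_module R)" and M: "left_module R M" and fg: "finitely_generated R M"
  shows "finite_length R M"
proof -
  obtain \<nu> :: "_ set \<Rightarrow> nat" where \<nu>: "\<forall>H K. submodule H R (regular_module R) \<longrightarrow>
      submodule K R (regular_module R) \<longrightarrow> H \<subset> K \<longrightarrow> \<nu> H < \<nu> K"
    using fl unfolding finite_length_def by (elim exE)
  obtain B where B: "finite B" "B \<subseteq> carrier M" "lmod_span R M B = carrier M"
    using fg unfolding finitely_generated_def by blast
  have "finite_length R (M\<lparr>carrier := lmod_span R M B\<rparr>)"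
    by (rule finite_length_span[OF M B(1,2), of "{}" \<nu>]) (use \<nu> in auto)
  then show ?thesis using B(3) by simp
qed

lemma finitely_generated_finite_length:
  assumes fl: "finite_length R M" and M: "left_module R M"
  shows "finitely_generated R M"
proof -
  interpret M: left_module R M by fact
  let ?S = "lmod_span R M ` {B. finite B \<and> B \<subseteq> carrier M}"
  have "?S \<noteq> {}" by blast
  moreover have "submodule H R M" if "H \<in> ?S" for H using that submodule_span[OF M] by blast
  ultimately obtain H where "H \<in> ?S" and max: "\<forall>K\<in>?S. H \<subseteq> K \<longrightarrow> K = H"
    using finite_length_maximal[OF fl M, of ?S] by blast
  then obtain B where B: "finite B" "B \<subseteq> carrier M" "H = lmod_span R M B" by blast
  have "x \<in> H" if x: "x \<in> carrier M" for x
  proof -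
    have "lmod_span R M (insert x B) \<in> ?S" using B x by blast
    moreover have "H \<subseteq> lmod_span R M (insert x B)" unfolding B(3) by (rule span_mono) blast
    ultimately have "lmod_span R M (insert x B) = H" using max by blast
    then show ?thesis using span_superset[of "insert x B" R M] by blast
  qed
  then have "lmod_span R M B = carrier M" using submodule_subset[OF submodule_span[OF M B(2)]] B(3) by blast
  then show ?thesis using B unfolding finitely_generated_def by blast
qed

lemma span_hom_image:
  assumes M: "left_module R M" and N: "left_module R N" and f: "f \<in> lmod_hom R M N" and B: "B \<subseteq> carrier M"
  shows "f ` lmod_span R M B \<subseteq> lmod_span R N (f ` B)"
proof -
  have fB: "f ` B \<subseteq> carrier N" using B lmod_hom_closed[OF f] by blast
  have "submodule {x \<in> carrier M. f x \<in> lmod_span R N (f ` B)} R M"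
    by (rule submodule_vimage[OF f M N submodule_span[OF N fB]])
  moreover have "B \<subseteq> {x \<in> carrier M. f x \<in> lmod_span R N (f ` B)}"
    using B span_superset[of "f ` B" R N] by blast
  ultimately have "lmod_span R M B \<subseteq> {x \<in> carrier M. f x \<in> lmod_span R N (f ` B)}" by (rule span_least)
  then show ?thesis by blast
qed

lemma finitely_generated_image:
  assumes M: "left_module R M" and N: "left_module R N" and f: "f \<in> lmod_hom R M N" "f ` carrier M = carrier N"
    and fg: "finitely_generated R M"
  shows "finitely_generated R N"
proof -
  obtain B where B: "finite B" "B \<subseteq> carrier M" "lmod_span R M B = carrier M"
    using fg unfolding finitely_generated_def by blast
  have fB: "f ` B \<subseteq> carrier N" using B lmod_hom_closed[OF f(1)] by blast
  have "carrier N \<subseteq> lmod_span R N (f ` B)"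
    using span_hom_image[OF M N f(1) B(2)] B(3) f(2) by simp
  then have "lmod_span R N (f ` B) = carrier N" using submodule_subset[OF submodule_span[OF N fB]] by blast
  then show ?thesis using B(1) fB unfolding finitely_generated_def by blast
qed

text \<open>
  Lift the generators of \<open>M\<close>. Together with the kernel, their lifts span the cover, and the kernel is
  superfluous.
\<close>

lemma finitely_generated_cover:
  assumes M: "left_module R M" and C: "projective_cover R C p M" and fg: "finitely_generated R M"
  shows "finitely_generated R C"
proof -
  note c = projective_coverD[OF C]
  note lC = projective_left_module[OF c(1)]
  interpret C: left_module R C by (rule lC)
  interpret M: left_module R M by (rule M)
  obtain B where B: "finite B" "B \<subseteq> carrier M" "lmod_span R M B = carrier M"
    using fg unfolding finitely_generated_def by blast
  define A where "A = inv_into (carrier C) p ` B"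
  have A: "finite A" "A \<subseteq> carrier C" "p ` A = B"
    using B(1,2) c(3) by (auto simp: A_def inv_into_into f_inv_into_f image_image subset_eq intro!: image_eqI)
  have s: "submodule (lmod_span R C A) R C" by (rule submodule_span[OF lC A(2)])
  have pA: "carrier M \<subseteq> p ` lmod_span R C A"
  proof -
    have "B \<subseteq> p ` lmod_span R C A" using A(3) span_superset[of A R C] by blast
    then show ?thesis using span_least[OF submodule_image[OF c(2) lC M s]] B(3) by blast
  qed
  have "lmod_span R C A <+>\<^bsub>C\<^esub> a_kernel C M p = carrier C"
  proof (intro equalityI subsetI)
    fix x assume x: "x \<in> carrier C"
    then obtain y where y: "y \<in> lmod_span R C A" "p x = p y" using pA lmod_hom_closed[OF c(2) x] by blast
    have yC: "y \<in> carrier C" using submodule_mem[OF s y(1)] .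
    have "x \<ominus>\<^bsub>C\<^esub> y \<in> a_kernel C M p"
      using lmod_hom_diff[OF c(2) lC M x yC] y(2) M.M.diff_self[OF lmod_hom_closed[OF c(2) yC]] x yC by (simp add: a_kernel_iff)
    then show "x \<in> lmod_span R C A <+>\<^bsub>C\<^esub> a_kernel C M p"
      using C.M.add_diff_cancel[OF x yC] y(1) unfolding set_add_iff by metis
  qed (use set_add_least[OF submodule_carrier[OF lC] submodule_subset[OF s] a_kernel_subset] in blast)
  then have "lmod_span R C A = carrier C" by (rule c(4)[OF s])
  then show ?thesis using A unfolding finitely_generated_def by blast
qed

context perfect_ring
begin

lemma finitely_generated_Omega1:
  fixes M :: "('r, 'u) module"
  assumes fl: "finite_length R (regular_module R)" and M: "left_module R M" and fg: "finitely_generated R M"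
  shows "finitely_generated R (Omega1 R M)"
proof -
  obtain C :: "('r, 'u) module" and p where C: "projective_cover R C p M" "Omega1 R M = ker_module C M p"
    using Omega1_cover[OF M] by blast
  note c = projective_coverD[OF C(1)]
  note lC = projective_left_module[OF c(1)]
  have k: "submodule (a_kernel C M p) R C" by (rule submodule_kernel[OF c(2) lC M])
  have "finite_length R C"
    by (rule finite_length_finitely_generated[OF fl lC finitely_generated_cover[OF M C(1) fg]])
  then show ?thesis unfolding C(2)
    by (intro finitely_generated_finite_length finite_length_submodule left_module_submodule lC k)
qed

end


section \<open>Reduction modulo a central regular element\<close>

text \<open>
  The ring \<open>S\<close> is \<open>R\<close> modulo the central element \<open>z\<close>, which is not a zero divisor.
\<close>

locale central_reduction =
  fixes R :: "('r, 'x) ring_scheme" and S :: "('s, 'y) ring_scheme" and \<phi> :: "'r \<Rightarrow> 's" and z :: 'r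
  assumes ring_R: "ring R" and ring_S: "ring S"
    and hom: "\<phi> \<in> ring_hom R S" and surj: "\<phi> ` carrier R = carrier S"
    and z_closed: "z \<in> carrier R"
    and z_central: "\<forall>a\<in>carrier R. a \<otimes>\<^bsub>R\<^esub> z = z \<otimes>\<^bsub>R\<^esub> a"
    and z_regular: "\<forall>a\<in>carrier R. z \<otimes>\<^bsub>R\<^esub> a = \<zero>\<^bsub>R\<^esub> \<longrightarrow> a = \<zero>\<^bsub>R\<^esub>"
    and kernel: "\<forall>a\<in>carrier R. \<phi> a = \<zero>\<^bsub>S\<^esub> \<longleftrightarrow> (\<exists>b\<in>carrier R. a = z \<otimes>\<^bsub>R\<^esub> b)"
begin

definition torsion_free :: "('r, 'm) module \<Rightarrow> bool"
  where "torsion_free X \<longleftrightarrow> (\<forall>x\<in>carrier X. z \<odot>\<^bsub>X\<^esub> x = \<zero>\<^bsub>X\<^esub> \<longrightarrow> x = \<zero>\<^bsub>X\<^esub>)"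

text \<open>
  \<open>Y\<close> is \<open>X\<close> modulo \<open>z X\<close>, regarded as a module over \<open>S\<close>, and \<open>\<rho>\<close> is the projection.
\<close>

definition reduction :: "('r, 'm) module \<Rightarrow> ('m \<Rightarrow> 'n) \<Rightarrow> ('s, 'n) module \<Rightarrow> bool"
  where "reduction X \<rho> Y \<longleftrightarrow> left_module S Y \<and> \<rho> \<in> lmod_hom R X (restrict_scalars \<phi> Y) \<and>
    \<rho> ` carrier X = carrier Y \<and> (\<forall>x\<in>carrier X. \<rho> x = \<zero>\<^bsub>Y\<^esub> \<longleftrightarrow> (\<exists>y\<in>carrier X. x = z \<odot>\<^bsub>X\<^esub> y))"

lemma left_module_inflate: "left_module S Y \<Longrightarrow> left_module R (restrict_scalars \<phi> Y)"
  by (rule left_module_restrict_scalars[OF _ hom ring_R])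

lemma phi_z: "\<phi> z = \<zero>\<^bsub>S\<^esub>"
proof -
  interpret R: ring R by (rule ring_R)
  have "z = z \<otimes>\<^bsub>R\<^esub> \<one>\<^bsub>R\<^esub>" using z_closed by simp
  then show ?thesis using kernel z_closed R.one_closed by blast
qed

lemma z_inflate:
  assumes "left_module S Y" "y \<in> carrier Y"
  shows "\<phi> z \<odot>\<^bsub>Y\<^esub> y = \<zero>\<^bsub>Y\<^esub>"
  using left_module.smult_zero_left[OF assms] by (simp add: phi_z)

lemma z_hom:
  assumes "left_module R X"
  shows "(\<lambda>x. z \<odot>\<^bsub>X\<^esub> x) \<in> lmod_hom R X X"
proof -
  interpret X: left_module R X by fact
  show ?thesis
    using z_closed z_central by (intro lmod_homI) (auto simp: X.smult_closed X.smult_r_distr X.smult_assoc[symmetric])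
qed

lemma reductionD:
  assumes "reduction X \<rho> Y"
  shows "left_module S Y" "\<rho> \<in> lmod_hom R X (restrict_scalars \<phi> Y)" "\<rho> ` carrier X = carrier Y"
    "\<And>x. x \<in> carrier X \<Longrightarrow> \<rho> x = \<zero>\<^bsub>Y\<^esub> \<longleftrightarrow> (\<exists>y\<in>carrier X. x = z \<odot>\<^bsub>X\<^esub> y)"
  using assms unfolding reduction_def by blast+

text \<open>
  A class modulo \<open>z X\<close> is represented by one of its members. So the quotient fits on every type into
  which the type of \<open>X\<close> embeds.
\<close>

lemma reduction_exists:
  fixes X :: "('r, 'm) module" and h :: "'m \<Rightarrow> 'n"
  assumes X: "left_module R X" and h: "inj h"
  shows "\<exists>\<rho> (Y :: ('s, 'n) module). reduction X \<rho> Y"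
proof -
  interpret R: ring R by (rule ring_R)
  interpret X: left_module R X by fact
  let ?Z = "(\<lambda>x. z \<odot>\<^bsub>X\<^esub> x) ` carrier X"
  have Z: "submodule ?Z R X" by (rule submodule_image[OF z_hom[OF X] X X submodule_carrier[OF X]])
  define c where "c x = {y \<in> carrier X. y \<ominus>\<^bsub>X\<^esub> x \<in> ?Z}" for x
  define \<rho> where "\<rho> x = h (SOME y. y \<in> c x)" for x
  have self: "x \<in> c x" if "x \<in> carrier X" for x
    using that submodule_zero[OF Z] by (simp add: c_def X.M.diff_self)
  have sub: "c x \<subseteq> c x'" if "x \<in> carrier X" "x' \<in> carrier X" "x \<ominus>\<^bsub>X\<^esub> x' \<in> ?Z" for x x'
  proof
    fix y assume y: "y \<in> c x"
    have "y \<ominus>\<^bsub>X\<^esub> x' = (y \<ominus>\<^bsub>X\<^esub> x) \<oplus>\<^bsub>X\<^esub> (x \<ominus>\<^bsub>X\<^esub> x')"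
      using y that by (simp add: c_def X.M.diff_eq_iff X.M.a_assoc X.M.diff_add_cancel)
    then show "y \<in> c x'" using y that submodule_add[OF Z] by (simp add: c_def)
  qed
  have neg: "x' \<ominus>\<^bsub>X\<^esub> x \<in> ?Z" if "x \<in> carrier X" "x' \<in> carrier X" "x \<ominus>\<^bsub>X\<^esub> x' \<in> ?Z" for x x'
  proof -
    have "x' \<ominus>\<^bsub>X\<^esub> x = \<ominus>\<^bsub>X\<^esub> (x \<ominus>\<^bsub>X\<^esub> x')"
      using that by (simp add: X.M.minus_eq X.M.minus_add X.M.a_comm)
    then show ?thesis using submodule_neg[OF Z that(3)] by simp
  qed
  have eq: "\<rho> x = \<rho> x' \<longleftrightarrow> x \<ominus>\<^bsub>X\<^esub> x' \<in> ?Z" if x: "x \<in> carrier X" "x' \<in> carrier X" for x x'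
  proof
    assume "x \<ominus>\<^bsub>X\<^esub> x' \<in> ?Z"
    then have "c x = c x'" using sub[OF x] sub[OF x(2,1) neg[OF x]] by blast
    then show "\<rho> x = \<rho> x'" by (simp add: \<rho>_def)
  next
    assume "\<rho> x = \<rho> x'"
    then have e: "(SOME y. y \<in> c x) = (SOME y. y \<in> c x')" using h by (simp add: \<rho>_def inj_eq)
    define y where "y = (SOME y. y \<in> c x)"
    have "y \<in> c x" unfolding y_def by (rule someI[of "\<lambda>y. y \<in> c x", OF self[OF x(1)]])
    moreover have "y \<in> c x'" unfolding y_def e by (rule someI[of "\<lambda>y. y \<in> c x'", OF self[OF x(2)]])
    ultimately have y: "y \<in> carrier X" "y \<ominus>\<^bsub>X\<^esub> x \<in> ?Z" "y \<ominus>\<^bsub>X\<^esub> x' \<in> ?Z" by (auto simp: c_def)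
    have "x \<ominus>\<^bsub>X\<^esub> x' = (x \<ominus>\<^bsub>X\<^esub> y) \<oplus>\<^bsub>X\<^esub> (y \<ominus>\<^bsub>X\<^esub> x')"
      using y(1) x by (simp add: X.M.diff_eq_iff X.M.a_assoc X.M.diff_add_cancel)
    then show "x \<ominus>\<^bsub>X\<^esub> x' \<in> ?Z" using submodule_add[OF Z neg[OF y(1) x(1) y(2)] y(3)] by simp
  qed
  obtain Y :: "('s, 'n) module" where Y: "left_module S Y" "carrier Y = \<rho> ` carrier X"
    "\<rho> \<in> lmod_hom R X (restrict_scalars \<phi> Y)"
  proof (rule push_module[OF X ring_S hom surj, where \<rho> = \<rho>])
    fix x y x' y' assume "x \<in> carrier X" "y \<in> carrier X" "x' \<in> carrier X" "y' \<in> carrier X"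
      "\<rho> x = \<rho> x'" "\<rho> y = \<rho> y'"
    then show "\<rho> (x \<oplus>\<^bsub>X\<^esub> y) = \<rho> (x' \<oplus>\<^bsub>X\<^esub> y')"
      using submodule_add[OF Z] X.M.add_diff_add[of x y x' y'] by (simp add: eq)
  next
    fix a x a' x' assume *: "a \<in> carrier R" "a' \<in> carrier R" "x \<in> carrier X" "x' \<in> carrier X"
      "\<phi> a = \<phi> a'" "\<rho> x = \<rho> x'"
    interpret S: ring S by (rule ring_S)
    have "\<phi> (a \<ominus>\<^bsub>R\<^esub> a') \<oplus>\<^bsub>S\<^esub> \<phi> a' = \<phi> a"
      using ring_hom_add[OF hom, of "a \<ominus>\<^bsub>R\<^esub> a'" a'] * R.diff_add_cancel by simp
    then have "\<phi> (a \<ominus>\<^bsub>R\<^esub> a') = \<zero>\<^bsub>S\<^esub>"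
      using *(1,2,5) ring_hom_closed[OF hom, of "a \<ominus>\<^bsub>R\<^esub> a'"] ring_hom_closed[OF hom, of a'] by simp
    then obtain b where b: "b \<in> carrier R" "a \<ominus>\<^bsub>R\<^esub> a' = z \<otimes>\<^bsub>R\<^esub> b"
      using kernel R.minus_closed[OF *(1,2)] by blast
    have "(a \<ominus>\<^bsub>R\<^esub> a') \<odot>\<^bsub>X\<^esub> x = z \<odot>\<^bsub>X\<^esub> (b \<odot>\<^bsub>X\<^esub> x)"
      using b * z_closed by (simp add: X.smult_assoc)
    then have 1: "(a \<ominus>\<^bsub>R\<^esub> a') \<odot>\<^bsub>X\<^esub> x \<in> ?Z" using X.smult_closed[OF b(1) *(3)] by blast
    have 2: "a' \<odot>\<^bsub>X\<^esub> (x \<ominus>\<^bsub>X\<^esub> x') \<in> ?Z" using * submodule_smult[OF Z *(2)] by (simp add: eq)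
    have "a \<odot>\<^bsub>X\<^esub> x \<ominus>\<^bsub>X\<^esub> a' \<odot>\<^bsub>X\<^esub> x' = (a \<ominus>\<^bsub>R\<^esub> a') \<odot>\<^bsub>X\<^esub> x \<oplus>\<^bsub>X\<^esub> a' \<odot>\<^bsub>X\<^esub> (x \<ominus>\<^bsub>X\<^esub> x')"
      using * by (simp add: X.smult_diff_left X.smult_diff_right X.M.diff_eq_iff X.M.a_assoc X.M.diff_add_cancel X.smult_closed)
    then have "a \<odot>\<^bsub>X\<^esub> x \<ominus>\<^bsub>X\<^esub> a' \<odot>\<^bsub>X\<^esub> x' \<in> ?Z" using submodule_add[OF Z 1 2] by simp
    then show "\<rho> (a \<odot>\<^bsub>X\<^esub> x) = \<rho> (a' \<odot>\<^bsub>X\<^esub> x')" using * by (simp add: eq X.smult_closed)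
  qed
  have "\<rho> \<zero>\<^bsub>X\<^esub> = \<zero>\<^bsub>Y\<^esub>" using lmod_hom_zero[OF Y(3) X left_module_inflate[OF Y(1)]] by simp
  then have "\<rho> x = \<zero>\<^bsub>Y\<^esub> \<longleftrightarrow> (\<exists>y\<in>carrier X. x = z \<odot>\<^bsub>X\<^esub> y)" if "x \<in> carrier X" for x
    using eq[OF that, of "\<zero>\<^bsub>X\<^esub>"] X.M.diff_zero[OF that] by auto
  then show ?thesis using Y unfolding reduction_def by blast
qed

lemma reduction_factor:
  assumes r: "reduction X \<rho> Y" and X: "left_module R X" and Z: "left_module S Z"
    and f: "f \<in> lmod_hom R X (restrict_scalars \<phi> Z)"
  shows "\<exists>g\<in>lmod_hom S Y Z. \<forall>x\<in>carrier X. g (\<rho> x) = f x"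
proof (rule lmod_hom_factor[OF X surj reductionD(2,3)[OF r] f])
  interpret X: left_module R X by fact
  interpret Z: left_module S Z by fact
  note rD = reductionD[OF r]
  note rY = left_module_inflate[OF rD(1)] and rZ = left_module_inflate[OF Z]
  interpret RY: left_module R "restrict_scalars \<phi> Y" by (rule rY)
  interpret RZ: left_module R "restrict_scalars \<phi> Z" by (rule rZ)
  fix x x' assume x: "x \<in> carrier X" "x' \<in> carrier X" "\<rho> x = \<rho> x'"
  have "\<rho> (x \<ominus>\<^bsub>X\<^esub> x') = \<zero>\<^bsub>Y\<^esub>"
    using lmod_hom_diff[OF rD(2) X rY x(1,2)] x(3) RY.M.diff_self[OF lmod_hom_closed[OF rD(2) x(2)]] by simp
  then obtain y where y: "y \<in> carrier X" "x \<ominus>\<^bsub>X\<^esub> x' = z \<odot>\<^bsub>X\<^esub> y"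
    using rD(4)[OF X.M.minus_closed[OF x(1,2)]] by blast
  have "f (z \<odot>\<^bsub>X\<^esub> y) = \<zero>\<^bsub>restrict_scalars \<phi> Z\<^esub>"
    using lmod_hom_smult[OF f z_closed y(1)] z_inflate[OF Z, of "f y"] lmod_hom_closed[OF f y(1)] by simp
  then have "f x \<ominus>\<^bsub>restrict_scalars \<phi> Z\<^esub> f x' = \<zero>\<^bsub>restrict_scalars \<phi> Z\<^esub>"
    using lmod_hom_diff[OF f X rZ x(1,2)] y(2) by simp
  then show "f x = f x'"
    using RZ.M.diff_eq_zero_iff[OF lmod_hom_closed[OF f x(1)] lmod_hom_closed[OF f x(2)]] by blast
qed

lemma torsion_free_submodule:
  "\<lbrakk>torsion_free X; submodule H R X\<rbrakk> \<Longrightarrow> torsion_free (X\<lparr>carrier := H\<rparr>)"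
  unfolding torsion_free_def using submodule_mem by fastforce

lemma projective_torsion_free:
  assumes P: "projective R P"
  shows "torsion_free P"
proof -
  note lP = projective_left_module[OF P]
  interpret P: left_module R P by (rule lP)
  interpret R: ring R by (rule ring_R)
  let ?F = "free_module R (carrier P)"
  have F: "left_module R ?F" by (rule left_module_free[OF ring_R])
  have tF: "torsion_free ?F"
    unfolding torsion_free_def
  proof (intro ballI impI)
    fix w assume w: "w \<in> carrier ?F" "z \<odot>\<^bsub>?F\<^esub> w = \<zero>\<^bsub>?F\<^esub>"
    show "w = \<zero>\<^bsub>?F\<^esub>"
    proof (rule extensionalityI[of _ "carrier P"])
      show "w \<in> extensional (carrier P)" using w(1) by (auto simp: free_module_carrier_iff PiE_def)
      fix x assume x: "x \<in> carrier P"
      then have "z \<otimes>\<^bsub>R\<^esub> w x = \<zero>\<^bsub>R\<^esub>" using fun_cong[OF w(2), of x] by simp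
      then have "w x = \<zero>\<^bsub>R\<^esub>" using z_regular w(1) x by (auto simp: free_module_carrier_iff)
      then show "w x = \<zero>\<^bsub>?F\<^esub> x" using x by simp
    qed simp
  qed
  obtain s where s: "s \<in> lmod_hom R P ?F" "\<forall>x\<in>carrier P. free_lift R (carrier P) P (\<lambda>x. x) (s x) = x"
    using projective_split[OF P F free_cover[OF lP]] by blast
  show ?thesis
    unfolding torsion_free_def
  proof (intro ballI impI)
    fix x assume x: "x \<in> carrier P" "z \<odot>\<^bsub>P\<^esub> x = \<zero>\<^bsub>P\<^esub>"
    have "z \<odot>\<^bsub>?F\<^esub> s x = \<zero>\<^bsub>?F\<^esub>"
      using lmod_hom_smult[OF s(1) z_closed x(1)] x(2) lmod_hom_zero[OF s(1) lP F] by (simp only:)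
    then have "s x = \<zero>\<^bsub>?F\<^esub>" using tF lmod_hom_closed[OF s(1) x(1)] unfolding torsion_free_def by blast
    then show "x = \<zero>\<^bsub>P\<^esub>"
      using bspec[OF s(2) x(1)] lmod_hom_zero[OF free_cover(1)[OF lP] F lP] by (simp only:)
  qed
qed

text \<open>
  The reduction map lifts to the inflated free cover of \<open>Y\<close>, and the lift factors through \<open>Y\<close>.
\<close>

lemma projective_reduction:
  assumes P: "projective R P" and r: "reduction P \<rho> Y"
  shows "projective S Y"
proof -
  note lP = projective_left_module[OF P] and rD = reductionD[OF r]
  let ?F = "free_module S (carrier Y)" and ?c = "free_lift S (carrier Y) Y (\<lambda>x. x)"
  have F: "left_module S ?F" by (rule left_module_free[OF ring_S])
  note c = free_cover[OF rD(1)]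
  have "?c ` carrier (restrict_scalars \<phi> ?F) = carrier (restrict_scalars \<phi> Y)" using c(2) by simp
  then obtain t where t: "t \<in> lmod_hom R P (restrict_scalars \<phi> ?F)" "\<forall>x\<in>carrier P. ?c (t x) = \<rho> x"
    using projective_lift[OF P left_module_inflate[OF F] left_module_inflate[OF rD(1)] rD(2)
        lmod_hom_restrict_scalars[OF c(1) hom]] by blast
  obtain s where s: "s \<in> lmod_hom S Y ?F" "\<forall>x\<in>carrier P. s (\<rho> x) = t x"
    using reduction_factor[OF r lP F t(1)] by blast
  show ?thesis
  proof (rule projectiveI[OF rD(1) s(1)])
    fix y assume "y \<in> carrier Y"
    then obtain x where "x \<in> carrier P" "y = \<rho> x" using rD(3) by (metis imageE)
    then show "?c (s y) = y" using s(2) t(2) by simp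
  qed
qed

text \<open>
  Reduction preserves exact sequences \<open>0 \<rightarrow> K \<rightarrow> P \<rightarrow> X \<rightarrow> 0\<close> with \<open>X\<close> torsion-free: if \<open>z y\<close> lies in \<open>K\<close>, then
  \<open>z\<close> kills the image of \<open>y\<close> in \<open>X\<close>, so \<open>y\<close> lies in \<open>K\<close>, and the map from \<open>K/zK\<close> to \<open>P/zP\<close> is injective.
\<close>

lemma pd_le_reduction:
  fixes X :: "('r, 'm) module" and Y :: "('s, 'n) module" and h :: "'m \<Rightarrow> 'n"
  assumes h: "inj h"
  shows "\<lbrakk>pd_le R k X; torsion_free X; reduction X \<rho> Y\<rbrakk> \<Longrightarrow> pd_le S k Y"
proof (induction k arbitrary: X \<rho> Y)
  case 0
  then show ?case using projective_reduction by simp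
next
  case (Suc k X \<rho> Y)
  note rD = reductionD[OF Suc.prems(3)]
  have lX: "left_module R X" by (rule pd_le_left_module[OF Suc.prems(1)])
  interpret X: left_module R X by (rule lX)
  interpret Y: left_module S Y by (rule rD(1))
  obtain P :: "('r, 'm) module" and p where P: "projective R P" and p: "p \<in> lmod_hom R P X" "p ` carrier P = carrier X"
    and K: "pd_le R k (ker_module P X p)" using Suc.prems(1) by auto
  note lP = projective_left_module[OF P]
  interpret P: left_module R P by (rule lP)
  let ?K = "ker_module P X p"
  have lK: "left_module R ?K" by (rule left_module_kernel[OF p(1) lP lX])
  have tP: "torsion_free P" by (rule projective_torsion_free[OF P])
  have tK: "torsion_free ?K" by (rule torsion_free_submodule[OF tP submodule_kernel[OF p(1) lP lX]])
  obtain \<rho>P and YP :: "('s, 'n) module" where rP: "reduction P \<rho>P YP" using reduction_exists[OF lP h] by blast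
  obtain \<rho>K and YK :: "('s, 'n) module" where rK: "reduction ?K \<rho>K YK" using reduction_exists[OF lK h] by blast
  note PD = reductionD[OF rP] and KD = reductionD[OF rK]
  interpret YP: left_module S YP by (rule PD(1))
  obtain q where q: "q \<in> lmod_hom S YP Y" "\<forall>x\<in>carrier P. q (\<rho>P x) = \<rho> (p x)"
    using reduction_factor[OF rP lP rD(1) lmod_hom_compose[OF p(1) rD(2)]] by blast
  obtain j where j: "j \<in> lmod_hom S YK YP" "\<forall>x\<in>carrier ?K. j (\<rho>K x) = \<rho>P x"
    using reduction_factor[OF rK lK PD(1) lmod_hom_restrict_dom[OF PD(2) a_kernel_subset]] by blast
  have qs: "q ` carrier YP = carrier Y"
  proof (intro equalityI subsetI)
    fix y assume "y \<in> carrier Y"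
    then obtain x where x: "x \<in> carrier X" "y = \<rho> x" using rD(3) by (metis imageE)
    then obtain w where "w \<in> carrier P" "x = p w" using p(2) by (metis imageE)
    then show "y \<in> q ` carrier YP" using q(2) x PD(3) by (metis imageI)
  qed (use lmod_hom_closed[OF q(1)] in blast)
  have jq: "j u \<in> a_kernel YP Y q" if "u \<in> carrier YK" for u
  proof -
    obtain x where "x \<in> carrier ?K" "u = \<rho>K x" using \<open>u \<in> carrier YK\<close> unfolding KD(3)[symmetric] by (elim imageE)
    then have x: "x \<in> carrier P" "p x = \<zero>\<^bsub>X\<^esub>" "j u = \<rho>P x" using j(2) by (auto simp: a_kernel_iff)
    then show ?thesis
      using q(2) lmod_hom_zero[OF rD(2) lX left_module_inflate[OF rD(1)]] lmod_hom_closed[OF PD(2) x(1)]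
      by (simp add: a_kernel_iff)
  qed
  have jinj: "inj_on j (carrier YK)"
  proof (rule inj_on_kernel[OF j(1) KD(1) PD(1)])
    fix u assume u: "u \<in> carrier YK" "j u = \<zero>\<^bsub>YP\<^esub>"
    obtain x where x: "x \<in> carrier ?K" "u = \<rho>K x" using u(1) unfolding KD(3)[symmetric] by (elim imageE)
    have xP: "x \<in> carrier P" "p x = \<zero>\<^bsub>X\<^esub>" using x(1) by (auto simp: a_kernel_iff)
    have "\<rho>P x = \<zero>\<^bsub>YP\<^esub>" using u(2) x j(2) by simp
    then obtain y where y: "y \<in> carrier P" "x = z \<odot>\<^bsub>P\<^esub> y" using PD(4)[OF xP(1)] by blast
    have "z \<odot>\<^bsub>X\<^esub> p y = \<zero>\<^bsub>X\<^esub>" using lmod_hom_smult[OF p(1) z_closed y(1)] xP(2) y(2) by simp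
    then have "p y = \<zero>\<^bsub>X\<^esub>" using Suc.prems(2) lmod_hom_closed[OF p(1) y(1)] by (simp add: torsion_free_def)
    then have "y \<in> carrier ?K" using y(1) by (simp add: a_kernel_iff)
    then show "u = \<zero>\<^bsub>YK\<^esub>" using KD(4)[OF x(1)] x(2) y(2) by auto
  qed
  have "a_kernel YP Y q \<subseteq> j ` carrier YK"
  proof
    fix v assume "v \<in> a_kernel YP Y q"
    then have v: "v \<in> carrier YP" "q v = \<zero>\<^bsub>Y\<^esub>" by (auto simp: a_kernel_iff)
    obtain x where x: "x \<in> carrier P" "v = \<rho>P x" using v(1) unfolding PD(3)[symmetric] by (elim imageE)
    have "\<rho> (p x) = \<zero>\<^bsub>Y\<^esub>" using v(2) x q(2) by simp
    then obtain w where w: "w \<in> carrier X" "p x = z \<odot>\<^bsub>X\<^esub> w" using rD(4)[OF lmod_hom_closed[OF p(1) x(1)]] by blast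
    obtain y where y: "y \<in> carrier P" "w = p y" using w(1) p(2) by (metis imageE)
    have zy: "z \<odot>\<^bsub>P\<^esub> y \<in> carrier P" by (rule P.smult_closed[OF z_closed y(1)])
    have pzy: "p (z \<odot>\<^bsub>P\<^esub> y) = p x" using lmod_hom_smult[OF p(1) z_closed y(1)] w(2) y(2) by simp
    have "p (x \<ominus>\<^bsub>P\<^esub> z \<odot>\<^bsub>P\<^esub> y) = \<zero>\<^bsub>X\<^esub>"
      using lmod_hom_diff[OF p(1) lP lX x(1) zy] pzy X.M.diff_self[OF lmod_hom_closed[OF p(1) x(1)]] by simp
    then have k: "x \<ominus>\<^bsub>P\<^esub> z \<odot>\<^bsub>P\<^esub> y \<in> carrier ?K" using x(1) zy by (simp add: a_kernel_iff)
    note rPm = left_module_inflate[OF PD(1)]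
    interpret RY: left_module R "restrict_scalars \<phi> YP" by (rule rPm)
    have "\<rho>P (z \<odot>\<^bsub>P\<^esub> y) = \<zero>\<^bsub>restrict_scalars \<phi> YP\<^esub>" using PD(4)[OF zy] y(1) by auto
    then have "\<rho>P (x \<ominus>\<^bsub>P\<^esub> z \<odot>\<^bsub>P\<^esub> y) = \<rho>P x"
      using lmod_hom_diff[OF PD(2) lP rPm x(1) zy] RY.M.diff_zero[OF lmod_hom_closed[OF PD(2) x(1)]] by simp
    then have "v = j (\<rho>K (x \<ominus>\<^bsub>P\<^esub> z \<odot>\<^bsub>P\<^esub> y))" using bspec[OF j(2) k] x(2) by simp
    then show "v \<in> j ` carrier YK" using k KD(3) by blast
  qed
  then have "bij_betw j (carrier YK) (carrier (ker_module YP Y q))"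
    using jinj jq by (auto simp: bij_betw_def)
  moreover have "j \<in> lmod_hom S YK (ker_module YP Y q)"
    by (rule lmod_hom_restrict_cod[OF j(1)]) (use jq in blast)
  ultimately have "lmod_iso S YK (ker_module YP Y q)" by (intro lmod_isoI)
  moreover have "pd_le S k YK" by (rule Suc.IH[OF K tK rK])
  ultimately have "pd_le S k (ker_module YP Y q)"
    using pd_le_iso left_module_kernel[OF q(1) PD(1) rD(1)] by blast
  then show ?case using rD(1) projective_reduction[OF P rP] q(1) qs by auto
qed

text \<open>
  The reduction of \<open>0 \<rightarrow> K \<rightarrow> P \<rightarrow> M \<rightarrow> 0\<close> with \<open>z M = 0\<close> is the exact sequence
  \<open>0 \<rightarrow> M \<rightarrow> K/zK \<rightarrow> P/zP \<rightarrow> M \<rightarrow> 0\<close>, where \<open>M = zP/zK\<close> since \<open>P\<close> is torsion-free.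
\<close>

lemma reduction_sequence:
  assumes M: "left_module S M" and P: "projective R P"
    and e: "e \<in> lmod_hom R P (restrict_scalars \<phi> M)" "e ` carrier P = carrier M"
    and rP: "reduction P \<rho>P YP" and rK: "reduction (ker_module P (restrict_scalars \<phi> M) e) \<rho>K YK"
  shows "\<exists>p\<in>lmod_hom S YP M. \<exists>q\<in>lmod_hom S YK (ker_module YP M p).
    p ` carrier YP = carrier M \<and> q ` carrier YK = a_kernel YP M p \<and>
    lmod_iso S M (ker_module YK (ker_module YP M p) q)"
proof -
  note lP = projective_left_module[OF P]
  note rM = left_module_inflate[OF M]
  interpret P: left_module R P by (rule lP)
  interpret M: left_module S M by (rule M)
  interpret RM: left_module R "restrict_scalars \<phi> M" by (rule rM)
  let ?K = "ker_module P (restrict_scalars \<phi> M) e"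
  have sK: "submodule (a_kernel P (restrict_scalars \<phi> M) e) R P" by (rule submodule_kernel[OF e(1) lP rM])
  have lK: "left_module R ?K" by (rule left_module_submodule[OF lP sK])
  interpret K: left_module R ?K by (rule lK)
  have K_iff: "x \<in> carrier ?K \<longleftrightarrow> x \<in> carrier P \<and> e x = \<zero>\<^bsub>M\<^esub>" for x by (simp add: a_kernel_iff)
  have tP: "torsion_free P" by (rule projective_torsion_free[OF P])
  note PD = reductionD[OF rP] and KD = reductionD[OF rK]
  interpret YP: left_module S YP by (rule PD(1))
  interpret YK: left_module S YK by (rule KD(1))
  obtain p where p: "p \<in> lmod_hom S YP M" "\<forall>x\<in>carrier P. p (\<rho>P x) = e x"
    using reduction_factor[OF rP lP M e(1)] by blast
  have ps: "p ` carrier YP = carrier M"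
  proof (intro equalityI subsetI)
    fix y assume "y \<in> carrier M"
    then obtain x where "x \<in> carrier P" "y = e x" using e(2) by (metis imageE)
    then show "y \<in> p ` carrier YP" using p(2) PD(3) by (metis imageI)
  qed (use lmod_hom_closed[OF p(1)] in blast)
  obtain q where q0: "q \<in> lmod_hom S YK YP" "\<forall>x\<in>carrier ?K. q (\<rho>K x) = \<rho>P x"
    using reduction_factor[OF rK lK PD(1) lmod_hom_restrict_dom[OF PD(2) a_kernel_subset]] by blast
  have qs: "q ` carrier YK = a_kernel YP M p"
  proof (intro equalityI subsetI)
    fix v assume "v \<in> q ` carrier YK"
    then obtain x where "x \<in> carrier ?K" "v = q (\<rho>K x)" unfolding KD(3)[symmetric] by blast
    then have "x \<in> carrier P" "e x = \<zero>\<^bsub>M\<^esub>" "v = \<rho>P x" using q0(2) K_iff by auto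
    then show "v \<in> a_kernel YP M p" using p(2) lmod_hom_closed[OF PD(2)] by (simp add: a_kernel_iff)
  next
    fix v assume "v \<in> a_kernel YP M p"
    then have v: "v \<in> carrier YP" "p v = \<zero>\<^bsub>M\<^esub>" by (auto simp: a_kernel_iff)
    obtain x where x: "x \<in> carrier P" "v = \<rho>P x" using v(1) unfolding PD(3)[symmetric] by (elim imageE)
    then have xK: "x \<in> carrier ?K" using p(2) v(2) K_iff by simp
    then have "v = q (\<rho>K x)" using q0(2) x(2) by simp
    then show "v \<in> q ` carrier YK" using xK KD(3) by blast
  qed
  have q: "q \<in> lmod_hom S YK (ker_module YP M p)" by (rule lmod_hom_restrict_cod[OF q0(1)]) (use qs in simp)
  have zyK: "z \<odot>\<^bsub>P\<^esub> y \<in> carrier ?K" if "y \<in> carrier P" for y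
    using lmod_hom_smult[OF e(1) z_closed that] z_inflate[OF M, of "e y"] lmod_hom_closed[OF e(1) that]
      P.smult_closed[OF z_closed that] K_iff by simp
  \<comment> \<open>the map \<open>e y \<mapsto> z y mod z K\<close>\<close>
  define g where "g y = \<rho>K (z \<odot>\<^bsub>P\<^esub> y)" for y
  have g: "g \<in> lmod_hom R P (restrict_scalars \<phi> YK)"
    unfolding g_def
  proof (rule lmod_hom_compose[OF _ KD(2)])
    show "(\<lambda>x. z \<odot>\<^bsub>P\<^esub> x) \<in> lmod_hom R P ?K"
      by (rule lmod_hom_restrict_cod[OF z_hom[OF lP]]) (use zyK in auto)
  qed
  have g0: "g y = \<zero>\<^bsub>YK\<^esub> \<longleftrightarrow> e y = \<zero>\<^bsub>M\<^esub>" if y: "y \<in> carrier P" for y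
  proof
    assume "g y = \<zero>\<^bsub>YK\<^esub>"
    then obtain k where k: "k \<in> carrier ?K" "z \<odot>\<^bsub>P\<^esub> y = z \<odot>\<^bsub>P\<^esub> k" using KD(4)[OF zyK[OF y]] unfolding g_def by auto
    have kP: "k \<in> carrier P" "e k = \<zero>\<^bsub>M\<^esub>" using k(1) K_iff by auto
    have "z \<odot>\<^bsub>P\<^esub> (y \<ominus>\<^bsub>P\<^esub> k) = \<zero>\<^bsub>P\<^esub>"
      using k(2) kP y z_closed P.M.diff_self[OF P.smult_closed[OF z_closed kP(1)]] by (simp add: P.smult_diff_right)
    then have "y \<ominus>\<^bsub>P\<^esub> k = \<zero>\<^bsub>P\<^esub>" using tP y kP(1) by (simp add: torsion_free_def)
    then have "y = k" using P.M.diff_eq_zero_iff y kP(1) by blast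
    then show "e y = \<zero>\<^bsub>M\<^esub>" using kP by simp
  next
    assume "e y = \<zero>\<^bsub>M\<^esub>"
    then have "y \<in> carrier ?K" using y K_iff by simp
    then show "g y = \<zero>\<^bsub>YK\<^esub>" using KD(4)[OF zyK[OF y]] unfolding g_def by auto
  qed
  have rYK: "left_module R (restrict_scalars \<phi> YK)" by (rule left_module_inflate[OF KD(1)])
  interpret RYK: left_module R "restrict_scalars \<phi> YK" by (rule rYK)
  have fib: "g x = g x'" if "x \<in> carrier P" "x' \<in> carrier P" "e x = e x'" for x x'
  proof -
    have "e (x \<ominus>\<^bsub>P\<^esub> x') = \<zero>\<^bsub>M\<^esub>"
      using lmod_hom_diff[OF e(1) lP rM that(1,2)] that(3) RM.M.diff_self[OF lmod_hom_closed[OF e(1) that(2)]] by simp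
    then have "g x \<ominus>\<^bsub>restrict_scalars \<phi> YK\<^esub> g x' = \<zero>\<^bsub>restrict_scalars \<phi> YK\<^esub>"
      using g0[OF P.M.minus_closed[OF that(1,2)]] lmod_hom_diff[OF g lP rYK that(1,2)] by simp
    then show ?thesis
      using RYK.M.diff_eq_zero_iff[OF lmod_hom_closed[OF g that(1)] lmod_hom_closed[OF g that(2)]] by blast
  qed
  obtain i where i: "i \<in> lmod_hom S M YK" "\<forall>x\<in>carrier P. i (e x) = g x"
    using lmod_hom_factor[OF lP surj e(1) _ g] e(2) fib by blast
  have iinj: "inj_on i (carrier M)"
  proof (rule inj_on_kernel[OF i(1) M KD(1)])
    fix y assume y: "y \<in> carrier M" "i y = \<zero>\<^bsub>YK\<^esub>"
    then obtain x where "x \<in> carrier P" "y = e x" using e(2) by (metis imageE)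
    then show "y = \<zero>\<^bsub>M\<^esub>" using y(2) i(2) g0 by simp
  qed
  have iim: "i ` carrier M = a_kernel YK (ker_module YP M p) q"
  proof (intro equalityI subsetI)
    fix u assume "u \<in> i ` carrier M"
    then obtain y where y: "y \<in> carrier P" "u = g y" using i(2) e(2) by (metis imageE)
    have "q u = \<rho>P (z \<odot>\<^bsub>P\<^esub> y)" using y(2) q0(2) zyK[OF y(1)] by (simp add: g_def)
    then have "q u = \<zero>\<^bsub>YP\<^esub>" using PD(4)[OF P.smult_closed[OF z_closed y(1)]] y(1) by auto
    then show "u \<in> a_kernel YK (ker_module YP M p) q"
      using lmod_hom_closed[OF g y(1)] y(2) by (simp add: a_kernel_iff)
  next
    fix u assume "u \<in> a_kernel YK (ker_module YP M p) q"
    then have u: "u \<in> carrier YK" "q u = \<zero>\<^bsub>YP\<^esub>" by (auto simp: a_kernel_iff)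
    obtain x where x: "x \<in> carrier ?K" "u = \<rho>K x" using u(1) unfolding KD(3)[symmetric] by (elim imageE)
    have xP: "x \<in> carrier P" using x(1) K_iff by blast
    have "\<rho>P x = \<zero>\<^bsub>YP\<^esub>" using u(2) x q0(2) by simp
    then obtain y where y: "y \<in> carrier P" "x = z \<odot>\<^bsub>P\<^esub> y" using PD(4)[OF xP] by blast
    then have "u = i (e y)" using i(2) x(2) by (simp add: g_def)
    then show "u \<in> i ` carrier M" using e(2) y(1) by blast
  qed
  have "lmod_iso S M (ker_module YK (ker_module YP M p) q)"
    by (rule lmod_isoI[OF lmod_hom_restrict_cod[OF i(1)]]) (use iinj iim in \<open>auto simp: bij_betw_def\<close>)
  then show ?thesis using p(1) q ps qs by blast
qed

end

text \<open>
  The images of the differentials are the successive kernels. From the last differential, which is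
  injective, one descends to the first.
\<close>

lemma proj_resolution_pd_le:
  fixes P :: "nat \<Rightarrow> ('r, 'u) module"
  assumes res: "proj_resolution R M P d e" and M: "left_module R M"
    and z: "\<forall>i>m. carrier (P i) = {\<zero>\<^bsub>P i\<^esub>}" and m: "m > 0"
  shows "pd_le R (m - 1) (ker_module (P 0) M e)"
proof -
  have P: "projective R (P i)" and d: "d i \<in> lmod_hom R (P (Suc i)) (P i)"
    and ex: "d (Suc i) ` carrier (P (Suc (Suc i))) = a_kernel (P (Suc i)) (P i) (d i)" for i
    using res unfolding proj_resolution_def by blast+
  have ex0: "d 0 ` carrier (P (Suc 0)) = a_kernel (P 0) M e" using res unfolding proj_resolution_def by simp
  have e: "e \<in> lmod_hom R (P 0) M" using res unfolding proj_resolution_def by blast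
  note lP = projective_left_module[OF P]
  let ?Z = "\<lambda>i. (P i)\<lparr>carrier := d i ` carrier (P (Suc i))\<rparr>"
  have sZ: "submodule (d i ` carrier (P (Suc i))) R (P i)" for i
    by (rule submodule_image[OF d lP lP submodule_carrier[OF lP]])
  have lZ: "left_module R (?Z i)" for i by (rule left_module_submodule[OF lP sZ])
  have dZ: "d i \<in> lmod_hom R (P (Suc i)) (?Z i)" for i by (rule lmod_hom_restrict_cod[OF d]) simp
  have kZ: "a_kernel (P (Suc i)) (?Z i) (d i) = d (Suc i) ` carrier (P (Suc (Suc i)))" for i
    by (auto simp: ex a_kernel_iff)
  have "i + j + 1 = m \<Longrightarrow> pd_le R j (?Z i)" for i j
  proof (induction j arbitrary: i)
    case 0
    have "carrier (P (Suc (Suc i))) = {\<zero>\<^bsub>P (Suc (Suc i))\<^esub>}" using z 0 by simp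
    then have k: "a_kernel (P (Suc i)) (?Z i) (d i) = {\<zero>\<^bsub>P (Suc i)\<^esub>}"
      using kZ[of i] lmod_hom_zero[OF d lP lP] by simp
    have "inj_on (d i) (carrier (P (Suc i)))"
    proof (rule inj_on_kernel[OF dZ lP lZ])
      fix x assume "x \<in> carrier (P (Suc i))" "d i x = \<zero>\<^bsub>?Z i\<^esub>"
      then have "x \<in> a_kernel (P (Suc i)) (?Z i) (d i)" by (simp add: a_kernel_iff)
      then show "x = \<zero>\<^bsub>P (Suc i)\<^esub>" unfolding k by simp
    qed
    then have "lmod_iso R (P (Suc i)) (?Z i)"
      by (intro lmod_isoI[OF dZ]) (simp add: bij_betw_def)
    then show ?case using projective_iso[OF P lZ] by simp
  next
    case (Suc j)
    have "pd_le R j (?Z (Suc i))" by (rule Suc.IH) (use Suc.prems in simp)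
    then have "pd_le R j (ker_module (P (Suc i)) (?Z i) (d i))" unfolding kZ .
    then show ?case unfolding pd_le.simps
      by (intro conjI exI[of _ "P (Suc i)"] exI[of _ "d i"] lZ P dZ) simp_all
  qed
  from this[of 0 "m - 1"] show ?thesis using m ex0 by simp
qed

locale reduction_syzygies = central_reduction R S \<phi> z + S: perfect_ring S enc
  for R :: "('r, 'x) ring_scheme" and S :: "('s, 'y) ring_scheme" and \<phi> z and enc :: "('s \<times> 'u) list \<Rightarrow> 'u"
begin

text \<open>
  The reduced sequence presents \<open>M\<close> as the kernel of a map from \<open>K/zK\<close> onto the kernel \<open>L\<close> of
  \<open>P/zP \<rightarrow> M\<close>, where \<open>K/zK\<close> has projective dimension at most \<open>k\<close> and \<open>L\<close> is \<open>\<Omega> M\<close> up to a projective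
  summand. So the \<open>k\<close>-th syzygy of \<open>M\<close> is the \<open>(k + 1)\<close>-st syzygy of \<open>L\<close> plus a projective module.
\<close>

lemma syzygy_periodic:
  fixes M :: "('s, 'u) module" and P :: "('r, 'v) module" and h :: "'v \<Rightarrow> 'u"
  assumes M: "left_module S M" and P: "projective R P" and h: "inj h"
    and e: "e \<in> lmod_hom R P (restrict_scalars \<phi> M)" "e ` carrier P = carrier M"
    and pd: "pd_le R k (ker_module P (restrict_scalars \<phi> M) e)"
  shows "\<exists>Q :: ('s, 'u) module. projective S Q \<and>
    lmod_iso S ((Omega1 S ^^ k) M) (dsum2 ((Omega1 S ^^ Suc (Suc k)) M) Q)"
proof -
  let ?K = "ker_module P (restrict_scalars \<phi> M) e"
  note lP = projective_left_module[OF P]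
  have sK: "submodule (a_kernel P (restrict_scalars \<phi> M) e) R P"
    by (rule submodule_kernel[OF e(1) lP left_module_inflate[OF M]])
  have lK: "left_module R ?K" by (rule left_module_submodule[OF lP sK])
  obtain \<rho>P and YP :: "('s, 'u) module" where rP: "reduction P \<rho>P YP" using reduction_exists[OF lP h] by blast
  obtain \<rho>K and YK :: "('s, 'u) module" where rK: "reduction ?K \<rho>K YK" using reduction_exists[OF lK h] by blast
  have pdK: "pd_le S k YK"
    by (rule pd_le_reduction[OF h pd torsion_free_submodule[OF projective_torsion_free[OF P] sK] rK])
  have pYP: "projective S YP" by (rule projective_reduction[OF P rP])
  obtain p q where p: "p \<in> lmod_hom S YP M" "p ` carrier YP = carrier M"
    and q: "q \<in> lmod_hom S YK (ker_module YP M p)" "q ` carrier YK = a_kernel YP M p"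
    and iso: "lmod_iso S M (ker_module YK (ker_module YP M p) q)"
    using reduction_sequence[OF M P e rP rK] by blast
  let ?L = "ker_module YP M p"
  have lL: "left_module S ?L" by (rule left_module_kernel[OF p(1) projective_left_module[OF pYP] M])
  have "q ` carrier YK = carrier ?L" using q(2) by simp
  then obtain Q :: "('s, 'u) module" where Q: "projective S Q"
    "lmod_iso S ((Omega1 S ^^ k) M) (dsum2 ((Omega1 S ^^ Suc k) ?L) Q)"
    using S.syzygy_of_extension[OF pdK lL q(1) _ M iso] by blast
  obtain H where H: "projective S (YP\<lparr>carrier := H\<rparr>)" "lmod_iso S ?L (dsum2 (Omega1 S M) (YP\<lparr>carrier := H\<rparr>))"
    using S.Omega1_kernel[OF M pYP p] by blast
  note OM = S.left_module_Omega1[OF M]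
  have "lmod_iso S ((Omega1 S ^^ k) (Omega1 S ?L)) ((Omega1 S ^^ k) (Omega1 S (Omega1 S M)))"
    by (intro S.Omega1_funpow_cong S.left_module_Omega1 lL OM S.Omega1_dsum2[OF OM lL H])
  then have "lmod_iso S ((Omega1 S ^^ Suc k) ?L) ((Omega1 S ^^ Suc (Suc k)) M)"
    by (simp only: funpow_Suc_right o_apply)
  then show ?thesis using Q lmod_iso_trans[OF Q(2) dsum2_cong[OF _ lmod_iso_refl]] by blast
qed

end


section \<open>Krull--Schmidt decompositions\<close>

text \<open>
  Nonzero modules with local endomorphism ring, described by the condition that \<open>f\<close> or \<open>1 - f\<close> is
  invertible for every endomorphism \<open>f\<close>.
\<close>

definition local_module :: "('r, 'x) ring_scheme \<Rightarrow> ('r, 'm) module \<Rightarrow> bool"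
  where "local_module R M \<longleftrightarrow> left_module R M \<and> carrier M \<noteq> {\<zero>\<^bsub>M\<^esub>} \<and>
    (\<forall>f\<in>lmod_hom R M M. bij_betw f (carrier M) (carrier M) \<or>
      bij_betw (\<lambda>x. x \<ominus>\<^bsub>M\<^esub> f x) (carrier M) (carrier M))"

lemma End_ring_simps:
  "carrier (End_ring R M) = lmod_hom R M M \<inter> extensional (carrier M)"
  "f \<otimes>\<^bsub>End_ring R M\<^esub> g = (\<lambda>x\<in>carrier M. f (g x))"
  "\<one>\<^bsub>End_ring R M\<^esub> = (\<lambda>x\<in>carrier M. x)"
  "\<zero>\<^bsub>End_ring R M\<^esub> = (\<lambda>x\<in>carrier M. \<zero>\<^bsub>M\<^esub>)"
  "f \<oplus>\<^bsub>End_ring R M\<^esub> g = (\<lambda>x\<in>carrier M. f x \<oplus>\<^bsub>M\<^esub> g x)"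
  by (simp_all add: End_ring_def compose_def)

lemma ring_End_ring:
  assumes M: "left_module R M"
  shows "ring (End_ring R M)"
proof -
  interpret M: left_module R M by fact
  note E = End_ring_simps
  have cl: "(\<lambda>x\<in>carrier M. f x) \<in> carrier (End_ring R M)" if "f \<in> lmod_hom R M M" for f
    using lmod_hom_cong[OF that M, of "\<lambda>x\<in>carrier M. f x"] by (simp add: E)
  have mem: "f \<in> lmod_hom R M M" "f \<in> extensional (carrier M)" if "f \<in> carrier (End_ring R M)" for f
    using that by (auto simp: E)
  note c = lmod_hom_closed[OF mem(1)]
  note eqI = extensionalityI[of _ "carrier M"]
  have add: "f \<oplus>\<^bsub>End_ring R M\<^esub> g \<in> carrier (End_ring R M)"
    if "f \<in> carrier (End_ring R M)" "g \<in> carrier (End_ring R M)" for f g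
    using cl[OF lmod_hom_sum[OF mem(1)[OF that(1)] mem(1)[OF that(2)] M]] by (simp add: E(5))
  have mult: "f \<otimes>\<^bsub>End_ring R M\<^esub> g \<in> carrier (End_ring R M)"
    if "f \<in> carrier (End_ring R M)" "g \<in> carrier (End_ring R M)" for f g
    using cl[OF lmod_hom_compose[OF mem(1)[OF that(2)] mem(1)[OF that(1)]]] by (simp add: E(2))
  have zero: "\<zero>\<^bsub>End_ring R M\<^esub> \<in> carrier (End_ring R M)" unfolding E(4) by (rule cl[OF lmod_hom_const_zero[OF M]])
  have one: "\<one>\<^bsub>End_ring R M\<^esub> \<in> carrier (End_ring R M)" unfolding E(3) by (rule cl[OF lmod_hom_id])
  show ?thesis
  proof (rule ringI)
    show "abelian_group (End_ring R M)"
    proof (rule abelian_groupI[OF add zero])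
      fix f g h assume fgh: "f \<in> carrier (End_ring R M)" "g \<in> carrier (End_ring R M)" "h \<in> carrier (End_ring R M)"
      show "f \<oplus>\<^bsub>End_ring R M\<^esub> g \<oplus>\<^bsub>End_ring R M\<^esub> h = f \<oplus>\<^bsub>End_ring R M\<^esub> (g \<oplus>\<^bsub>End_ring R M\<^esub> h)"
        by (rule eqI) (auto simp: E(5) c[OF fgh(1)] c[OF fgh(2)] c[OF fgh(3)] M.M.a_assoc)
    next
      fix f g assume fg: "f \<in> carrier (End_ring R M)" "g \<in> carrier (End_ring R M)"
      show "f \<oplus>\<^bsub>End_ring R M\<^esub> g = g \<oplus>\<^bsub>End_ring R M\<^esub> f"
        by (rule eqI) (auto simp: E(5) c[OF fg(1)] c[OF fg(2)] M.M.a_comm)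
    next
      fix f assume f: "f \<in> carrier (End_ring R M)"
      show "\<zero>\<^bsub>End_ring R M\<^esub> \<oplus>\<^bsub>End_ring R M\<^esub> f = f"
        by (rule eqI) (auto simp: E(4,5) c[OF f] mem(2)[OF f])
      have "(\<lambda>x\<in>carrier M. \<zero>\<^bsub>M\<^esub> \<ominus>\<^bsub>M\<^esub> f x) \<in> carrier (End_ring R M)"
        by (rule cl[OF lmod_hom_difference[OF lmod_hom_const_zero[OF M] mem(1)[OF f] M]])
      moreover have "(\<lambda>x\<in>carrier M. \<zero>\<^bsub>M\<^esub> \<ominus>\<^bsub>M\<^esub> f x) \<oplus>\<^bsub>End_ring R M\<^esub> f = \<zero>\<^bsub>End_ring R M\<^esub>"
        by (rule eqI) (auto simp: E(4,5) c[OF f] M.M.diff_add_cancel)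
      ultimately show "\<exists>g\<in>carrier (End_ring R M). g \<oplus>\<^bsub>End_ring R M\<^esub> f = \<zero>\<^bsub>End_ring R M\<^esub>" by blast
    qed
    show "monoid (End_ring R M)"
    proof (rule monoidI[OF mult one])
      fix f g h assume fgh: "f \<in> carrier (End_ring R M)" "g \<in> carrier (End_ring R M)" "h \<in> carrier (End_ring R M)"
      show "f \<otimes>\<^bsub>End_ring R M\<^esub> g \<otimes>\<^bsub>End_ring R M\<^esub> h = f \<otimes>\<^bsub>End_ring R M\<^esub> (g \<otimes>\<^bsub>End_ring R M\<^esub> h)"
        by (rule eqI) (auto simp: E(2) c[OF fgh(3)])
    next
      fix f assume f: "f \<in> carrier (End_ring R M)"
      show "\<one>\<^bsub>End_ring R M\<^esub> \<otimes>\<^bsub>End_ring R M\<^esub> f = f"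
        by (rule eqI) (auto simp: E(2,3) c[OF f] mem(2)[OF f])
      show "f \<otimes>\<^bsub>End_ring R M\<^esub> \<one>\<^bsub>End_ring R M\<^esub> = f"
        by (rule eqI) (auto simp: E(2,3) mem(2)[OF f])
    qed
    fix f g h assume fgh: "f \<in> carrier (End_ring R M)" "g \<in> carrier (End_ring R M)" "h \<in> carrier (End_ring R M)"
    show "(f \<oplus>\<^bsub>End_ring R M\<^esub> g) \<otimes>\<^bsub>End_ring R M\<^esub> h =
        f \<otimes>\<^bsub>End_ring R M\<^esub> h \<oplus>\<^bsub>End_ring R M\<^esub> g \<otimes>\<^bsub>End_ring R M\<^esub> h"
      by (rule eqI) (auto simp: E(2,5) c[OF fgh(3)])
    show "h \<otimes>\<^bsub>End_ring R M\<^esub> (f \<oplus>\<^bsub>End_ring R M\<^esub> g) =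
        h \<otimes>\<^bsub>End_ring R M\<^esub> f \<oplus>\<^bsub>End_ring R M\<^esub> h \<otimes>\<^bsub>End_ring R M\<^esub> g"
      by (rule eqI) (auto simp: E(2,5) c[OF fgh(1)] c[OF fgh(2)] lmod_hom_add[OF mem(1)[OF fgh(3)]])
  qed
qed

lemma Units_End_ring:
  assumes M: "left_module R M" and f: "f \<in> carrier (End_ring R M)"
  shows "f \<in> Units (End_ring R M) \<longleftrightarrow> bij_betw f (carrier M) (carrier M)"
proof
  have fh: "f \<in> lmod_hom R M M" using f by (simp add: End_ring_simps)
  assume "f \<in> Units (End_ring R M)"
  then obtain g where g: "g \<in> carrier (End_ring R M)" "g \<otimes>\<^bsub>End_ring R M\<^esub> f = \<one>\<^bsub>End_ring R M\<^esub>"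
    "f \<otimes>\<^bsub>End_ring R M\<^esub> g = \<one>\<^bsub>End_ring R M\<^esub>" unfolding Units_def by blast
  have gh: "g \<in> lmod_hom R M M" using g(1) by (simp add: End_ring_simps)
  have "g (f x) = x" "f (g x) = x" if "x \<in> carrier M" for x
    using fun_cong[OF g(2), of x] fun_cong[OF g(3), of x] that by (auto simp: End_ring_simps)
  then show "bij_betw f (carrier M) (carrier M)"
    using lmod_hom_closed[OF fh] lmod_hom_closed[OF gh] by (intro bij_betwI[where g = g]) auto
next
  have fh: "f \<in> lmod_hom R M M" using f by (simp add: End_ring_simps)
  assume "bij_betw f (carrier M) (carrier M)"
  then obtain g where g: "g \<in> lmod_hom R M M" "\<forall>x\<in>carrier M. g (f x) = x" "\<forall>x\<in>carrier M. f (g x) = x"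
    using bij_inverse_hom[OF M fh] by blast
  have "(\<lambda>x\<in>carrier M. g x) \<in> carrier (End_ring R M)"
    using lmod_hom_cong[OF g(1) M, of "\<lambda>x\<in>carrier M. g x"] by (simp add: End_ring_simps)
  moreover have "(\<lambda>x\<in>carrier M. g x) \<otimes>\<^bsub>End_ring R M\<^esub> f = \<one>\<^bsub>End_ring R M\<^esub>"
    using g(2) lmod_hom_closed[OF fh] by (auto simp: End_ring_simps)
  moreover have "f \<otimes>\<^bsub>End_ring R M\<^esub> (\<lambda>x\<in>carrier M. g x) = \<one>\<^bsub>End_ring R M\<^esub>"
    using g(3) by (auto simp: End_ring_simps)
  ultimately show "f \<in> Units (End_ring R M)" unfolding Units_def using f by blast
qed

text \<open>
  If \<open>a + b\<close> is invertible with inverse \<open>v\<close>, then \<open>v a\<close> and \<open>v b\<close> add up to the identity, so one of them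
  is invertible.
\<close>

lemma local_ring_End_ring:
  assumes "local_module R M"
  shows "local_ring (End_ring R M)"
  unfolding local_ring_def
proof (intro conjI ballI notI)
  have M: "left_module R M" and ne: "carrier M \<noteq> {\<zero>\<^bsub>M\<^esub>}" using assms by (auto simp: local_module_def)
  interpret M: left_module R M by (rule M)
  show "ring (End_ring R M)" by (rule ring_End_ring[OF M])
  show False if "\<one>\<^bsub>End_ring R M\<^esub> = \<zero>\<^bsub>End_ring R M\<^esub>"
  proof -
    have "x = \<zero>\<^bsub>M\<^esub>" if x: "x \<in> carrier M" for x
      using fun_cong[OF \<open>\<one>\<^bsub>End_ring R M\<^esub> = \<zero>\<^bsub>End_ring R M\<^esub>\<close>, of x] x by (simp add: End_ring_simps)
    then show False using ne M.M.zero_closed by blast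
  qed
  fix a b assume a: "a \<in> carrier (End_ring R M) - Units (End_ring R M)"
    and b: "b \<in> carrier (End_ring R M) - Units (End_ring R M)"
    and u: "a \<oplus>\<^bsub>End_ring R M\<^esub> b \<in> Units (End_ring R M)"
  have ah: "a \<in> lmod_hom R M M" and bh: "b \<in> lmod_hom R M M" using a b by (auto simp: End_ring_simps)
  let ?u = "a \<oplus>\<^bsub>End_ring R M\<^esub> b"
  have uE: "?u \<in> carrier (End_ring R M)" using u by (simp add: Units_def)
  have uh: "?u \<in> lmod_hom R M M" using uE by (simp add: End_ring_simps)
  have ub: "bij_betw ?u (carrier M) (carrier M)" using Units_End_ring[OF M uE] u by blast
  have ux: "?u x = a x \<oplus>\<^bsub>M\<^esub> b x" if "x \<in> carrier M" for x using that by (simp add: End_ring_simps)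
  obtain v where v: "v \<in> lmod_hom R M M" "\<forall>x\<in>carrier M. v (?u x) = x" "\<forall>x\<in>carrier M. ?u (v x) = x"
    using bij_inverse_hom[OF M uh ub] by blast
  have cl: "\<And>x. x \<in> carrier M \<Longrightarrow> a x \<in> carrier M" "\<And>x. x \<in> carrier M \<Longrightarrow> b x \<in> carrier M" "\<And>x. x \<in> carrier M \<Longrightarrow> v x \<in> carrier M"
    using lmod_hom_closed[OF ah] lmod_hom_closed[OF bh] lmod_hom_closed[OF v(1)] by auto
  have va: "(\<lambda>x. v (a x)) \<in> lmod_hom R M M" by (rule lmod_hom_compose[OF ah v(1)])
  have vb: "x \<ominus>\<^bsub>M\<^esub> v (a x) = v (b x)" if x: "x \<in> carrier M" for x
  proof -
    have "x = v (a x) \<oplus>\<^bsub>M\<^esub> v (b x)" using v(2) x ux[OF x] lmod_hom_add[OF v(1) cl(1)[OF x] cl(2)[OF x]] by metis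
    then show ?thesis using M.M.add_diff_cancel_left[OF cl(3)[OF cl(1)[OF x]] cl(3)[OF cl(2)[OF x]]] by simp
  qed
  have bij: "bij_betw c (carrier M) (carrier M)" if "bij_betw (\<lambda>x. v (c x)) (carrier M) (carrier M)" "c \<in> lmod_hom R M M" for c
  proof -
    have "bij_betw (\<lambda>x. ?u (v (c x))) (carrier M) (carrier M)"
      using bij_betw_trans[OF that(1) ub] by (simp add: comp_def)
    moreover have "?u (v (c x)) = c x" if "x \<in> carrier M" for x
      using v(3) lmod_hom_closed[OF \<open>c \<in> lmod_hom R M M\<close> that] by blast
    ultimately show ?thesis by (simp cong: bij_betw_cong)
  qed
  have "bij_betw (\<lambda>x. v (a x)) (carrier M) (carrier M) \<or> bij_betw (\<lambda>x. x \<ominus>\<^bsub>M\<^esub> v (a x)) (carrier M) (carrier M)"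
    using assms va unfolding local_module_def by blast
  then have "bij_betw a (carrier M) (carrier M) \<or> bij_betw b (carrier M) (carrier M)"
    using bij[OF _ ah] bij[OF _ bh] vb by (auto cong: bij_betw_cong)
  then show False using Units_End_ring[OF M] a b by blast
qed

lemma funpow_kernel_mono:
  assumes M: "left_module R M" and f: "f \<in> lmod_hom R M M" and "a \<le> b"
  shows "a_kernel M M (f ^^ a) \<subseteq> a_kernel M M (f ^^ b)" "(f ^^ b) ` carrier M \<subseteq> (f ^^ a) ` carrier M"
proof -
  obtain c where c: "b = c + a" using assms(3) by (metis add.commute le_iff_add)
  note fn = lmod_hom_funpow[OF f]
  show "a_kernel M M (f ^^ a) \<subseteq> a_kernel M M (f ^^ b)"
    using lmod_hom_zero[OF fn M M] by (auto simp: a_kernel_iff c funpow_add)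
  have "(f ^^ b) x = (f ^^ a) ((f ^^ c) x)" for x unfolding c by (simp add: add.commute[of c a] funpow_add)
  then show "(f ^^ b) ` carrier M \<subseteq> (f ^^ a) ` carrier M" using lmod_hom_closed[OF fn] by auto
qed

text \<open>
  Fitting's lemma. For large \<open>n\<close> the kernels and the images of the powers of \<open>f\<close> are stationary, so the
  module is the direct sum of the kernel and the image of \<open>f^n\<close>. If the kernel vanishes, \<open>f\<close> is
  bijective. If the image vanishes, \<open>f\<close> is nilpotent and \<open>1 - f\<close> is bijective.
\<close>

lemma local_module_of_indecomposable:
  assumes M: "left_module R M" and fl: "finite_length R M" and ne: "carrier M \<noteq> {\<zero>\<^bsub>M\<^esub>}"
    and ind: "\<And>H K. \<lbrakk>submodule H R M; submodule K R M; H \<inter> K = {\<zero>\<^bsub>M\<^esub>}; H <+>\<^bsub>M\<^esub> K = carrier M\<rbrakk> \<Longrightarrow>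
      H = {\<zero>\<^bsub>M\<^esub>} \<or> K = {\<zero>\<^bsub>M\<^esub>}"
  shows "local_module R M"
  unfolding local_module_def
proof (intro conjI ballI M ne)
  interpret M: left_module R M by (rule M)
  fix f assume f: "f \<in> lmod_hom R M M"
  note fn = lmod_hom_funpow[OF f]
  let ?K = "\<lambda>n. a_kernel M M (f ^^ n)" and ?I = "\<lambda>n. (f ^^ n) ` carrier M"
  have sK: "submodule (?K n) R M" for n by (rule submodule_kernel[OF fn M M])
  have sI: "submodule (?I n) R M" for n by (rule submodule_image[OF fn M M submodule_carrier[OF M]])
  have "\<exists>H\<in>range ?K. \<forall>K\<in>range ?K. H \<subseteq> K \<longrightarrow> K = H"
    by (rule finite_length_maximal[OF fl M]) (use sK in auto)
  then have "\<exists>a. \<forall>n. ?K a \<subseteq> ?K n \<longrightarrow> ?K n = ?K a" by simp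
  then obtain a where "\<forall>n. ?K a \<subseteq> ?K n \<longrightarrow> ?K n = ?K a" by (elim exE)
  then have a: "\<And>n. ?K a \<subseteq> ?K n \<Longrightarrow> ?K n = ?K a" by simp
  have "\<exists>H\<in>range ?I. \<forall>K\<in>range ?I. K \<subseteq> H \<longrightarrow> K = H"
    by (rule finite_length_minimal[OF fl]) (use sI in auto)
  then have "\<exists>b. \<forall>n. ?I n \<subseteq> ?I b \<longrightarrow> ?I n = ?I b" by simp
  then obtain b where "\<forall>n. ?I n \<subseteq> ?I b \<longrightarrow> ?I n = ?I b" by (elim exE)
  then have b: "\<And>n. ?I n \<subseteq> ?I b \<Longrightarrow> ?I n = ?I b" by simp
  define n where "n = Suc (max a b)"
  have Kn: "?K (n + n) = ?K n"
    using a[OF funpow_kernel_mono(1)[OF M f, of a "n + n"]] a[OF funpow_kernel_mono(1)[OF M f, of a n]] by (simp add: n_def)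
  have In: "?I (n + n) = ?I n"
    using b[OF funpow_kernel_mono(2)[OF M f, of b "n + n"]] b[OF funpow_kernel_mono(2)[OF M f, of b n]] by (simp add: n_def)
  have fnn: "(f ^^ (n + n)) x = (f ^^ n) ((f ^^ n) x)" for x by (simp add: funpow_add)
  have "?K n \<inter> ?I n = {\<zero>\<^bsub>M\<^esub>}"
  proof (intro equalityI subsetI)
    fix x assume "x \<in> ?K n \<inter> ?I n"
    then obtain y where y: "y \<in> carrier M" "x = (f ^^ n) y" "(f ^^ n) x = \<zero>\<^bsub>M\<^esub>" by (auto simp: a_kernel_iff)
    then have "y \<in> ?K (n + n)" by (simp add: a_kernel_iff fnn)
    then have "y \<in> ?K n" unfolding Kn .
    then show "x \<in> {\<zero>\<^bsub>M\<^esub>}" using y(2) by (simp add: a_kernel_iff)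
  qed (use submodule_zero[OF sK] submodule_zero[OF sI] in blast)
  moreover have KI: "?K n <+>\<^bsub>M\<^esub> ?I n = carrier M"
  proof (intro equalityI subsetI)
    fix x assume x: "x \<in> carrier M"
    then have "(f ^^ n) x \<in> ?I (n + n)" unfolding In by blast
    then obtain y where y: "y \<in> carrier M" "(f ^^ n) x = (f ^^ n) ((f ^^ n) y)" unfolding fnn by blast
    have fy: "(f ^^ n) y \<in> carrier M" by (rule lmod_hom_closed[OF fn y(1)])
    have "(f ^^ n) (x \<ominus>\<^bsub>M\<^esub> (f ^^ n) y) = \<zero>\<^bsub>M\<^esub>"
      using lmod_hom_diff[OF fn M M x fy] y(2) M.M.diff_self[OF lmod_hom_closed[OF fn fy]] by simp
    then have "x \<ominus>\<^bsub>M\<^esub> (f ^^ n) y \<in> ?K n" using x fy by (simp add: a_kernel_iff)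
    then show "x \<in> ?K n <+>\<^bsub>M\<^esub> ?I n"
      using M.M.diff_add_cancel[OF x fy] y(1) unfolding set_add_iff by (metis imageI)
  qed (use set_add_least[OF submodule_carrier[OF M] submodule_subset[OF sK] submodule_subset[OF sI]] in blast)
  ultimately consider "?K n = {\<zero>\<^bsub>M\<^esub>}" | "?I n = {\<zero>\<^bsub>M\<^esub>}" using ind[OF sK sI] by blast
  then show "bij_betw f (carrier M) (carrier M) \<or> bij_betw (\<lambda>x. x \<ominus>\<^bsub>M\<^esub> f x) (carrier M) (carrier M)"
  proof cases
    case 1
    have "inj_on f (carrier M)"
    proof (rule inj_on_kernel[OF f M M])
      fix x assume "x \<in> carrier M" "f x = \<zero>\<^bsub>M\<^esub>"
      then have "x \<in> ?K 1" by (simp add: a_kernel_iff)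
      then have "x \<in> ?K n" using funpow_kernel_mono(1)[OF M f, of 1 n] by (auto simp: n_def)
      then show "x = \<zero>\<^bsub>M\<^esub>" unfolding 1 by simp
    qed
    moreover have "f ` carrier M = carrier M"
    proof (intro equalityI subsetI)
      fix x assume "x \<in> carrier M"
      then obtain k y where "k \<in> ?K n" "y \<in> ?I n" "x = k \<oplus>\<^bsub>M\<^esub> y" using set_add_eqD[OF KI] by blast
      then have "x \<in> ?I n" using 1 submodule_mem[OF sI] by simp
      then have "x \<in> ?I 1" using funpow_kernel_mono(2)[OF M f, of 1 n] by (auto simp: n_def)
      then show "x \<in> f ` carrier M" by simp
    qed (use lmod_hom_closed[OF f] in blast)
    ultimately show ?thesis by (simp add: bij_betw_def)
  next
    case 2
    let ?g = "\<lambda>x. x \<ominus>\<^bsub>M\<^esub> f x"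
    have g: "?g \<in> lmod_hom R M M" by (rule lmod_hom_difference[OF lmod_hom_id f M])
    have fg: "\<forall>x\<in>carrier M. f x \<oplus>\<^bsub>M\<^esub> ?g x = x" using M.M.add_diff_cancel lmod_hom_closed[OF f] by simp
    have f0: "(f ^^ n) x = \<zero>\<^bsub>M\<^esub>" if "x \<in> carrier M" for x using 2 that by blast
    have "inj_on ?g (carrier M)"
    proof (rule inj_on_kernel[OF g M M])
      fix x assume x: "x \<in> carrier M" "?g x = \<zero>\<^bsub>M\<^esub>"
      then have "(?g ^^ 1) x = \<zero>\<^bsub>M\<^esub>" by simp
      then show "x = \<zero>\<^bsub>M\<^esub>" by (rule complementary_hom_coprime(2)[OF M f g fg x(1) f0[OF x(1)]])
    qed
    moreover have "?g ` carrier M = carrier M"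
    proof (intro equalityI subsetI)
      fix x assume x: "x \<in> carrier M"
      obtain u v where "u \<in> carrier M" "v \<in> carrier M" "x = (f ^^ n) u \<oplus>\<^bsub>M\<^esub> (?g ^^ 1) v"
        using complementary_hom_coprime(1)[OF M f g fg x, of n 1] by blast
      then have "x = ?g v" using f0 lmod_hom_closed[OF g] by simp
      then show "x \<in> ?g ` carrier M" using \<open>v \<in> carrier M\<close> by blast
    qed (use lmod_hom_closed[OF g] in blast)
    ultimately show ?thesis by (simp add: bij_betw_def)
  qed
qed

lemma dsum_cong:
  assumes "\<And>i. i \<in> I \<Longrightarrow> A i = B i"
  shows "dsum I A = dsum I B"
proof -
  have "{i \<in> I. f i \<noteq> \<zero>\<^bsub>A i\<^esub>} = {i \<in> I. f i \<noteq> \<zero>\<^bsub>B i\<^esub>}" for f using assms by auto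
  moreover have "(\<Pi>\<^sub>E i\<in>I. carrier (A i)) = (\<Pi>\<^sub>E i\<in>I. carrier (B i))" using assms by (intro PiE_cong) simp
  ultimately show ?thesis unfolding dsum_def using assms by (auto simp: fun_eq_iff restrict_def)
qed

lemma dsum_finite_carrier:
  "finite I \<Longrightarrow> carrier (dsum I A) = (\<Pi>\<^sub>E i\<in>I. carrier (A i))"
  by (auto simp: dsum_def)

lemma dsum_empty: "carrier (dsum {} A) = {\<zero>\<^bsub>dsum {} A\<^esub>}"
  by (auto simp: dsum_def)

lemma dsum_Suc: "lmod_iso R (dsum {..<Suc k} A) (dsum2 (dsum {..<k} A) (A k))"
proof (rule lmod_isoI_inverse)
  let ?f = "\<lambda>f. (restrict f {..<k}, f k)"
  let ?g = "\<lambda>(f, x). \<lambda>i\<in>{..<Suc k}. if i = k then x else f i"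
  have fin: "finite {..<k}" "finite {..<Suc k}" by simp_all
  note c = dsum_finite_carrier[OF fin(1)] dsum_finite_carrier[OF fin(2)]
  show "?f \<in> lmod_hom R (dsum {..<Suc k} A) (dsum2 (dsum {..<k} A) (A k))"
  proof (rule lmod_homI)
    show "?f f \<in> carrier (dsum2 (dsum {..<k} A) (A k))" if "f \<in> carrier (dsum {..<Suc k} A)" for f
      using that by (auto simp: c PiE_iff)
  qed (auto intro!: ext simp: restrict_def)
  show "?g \<in> lmod_hom R (dsum2 (dsum {..<k} A) (A k)) (dsum {..<Suc k} A)"
  proof (rule lmod_homI)
    show "?g w \<in> carrier (dsum {..<Suc k} A)" if w: "w \<in> carrier (dsum2 (dsum {..<k} A) (A k))" for w
    proof -
      obtain f x where fx: "w = (f, x)" "\<And>i. i < k \<Longrightarrow> f i \<in> carrier (A i)" "x \<in> carrier (A k)"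
        using w by (auto simp: c PiE_iff)
      have "(\<lambda>i\<in>{..<Suc k}. if i = k then x else f i) \<in> (\<Pi>\<^sub>E i\<in>{..<Suc k}. carrier (A i))"
        by (rule restrict_PiE_iff[THEN iffD2]) (use fx in \<open>auto simp: less_Suc_eq\<close>)
      then show ?thesis by (simp add: fx(1) c)
    qed
  qed (auto simp: fun_eq_iff restrict_def)
  show "?g (?f f) = f" if f: "f \<in> carrier (dsum {..<Suc k} A)" for f
  proof (rule extensionalityI[of _ "{..<Suc k}"])
    show "f \<in> extensional {..<Suc k}" using f by (simp add: c PiE_iff)
  qed (auto simp: less_Suc_eq)
  show "?f (?g w) = w" if w: "w \<in> carrier (dsum2 (dsum {..<k} A) (A k))" for w
  proof -
    obtain f x where fx: "w = (f, x)" "f \<in> extensional {..<k}" using w by (auto simp: c PiE_iff)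
    have "restrict (\<lambda>i\<in>{..<Suc k}. if i = k then x else f i) {..<k} = f"
      by (rule extensionalityI[of _ "{..<k}"]) (auto simp: fx(2))
    then show ?thesis by (simp add: fx(1))
  qed
qed

lemma lmod_iso_zero:
  assumes "left_module R N" "carrier M = {\<zero>\<^bsub>M\<^esub>}" "carrier N = {\<zero>\<^bsub>N\<^esub>}" "left_module R M"
  shows "lmod_iso R M N"
  using lmod_hom_const_zero[OF assms(1), of M] by (rule lmod_isoI) (simp add: assms bij_betw_def)

lemma dsum2_zero_left:
  assumes "left_module R M" "left_module R N" "carrier M = {\<zero>\<^bsub>M\<^esub>}"
  shows "lmod_iso R (dsum2 M N) N"
  by (rule lmod_isoI[OF lmod_hom_snd]) (auto simp: bij_betw_def inj_on_def assms(3) image_iff)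

lemma dsum_singleton:
  fixes A :: "'i \<Rightarrow> ('r, 'm) module"
  assumes "left_module R (A i)"
  shows "lmod_iso R (A i) (dsum {i} A)"
proof -
  interpret left_module R "A i" by fact
  have c: "carrier (dsum {i} A) = (\<Pi>\<^sub>E j\<in>{i}. carrier (A j))" by (rule dsum_finite_carrier) simp
  show ?thesis
  proof (rule lmod_isoI_inverse)
    show "(\<lambda>x. \<lambda>j\<in>{i}. x) \<in> lmod_hom R (A i) (dsum {i} A)"
    proof (rule lmod_homI)
      show "(\<lambda>j\<in>{i}. x) \<in> carrier (dsum {i} A)" if "x \<in> carrier (A i)" for x using that by (auto simp: c)
    qed (auto simp: fun_eq_iff restrict_def)
    show "(\<lambda>f. f i) \<in> lmod_hom R (dsum {i} A) (A i)"
      by (rule lmod_homI) (auto simp: c)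
    show "(\<lambda>j\<in>{i}. f i) = f" if "f \<in> carrier (dsum {i} A)" for f
      by (rule extensionalityI[of _ "{i}"]) (use that in \<open>auto simp: c PiE_iff\<close>)
  qed simp
qed

lemma dsum_append:
  fixes k l :: nat
  assumes "\<And>i. i < k \<Longrightarrow> left_module R (A i)" "\<And>i. i < l \<Longrightarrow> left_module R (B i)" "ring R"
  shows "lmod_iso R (dsum {..<k + l} (\<lambda>i. if i < k then A i else B (i - k))) (dsum2 (dsum {..<k} A) (dsum {..<l} B))"
  using assms(2)
proof (induction l)
  case 0
  have e: "dsum {..<k} (\<lambda>i. if i < k then A i else B (i - k)) = dsum {..<k} A" by (rule dsum_cong) simp
  have A: "left_module R (dsum {..<k} A)" by (rule left_module_dsum[OF assms(3)]) (use assms(1) in simp)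
  have Z: "left_module R (dsum {..<0} B)" by (rule left_module_dsum[OF assms(3)]) simp
  have "lmod_iso R (dsum2 (dsum {..<0} B) (dsum {..<k} A)) (dsum {..<k} A)"
    by (rule dsum2_zero_left[OF Z A]) (simp add: dsum_empty del: dsum_simps)
  then have "lmod_iso R (dsum {..<k} A) (dsum2 (dsum {..<0} B) (dsum {..<k} A))"
    by (rule lmod_iso_sym[OF _ left_module_dsum2[OF Z A]])
  then show ?case using lmod_iso_trans[OF _ dsum2_commute] e by simp
next
  case (Suc l)
  let ?C = "\<lambda>i. if i < k then A i else B (i - k)"
  have A: "left_module R (dsum {..<k} A)" by (rule left_module_dsum[OF assms(3)]) (use assms(1) in simp)
  have B: "left_module R (dsum {..<Suc l} B)" by (rule left_module_dsum[OF assms(3)]) (use Suc.prems in simp)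
  have IH: "lmod_iso R (dsum {..<k + l} ?C) (dsum2 (dsum {..<k} A) (dsum {..<l} B))" using Suc by simp
  have "lmod_iso R (dsum {..<k + Suc l} ?C) (dsum2 (dsum {..<k + l} ?C) (B l))"
    using dsum_Suc[of R "k + l" ?C] by simp
  then have "lmod_iso R (dsum {..<k + Suc l} ?C) (dsum2 (dsum2 (dsum {..<k} A) (dsum {..<l} B)) (B l))"
    by (rule lmod_iso_trans[OF _ dsum2_cong[OF IH lmod_iso_refl]])
  then have "lmod_iso R (dsum {..<k + Suc l} ?C) (dsum2 (dsum {..<k} A) (dsum2 (dsum {..<l} B) (B l)))"
    by (rule lmod_iso_trans[OF _ dsum2_assoc])
  then show ?case
    by (rule lmod_iso_trans[OF _ dsum2_cong[OF lmod_iso_refl lmod_iso_sym[OF dsum_Suc B]]])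
qed

definition finite_sum_of :: "('r, 'x) ring_scheme \<Rightarrow> (('r, 'u) module \<Rightarrow> bool) \<Rightarrow> ('r, 'm) module \<Rightarrow> bool"
  where "finite_sum_of R Q X \<longleftrightarrow> (\<exists>(k::nat) A. (\<forall>i<k. Q (A i)) \<and> lmod_iso R X (dsum {..<k} A))"

lemma finite_sum_of_iso: "\<lbrakk>finite_sum_of R Q Y; lmod_iso R X Y\<rbrakk> \<Longrightarrow> finite_sum_of R Q X"
  unfolding finite_sum_of_def using lmod_iso_trans by blast

lemma finite_sum_of_mono: "\<lbrakk>finite_sum_of R Q X; \<And>A. Q A \<Longrightarrow> Q' A\<rbrakk> \<Longrightarrow> finite_sum_of R Q' X"
  unfolding finite_sum_of_def by blast

lemma finite_sum_of_zero:
  assumes "left_module R X" "carrier X = {\<zero>\<^bsub>X\<^esub>}"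
  shows "finite_sum_of R Q X"
proof -
  have R: "ring R" using assms(1) by (simp add: left_module_def)
  have "lmod_iso R X (dsum {..<0} (undefined :: nat \<Rightarrow> ('a, 'd) module))"
    by (rule lmod_iso_zero[OF left_module_dsum[OF R] assms(2) _ assms(1)]) (simp_all add: dsum_empty del: dsum_simps)
  then show ?thesis unfolding finite_sum_of_def by (intro exI[of _ 0] exI[of _ undefined]) simp
qed

lemma finite_sum_of_single:
  assumes "left_module R X" "Q X"
  shows "finite_sum_of R Q X"
  using dsum_singleton[of R "\<lambda>_. X" 0] assms unfolding finite_sum_of_def
  by (intro exI[of _ 1] exI[of _ "\<lambda>_. X"] conjI) (simp_all add: lessThan_Suc)

lemma finite_sum_of_dsum2:
  assumes R: "ring R" and Q: "\<And>A. Q A \<Longrightarrow> left_module R A"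
    and X: "finite_sum_of R Q X" and Y: "finite_sum_of R Q Y"
  shows "finite_sum_of R Q (dsum2 X Y)"
proof -
  obtain k :: nat and A where A: "\<forall>i<k. Q (A i)" "lmod_iso R X (dsum {..<k} A)"
    using X unfolding finite_sum_of_def by blast
  obtain l :: nat and B where B: "\<forall>i<l. Q (B i)" "lmod_iso R Y (dsum {..<l} B)"
    using Y unfolding finite_sum_of_def by blast
  let ?C = "\<lambda>i. if i < k then A i else B (i - k)"
  have Al: "left_module R (A i)" if "i < k" for i using A(1) Q that by blast
  have Bl: "left_module R (B i)" if "i < l" for i using B(1) Q that by blast
  have Cl: "left_module R (?C i)" if "i < k + l" for i using Al[of i] Bl[of "i - k"] that by auto
  have C: "lmod_iso R (dsum {..<k + l} ?C) (dsum2 (dsum {..<k} A) (dsum {..<l} B))"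
    by (rule dsum_append[OF Al Bl R])
  have lC: "left_module R (dsum {..<k + l} ?C)" by (rule left_module_dsum[OF R]) (use Cl in simp)
  have "lmod_iso R (dsum2 X Y) (dsum {..<k + l} ?C)"
    by (rule lmod_iso_trans[OF dsum2_cong[OF A(2) B(2)] lmod_iso_sym[OF C lC]])
  moreover have "\<forall>i<k + l. Q (?C i)" using A(1) B(1) by auto
  ultimately show ?thesis unfolding finite_sum_of_def by (intro exI[of _ "k + l"] exI[of _ ?C] conjI)
qed

lemma finite_sum_of_dsum:
  assumes R: "ring R" and Q: "\<And>A. Q A \<Longrightarrow> left_module R A"
    and A: "\<And>i. i < (k::nat) \<Longrightarrow> finite_sum_of R Q (A i)"
  shows "finite_sum_of R Q (dsum {..<k} A)"
  using A
proof (induction k)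
  case 0
  have "left_module R (dsum {..<0} A)" by (rule left_module_dsum[OF R]) simp
  then show ?case by (rule finite_sum_of_zero) (simp add: dsum_empty del: dsum_simps)
next
  case (Suc k)
  then have "finite_sum_of R Q (dsum2 (dsum {..<k} A) (A k))"
    by (intro finite_sum_of_dsum2[OF R Q]) auto
  then show ?case by (rule finite_sum_of_iso[OF _ dsum_Suc])
qed

lemma internal_dsum_iso:
  assumes M: "left_module R M" and H: "submodule H R M" and K: "submodule K R M"
    and HK: "H \<inter> K = {\<zero>\<^bsub>M\<^esub>}" "H <+>\<^bsub>M\<^esub> K = carrier M"
  shows "lmod_iso R (dsum2 (M\<lparr>carrier := H\<rparr>) (M\<lparr>carrier := K\<rparr>)) M"
proof -
  interpret M: left_module R M by (rule M)
  note lH = left_module_submodule[OF M H] and lK = left_module_submodule[OF M K]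
  let ?D = "dsum2 (M\<lparr>carrier := H\<rparr>) (M\<lparr>carrier := K\<rparr>)"
  let ?f = "\<lambda>(x, y). x \<oplus>\<^bsub>M\<^esub> y"
  have f: "?f \<in> lmod_hom R ?D M"
    by (rule lmod_hom_copair[OF lmod_hom_incl[OF submodule_subset[OF H]] lmod_hom_incl[OF submodule_subset[OF K]] M])
  have "inj_on ?f (carrier ?D)"
  proof (rule inj_on_kernel[OF f left_module_dsum2[OF lH lK] M])
    fix w assume w: "w \<in> carrier ?D" "?f w = \<zero>\<^bsub>M\<^esub>"
    then obtain x y where xy: "w = (x, y)" "x \<in> H" "y \<in> K" "x \<oplus>\<^bsub>M\<^esub> y = \<zero>\<^bsub>M\<^esub>" by auto
    have c: "x \<in> carrier M" "y \<in> carrier M" using xy submodule_mem[OF H] submodule_mem[OF K] by auto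
    have "x = \<ominus>\<^bsub>M\<^esub> y" using M.M.minus_equality[OF xy(4) c(2,1)] by simp
    then have "x \<in> H \<inter> K" using xy submodule_neg[OF K] by simp
    then have x0: "x = \<zero>\<^bsub>M\<^esub>" using HK(1) by simp
    then have "y = \<zero>\<^bsub>M\<^esub>" using xy(4) c by simp
    then show "w = \<zero>\<^bsub>?D\<^esub>" using xy(1) x0 by simp
  qed
  moreover have "?f ` carrier ?D = carrier M"
  proof (intro equalityI subsetI)
    fix x assume "x \<in> carrier M"
    then obtain h k where "h \<in> H" "k \<in> K" "x = h \<oplus>\<^bsub>M\<^esub> k" using set_add_eqD[OF HK(2)] by blast
    then show "x \<in> ?f ` carrier ?D" by (intro image_eqI[of _ _ "(h, k)"]) auto
  qed (use lmod_hom_closed[OF f] in blast)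
  ultimately show ?thesis by (intro lmod_isoI[OF f]) (simp add: bij_betw_def)
qed

lemma direct_summand_left_module: "direct_summand R A M \<Longrightarrow> left_module R A"
  by (simp add: direct_summand_def)

lemma direct_summand_trans:
  assumes "direct_summand R A B" "direct_summand R B M" "left_module R M"
  shows "direct_summand R A M"
proof -
  note A = direct_summand_left_module[OF assms(1)] and B = direct_summand_left_module[OF assms(2)]
  obtain s r where sr: "s \<in> lmod_hom R A B" "r \<in> lmod_hom R B A" "\<forall>x\<in>carrier A. r (s x) = x"
    using direct_summand_retract[OF assms(1) B] by blast
  obtain s' r' where sr': "s' \<in> lmod_hom R B M" "r' \<in> lmod_hom R M B" "\<forall>x\<in>carrier B. r' (s' x) = x"
    using direct_summand_retract[OF assms(2,3)] by blast
  show ?thesis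
    by (rule direct_summandI[OF A assms(3) lmod_hom_compose[OF sr(1) sr'(1)] lmod_hom_compose[OF sr'(2) sr(2)]])
      (use sr(3) sr'(3) lmod_hom_closed[OF sr(1)] in simp)
qed

lemma direct_summand_iso:
  assumes "lmod_iso R A M" "left_module R A" "left_module R M"
  shows "direct_summand R A M"
proof -
  obtain f g where fg: "f \<in> lmod_hom R A M" "g \<in> lmod_hom R M A" "\<forall>x\<in>carrier A. g (f x) = x"
    using lmod_iso_inverse[OF assms(1,2)] by blast
  then show ?thesis using direct_summandI[OF assms(2,3) fg(1,2)] by blast
qed

lemma direct_summand_dsum2:
  assumes "left_module R A" "left_module R B"
  shows "direct_summand R A (dsum2 A B)"
  by (rule direct_summandI[OF assms(1) left_module_dsum2[OF assms] lmod_hom_inl[OF assms(2)] lmod_hom_fst]) simp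

lemma finite_length_iso:
  assumes iso: "lmod_iso R M N" and fl: "finite_length R N" and M: "left_module R M" and N: "left_module R N"
  shows "finite_length R M"
proof -
  obtain f where f: "f \<in> lmod_hom R M N" "bij_betw f (carrier M) (carrier N)"
    using iso by (auto simp: lmod_iso_def)
  obtain \<mu> :: "_ set \<Rightarrow> nat" where \<mu>: "\<forall>H K. submodule H R N \<longrightarrow> submodule K R N \<longrightarrow> H \<subset> K \<longrightarrow> \<mu> H < \<mu> K"
    using fl unfolding finite_length_def by (elim exE)
  have inj: "inj_on f (carrier M)" using f(2) by (simp add: bij_betw_def)
  have "\<mu> (f ` H) < \<mu> (f ` K)" if "submodule H R M" "submodule K R M" "H \<subset> K" for H K
  proof -
    have "f ` H \<subset> f ` K"
      using that inj_on_image_eq_iff[OF inj submodule_subset[OF that(1)] submodule_subset[OF that(2)]] by blast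
    then show ?thesis using \<mu> submodule_image[OF f(1) M N that(1)] submodule_image[OF f(1) M N that(2)] by blast
  qed
  then show ?thesis unfolding finite_length_def by (intro exI[of _ "\<lambda>H. \<mu> (f ` H)"]) blast
qed

lemma finite_length_direct_summand:
  assumes "direct_summand R A M" "finite_length R M" "left_module R M"
  shows "finite_length R A"
proof -
  obtain H where H: "submodule H R M" "lmod_iso R A (M\<lparr>carrier := H\<rparr>)" and A: "left_module R A"
    using assms(1) unfolding direct_summand_def by blast
  show ?thesis
    by (rule finite_length_iso[OF H(2) finite_length_submodule[OF assms(2,3) H(1)] A left_module_submodule[OF assms(3) H(1)]])
qed

lemma finite_length_decomposition:
  fixes M :: "('r, 'u) module"
  assumes fl: "finite_length R M" and M: "left_module R M"
  shows "finite_sum_of R (\<lambda>A :: ('r, 'u) module. local_module R A \<and> direct_summand R A M) M"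
proof -
  interpret M: left_module R M by (rule M)
  let ?Q = "\<lambda>A :: ('r, 'u) module. local_module R A \<and> direct_summand R A M"
  obtain \<mu> :: "_ set \<Rightarrow> nat" where \<mu>: "\<forall>H K. submodule H R M \<longrightarrow> submodule K R M \<longrightarrow> H \<subset> K \<longrightarrow> \<mu> H < \<mu> K"
    using fl unfolding finite_length_def by (elim exE)
  have "\<lbrakk>submodule H R M; direct_summand R (M\<lparr>carrier := H\<rparr>) M\<rbrakk> \<Longrightarrow> finite_sum_of R ?Q (M\<lparr>carrier := H\<rparr>)" for H
  proof (induction "\<mu> H" arbitrary: H rule: less_induct)
    case less
    let ?H = "M\<lparr>carrier := H\<rparr>"
    have lH: "left_module R ?H" by (rule left_module_submodule[OF M less.prems(1)])
    show ?case
    proof (cases "H = {\<zero>\<^bsub>M\<^esub>}")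
      case True
      then show ?thesis by (intro finite_sum_of_zero lH) simp
    next
      case False
      show ?thesis
      proof (cases "\<exists>A B. submodule A R ?H \<and> submodule B R ?H \<and> A \<inter> B = {\<zero>\<^bsub>?H\<^esub>} \<and>
          A <+>\<^bsub>?H\<^esub> B = carrier ?H \<and> A \<noteq> {\<zero>\<^bsub>?H\<^esub>} \<and> B \<noteq> {\<zero>\<^bsub>?H\<^esub>}")
        case False
        then have "local_module R ?H"
          using \<open>H \<noteq> {\<zero>\<^bsub>M\<^esub>}\<close> lH finite_length_submodule[OF fl M less.prems(1)]
          by (intro local_module_of_indecomposable) auto
        then show ?thesis using less.prems(2) by (intro finite_sum_of_single lH) simp
      next
        case True
        then obtain A B where AB: "submodule A R ?H" "submodule B R ?H" "A \<inter> B = {\<zero>\<^bsub>?H\<^esub>}"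
          "A <+>\<^bsub>?H\<^esub> B = carrier ?H" "A \<noteq> {\<zero>\<^bsub>?H\<^esub>}" "B \<noteq> {\<zero>\<^bsub>?H\<^esub>}" by blast
        have sAB: "submodule A R M" "A \<subseteq> H" "submodule B R M" "B \<subseteq> H"
          using AB(1,2) submodule_trans[OF M less.prems(1)] by auto
        have "A \<noteq> H"
        proof
          assume "A = H"
          then have "B = {\<zero>\<^bsub>?H\<^esub>}" using AB(3) sAB(4) submodule_zero[OF AB(2)] by auto
          then show False using AB(6) by simp
        qed
        have "B \<noteq> H"
        proof
          assume "B = H"
          then have "A = {\<zero>\<^bsub>?H\<^esub>}" using AB(3) sAB(2) submodule_zero[OF AB(1)] by auto
          then show False using AB(5) by simp
        qed
        have iso: "lmod_iso R (dsum2 (M\<lparr>carrier := A\<rparr>) (M\<lparr>carrier := B\<rparr>)) ?H"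
          using internal_dsum_iso[OF lH AB(1-4)] by simp
        have lA: "left_module R (M\<lparr>carrier := A\<rparr>)" and lB: "left_module R (M\<lparr>carrier := B\<rparr>)"
          using left_module_submodule[OF M] sAB by auto
        note lD = left_module_dsum2[OF lA lB]
        have dH: "direct_summand R (dsum2 (M\<lparr>carrier := A\<rparr>) (M\<lparr>carrier := B\<rparr>)) ?H"
          by (rule direct_summand_iso[OF iso lD lH])
        have dA: "direct_summand R (M\<lparr>carrier := A\<rparr>) ?H"
          by (rule direct_summand_trans[OF direct_summand_dsum2[OF lA lB] dH lH])
        have "direct_summand R (M\<lparr>carrier := B\<rparr>) (dsum2 (M\<lparr>carrier := A\<rparr>) (M\<lparr>carrier := B\<rparr>))"
          by (rule direct_summand_trans[OF direct_summand_dsum2[OF lB lA]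
                direct_summand_iso[OF dsum2_commute left_module_dsum2[OF lB lA] lD] lD])
        then have dB: "direct_summand R (M\<lparr>carrier := B\<rparr>) ?H" by (rule direct_summand_trans[OF _ dH lH])
        have "finite_sum_of R ?Q (M\<lparr>carrier := A\<rparr>)"
          using \<mu> sAB less.prems(1) \<open>A \<noteq> H\<close> direct_summand_trans[OF dA less.prems(2) M] by (intro less.hyps) auto
        moreover have "finite_sum_of R ?Q (M\<lparr>carrier := B\<rparr>)"
          using \<mu> sAB less.prems(1) \<open>B \<noteq> H\<close> direct_summand_trans[OF dB less.prems(2) M] by (intro less.hyps) auto
        ultimately have "finite_sum_of R ?Q (dsum2 (M\<lparr>carrier := A\<rparr>) (M\<lparr>carrier := B\<rparr>))"
          by (intro finite_sum_of_dsum2) (auto simp: M.R.ring_axioms direct_summand_left_module)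
        then show ?thesis by (rule finite_sum_of_iso[OF _ lmod_iso_sym[OF iso lD]])
      qed
    qed
  qed
  from this[OF submodule_carrier[OF M]] show ?thesis
    using direct_summand_iso[OF lmod_iso_refl M M] by simp
qed

text \<open>
  The exchange property of modules with local endomorphism ring: the identity of \<open>X\<close> is the sum of
  its components through \<open>A\<close> and \<open>B\<close>, so one of these is invertible.
\<close>

lemma local_module_exchange:
  assumes X: "local_module R X" and A: "left_module R A" and B: "left_module R B"
    and d: "direct_summand R X (dsum2 A B)"
  shows "direct_summand R X A \<or> direct_summand R X B"
proof -
  have lX: "left_module R X" using X by (simp add: local_module_def)
  interpret X: left_module R X by (rule lX)
  interpret A: left_module R A by (rule A)
  interpret B: left_module R B by (rule B)
  obtain s r where s: "s \<in> lmod_hom R X (dsum2 A B)" and r: "r \<in> lmod_hom R (dsum2 A B) X" and rs: "\<forall>x\<in>carrier X. r (s x) = x"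
    using direct_summand_retract[OF d left_module_dsum2[OF A B]] by blast
  have s1: "(\<lambda>x. fst (s x)) \<in> lmod_hom R X A" by (rule lmod_hom_compose[OF s lmod_hom_fst])
  have s2: "(\<lambda>x. snd (s x)) \<in> lmod_hom R X B" by (rule lmod_hom_compose[OF s lmod_hom_snd])
  have r1: "(\<lambda>a. r (a, \<zero>\<^bsub>B\<^esub>)) \<in> lmod_hom R A X" by (rule lmod_hom_compose[OF lmod_hom_inl[OF B] r])
  have r2: "(\<lambda>b. r (\<zero>\<^bsub>A\<^esub>, b)) \<in> lmod_hom R B X" by (rule lmod_hom_compose[OF lmod_hom_inr[OF A] r])
  note f = lmod_hom_compose[OF s1 r1] and g = lmod_hom_compose[OF s2 r2]
  have fg: "x \<ominus>\<^bsub>X\<^esub> r (fst (s x), \<zero>\<^bsub>B\<^esub>) = r (\<zero>\<^bsub>A\<^esub>, snd (s x))" if x: "x \<in> carrier X" for x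
  proof -
    have c: "fst (s x) \<in> carrier A" "snd (s x) \<in> carrier B" using lmod_hom_closed[OF s x] by auto
    have "(fst (s x), \<zero>\<^bsub>B\<^esub>) \<oplus>\<^bsub>dsum2 A B\<^esub> (\<zero>\<^bsub>A\<^esub>, snd (s x)) = s x" using c by simp
    then have "r (fst (s x), \<zero>\<^bsub>B\<^esub>) \<oplus>\<^bsub>X\<^esub> r (\<zero>\<^bsub>A\<^esub>, snd (s x)) = x"
      using lmod_hom_add[OF r, of "(fst (s x), \<zero>\<^bsub>B\<^esub>)" "(\<zero>\<^bsub>A\<^esub>, snd (s x))"] c rs x by simp
    then show ?thesis
      using X.M.add_diff_cancel_left[OF lmod_hom_closed[OF f x] lmod_hom_closed[OF g x]] by simp
  qed
  have "bij_betw (\<lambda>x. r (fst (s x), \<zero>\<^bsub>B\<^esub>)) (carrier X) (carrier X) \<or>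
      bij_betw (\<lambda>x. x \<ominus>\<^bsub>X\<^esub> r (fst (s x), \<zero>\<^bsub>B\<^esub>)) (carrier X) (carrier X)"
    using X f unfolding local_module_def by blast
  then have "bij_betw (\<lambda>x. r (fst (s x), \<zero>\<^bsub>B\<^esub>)) (carrier X) (carrier X) \<or>
      bij_betw (\<lambda>x. r (\<zero>\<^bsub>A\<^esub>, snd (s x))) (carrier X) (carrier X)"
    using fg by (simp cong: bij_betw_cong)
  then show ?thesis
  proof
    assume bij: "bij_betw (\<lambda>x. r (fst (s x), \<zero>\<^bsub>B\<^esub>)) (carrier X) (carrier X)"
    obtain v where v: "v \<in> lmod_hom R X X" "\<forall>x\<in>carrier X. v (r (fst (s x), \<zero>\<^bsub>B\<^esub>)) = x"
      using bij_inverse_hom[OF lX f bij] by blast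
    show ?thesis
      by (rule disjI1, rule direct_summandI[OF lX A s1 lmod_hom_compose[OF r1 v(1)]]) (use v(2) in simp)
  next
    assume bij: "bij_betw (\<lambda>x. r (\<zero>\<^bsub>A\<^esub>, snd (s x))) (carrier X) (carrier X)"
    obtain v where v: "v \<in> lmod_hom R X X" "\<forall>x\<in>carrier X. v (r (\<zero>\<^bsub>A\<^esub>, snd (s x))) = x"
      using bij_inverse_hom[OF lX g bij] by blast
    show ?thesis
      by (rule disjI2, rule direct_summandI[OF lX B s2 lmod_hom_compose[OF r2 v(1)]]) (use v(2) in simp)
  qed
qed

lemma local_module_exchange_dsum:
  assumes X: "local_module R X" and R: "ring R"
  shows "\<lbrakk>\<And>i. i < (k::nat) \<Longrightarrow> left_module R (A i); direct_summand R X (dsum {..<k} A)\<rbrakk> \<Longrightarrow> \<exists>i<k. direct_summand R X (A i)"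
proof (induction k)
  case 0
  have lX: "left_module R X" using X by (simp add: local_module_def)
  have D: "left_module R (dsum {..<0} A)" by (rule left_module_dsum[OF R]) simp
  obtain s r where s: "s \<in> lmod_hom R X (dsum {..<0} A)" and r: "r \<in> lmod_hom R (dsum {..<0} A) X" and rs: "\<forall>x\<in>carrier X. r (s x) = x"
    using direct_summand_retract[OF 0(2) D] by blast
  have "x = \<zero>\<^bsub>X\<^esub>" if "x \<in> carrier X" for x
  proof -
    have "s x \<in> carrier (dsum {} A)" using lmod_hom_closed[OF s that] by simp
    then have "s x = \<zero>\<^bsub>dsum {..<0} A\<^esub>" unfolding dsum_empty by (simp del: dsum_simps)
    then have "r (s x) = \<zero>\<^bsub>X\<^esub>" using lmod_hom_zero[OF r D lX] by (simp only:)
    then show ?thesis using rs that by simp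
  qed
  then have "carrier X = {\<zero>\<^bsub>X\<^esub>}" using zero_mem_carrier[OF lX] by blast
  then show ?case using X by (simp add: local_module_def)
next
  case (Suc k)
  have D: "left_module R (dsum {..<k} A)" by (rule left_module_dsum[OF R]) (use Suc.prems(1) in simp)
  have D': "left_module R (dsum {..<Suc k} A)" by (rule left_module_dsum[OF R]) (use Suc.prems(1) in simp)
  have Ak: "left_module R (A k)" using Suc.prems(1) by simp
  have "direct_summand R X (dsum2 (dsum {..<k} A) (A k))"
    by (rule direct_summand_trans[OF Suc.prems(2) direct_summand_iso[OF dsum_Suc D' left_module_dsum2[OF D Ak]]
          left_module_dsum2[OF D Ak]])
  then have "direct_summand R X (dsum {..<k} A) \<or> direct_summand R X (A k)"
    by (rule local_module_exchange[OF X D Ak])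
  then show ?case
  proof
    assume "direct_summand R X (dsum {..<k} A)"
    then obtain i where "i < k" "direct_summand R X (A i)" using Suc.IH Suc.prems(1) by auto
    then show ?thesis by (intro exI[of _ i]) simp
  qed auto
qed

text \<open>
  Let \<open>e\<close> be the projection of \<open>B\<close> to \<open>X\<close>. As \<open>1 - e\<close> vanishes on the nonzero image of \<open>X\<close>, it is not
  invertible. So \<open>e\<close> is.
\<close>

lemma local_module_summand_iso:
  assumes X: "local_module R X" and B: "local_module R B" and d: "direct_summand R X B"
  shows "lmod_iso R X B"
proof -
  have lX: "left_module R X" and lB: "left_module R B" using X B by (auto simp: local_module_def)
  interpret X: left_module R X by (rule lX)
  interpret B: left_module R B by (rule lB)
  obtain s r where s: "s \<in> lmod_hom R X B" and r: "r \<in> lmod_hom R B X" and rs: "\<forall>x\<in>carrier X. r (s x) = x"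
    using direct_summand_retract[OF d lB] by blast
  have e: "(\<lambda>x. s (r x)) \<in> lmod_hom R B B" by (rule lmod_hom_compose[OF r s])
  have "\<not> bij_betw (\<lambda>x. x \<ominus>\<^bsub>B\<^esub> s (r x)) (carrier B) (carrier B)"
  proof
    assume "bij_betw (\<lambda>x. x \<ominus>\<^bsub>B\<^esub> s (r x)) (carrier B) (carrier B)"
    then have inj: "inj_on (\<lambda>x. x \<ominus>\<^bsub>B\<^esub> s (r x)) (carrier B)" by (simp add: bij_betw_def)
    have "x = \<zero>\<^bsub>X\<^esub>" if x: "x \<in> carrier X" for x
    proof -
      note sx = lmod_hom_closed[OF s x]
      have "s x \<ominus>\<^bsub>B\<^esub> s (r (s x)) = \<zero>\<^bsub>B\<^esub> \<ominus>\<^bsub>B\<^esub> s (r \<zero>\<^bsub>B\<^esub>)"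
        using rs x B.M.diff_self[OF sx] lmod_hom_zero[OF r lB lX] lmod_hom_zero[OF s lX lB] B.M.diff_self[OF B.M.zero_closed]
        by (simp only:)
      then have "s x = \<zero>\<^bsub>B\<^esub>" using inj_onD[OF inj _ sx B.M.zero_closed] by blast
      then show ?thesis using rs x lmod_hom_zero[OF r lB lX] by metis
    qed
    then show False using X X.M.zero_closed unfolding local_module_def by blast
  qed
  then have bij: "bij_betw (\<lambda>x. s (r x)) (carrier B) (carrier B)" using B e unfolding local_module_def by blast
  have "inj_on s (carrier X)" using rs by (metis inj_onI)
  moreover have "s ` carrier X = carrier B"
  proof (intro equalityI subsetI)
    fix y assume "y \<in> carrier B"
    then have "y \<in> (\<lambda>x. s (r x)) ` carrier B" using bij by (simp add: bij_betw_def)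
    then show "y \<in> s ` carrier X" using lmod_hom_closed[OF r] by blast
  qed (use lmod_hom_closed[OF s] in blast)
  ultimately show ?thesis by (intro lmod_isoI[OF s]) (simp add: bij_betw_def)
qed

lemma add_category_summand:
  assumes "direct_summand R B N" "N \<in> S"
  shows "B \<in> add_category R S"
proof -
  have B: "left_module R B" using assms(1) by (rule direct_summand_left_module)
  have "lmod_iso R B (dsum {..<1::nat} (\<lambda>_. B))"
    using dsum_singleton[of R "\<lambda>_. B" "0::nat"] B by (simp add: lessThan_Suc)
  then show ?thesis unfolding add_category_def mem_Collect_eq
    using B assms by (intro conjI exI[of _ 1] exI[of _ "\<lambda>_. B"]) auto
qed

text \<open>
  Every object is a direct sum of local summands of the \<open>N j\<close>, which gives the Krull--Schmidt
  property. For an indecomposable object only one summand \<open>A\<close> remains. It is a summand of some \<open>N i\<close>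
  with \<open>i \<in> J\<close>, so by the exchange property it is isomorphic to a term of a fixed decomposition of
  \<open>N i\<close> into local modules. There are finitely many such terms.
\<close>

lemma finite_type_of_finite_length:
  fixes N :: "'j \<Rightarrow> ('r, 'u) module"
  assumes R: "ring R" and N: "\<And>j. left_module R (N j)" "\<And>j. finite_length R (N j)"
    and J: "finite J" "\<And>j. \<exists>i\<in>J. lmod_iso R (N j) (N i)"
  shows "krull_schmidt R (add_category R (range N))"
    and "\<exists>F :: ('r, 'u) module set. finite F \<and>
      (\<forall>X. indecomposable_in R (add_category R (range N)) X \<longrightarrow> (\<exists>Y\<in>F. lmod_iso R X Y))"
proof -
  let ?C = "add_category R (range N)"
  let ?Q = "\<lambda>A :: ('r, 'u) module. local_module R A \<and> (\<exists>j. direct_summand R A (N j))"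
  have Ql: "left_module R A" if "?Q A" for A using that by (simp add: local_module_def)
  have dec: "finite_sum_of R ?Q X" if X: "X \<in> ?C" for X
  proof -
    obtain k and A :: "nat \<Rightarrow> ('r, 'u) module" where A: "\<forall>i<k. \<exists>L\<in>range N. direct_summand R (A i) L" "lmod_iso R X (dsum {..<k} A)"
      using X unfolding add_category_def mem_Collect_eq by (elim conjE exE)
    have "finite_sum_of R ?Q (A i)" if i: "i < k" for i
    proof -
      obtain j where j: "direct_summand R (A i) (N j)" using A(1) i by blast
      have "finite_sum_of R (\<lambda>B :: ('r, 'u) module. local_module R B \<and> direct_summand R B (A i)) (A i)"
        by (rule finite_length_decomposition[OF finite_length_direct_summand[OF j N(2,1)] direct_summand_left_module[OF j]])
      then show ?thesis
        by (rule finite_sum_of_mono) (use direct_summand_trans[OF _ j N(1)] in blast)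
    qed
    then have "finite_sum_of R ?Q (dsum {..<k} A)" using finite_sum_of_dsum[OF R, of ?Q k A] Ql by blast
    then show ?thesis by (rule finite_sum_of_iso[OF _ A(2)])
  qed
  have QC: "A \<in> ?C" if "?Q A" for A using that add_category_summand by blast
  show "krull_schmidt R ?C"
    unfolding krull_schmidt_def
  proof
    fix X assume "X \<in> ?C"
    then obtain k :: nat and A where A: "\<forall>i<k. ?Q (A i)" "lmod_iso R X (dsum {..<k} A)"
      using dec unfolding finite_sum_of_def by blast
    have "\<forall>i<k. A i \<in> ?C \<and> local_ring (End_ring R (A i))"
      using A(1) QC local_ring_End_ring by blast
    then show "\<exists>(k::nat) A. (\<forall>i<k. A i \<in> ?C \<and> local_ring (End_ring R (A i))) \<and> lmod_iso R X (dsum {..<k} A)"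
      using A(2) by blast
  qed
  have "\<exists>(k::nat) (B :: nat \<Rightarrow> ('r, 'u) module). (\<forall>i<k. local_module R (B i)) \<and> lmod_iso R (N j) (dsum {..<k} B)" for j
    using finite_length_decomposition[OF N(2,1), of j] unfolding finite_sum_of_def by blast
  then obtain k :: "'j \<Rightarrow> nat" and B :: "'j \<Rightarrow> nat \<Rightarrow> ('r, 'u) module" where
    B: "\<And>j. \<forall>i<k j. local_module R (B j i)" "\<And>j. lmod_iso R (N j) (dsum {..<k j} (B j))" by metis
  define F where "F = (\<Union>j\<in>J. B j ` {..<k j})"
  have "finite F" using J(1) by (simp add: F_def)
  moreover have "\<exists>Y\<in>F. lmod_iso R X Y" if X: "indecomposable_in R ?C X" for X
  proof -
    have XC: "X \<in> ?C" and Xne: "carrier X \<noteq> {\<zero>\<^bsub>X\<^esub>}"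
      and Xi: "\<And>A B. \<lbrakk>A \<in> ?C; B \<in> ?C; lmod_iso R X (dsum2 A B)\<rbrakk> \<Longrightarrow> carrier A = {\<zero>\<^bsub>A\<^esub>} \<or> carrier B = {\<zero>\<^bsub>B\<^esub>}"
      using X unfolding indecomposable_in_def by blast+
    have lX: "left_module R X" using XC by (simp add: add_category_def)
    obtain l :: nat and A where A: "\<forall>i<l. ?Q (A i)" "lmod_iso R X (dsum {..<l} A)"
      using dec[OF XC] unfolding finite_sum_of_def by blast
    have lA: "left_module R (A i)" if "i < l" for i using A(1) Ql that by blast
    have "l \<noteq> 0"
    proof
      assume "l = 0"
      then obtain f g where fg: "f \<in> lmod_hom R X (dsum {} A)" "g \<in> lmod_hom R (dsum {} A) X" "\<forall>x\<in>carrier X. g (f x) = x"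
        using lmod_iso_inverse[OF A(2) lX] by auto
      have D: "left_module R (dsum {} A)" by (rule left_module_dsum[OF R]) simp
      have "x = \<zero>\<^bsub>X\<^esub>" if x: "x \<in> carrier X" for x
      proof -
        have "f x = \<zero>\<^bsub>dsum {} A\<^esub>" using lmod_hom_closed[OF fg(1) x] unfolding dsum_empty by (simp del: dsum_simps)
        then have "g (f x) = \<zero>\<^bsub>X\<^esub>" using lmod_hom_zero[OF fg(2) D lX] by (simp only:)
        then show ?thesis using fg(3) x by simp
      qed
      then show False using Xne zero_mem_carrier[OF lX] by blast
    qed
    then obtain l' where l': "l = Suc l'" by (cases l) auto
    let ?D = "dsum {..<l'} A"
    have lD: "left_module R ?D" by (rule left_module_dsum[OF R]) (use lA l' in simp)
    have lAl: "left_module R (A l')" using lA l' by simp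
    have iso: "lmod_iso R X (dsum2 ?D (A l'))"
      using A(2) unfolding l' by (rule lmod_iso_trans[OF _ dsum_Suc])
    \<comment> \<open>the sum of all but the last summand lives on another type, hence the copy \<open>D\<close> of it inside \<open>X\<close>\<close>
    obtain f g where fg: "f \<in> lmod_hom R X (dsum2 ?D (A l'))" "g \<in> lmod_hom R (dsum2 ?D (A l')) X"
      "\<forall>x\<in>carrier X. g (f x) = x" "\<forall>y\<in>carrier (dsum2 ?D (A l')). f (g y) = y"
      using lmod_iso_inverse[OF iso lX] by blast
    let ?h = "\<lambda>x. g (x, \<zero>\<^bsub>A l'\<^esub>)"
    have "inj_on ?h (carrier ?D)"
    proof (rule inj_onI)
      fix x y assume xy: "x \<in> carrier ?D" "y \<in> carrier ?D" "?h x = ?h y"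
      have "f (?h x) = (x, \<zero>\<^bsub>A l'\<^esub>)" if "x \<in> carrier ?D" for x
        using bspec[OF fg(4), of "(x, \<zero>\<^bsub>A l'\<^esub>)"] that zero_mem_carrier[OF lAl] by simp
      from this[OF xy(1)] this[OF xy(2)] show "x = y" unfolding xy(3) by simp
    qed
    then obtain D :: "('r, 'u) module" where D: "left_module R D" "?h \<in> lmod_hom R ?D D" "bij_betw ?h (carrier ?D) (carrier D)"
      using copy_module[OF lD] by blast
    have DI: "lmod_iso R ?D D" by (rule lmod_isoI[OF D(2,3)])
    have ID: "lmod_iso R D ?D" by (rule lmod_iso_sym[OF DI lD])
    have "\<exists>L\<in>range N. direct_summand R (A i) L" if "i < l'" for i
      using A(1)[rule_format, of i] that l' by auto
    then have "\<forall>i<l'. \<exists>L\<in>range N. direct_summand R (A i) L" by (intro allI impI)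
    then have "(\<forall>i<l'. \<exists>L\<in>range N. direct_summand R (A i) L) \<and> lmod_iso R D ?D" using ID by (rule conjI)
    then have "\<exists>(k::nat) A :: nat \<Rightarrow> ('r, 'u) module.
        (\<forall>i<k. \<exists>L\<in>range N. direct_summand R (A i) L) \<and> lmod_iso R D (dsum {..<k} A)" by (intro exI)
    with D(1) have "D \<in> ?C" unfolding add_category_def mem_Collect_eq by (rule conjI)
    moreover have "A l' \<in> ?C" using QC[of "A l'"] A(1) l' by simp
    moreover have isoD: "lmod_iso R X (dsum2 D (A l'))"
      by (rule lmod_iso_trans[OF iso dsum2_cong[OF DI lmod_iso_refl]])
    ultimately have "carrier D = {\<zero>\<^bsub>D\<^esub>} \<or> carrier (A l') = {\<zero>\<^bsub>A l'\<^esub>}" by (rule Xi)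
    moreover have loc: "local_module R (A l')" using A(1) l' by blast
    ultimately have "carrier D = {\<zero>\<^bsub>D\<^esub>}" by (simp add: local_module_def)
    then have XA: "lmod_iso R X (A l')" by (rule lmod_iso_trans[OF isoD dsum2_zero_left[OF D(1) lAl]])
    obtain j where j: "direct_summand R (A l') (N j)" using A(1) l' by blast
    obtain i where i: "i \<in> J" "lmod_iso R (N j) (N i)" using J(2) by blast
    have lB: "left_module R (B i n)" if "n < k i" for n using B(1) that by (simp add: local_module_def)
    have lBi: "left_module R (dsum {..<k i} (B i))" by (rule left_module_dsum[OF R]) (use lB in simp)
    have "direct_summand R (N j) (dsum {..<k i} (B i))"
      by (rule direct_summand_iso[OF lmod_iso_trans[OF i(2) B(2)] N(1) lBi])
    then have "direct_summand R (A l') (dsum {..<k i} (B i))" by (rule direct_summand_trans[OF j _ lBi])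
    then have "\<exists>n<k i. direct_summand R (A l') (B i n)"
      using local_module_exchange_dsum[OF loc R, where k = "k i" and A = "B i"] lB by simp
    then obtain n where n: "n < k i" "direct_summand R (A l') (B i n)" by blast
    have "lmod_iso R (A l') (B i n)" using local_module_summand_iso[OF loc _ n(2)] B(1) n(1) by blast
    then have "lmod_iso R X (B i n)" by (rule lmod_iso_trans[OF XA])
    then show ?thesis using i(1) n(1) by (auto simp: F_def)
  qed
  ultimately show "\<exists>F :: ('r, 'u) module set. finite F \<and> (\<forall>X. indecomposable_in R ?C X \<longrightarrow> (\<exists>Y\<in>F. lmod_iso R X Y))"
    by blast
qed


section \<open>Periodic syzygies\<close>

lemma left_module_univ_copy:
  assumes "left_module R M"
  shows "left_module R (univ_copy M)"
proof -
  interpret M: left_module R M by fact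
  have ab: "abelian_group (univ_copy M)"
  proof (rule abelian_groupI)
    fix x assume "x \<in> carrier (univ_copy M)"
    then obtain y where "y \<in> carrier M" "x = [Inr y]" by (auto simp: univ_copy_def)
    then show "\<exists>y\<in>carrier (univ_copy M). y \<oplus>\<^bsub>univ_copy M\<^esub> x = \<zero>\<^bsub>univ_copy M\<^esub>"
      by (intro bexI[of _ "[Inr (\<ominus>\<^bsub>M\<^esub> y)]"]) (auto simp: univ_copy_def M.M.l_neg)
  qed (auto simp: univ_copy_def M.M.a_ac)
  show ?thesis
    by (intro left_module.intro M.R.ring_axioms ab left_module_axioms.intro)
      (auto simp: univ_copy_def M.smult_closed M.smult_l_distr M.smult_r_distr M.smult_assoc M.smult_one)
qed

lemma univ_copy_iso: "lmod_iso R M (univ_copy M)"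
  by (rule lmod_isoI[where f = "\<lambda>x. [Inr x]"])
    (auto intro!: lmod_homI bij_betw_imageI inj_onI simp: univ_copy_def)

lemma Omega_eq_funpow: "Omega R j M = (Omega1 R ^^ j) (univ_copy M)"
  by (induction j) auto

lemma Inf_enat_attained:
  assumes "Inf {enat k |k. Q k} = enat m"
  shows "Q m"
proof -
  let ?A = "{enat k |k. Q k}"
  have ne: "?A \<noteq> {}"
  proof
    assume "?A = {}"
    have "Inf {} = enat m" using assms unfolding \<open>?A = {}\<close> .
    then show False by (simp add: Inf_enat_def)
  qed
  then obtain x where "x \<in> ?A" by blast
  then have "(LEAST x. x \<in> ?A) \<in> ?A" by (rule LeastI)
  then have "Inf ?A \<in> ?A" unfolding Inf_enat_def if_not_P[OF ne] .
  then show ?thesis unfolding assms by simp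
qed

lemma proj_dim_attained:
  fixes M :: "('r, 'm) module"
  assumes "proj_dim R M = enat m"
  shows "\<exists>(P :: nat \<Rightarrow> ('r, ('r, 'm) univ) module) d e.
    proj_resolution R M P d e \<and> (\<forall>i>m. carrier (P i) = {\<zero>\<^bsub>P i\<^esub>})"
  by (rule Inf_enat_attained) (use assms in \<open>unfold proj_dim_def\<close>)

context reduction_syzygies
begin

text \<open>
  A resolution of length zero makes \<open>M\<close> projective, hence torsion-free, but \<open>z\<close> kills \<open>M\<close>.
\<close>

lemma proj_dim_positive:
  fixes M :: "('s, 'm) module"
  assumes M: "left_module S M" and ne: "carrier M \<noteq> {\<zero>\<^bsub>M\<^esub>}"
    and pd: "proj_dim R (restrict_scalars \<phi> M) = enat m"
  shows "m > 0"
proof (rule ccontr)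
  assume "\<not> m > 0"
  obtain P :: "nat \<Rightarrow> ('r, ('r, 'm) univ) module" and d e where
    res: "proj_resolution R (restrict_scalars \<phi> M) P d e" and z0: "\<forall>i>m. carrier (P i) = {\<zero>\<^bsub>P i\<^esub>}"
    using proj_dim_attained[OF pd] by blast
  have P: "projective R (P i)" and e: "e \<in> lmod_hom R (P 0) (restrict_scalars \<phi> M)" "e ` carrier (P 0) = carrier M"
    and d: "d 0 \<in> lmod_hom R (P (Suc 0)) (P 0)"
    and k: "d 0 ` carrier (P 1) = a_kernel (P 0) (restrict_scalars \<phi> M) e" for i
    using res unfolding proj_resolution_def by auto
  note lP = projective_left_module[OF P]
  have "carrier (P (Suc 0)) = {\<zero>\<^bsub>P (Suc 0)\<^esub>}" using z0 \<open>\<not> m > 0\<close> by simp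
  then have k0: "a_kernel (P 0) (restrict_scalars \<phi> M) e = {\<zero>\<^bsub>P 0\<^esub>}"
    using k lmod_hom_zero[OF d lP lP] by simp
  have "x = \<zero>\<^bsub>M\<^esub>" if x: "x \<in> carrier M" for x
  proof -
    have "x \<in> e ` carrier (P 0)" unfolding e(2) by (rule x)
    then obtain y where y: "y \<in> carrier (P 0)" "x = e y" by (elim imageE)
    have zy: "z \<odot>\<^bsub>P 0\<^esub> y \<in> carrier (P 0)" by (rule left_module.smult_closed[OF lP z_closed y(1)])
    have "e (z \<odot>\<^bsub>P 0\<^esub> y) = \<zero>\<^bsub>M\<^esub>"
      using lmod_hom_smult[OF e(1) z_closed y(1)] z_inflate[OF M, of "e y"] lmod_hom_closed[OF e(1) y(1)] by simp
    then have "z \<odot>\<^bsub>P 0\<^esub> y \<in> a_kernel (P 0) (restrict_scalars \<phi> M) e" using zy by (simp add: a_kernel_iff)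
    then have "z \<odot>\<^bsub>P 0\<^esub> y = \<zero>\<^bsub>P 0\<^esub>" unfolding k0 by simp
    then have "y = \<zero>\<^bsub>P 0\<^esub>" using projective_torsion_free[OF P] y(1) unfolding torsion_free_def by blast
    then show ?thesis using y(2) lmod_hom_zero[OF e(1) lP left_module_inflate[OF M]] by simp
  qed
  then show False using ne zero_mem_carrier[OF M] by blast
qed

end

text \<open>
  The syzygies start from a copy of \<open>M\<close> on the type of words, so the given resolution of \<open>M\<close> is composed
  with the isomorphism to that copy. Its terms live on words over the type of \<open>R\<close>, and \<open>h\<close> brings their
  reductions to words over the type of \<open>S\<close>.
\<close>

lemma syzygy_periodicity:
  fixes M :: "('s, 'm) module" and enc :: "('s \<times> ('s, 'm) univ) list \<Rightarrow> ('s, 'm) univ"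
    and h :: "('r, 'm) univ \<Rightarrow> ('s, 'm) univ" and R :: "('r, 'x) ring_scheme"
  assumes rs: "reduction_syzygies R S \<phi> z enc" and h: "inj h"
    and M: "left_module S M" and ne: "carrier M \<noteq> {\<zero>\<^bsub>M\<^esub>}"
    and pd: "proj_dim R (restrict_scalars \<phi> M) = enat m"
  shows "\<exists>P :: ('s, ('s, 'm) univ) module. projective S P \<and>
      lmod_iso S (Omega S (m - 1) M) (dsum2 (Omega S (m + 1) M) P)"
proof -
  interpret rs: reduction_syzygies R S \<phi> z enc by (rule rs)
  have m: "m > 0" by (rule rs.proj_dim_positive[OF M ne pd])
  obtain P :: "nat \<Rightarrow> ('r, ('r, 'm) univ) module" and d e where
    res: "proj_resolution R (restrict_scalars \<phi> M) P d e" and z0: "\<forall>i>m. carrier (P i) = {\<zero>\<^bsub>P i\<^esub>}"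
    using proj_dim_attained[OF pd] by blast
  have P: "projective R (P 0)" and e: "e \<in> lmod_hom R (P 0) (restrict_scalars \<phi> M)" "e ` carrier (P 0) = carrier M"
    using res unfolding proj_resolution_def by auto
  let ?M = "univ_copy M"
  have lU: "left_module S ?M" by (rule left_module_univ_copy[OF M])
  obtain f g where f: "f \<in> lmod_hom S M ?M" and g: "g \<in> lmod_hom S ?M M"
    and gf: "\<forall>x\<in>carrier M. g (f x) = x" and fg: "\<forall>y\<in>carrier ?M. f (g y) = y"
    using lmod_iso_inverse[OF univ_copy_iso M] by blast
  have f': "f \<in> lmod_hom R (restrict_scalars \<phi> M) (restrict_scalars \<phi> ?M)"
    by (rule lmod_hom_restrict_scalars[OF f rs.hom])
  have fe: "(\<lambda>x. f (e x)) \<in> lmod_hom R (P 0) (restrict_scalars \<phi> ?M)"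
    by (rule lmod_hom_compose[OF e(1) f'])
  have "f ` carrier M = carrier ?M"
    using fg lmod_hom_closed[OF f] lmod_hom_closed[OF g] by (auto simp: image_iff) metis
  then have fes: "(\<lambda>x. f (e x)) ` carrier (P 0) = carrier ?M" using e(2) by (metis image_image)
  have k: "a_kernel (P 0) (restrict_scalars \<phi> ?M) (\<lambda>x. f (e x)) = a_kernel (P 0) (restrict_scalars \<phi> M) e"
    by (rule kernel_compose_iso[OF e(1) f' rs.left_module_inflate[OF M] rs.left_module_inflate[OF lU]]) (use gf in simp)
  have "pd_le R (m - 1) (ker_module (P 0) (restrict_scalars \<phi> ?M) (\<lambda>x. f (e x)))"
    unfolding k by (rule proj_resolution_pd_le[OF res rs.left_module_inflate[OF M] z0 m])
  from rs.syzygy_periodic[OF lU P h fe fes this]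
  obtain Q :: "('s, ('s, 'm) univ) module" where "projective S Q"
    "lmod_iso S ((Omega1 S ^^ (m - 1)) ?M) (dsum2 ((Omega1 S ^^ Suc (Suc (m - 1))) ?M) Q)" by blast
  moreover have "Suc (Suc (m - 1)) = m + 1" using m by simp
  ultimately show ?thesis unfolding Omega_eq_funpow by metis
qed

text \<open>
  Applying \<open>\<Omega>\<close> once removes the projective summand. From then on the syzygies have period two.
\<close>

lemma (in perfect_ring) Omega1_funpow_periodic:
  fixes N :: "('r, 'u) module"
  assumes N: "left_module R N" and P: "projective R (P :: ('r, 'u) module)"
    and iso: "lmod_iso R ((Omega1 R ^^ k) N) (dsum2 ((Omega1 R ^^ Suc (Suc k)) N) P)"
  shows "j \<ge> Suc k \<Longrightarrow> lmod_iso R ((Omega1 R ^^ j) N) ((Omega1 R ^^ (j + 2 * i)) N)"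
proof -
  note l = left_module_Omega1_funpow[OF N]
  have 1: "lmod_iso R (Omega1 R ((Omega1 R ^^ k) N)) (Omega1 R ((Omega1 R ^^ Suc (Suc k)) N))"
    by (rule Omega1_dsum2[OF l l P iso])
  have 2: "lmod_iso R ((Omega1 R ^^ j) N) ((Omega1 R ^^ (j + 2)) N)" if "j \<ge> Suc k" for j
  proof -
    have "j = (j - Suc k) + Suc k" "j + 2 = (j - Suc k) + Suc (Suc (Suc k))" using that by auto
    moreover have "lmod_iso R ((Omega1 R ^^ n) (Omega1 R ((Omega1 R ^^ k) N)))
        ((Omega1 R ^^ n) (Omega1 R ((Omega1 R ^^ Suc (Suc k)) N)))" for n
      by (rule Omega1_funpow_cong[OF left_module_Omega1[OF l] left_module_Omega1[OF l] 1])
    then have "lmod_iso R ((Omega1 R ^^ (n + Suc k)) N) ((Omega1 R ^^ (n + Suc (Suc (Suc k)))) N)" for n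
      by (simp only: funpow_add funpow.simps(2) o_apply)
    ultimately show ?thesis by metis
  qed
  show "lmod_iso R ((Omega1 R ^^ j) N) ((Omega1 R ^^ (j + 2 * i)) N)" if j: "j \<ge> Suc k"
  proof (induction i)
    case 0
    then show ?case by (simp add: lmod_iso_refl)
  next
    case (Suc i)
    have "lmod_iso R ((Omega1 R ^^ (j + 2 * i)) N) ((Omega1 R ^^ (j + 2 * i + 2)) N)" by (rule 2) (use j in simp)
    then show ?case using lmod_iso_trans[OF Suc] by simp
  qed
qed

text \<open>
  The single summand \<open>\<Omega>^(k+2) M\<close> of \<open>\<Omega>^k M\<close> occurs again in every second later degree.
\<close>

lemma rep_le_of_periodic:
  fixes M :: "('s, 'm) module" and enc :: "('s \<times> ('s, 'm) univ) list \<Rightarrow> ('s, 'm) univ"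
  assumes sc: "perfect_ring S enc" and M: "left_module S M" and P: "projective S (P :: ('s, ('s, 'm) univ) module)"
    and iso: "lmod_iso S (Omega S k M) (dsum2 (Omega S (Suc (Suc k)) M) P)"
  shows "rep S M \<le> enat k"
proof -
  interpret sc: perfect_ring S enc by (rule sc)
  let ?M = "univ_copy M"
  have lU: "left_module S ?M" by (rule left_module_univ_copy[OF M])
  have l: "left_module S (Omega S j M)" for j unfolding Omega_eq_funpow by (rule sc.left_module_Omega1_funpow[OF lU])
  let ?A = "Omega S (Suc (Suc k)) M"
  \<comment> \<open>the empty word serves as the only index\<close>
  let ?D = "dsum {[] :: ('s, 'm) univ} (\<lambda>_. ?A)"
  have "lmod_iso S (Omega S k M) (dsum2 P ?A)" by (rule lmod_iso_trans[OF iso dsum2_commute])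
  then have "lmod_iso S (Omega S k M) (dsum2 P ?D)"
    by (rule lmod_iso_trans[OF _ dsum2_cong[OF lmod_iso_refl dsum_singleton[of S "\<lambda>_. ?A", OF l]]])
  moreover have "infinite {j. direct_summand S ?A (Omega S j M)}"
  proof (rule infinite_super)
    have "lmod_iso S ?A (Omega S (Suc (Suc k) + 2 * i) M)" for i
      unfolding Omega_eq_funpow
      by (rule sc.Omega1_funpow_periodic[OF lU P iso[unfolded Omega_eq_funpow]]) simp
    then show "range (\<lambda>i. Suc (Suc k) + 2 * i) \<subseteq> {j. direct_summand S ?A (Omega S j M)}"
      using direct_summand_iso[OF _ l l] by blast
    show "infinite (range (\<lambda>i::nat. Suc (Suc k) + 2 * i))" by (rule range_inj_infinite) (auto simp: inj_def)
  qed
  ultimately have "repetitive_at S M k"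
    unfolding repetitive_at_def
    by (intro exI[of _ P] exI[of _ "{[]}"] exI[of _ "\<lambda>_. ?A"] conjI ballI P l)
  then show ?thesis unfolding rep_def by (intro Inf_lower) blast
qed

text \<open>
  By periodicity the syzygies up to degree \<open>k + 2\<close> represent all isomorphism types of syzygies.
\<close>

lemma finite_syzygy_type_of_periodic:
  fixes M :: "('s, 'm) module" and enc :: "('s \<times> ('s, 'm) univ) list \<Rightarrow> ('s, 'm) univ"
  assumes sc: "perfect_ring S enc" and M: "left_module S M" and P: "projective S (P :: ('s, ('s, 'm) univ) module)"
    and iso: "lmod_iso S (Omega S k M) (dsum2 (Omega S (Suc (Suc k)) M) P)"
    and fl: "finite_length S (regular_module S)" and fg: "finitely_generated S M"
  shows "finite_syzygy_type S M"
proof -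
  interpret sc: perfect_ring S enc by (rule sc)
  let ?M = "univ_copy M"
  have lU: "left_module S ?M" by (rule left_module_univ_copy[OF M])
  have l: "left_module S (Omega S j M)" for j unfolding Omega_eq_funpow by (rule sc.left_module_Omega1_funpow[OF lU])
  obtain f where f: "f \<in> lmod_hom S M ?M" "bij_betw f (carrier M) (carrier ?M)"
    using univ_copy_iso[of S M] unfolding lmod_iso_def by blast
  have "finitely_generated S ?M"
    by (rule finitely_generated_image[OF M lU f(1) _ fg]) (use f(2) in \<open>simp add: bij_betw_def\<close>)
  then have fgO: "finitely_generated S (Omega S j M)" for j
  proof (induction j)
    case (Suc j)
    then show ?case using sc.finitely_generated_Omega1[OF fl l] by simp
  qed simp
  have flO: "finite_length S (Omega S j M)" for j by (rule finite_length_finitely_generated[OF fl l fgO])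
  have fin: "\<exists>i\<in>{..k + 2}. lmod_iso S (Omega S j M) (Omega S i M)" for j
  proof (cases "j \<le> k + 2")
    case True
    then show ?thesis using lmod_iso_refl by blast
  next
    case False
    define i where "i = (if even (j - Suc k) then Suc k else k + 2)"
    obtain n where n: "j = i + 2 * n"
    proof (cases "even (j - Suc k)")
      case True
      then obtain n where "j - Suc k = 2 * n" by blast
      then show ?thesis using that[of n] True False by (simp add: i_def)
    next
      case False
      then obtain n where "j - Suc k = 2 * n + 1" by (metis oddE)
      then show ?thesis using that[of n] False by (simp add: i_def)
    qed
    have "lmod_iso S (Omega S i M) (Omega S (i + 2 * n) M)"
      unfolding Omega_eq_funpow
      by (rule sc.Omega1_funpow_periodic[OF lU P iso[unfolded Omega_eq_funpow]]) (simp add: i_def)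
    then have "lmod_iso S (Omega S j M) (Omega S i M)" unfolding n by (rule lmod_iso_sym[OF _ l])
    moreover have "i \<in> {..k + 2}" by (simp add: i_def)
    ultimately show ?thesis by blast
  qed
  show ?thesis
    unfolding finite_syzygy_type_def syzygy_category_def
    using finite_type_of_finite_length[OF sc.ring l flO _ fin] by blast
qed


section \<open>Orders over discrete valuation rings\<close>

lemma class_ring_simps' [simp]:
  "carrier (class_ring :: 'a ring) = (UNIV :: 'a :: {times,plus,one,zero} set)"
  "x \<otimes>\<^bsub>class_ring\<^esub> y = x * y" "x \<oplus>\<^bsub>class_ring\<^esub> y = x + y" "\<zero>\<^bsub>class_ring\<^esub> = 0" "\<one>\<^bsub>class_ring\<^esub> = 1"
  by simp_all

lemma ring_class_ring: "ring (class_ring :: 'd::idom ring)"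
  by (rule class_ring.ring_axioms)

text \<open>
  Otherwise the zero ideal would be maximal, and the discrete valuation ring a field.
\<close>

lemma uniformizer_nonzero:
  fixes \<pi> :: "'d::idom"
  assumes "discrete_valuation_ring (class_ring :: 'd ring)" "uniformizer class_ring \<pi>"
  shows "\<pi> \<noteq> 0"
proof
  assume "\<pi> = 0"
  have D: "principal_domain (class_ring :: 'd ring)" using assms(1) by (simp add: discrete_valuation_ring_def)
  have "PIdl\<^bsub>class_ring\<^esub> \<pi> = {0 :: 'd}" using \<open>\<pi> = 0\<close> by (auto simp: cgenideal_def)
  then have "maximalideal {\<zero>\<^bsub>class_ring\<^esub> :: 'd} class_ring" using assms(2) by (simp add: uniformizer_def)
  then have "Ring.field (class_ring :: 'd ring)" by (rule cring.zeromaximalideal_fieldI[OF domain.axioms(1)[OF principal_domain.axioms(1)[OF D]]])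
  then show False using assms(1) by (simp add: discrete_valuation_ring_def)
qed

lemma left_module_mat_base: "left_module (class_ring :: 'd::idom ring) (mat_module_base n)"
proof -
  have ab: "abelian_group (mat_module_base n :: ('d, 'd fract mat) module)"
  proof (rule abelian_groupI)
    fix A :: "'d fract mat" assume "A \<in> carrier (mat_module_base n :: ('d, 'd fract mat) module)"
    then show "\<exists>B\<in>carrier (mat_module_base n :: ('d, 'd fract mat) module).
        B \<oplus>\<^bsub>mat_module_base n :: ('d, 'd fract mat) module\<^esub> A = \<zero>\<^bsub>mat_module_base n :: ('d, 'd fract mat) module\<^esub>"
      by (intro bexI[of _ "- A"]) (auto simp: mat_module_base_def module_mat_simps)
  qed (auto simp: mat_module_base_def module_mat_simps intro: comm_add_mat assoc_add_mat)
  show ?thesis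
    by (intro left_module.intro ring_class_ring ab left_module_axioms.intro)
      (auto simp: mat_module_base_def module_mat_simps add_smult_distrib_right_mat add_smult_distrib_left_mat mult_smult_assoc_mat)
qed

text \<open>
  The marker \<open>s\<close> announces a further letter and \<open>t\<close> the end of the code. So no code is a proper prefix of
  another one, and a sequence of codes can be recovered from its concatenation.
\<close>

fun encode_word :: "'a \<times> ('a + 'b) list \<Rightarrow> 'a \<Rightarrow> 'a \<Rightarrow> ('a + 'b) list"
  where "encode_word (a, u) s t = Inl s # Inl a # concat (map (\<lambda>c. [Inl s, c]) u) @ [Inl t]"

lemma encode_word_prefix_free:
  assumes "s \<noteq> t" "encode_word w s t @ r = encode_word w' s t @ r'"
  shows "w = w' \<and> r = r'"
proof -
  have aux: "concat (map (\<lambda>c. [Inl s, c]) u) @ Inl t # r = concat (map (\<lambda>c. [Inl s, c]) u') @ Inl t # r' \<Longrightarrow>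
      u = u' \<and> r = r'" for u u' :: "('a + 'b) list"
  proof (induction u arbitrary: u')
    case Nil
    then show ?case using assms(1) by (cases u') auto
  next
    case (Cons c u)
    then show ?case using assms(1) by (cases u') auto
  qed
  obtain a u a' u' where w: "w = (a, u)" "w' = (a', u')" by (cases w, cases w')
  have "a = a'" "concat (map (\<lambda>c. [Inl s, c]) u) @ Inl t # r = concat (map (\<lambda>c. [Inl s, c]) u') @ Inl t # r'"
    using assms(2) by (simp_all add: w)
  then show ?thesis using aux[of u u'] by (simp add: w)
qed

lemma word_encoding_exists:
  assumes "(s :: 'a) \<noteq> t"
  shows "\<exists>enc :: ('a \<times> ('a + 'b) list) list \<Rightarrow> ('a + 'b) list. inj enc"
proof -
  let ?enc = "\<lambda>xs :: ('a \<times> ('a + 'b) list) list. concat (map (\<lambda>w. encode_word w s t) xs)"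
  have ne: "encode_word w s t \<noteq> []" for w :: "'a \<times> ('a + 'b) list" by (cases w) simp
  have "?enc xs = ?enc ys \<Longrightarrow> xs = ys" for xs ys
  proof (induction xs arbitrary: ys)
    case Nil
    then show ?case using ne by (cases ys) auto
  next
    case (Cons w xs)
    then obtain w' ys' where ys: "ys = w' # ys'" using ne[of w] by (cases ys) auto
    have "encode_word w s t @ ?enc xs = encode_word w' s t @ ?enc ys'" using Cons.prems by (simp add: ys)
    then have "w = w' \<and> ?enc xs = ?enc ys'" by (rule encode_word_prefix_free[OF assms])
    then show ?case using Cons.IH ys by simp
  qed
  then have "inj ?enc" by (rule injI)
  then show ?thesis by blast
qed

lemma finite_length_restrict_scalars:
  assumes "finite_length R (restrict_scalars \<phi> M)" "\<phi> ` carrier R \<subseteq> carrier S"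
    and "left_module R (restrict_scalars \<phi> M)"
  shows "finite_length S M"
proof -
  interpret left_module R "restrict_scalars \<phi> M" by fact
  have s: "submodule H R (restrict_scalars \<phi> M)" if H: "submodule H S M" for H
  proof (rule submoduleI)
    show "a \<odot>\<^bsub>restrict_scalars \<phi> M\<^esub> x \<in> H" if "a \<in> carrier R" "x \<in> H" for a x
      using submodule_smult[OF H, of "\<phi> a" x] that assms(2) by auto
  qed (use submodule_subset[OF H] submodule_zero[OF H] submodule_add[OF H] in auto)
  obtain \<mu> :: "_ set \<Rightarrow> nat" where "\<forall>H K. submodule H R (restrict_scalars \<phi> M) \<longrightarrow>
      submodule K R (restrict_scalars \<phi> M) \<longrightarrow> H \<subset> K \<longrightarrow> \<mu> H < \<mu> K"
    using assms(1) unfolding finite_length_def by (elim exE)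
  then show ?thesis unfolding finite_length_def using s by (intro exI[of _ \<mu>]) simp
qed

lemma subgroup_left_ideal:
  assumes "ring R" "submodule H R (regular_module R)"
  shows "subgroup H (add_monoid R)"
proof -
  interpret R: ring R by fact
  have HR: "H \<subseteq> carrier R" using submodule_subset[OF assms(2)] by simp
  show ?thesis
  proof (rule R.add.subgroupI[OF HR])
    show "H \<noteq> {}" using submodule_zero[OF assms(2)] by blast
    show "\<ominus>\<^bsub>R\<^esub> a \<in> H" if "a \<in> H" for a
    proof -
      have "\<ominus>\<^bsub>R\<^esub> \<one>\<^bsub>R\<^esub> \<otimes>\<^bsub>R\<^esub> a = \<ominus>\<^bsub>R\<^esub> a" using HR that by (simp add: subset_eq R.l_minus)
      then show ?thesis using submodule_smult[OF assms(2), of "\<ominus>\<^bsub>R\<^esub> \<one>\<^bsub>R\<^esub>" a] that by simp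
    qed
    show "a \<oplus>\<^bsub>R\<^esub> b \<in> H" if "a \<in> H" "b \<in> H" for a b using submodule_add[OF assms(2) that] by simp
  qed
qed

lemma ideal_class_ring:
  assumes "submodule H (class_ring :: 'd::idom ring) (regular_module class_ring)"
  shows "ideal H (class_ring :: 'd ring)"
proof (rule idealI[OF ring_class_ring])
  show "subgroup H (add_monoid (class_ring :: 'd ring))"
    by (rule subgroup_left_ideal[OF ring_class_ring assms])
  show "x \<otimes>\<^bsub>class_ring\<^esub> a \<in> H" "a \<otimes>\<^bsub>class_ring\<^esub> x \<in> H" if "a \<in> H" "x \<in> carrier (class_ring :: 'd ring)" for a x
    using submodule_smult[OF assms, of x a] that by (simp_all add: mult.commute)
qed

locale order_over_dvr =
  fixes \<pi> :: "'d::idom" and n :: nat and \<O> :: "'d fract mat set"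
  assumes dvr: "discrete_valuation_ring (class_ring :: 'd ring)"
    and unif: "uniformizer class_ring \<pi>"
    and order: "classical_order n \<O>"
begin

abbreviation "OR \<equiv> order_ring n \<O>"
abbreviation "LR \<equiv> order_quotient n \<pi> \<O>"
abbreviation "quo \<equiv> (\<lambda>A. pi_ideal \<pi> \<O> +>\<^bsub>OR\<^esub> A)"

definition scalar :: "'d \<Rightarrow> 'd fract mat"
  where "scalar d = to_fract d \<cdot>\<^sub>m 1\<^sub>m n"

lemma subring_order: "subring \<O> (ring_mat TYPE('d fract) n ())"
  using order by (simp add: classical_order_def)

lemma ring_order: "ring OR"
  unfolding order_ring_def by (rule ring.subring_is_ring[OF ring_mat subring_order])

lemma order_simps [simp]:
  "carrier OR = \<O>" "A \<otimes>\<^bsub>OR\<^esub> B = A * B" "A \<oplus>\<^bsub>OR\<^esub> B = A + B" "\<one>\<^bsub>OR\<^esub> = 1\<^sub>m n" "\<zero>\<^bsub>OR\<^esub> = 0\<^sub>m n n"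
  by (simp_all add: order_ring_def ring_mat_simps)

lemma order_carrier: "A \<in> \<O> \<Longrightarrow> A \<in> carrier_mat n n"
  using subringE(1)[OF subring_order] by (auto simp: ring_mat_simps)

lemma order_submodule: "submodule \<O> (class_ring :: 'd ring) (mat_module_base n)"
  using order by (simp add: classical_order_def)

lemma order_smult: "A \<in> \<O> \<Longrightarrow> to_fract d \<cdot>\<^sub>m A \<in> \<O>"
  using submodule_smult[OF order_submodule, of d A] by (simp add: mat_module_base_def module_mat_simps)

lemma one_order: "1\<^sub>m n \<in> \<O>"
  using ring.ring_simprules(6)[OF ring_order] by simp

lemma scalar_closed: "scalar d \<in> \<O>"
  unfolding scalar_def by (rule order_smult[OF one_order])

lemma scalar_mult: "A \<in> \<O> \<Longrightarrow> scalar d * A = to_fract d \<cdot>\<^sub>m A" "A \<in> \<O> \<Longrightarrow> A * scalar d = to_fract d \<cdot>\<^sub>m A"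
  using order_carrier[of A] by (simp_all add: scalar_def mult_smult_assoc_mat[of _ n n _ n] mult_smult_distrib[of _ n n _ n])

lemma smult_smult_mat: "(a * b) \<cdot>\<^sub>m A = a \<cdot>\<^sub>m (b \<cdot>\<^sub>m (A :: 'd fract mat))"
  by (rule eq_matI) (auto simp: mult.assoc)

lemma scalar_hom: "scalar \<in> ring_hom (class_ring :: 'd ring) OR"
  by (rule ring_hom_memI)
    (auto simp: scalar_closed scalar_mult(1)[OF scalar_closed],
      auto simp: scalar_def add_smult_distrib_right_mat smult_smult_mat)

lemma pi_ideal_iff: "A \<in> pi_ideal \<pi> \<O> \<longleftrightarrow> (\<exists>B\<in>\<O>. A = scalar \<pi> * B)"
  unfolding pi_ideal_def by (auto simp: scalar_mult image_iff)

lemma pi_nonzero: "to_fract \<pi> \<noteq> 0"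
  using uniformizer_nonzero[OF dvr unif] by simp

lemma ideal_pi: "ideal (pi_ideal \<pi> \<O>) OR"
proof (rule idealI[OF ring_order])
  interpret ring OR by (rule ring_order)
  have lreg: "left_module OR (regular_module OR)" by (rule left_module_regular[OF ring_order])
  have s: "submodule (pi_ideal \<pi> \<O>) OR (regular_module OR)"
  proof (rule left_module.submoduleI[OF lreg])
    show "pi_ideal \<pi> \<O> \<subseteq> carrier (regular_module OR)" by (auto simp: pi_ideal_def order_smult)
    show "\<zero>\<^bsub>regular_module OR\<^esub> \<in> pi_ideal \<pi> \<O>"
      using zero_closed by (auto simp: pi_ideal_def intro!: image_eqI[of _ _ "0\<^sub>m n n"])
    show "A \<oplus>\<^bsub>regular_module OR\<^esub> B \<in> pi_ideal \<pi> \<O>" if AB: "A \<in> pi_ideal \<pi> \<O>" "B \<in> pi_ideal \<pi> \<O>" for A B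
    proof -
      obtain A' B' where *: "A' \<in> \<O>" "B' \<in> \<O>" "A = to_fract \<pi> \<cdot>\<^sub>m A'" "B = to_fract \<pi> \<cdot>\<^sub>m B'"
        using AB by (auto simp: pi_ideal_def)
      then have "A + B = to_fract \<pi> \<cdot>\<^sub>m (A' + B')"
        by (simp only: add_smult_distrib_left_mat[OF order_carrier[OF *(1)] order_carrier[OF *(2)]])
      moreover have "A' + B' \<in> \<O>" using a_closed[of A' B'] * by simp
      ultimately show ?thesis by (simp add: pi_ideal_def)
    qed
    show "C \<odot>\<^bsub>regular_module OR\<^esub> A \<in> pi_ideal \<pi> \<O>" if CA: "C \<in> carrier OR" "A \<in> pi_ideal \<pi> \<O>" for C A
    proof -
      obtain A' where *: "A' \<in> \<O>" "A = to_fract \<pi> \<cdot>\<^sub>m A'" using CA by (auto simp: pi_ideal_def)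
      then have "C * A = to_fract \<pi> \<cdot>\<^sub>m (C * A')"
        using order_carrier CA(1) by (simp add: mult_smult_distrib[of _ n n _ n])
      moreover have "C * A' \<in> \<O>" using m_closed[of C A'] * CA(1) by simp
      ultimately show ?thesis by (simp add: pi_ideal_def)
    qed
  qed
  show "subgroup (pi_ideal \<pi> \<O>) (add_monoid OR)"
    by (rule subgroup_left_ideal[OF ring_order s])
  show "X \<otimes>\<^bsub>OR\<^esub> A \<in> pi_ideal \<pi> \<O>" if "A \<in> pi_ideal \<pi> \<O>" "X \<in> carrier OR" for A X
    using submodule_smult[OF s that(2,1)] by simp
  show "A \<otimes>\<^bsub>OR\<^esub> X \<in> pi_ideal \<pi> \<O>" if AX: "A \<in> pi_ideal \<pi> \<O>" "X \<in> carrier OR" for A X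
  proof -
    obtain A' where *: "A' \<in> \<O>" "A = to_fract \<pi> \<cdot>\<^sub>m A'" using AX by (auto simp: pi_ideal_def)
    then have "A * X = to_fract \<pi> \<cdot>\<^sub>m (A' * X)"
      using order_carrier AX(2) by (simp add: mult_smult_assoc_mat[of _ n n _ n])
    moreover have "A' * X \<in> \<O>" using m_closed[of A' X] * AX(2) by simp
    ultimately show ?thesis by (simp add: pi_ideal_def)
  qed
qed

lemma ring_quotient: "ring LR"
  unfolding order_quotient_def by (rule ideal.quotient_is_ring[OF ideal_pi])

lemma quo_hom: "quo \<in> ring_hom OR LR"
  unfolding order_quotient_def by (rule ideal.rcos_ring_hom[OF ideal_pi])

lemma quo_surj: "quo ` \<O> = carrier LR"
  by (auto simp: order_quotient_def FactRing_def A_RCOSETS_def' )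

lemma zero_quotient: "\<zero>\<^bsub>LR\<^esub> = pi_ideal \<pi> \<O>"
  by (simp add: order_quotient_def FactRing_def)

lemma quo_zero_iff:
  assumes "A \<in> \<O>"
  shows "quo A = \<zero>\<^bsub>LR\<^esub> \<longleftrightarrow> (\<exists>B\<in>\<O>. A = scalar \<pi> * B)"
proof -
  interpret I: ideal "pi_ideal \<pi> \<O>" OR by (rule ideal_pi)
  have "A \<in> quo A" by (rule I.a_rcos_self) (simp add: assms)
  then have "quo A = pi_ideal \<pi> \<O> \<longleftrightarrow> A \<in> pi_ideal \<pi> \<O>" using I.a_rcos_const by blast
  then show ?thesis unfolding zero_quotient pi_ideal_iff .
qed

lemma central_reduction: "central_reduction OR LR quo (scalar \<pi>)"
proof (rule central_reduction.intro[OF ring_order ring_quotient quo_hom])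
  interpret ring OR by (rule ring_order)
  show "quo ` carrier OR = carrier LR" using quo_surj by simp
  show "scalar \<pi> \<in> carrier OR" by (simp add: scalar_closed)
  show "\<forall>A\<in>carrier OR. A \<otimes>\<^bsub>OR\<^esub> scalar \<pi> = scalar \<pi> \<otimes>\<^bsub>OR\<^esub> A" by (simp add: scalar_mult)
  show "\<forall>A\<in>carrier OR. scalar \<pi> \<otimes>\<^bsub>OR\<^esub> A = \<zero>\<^bsub>OR\<^esub> \<longrightarrow> A = \<zero>\<^bsub>OR\<^esub>"
  proof (intro ballI impI)
    fix A assume A: "A \<in> carrier OR" "scalar \<pi> \<otimes>\<^bsub>OR\<^esub> A = \<zero>\<^bsub>OR\<^esub>"
    then have c: "A \<in> carrier_mat n n" and e: "to_fract \<pi> \<cdot>\<^sub>m A = 0\<^sub>m n n" using order_carrier by (auto simp: scalar_mult)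
    have "A $$ (i, j) = 0" if "i < n" "j < n" for i j
    proof -
      have "to_fract \<pi> * A $$ (i, j) = (to_fract \<pi> \<cdot>\<^sub>m A) $$ (i, j)" using c that by simp
      then show ?thesis using pi_nonzero that unfolding e by simp
    qed
    then show "A = \<zero>\<^bsub>OR\<^esub>" using c by (intro eq_matI) auto
  qed
  show "\<forall>A\<in>carrier OR. quo A = \<zero>\<^bsub>LR\<^esub> \<longleftrightarrow> (\<exists>B\<in>carrier OR. A = scalar \<pi> \<otimes>\<^bsub>OR\<^esub> B)"
    using quo_zero_iff by simp
qed

text \<open>
  \<open>\<Lambda>\<close> is finitely generated over \<open>D\<close> and killed by \<open>\<pi>\<close>. As the only ideals of \<open>D\<close> above \<open>\<pi> D\<close> are \<open>\<pi> D\<close> and \<open>D\<close>,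
  it has finite length over \<open>D\<close>, and all the more over itself.
\<close>

lemma finite_length_quotient: "finite_length LR (regular_module LR)"
proof -
  interpret red: central_reduction OR LR quo "scalar \<pi>" by (rule central_reduction)
  interpret L: ring LR by (rule ring_quotient)
  let ?K = "class_ring :: 'd ring" and ?c = "\<lambda>d. quo (scalar d)"
  have "(\<lambda>d. quo (scalar d)) = quo \<circ> scalar" by auto
  then have c: "?c \<in> ring_hom ?K LR" using ring_hom_trans[OF scalar_hom quo_hom] by simp
  have lL: "left_module LR (regular_module LR)" by (rule left_module_regular[OF ring_quotient])
  let ?N = "restrict_scalars ?c (regular_module LR)"
  have lN: "left_module ?K ?N" by (rule left_module_restrict_scalars[OF lL c ring_class_ring])
  let ?OM = "(mat_module_base n :: ('d, 'd fract mat) module)\<lparr>carrier := \<O>\<rparr>"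
  have lO: "left_module ?K ?OM" by (rule left_module_submodule[OF left_module_mat_base order_submodule])
  have "finitely_generated ?K ?OM" using order by (simp add: classical_order_def)
  have q: "quo \<in> lmod_hom ?K ?OM ?N"
  proof (rule lmod_homI)
    fix A assume "A \<in> carrier ?OM"
    then show "quo A \<in> carrier ?N" using ring_hom_closed[OF quo_hom, of A] by simp
  next
    fix A B assume "A \<in> carrier ?OM" "B \<in> carrier ?OM"
    then show "quo (A \<oplus>\<^bsub>?OM\<^esub> B) = quo A \<oplus>\<^bsub>?N\<^esub> quo B"
      using ring_hom_add[OF quo_hom, of A B] by (simp add: mat_module_base_def module_mat_simps)
  next
    fix d A assume "d \<in> carrier ?K" "A \<in> carrier ?OM"
    then show "quo (d \<odot>\<^bsub>?OM\<^esub> A) = d \<odot>\<^bsub>?N\<^esub> quo A"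
      using ring_hom_mult[OF quo_hom, of "scalar d" A] by (simp add: scalar_closed scalar_mult mat_module_base_def module_mat_simps)
  qed
  have "finitely_generated ?K ?N"
    by (rule finitely_generated_image[OF lO lN q _ \<open>finitely_generated ?K ?OM\<close>]) (simp add: quo_surj)
  then obtain B where B: "finite B" "B \<subseteq> carrier ?N" "lmod_span ?K ?N B = carrier ?N"
    unfolding finitely_generated_def by blast
  interpret m: maximalideal "PIdl\<^bsub>?K\<^esub> \<pi>" ?K using unif by (simp add: uniformizer_def)
  \<comment> \<open>\<open>\<nu> H\<close> is the length of \<open>H\<close> modulo \<open>\<pi> D\<close>\<close>
  have "finite_length ?K (?N\<lparr>carrier := lmod_span ?K ?N B\<rparr>)"
  proof (rule finite_length_span[OF lN B(1,2), where I = "PIdl\<^bsub>?K\<^esub> \<pi>" and \<nu> = "\<lambda>H. if 1 \<in> H then 1 else 0"])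
    fix a x assume "a \<in> PIdl\<^bsub>?K\<^esub> \<pi>" "x \<in> carrier ?N"
    then obtain d where d: "a = d * \<pi>" by (auto simp: cgenideal_def)
    have "scalar a = scalar \<pi> * scalar d"
      using ring_hom_mult[OF scalar_hom, of \<pi> d] by (simp add: d mult.commute)
    then have "quo (scalar a) = \<zero>\<^bsub>LR\<^esub>" using quo_zero_iff[OF scalar_closed] scalar_closed by blast
    then show "a \<odot>\<^bsub>?N\<^esub> x = \<zero>\<^bsub>?N\<^esub>" using \<open>x \<in> carrier ?N\<close> by simp
  next
    fix H K assume H: "submodule H ?K (regular_module ?K)" and K: "submodule K ?K (regular_module ?K)"
      and I: "PIdl\<^bsub>?K\<^esub> \<pi> \<subseteq> H" and HK: "H \<subset> K"
    have "H = PIdl\<^bsub>?K\<^esub> \<pi>" using m.I_maximal[OF ideal_class_ring[OF H] I] HK by auto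
    moreover have "K = PIdl\<^bsub>?K\<^esub> \<pi> \<or> K = carrier ?K" using m.I_maximal[OF ideal_class_ring[OF K]] I HK by auto
    ultimately have K': "K = UNIV" using HK by auto
    have "1 \<notin> H"
    proof
      assume "1 \<in> H"
      then have "x \<in> H" for x using submodule_smult[OF H, of x 1] by simp
      then show False using HK by blast
    qed
    then show "(if 1 \<in> H then 1 else 0 :: nat) < (if 1 \<in> K then 1 else 0)" using K' by simp
  qed simp
  moreover have "X\<lparr>carrier := carrier X\<rparr> = X" for X :: "('d, 'd fract mat set) module" by simp
  ultimately have "finite_length ?K ?N" unfolding B(3) by (simp only:)
  then show ?thesis
    by (rule finite_length_restrict_scalars) (use ring_hom_closed[OF c] lN in auto)
qed

end

theorem theorem4p3:
  fixes \<pi> :: "'d::idom" and n m :: nat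
    and \<O> :: "'d fract mat set"
    and M :: "('d fract mat set, 'm) module"
    and \<Lambda> :: "'d fract mat set ring"
  assumes "discrete_valuation_ring (class_ring :: 'd ring)"
    and "uniformizer class_ring \<pi>"
    and "classical_order n \<O>"
    and "\<Lambda> = order_quotient n \<pi> \<O>"
    and "left_module \<Lambda> M"
    and "carrier M \<noteq> {\<zero>\<^bsub>M\<^esub>}"
    and "proj_dim (order_ring n \<O>) (inflate n \<pi> \<O> M) = enat m"
  shows "m > 0 \<and>
    (\<exists>P :: ('d fract mat set, ('d fract mat set, 'm) univ) module.
      projective \<Lambda> P \<and>
      lmod_iso \<Lambda> (Omega \<Lambda> (m - 1) M) (dsum2 (Omega \<Lambda> (m + 1) M) P)) \<and>
    rep \<Lambda> M \<le> enat (m - 1) \<and>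
    (finitely_generated \<Lambda> M \<longrightarrow> finite_syzygy_type \<Lambda> M)"
proof -
  interpret o: order_over_dvr \<pi> n \<O> using assms(1-3) by unfold_locales
  let ?quo = "\<lambda>A. pi_ideal \<pi> \<O> +>\<^bsub>order_ring n \<O>\<^esub> A"
  have R: "ring \<Lambda>" unfolding assms(4) by (rule o.ring_quotient)
  have fl: "finite_length \<Lambda> (regular_module \<Lambda>)" unfolding assms(4) by (rule o.finite_length_quotient)
  have "({} :: 'd fract mat set) \<noteq> UNIV" by blast
  \<comment> \<open>two distinct letters, as the encoding needs two markers\<close>
  then obtain enc :: "('d fract mat set \<times> ('d fract mat set, 'm) univ) list \<Rightarrow> ('d fract mat set, 'm) univ"
    where enc: "inj enc" using word_encoding_exists[where 'b = 'm] by (elim exE[rotated]) assumption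
  have sc: "perfect_ring \<Lambda> enc"
    by (rule perfect_ring.intro[OF R enc]) (rule projective_cover_exists[OF R fl _ enc])
  have rs: "reduction_syzygies (order_ring n \<O>) \<Lambda> ?quo (o.scalar \<pi>) enc"
    using o.central_reduction sc unfolding assms(4) by (intro reduction_syzygies.intro)
  interpret rs: reduction_syzygies "order_ring n \<O>" \<Lambda> ?quo "o.scalar \<pi>" enc by (rule rs)
  \<comment> \<open>singletons embed the type of the resolution over the order into that of the \<open>\<Lambda>\<close>-modules\<close>
  let ?h = "map (map_sum (\<lambda>a. {a}) (\<lambda>x. x)) :: ('d fract mat, 'm) univ \<Rightarrow> ('d fract mat set, 'm) univ"
  have h: "inj ?h" by (intro list.inj_map sum.inj_map) (auto simp: inj_def)
  have pd: "proj_dim (order_ring n \<O>) (restrict_scalars ?quo M) = enat m"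
    using assms(7) by (simp only: inflate_def)
  have m: "m > 0" by (rule rs.proj_dim_positive[OF assms(5,6) pd])
  obtain P :: "('d fract mat set, ('d fract mat set, 'm) univ) module" where P: "projective \<Lambda> P"
    "lmod_iso \<Lambda> (Omega \<Lambda> (m - 1) M) (dsum2 (Omega \<Lambda> (m + 1) M) P)"
    using syzygy_periodicity[OF rs h assms(5,6) pd] by blast
  have "Suc (Suc (m - 1)) = m + 1" using m by simp
  then have iso: "lmod_iso \<Lambda> (Omega \<Lambda> (m - 1) M) (dsum2 (Omega \<Lambda> (Suc (Suc (m - 1))) M) P)"
    using P(2) by (simp only:)
  have "rep \<Lambda> M \<le> enat (m - 1)" by (rule rep_le_of_periodic[OF sc assms(5) P(1) iso])
  moreover have "finite_syzygy_type \<Lambda> M" if "finitely_generated \<Lambda> M"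
    by (rule finite_syzygy_type_of_periodic[OF sc assms(5) P(1) iso fl that])
  ultimately show ?thesis using m P by blast
qed

end
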